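(* Let $\{\mathbb{X}(p)\}_p$ be independent random variables indexed by primes $p$, where for $p\equiv 2\pmod 3$ or $p=3$, $\mathbb{X}(p)$ takes each of the values $1,\omega_3,\omega_3^2$ with probability $1/3$ (and the value $0$ with probability $0$), and for $p\equiv 1\pmod 3$, $\mathbb{X}(p)=0$ with probability $\frac{2}{p+2}$ and $\mathbb{X}(p)$ takes each of the values $1,\omega_3,\omega_3^2$ with probability $\frac{p}{3(p+2)}$. Let $L(1,\mathbb{X})=\prod_p\left(1-\frac{\mathbb{X}(p)}{p}\right)^{-1}$ (almost surely convergent), and for $\tau>0$ set $$\Phi(\tau)=\mathbb{P}\left(|L(1,\mathbb{X})|>e^\gamma\tau\right),\qquad \Psi(\tau)=\mathbb{P}\left(|L(1,\mathbb{X})|<\left(\frac{\zeta(3)}{e^\gamma}\right)^{1/2}\frac{1}{\tau}\right).$$ Then for large $\tau$, $$\Phi(\tau)=\exp\left(-\frac{2e^{\tau-C_{\max}}}{\tau}\left(1+O(\tau^{-1})\right)\right),\qquad \Psi(\tau)=\exp\left(-\frac{e^{\tau^2-C_{\min}}}{\tau^2}\left(1+O(\tau^{-1})\right)\right),$$ where $$C_{\max}=\frac12\left(\int_0^1 \frac{2e^{2t}-2e^{-t}}{t(e^{2t}+2e^{-t})}\,dt+\int_1^\infty \frac{-6}{t(e^{3t}+2)}\,dt\right)\approx 0.98727,$$ $$C_{\min}=\int_{0}^1 \frac{2e^{t}-2e^{-2t}}{t(e^{-2t}+2e^{t})}\,dt +\int_1^{\infty} \frac{-3e^{-2t}}{t(e^{-2t}+2e^{t})}\,dt\approx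 1.40459.$$
   Context: $\omega_3=e^{2\pi i/3}$; $\gamma$ is the Euler–Mascheroni constant. *)

theory Defs
  imports "HOL-Probability.Probability"
begin

definition omega3 :: complex where
  "omega3 = exp (2 * pi * \<i> / 3)"

definition zeta3 :: real where
  "zeta3 = (\<Sum>n. 1 / (real (Suc n)) ^ 3)"

definition L1 :: "(nat \<Rightarrow> 'a \<Rightarrow> complex) \<Rightarrow> 'a \<Rightarrow> complex" where
  "L1 X w = lim (\<lambda>N. \<Prod>p\<in>{p. prime p \<and> p \<le> N}. inverse (1 - X p w / of_nat p))"

definition C_max :: real where
  "C_max = (1/2) * (integral {0..1} (\<lambda>t. (2 * exp (2*t) - 2 * exp (-t)) / (t * (exp (2*t) + 2 * exp (-t))))
                  + integral {1..} (\<lambda>t. -6 / (t * (exp (3*t) + 2))))"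

definition C_min :: real where
  "C_min = integral {0..1} (\<lambda>t. (2 * exp t - 2 * exp (-2*t)) / (t * (exp (-2*t) + 2 * exp t)))
         + integral {1..} (\<lambda>t. -3 * exp (-2*t) / (t * (exp (-2*t) + 2 * exp t)))"

end

(*
  Put Y = |L(1,X)| in the first case and Y = 1 / |L(1,X)|^2 in the second. In both, ln Y is a sum over
  primes of independent variables taking essentially two values, a p ~ 1/p with probability q and
  b p ~ -(q/(1-q))/p otherwise (q = 1/3 and q = 2/3). The prime number theorem with error O(n / ln^2 n)
  gives the cumulant generating function K(s) = s (ln ln s + c0) + D s / ln s + O(s / ln^2 s), where c0
  is Euler's constant, respectively Euler's constant minus ln zeta(3), and D is an integral of
  f(u) = ln (q exp u + (1-q) exp (-(q/(1-q)) u)). Chernoff's inequality at s = exp (T - D - 1) bounds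
  P(ln Y > ln T + c0) from above. For the lower bound the measure is tilted at a near-minimiser of
  K(s) - s (ln T + c0); since K(s+h) + K(s-h) - 2 K(s) = O(h^2 / s), the tilted law concentrates on
  a window of width 1/T^2.
*)
theory Submission
  imports Defs "HOL-Complex_Analysis.Complex_Analysis" "HOL-Real_Asymp.Real_Asymp"
begin

section \<open>Chebyshev's upper bound\<close>

text \<open>At \<open>s\<close> of size \<open>exp T\<close> the exponent has size
  \<open>s / T\<close>, so a relative error \<open>O(1/T)\<close> allows an error
  \<open>O(s / ln^2 s)\<close> in the cumulant. The delicate contribution is \<open>s\<close> times
  a sum like that of \<open>1/p\<close> over \<open>p \<le> s\<close>: it must be known up to
  \<open>1 / ln^2 s\<close>, which partial summation yields from
  \<open>theta n = n + O(n / ln^2 n)\<close>. A relative deviation eps of \<open>theta\<close> shows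
  up as a block integral of size eps^2, so the contour argument aims at tails of size
  \<open>1 / ln^4\<close>; the 3-4-1 inequality gives a zero-free region wide enough for that.
  Primes below and above \<open>s\<close> need different expansions. For \<open>p \<le> s\<close>
  the logarithm of the local moment is linear in \<open>s / p\<close> minus a bounded term, and the
  linear part is where Mertens' constant enters; for \<open>p > s\<close> it is quadratically small.
  Along \<open>ln s = T - D - 1 - y\<close> the exponent is proportional to
  \<open>(1 + y) exp (-y)\<close>, whose maximum at \<open>y = 0\<close> explains the choice of
  \<open>s\<close>. The positive atom is normalised to \<open>1/p\<close>; for small |L| this forces
  the square, hence \<open>\<tau>^2\<close>.\<close>

definition theta :: "nat \<Rightarrow> real" where
  "theta n = (\<Sum>p\<in>{p. prime p \<and> p \<le> n}. ln (real p))"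

lemma finite_primes_le [simp, intro]: "finite {p::nat. prime p \<and> p \<le> n}"
  by (rule finite_subset[of _ "{..n}"]) auto

lemma theta_mono: "m \<le> n \<Longrightarrow> theta m \<le> theta n"
  unfolding theta_def by (rule sum_mono2) (auto dest: prime_ge_1_nat)

lemma theta_Suc: "theta (Suc n) = theta n + (if prime (Suc n) then ln (real (Suc n)) else 0)"
proof -
  have "{p. prime p \<and> p \<le> Suc n} = (if prime (Suc n) then insert (Suc n) {p. prime p \<and> p \<le> n} else {p. prime p \<and> p \<le> n})"
    by (auto simp: le_Suc_eq)
  then show ?thesis by (simp add: theta_def)
qed

text \<open>The two middle entries of row \<open>2*m+1\<close> are equal and together at most the
  row sum \<open>2 * 4^m\<close>.\<close>

lemma binomial_odd_middle_le: "(2*m+1) choose m \<le> (4::nat) ^ m"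
proof -
  have "2 * ((2*m+1) choose m) = ((2*m+1) choose m) + ((2*m+1) choose (m+1))"
    using binomial_symmetric[of m "2*m+1"] by simp
  also have "\<dots> = (\<Sum>k\<in>{m, m+1}. (2*m+1) choose k)" by simp
  also have "\<dots> \<le> (\<Sum>k\<le>2*m+1. (2*m+1) choose k)" by (rule sum_mono2) auto
  also have "\<dots> = 2 ^ (2*m+1)" by (rule choose_row_sum)
  also have "\<dots> = 2 * 4 ^ m" by (simp add: power_mult)
  finally show ?thesis by simp
qed

text \<open>A prime in \<open>(m+1, 2*m+1]\<close> divides \<open>(2*m+1)!\<close> but neither
  \<open>m!\<close> nor \<open>(m+1)!\<close>, so it divides the middle binomial coefficient. The
  product of all these primes therefore divides it too and is at most \<open>4^m\<close>.\<close>

lemma theta_odd_step: "theta (2*m+1) \<le> theta (m+1) + real m * ln 4"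
proof -
  let ?P = "{p. prime p \<and> m + 1 < p \<and> p \<le> 2*m+1}"
  have fin: "finite ?P" by (rule finite_subset[of _ "{..2*m+1}"]) auto
  have dvd: "p dvd (2*m+1) choose m" if "p \<in> ?P" for p
  proof -
    from that have p: "prime p" "m + 1 < p" "p \<le> 2*m+1" by auto
    have "p dvd fact (2*m+1)" using p by (simp add: prime_dvd_fact_iff del: fact_Suc)
    also have "fact (2*m+1) = fact m * fact (m+1) * ((2*m+1) choose m)"
      using binomial_fact_lemma[of m "2*m+1"] by (simp add: algebra_simps)
    finally have "p dvd fact m \<or> p dvd fact (m+1) \<or> p dvd (2*m+1) choose m"
      using p(1) by (metis prime_dvd_mult_iff)
    moreover have "\<not> p dvd fact m" "\<not> p dvd fact (m+1)"
      using p by (auto simp: prime_dvd_fact_iff simp del: fact_Suc)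
    ultimately show ?thesis by blast
  qed
  have "\<Prod>?P dvd (2*m+1) choose m"
  proof -
    have "\<Prod>A dvd (2*m+1) choose m" if "A \<subseteq> ?P" "finite A" for A
      using that(2,1)
    proof (induction A rule: finite_induct)
      case (insert p A)
      have "coprime p (\<Prod>A)"
        by (rule prod_coprime_right) (use insert in \<open>auto intro!: primes_coprime\<close>)
      with insert dvd[of p] show ?case by (auto intro: divides_mult)
    qed auto
    with fin show ?thesis by blast
  qed
  then have "\<Prod>?P \<le> (2*m+1) choose m" by (rule dvd_imp_le) (simp add: zero_less_binomial_iff)
  then have le: "\<Prod>?P \<le> 4 ^ m" using binomial_odd_middle_le[of m] by linarith
  have "(\<Sum>p\<in>?P. ln (real p)) = ln (real (\<Prod>?P))"
    using fin by (subst of_nat_prod, subst ln_prod) auto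
  also have "\<dots> \<le> ln (real (4 ^ m))" 
    using le by (subst ln_le_cancel_iff) (auto intro!: prod_pos simp del: of_nat_power of_nat_prod dest: prime_gt_0_nat)
  also have "\<dots> = real m * ln 4" by (simp add: ln_realpow)
  finally have 1: "(\<Sum>p\<in>?P. ln (real p)) \<le> real m * ln 4" .
  have "{p. prime p \<and> p \<le> 2*m+1} = {p. prime p \<and> p \<le> m+1} \<union> ?P" by auto
  then have "theta (2*m+1) = theta (m+1) + (\<Sum>p\<in>?P. ln (real p))"
    unfolding theta_def using fin by (subst sum.union_disjoint[symmetric]) auto
  with 1 show ?thesis by simp
qed

text \<open>Strong induction: an even \<open>n > 2\<close> is not prime and reduces to
  \<open>n - 1\<close>, an odd \<open>n = 2*m+1\<close> reduces to \<open>m+1\<close>, and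
  \<open>(m+1) + m = n\<close> closes the recursion.\<close>

lemma theta_le: "theta n \<le> real n * ln 4"
proof (induction n rule: less_induct)
  case (less n)
  consider "n = 0" | "n = 1" | "n = 2" | "n > 2" "even n" | "n > 2" "odd n" by linarith
  then show ?case
  proof cases
    assume "n = 0" then show ?thesis by (simp add: theta_def)
  next
    assume "n = 1" then show ?thesis
      by (simp add: theta_def) (metis (no_types, lifting) One_nat_def le_zero_eq ln_ge_zero mem_Collect_eq not_prime_0 not_prime_1 le_Suc_eq numeral_One one_le_numeral sum_nonpos order_refl empty_Collect_eq sum.empty)
  next
    assume n: "n = 2"
    have "{p::nat. prime p \<and> p \<le> 2} = {2}" by (auto dest: prime_ge_2_nat)
    then have "theta 2 = ln 2" by (simp add: theta_def)
    moreover have "ln (2::real) \<le> ln 4" by simp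
    moreover have "0 \<le> ln (4::real)" by simp
    ultimately have "theta 2 \<le> 2 * ln 4" by linarith
    then show ?thesis using n by simp
  next
    assume n: "n > 2" "even n"
    then obtain k where k: "n = Suc k" "k > 0" by (cases n) auto
    have "\<not> prime n" using n primes_dvd_imp_eq two_is_prime_nat by blast
    then have "theta n = theta k" using k theta_Suc[of k] by simp
    also have "\<dots> \<le> real k * ln 4" using less k by simp
    also have "\<dots> \<le> real n * ln 4" using k by simp
    finally show ?thesis .
  next
    assume n: "n > 2" "odd n"
    then obtain m where m: "n = 2*m+1" by (elim oddE)
    have "theta n \<le> theta (m+1) + real m * ln 4" using theta_odd_step[of m] m by simp
    also have "theta (m+1) \<le> real (m+1) * ln 4" using less[of "m+1"] m n by simp
    finally show ?thesis by (simp add: m algebra_simps)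
  qed
qed

section \<open>The zeta function near the line of real part one\<close>

lemma norm_nat_powr: "n > 0 \<Longrightarrow> norm (of_nat n powr s :: complex) = real n powr Re s"
  by (subst norm_powr_real_powr) auto

lemma norm_real_powr: "x > 0 \<Longrightarrow> norm (complex_of_real x powr s) = x powr Re s"
  by (subst norm_powr_real_powr) auto

text \<open>The quotient is the integral of \<open>u powr (-x-1)\<close> over
  \<open>[a, a+1]\<close>, so this is the integral comparison in telescoping form. Negative
  \<open>x\<close> serves growing partial sums, positive \<open>x\<close> convergent tails.\<close>

lemma powr_telescope_step:
  fixes x a :: real
  assumes "x \<noteq> 0" "x \<ge> -1" "a > 0"
  shows "(a + 1) powr (-x-1) \<le> (a powr (-x) - (a+1) powr (-x)) / x"
    and "(a powr (-x) - (a+1) powr (-x)) / x \<le> a powr (-x-1)"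
proof -
  have "\<exists>z. a < z \<and> z < a + 1 \<and> (a+1) powr (-x) - a powr (-x) = (a + 1 - a) * ((-x) * z powr (-x-1))"
    by (rule MVT2) (use assms in \<open>auto intro!: derivative_eq_intros\<close>)
  then obtain z where z: "a < z" "z < a + 1" "(a+1) powr (-x) - a powr (-x) = (-x) * z powr (-x-1)" by auto
  have e: "(a powr (-x) - (a+1) powr (-x)) / x = z powr (-x-1)"
    using z(3) assms by (simp add: field_simps)
  show "(a + 1) powr (-x-1) \<le> (a powr (-x) - (a+1) powr (-x)) / x"
    unfolding e by (rule powr_mono2') (use z assms in auto)
  show "(a powr (-x) - (a+1) powr (-x)) / x \<le> a powr (-x-1)"
    unfolding e by (rule powr_mono2') (use z assms in auto)
qed

lemma sum_powr_le:
  assumes "0 < b" "b \<le> 1"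
  shows "(\<Sum>n<N. real (Suc n) powr (b - 1)) \<le> real N powr b / b"
proof (induction N)
  case (Suc N)
  show ?case
  proof (cases "N = 0")
    case True
    then show ?thesis using assms by (simp add: field_simps)
  next
    case False
    have "real (Suc N) powr (b - 1) \<le> (real (Suc N) powr b - real N powr b) / b"
      using powr_telescope_step(1)[of "-b" "real N"] assms False by (simp add: field_simps)
    with Suc show ?thesis by (simp add: diff_divide_distrib)
  qed
qed (use assms in auto)

lemma powr_tail:
  assumes "x > 0" "N > 0"
  shows "summable (\<lambda>n. real (n + Suc N) powr (-x-1))"
    and "(\<Sum>n. real (n + Suc N) powr (-x-1)) \<le> real N powr (-x) / x"
proof -
  let ?g = "\<lambda>n. real (n + N) powr (-x) / x"
  have "?g \<longlonglongrightarrow> 0" using assms(1) by real_asymp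
  then have s: "(\<lambda>n. ?g n - ?g (Suc n)) sums (?g 0 - 0)" by (rule telescope_sums')
  have le: "real (n + Suc N) powr (-x-1) \<le> ?g n - ?g (Suc n)" for n
    using powr_telescope_step(1)[of x "real (n + N)"] assms
    by (simp add: diff_divide_distrib add_ac)
  show 1: "summable (\<lambda>n. real (n + Suc N) powr (-x-1))"
    by (rule summable_comparison_test'[OF sums_summable[OF s], of 0]) (use le in auto)
  have "(\<Sum>n. real (n + Suc N) powr (-x-1)) \<le> (\<Sum>n. ?g n - ?g (Suc n))"
    by (rule suminf_le[OF le 1 sums_summable[OF s]])
  also have "\<dots> = real N powr (-x) / x" using s by (simp add: sums_iff)
  finally show "(\<Sum>n. real (n + Suc N) powr (-x-1)) \<le> real N powr (-x) / x" .
qed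

lemma norm_powr_diff_le:
  assumes a: "0 < a" "a \<le> x" and s: "Re s \<ge> -1"
  shows "norm (complex_of_real x powr (-s) - complex_of_real a powr (-s)) \<le> norm s * a powr (-Re s - 1) * (x - a)"
proof -
  let ?S = "closed_segment (complex_of_real a) (of_real x)"
  have S: "\<exists>t. z = of_real t \<and> a \<le> t \<and> t \<le> x" if "z \<in> ?S" for z
    using that a by (auto simp: closed_segment_of_real closed_segment_eq_real_ivl split: if_splits)
  have "norm (complex_of_real x powr (-s) - complex_of_real a powr (-s)) \<le> (norm s * a powr (-Re s - 1)) * norm (complex_of_real x - of_real a)"
  proof (rule field_differentiable_bound[of ?S])
    fix z assume z: "z \<in> ?S"
    then obtain t where t: "z = of_real t" "a \<le> t" "t \<le> x" using S by blast
    show "((\<lambda>z. z powr (-s)) has_field_derivative (-s) * z powr (-s - 1)) (at z within ?S)"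
      by (rule has_field_derivative_at_within, rule has_field_derivative_powr) (use t a in \<open>auto simp: complex_nonpos_Reals_iff\<close>)
    show "norm ((-s) * z powr (-s - 1)) \<le> norm s * a powr (-Re s - 1)"
      using t a s by (auto simp: norm_mult norm_real_powr intro!: mult_left_mono powr_mono2')
  qed auto
  then show ?thesis using a by (simp flip: of_real_diff)
qed

definition zeta_diff :: "nat \<Rightarrow> complex \<Rightarrow> complex" where
  "zeta_diff n s = (s - 1) * of_nat n powr (-s) + of_nat (Suc n) powr (1 - s) - of_nat n powr (1 - s)"

text \<open>Subtracting \<open>(1-s) z n powr (-s)\<close> from \<open>z powr (1-s)\<close> makes
  the derivative vanish at \<open>z = n\<close>. The derivative on \<open>[n, n+1]\<close> is then
  itself a difference, which gains a factor \<open>1/n\<close>; this is what makes the series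
  converge down to \<open>Re s > 0\<close>.\<close>

lemma norm_zeta_diff_le:
  assumes "n > 0" "Re s \<ge> -1"
  shows "norm (zeta_diff n s) \<le> norm s * norm (s - 1) * real n powr (-Re s - 1)"
proof -
  let ?a = "real n"
  let ?S = "closed_segment (complex_of_real ?a) (of_real (?a + 1))"
  let ?f = "\<lambda>z. z powr (1 - s) - (1 - s) * z * of_nat n powr (-s)"
  have S: "\<exists>t. z = of_real t \<and> ?a \<le> t \<and> t \<le> ?a + 1" if "z \<in> ?S" for z
    using that unfolding closed_segment_of_real by (auto simp: closed_segment_eq_real_ivl)
  have "norm (?f (of_real (?a + 1)) - ?f (of_real ?a)) \<le> (norm s * norm (s - 1) * ?a powr (-Re s - 1)) * norm (complex_of_real (?a + 1) - of_real ?a)"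
  proof (rule field_differentiable_bound[of ?S])
    fix z assume z: "z \<in> ?S"
    then obtain t where t: "z = of_real t" "?a \<le> t" "t \<le> ?a + 1" using S by blast
    have t0: "t > 0" using t assms by linarith
    show "(?f has_field_derivative (1 - s) * z powr (-s) - (1 - s) * of_nat n powr (-s)) (at z within ?S)"
      by (rule has_field_derivative_at_within) (use t t0 in \<open>auto intro!: derivative_eq_intros simp: complex_nonpos_Reals_iff\<close>)
    have "norm (z powr (-s) - complex_of_real ?a powr (-s)) \<le> norm s * ?a powr (-Re s - 1) * (t - ?a)"
      unfolding t(1) by (rule norm_powr_diff_le) (use assms t in auto)
    also have "\<dots> \<le> norm s * ?a powr (-Re s - 1) * 1" using t by (intro mult_left_mono) auto
    finally have "norm (1 - s) * norm (z powr (-s) - complex_of_real ?a powr (-s)) \<le> norm (1-s) * (norm s * ?a powr (-Re s - 1))"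
      by (intro mult_left_mono) auto
    then show "norm ((1 - s) * z powr (-s) - (1 - s) * of_nat n powr (-s)) \<le> norm s * norm (s - 1) * ?a powr (-Re s - 1)"
      by (simp add: right_diff_distrib[symmetric] norm_mult norm_minus_commute mult_ac)
  qed auto
  moreover have "?f (of_real (?a + 1)) - ?f (of_real ?a) = zeta_diff n s"
    by (simp add: zeta_diff_def algebra_simps)
  moreover have "norm (complex_of_real (?a + 1) - of_real ?a) = 1" by simp
  ultimately show ?thesis by simp
qed

lemma zeta_diff_holomorphic: "n > 0 \<Longrightarrow> zeta_diff n holomorphic_on S"
  unfolding zeta_diff_def by (auto intro!: holomorphic_intros)

lemma holomorphic_on_suminf:
  assumes S: "open S" and hol: "\<And>n. f n holomorphic_on S"
    and bound: "\<And>x. x \<in> S \<Longrightarrow> \<exists>d>0. \<exists>M. summable M \<and> (\<forall>n. \<forall>z\<in>cball x d. norm (f n z :: complex) \<le> M n)"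
  shows "(\<lambda>z. \<Sum>n. f n z) holomorphic_on S"
proof (rule holomorphic_uniform_sequence[OF S, of "\<lambda>N z. \<Sum>n<N. f n z"])
  fix x assume x: "x \<in> S"
  obtain d M where d: "d > 0" "summable M" "\<And>n z. z \<in> cball x d \<Longrightarrow> norm (f n z) \<le> M n"
    using bound[OF x] by blast
  obtain e where e: "e > 0" "cball x e \<subseteq> S" using S x open_contains_cball by blast
  have "uniform_limit (cball x (min d e)) (\<lambda>N z. \<Sum>n<N. f n z) (\<lambda>z. \<Sum>n. f n z) sequentially"
    by (rule Weierstrass_m_test[OF _ d(2)]) (use d(3) in auto)
  moreover have "cball x (min d e) \<subseteq> S" using e(2) by auto
  ultimately show "\<exists>d>0. cball x d \<subseteq> S \<and> uniform_limit (cball x d) (\<lambda>N z. \<Sum>n<N. f n z) (\<lambda>z. \<Sum>n. f n z) sequentially"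
    using d(1) e(1) by (intro exI[of _ "min d e"]) auto
qed (auto intro!: holomorphic_intros hol)

text \<open>\<open>zetaZ s = (s - 1) \<zeta>(s)\<close>, continued to \<open>Re s > 0\<close>: the term \<open>zeta_diff n s\<close> is \<open>s - 1\<close> times the difference
  between \<open>n powr (-s)\<close> and the integral of \<open>x powr (-s)\<close> over \<open>[n, n + 1]\<close>; these integrals add up to \<open>1 / (s - 1)\<close>.\<close>
definition zetaZ :: "complex \<Rightarrow> complex" where
  "zetaZ s = 1 + (\<Sum>n. zeta_diff (Suc n) s)"

lemma summable_powr_neg: "x > 0 \<Longrightarrow> summable (\<lambda>n. real (Suc n) powr (-x-1))"
  using powr_tail(1)[of x 1] by (subst summable_Suc_iff[symmetric]) simp

lemma summable_zeta_diff:
  assumes "Re s > 0" shows "summable (\<lambda>n. zeta_diff (Suc n) s)"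
proof (rule summable_norm_cancel, rule summable_comparison_test'[of "\<lambda>n. norm s * norm (s - 1) * real (Suc n) powr (-Re s - 1)" 0])
  show "summable (\<lambda>n. norm s * norm (s - 1) * real (Suc n) powr (-Re s - 1))"
    by (intro summable_mult summable_powr_neg assms)
  show "norm (norm (zeta_diff (Suc n) s)) \<le> norm s * norm (s - 1) * real (Suc n) powr (-Re s - 1)" for n
    using norm_zeta_diff_le[of "Suc n" s] assms by simp
qed

lemma zetaZ_holomorphic: "zetaZ holomorphic_on {s. Re s > 0}"
proof -
  have "(\<lambda>s. \<Sum>n. zeta_diff (Suc n) s) holomorphic_on {s. Re s > 0}"
  proof (rule holomorphic_on_suminf)
    fix x assume "x \<in> {s. Re s > 0}"
    then have x: "Re x > 0" by simp
    define d where "d = Re x / 2"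
    have d: "d > 0" using x by (simp add: d_def)
    define B where "B = norm x + d + 1"
    show "\<exists>d>0. \<exists>M. summable M \<and> (\<forall>n. \<forall>z\<in>cball x d. norm (zeta_diff (Suc n) z) \<le> M n)"
    proof (intro exI[of _ d] exI[of _ "\<lambda>n. B * B * real (Suc n) powr (-d-1)"] conjI allI ballI d)
      show "summable (\<lambda>n. B * B * real (Suc n) powr (-d-1))"
        by (intro summable_mult summable_powr_neg d)
      fix n z assume z: "z \<in> cball x d"
      have "\<bar>Re (x - z)\<bar> \<le> d" using z abs_Re_le_cmod[of "x - z"] by (simp add: dist_norm)
      then have "Re x - Re z \<le> d" by simp
      then have rz: "Re z \<ge> d" by (simp add: d_def)
      have nz: "norm z \<le> norm x + d" using z norm_triangle_ineq4[of x "x - z"] by (simp add: dist_norm)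
      have B1: "norm z \<le> B" using nz by (simp add: B_def)
      have B2: "norm (z - 1) \<le> B" using nz norm_triangle_ineq4[of z 1] by (simp add: B_def)
      have "norm (zeta_diff (Suc n) z) \<le> norm z * norm (z - 1) * real (Suc n) powr (-Re z - 1)"
        using norm_zeta_diff_le[of "Suc n" z] rz d by simp
      also have "\<dots> \<le> B * B * real (Suc n) powr (-d-1)"
        using B1 B2 rz d order_trans[OF norm_ge_zero B1] by (intro mult_mono powr_mono) auto
      finally show "norm (zeta_diff (Suc n) z) \<le> B * B * real (Suc n) powr (-d-1)" .
    qed
  qed (auto intro: zeta_diff_holomorphic open_halfspace_Re_gt)
  then show ?thesis unfolding zetaZ_def by (intro holomorphic_intros)
qed

lemma zetaZ_1: "zetaZ 1 = 1"
  by (simp add: zetaZ_def zeta_diff_def powr_zero_eq_one del: of_nat_Suc)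

lemma sum_zeta_diff:
  "(\<Sum>n<N. zeta_diff (Suc n) s) = (s - 1) * (\<Sum>n<N. of_nat (Suc n) powr (-s)) + of_nat (Suc N) powr (1 - s) - 1"
  by (induction N) (simp_all add: zeta_diff_def algebra_simps)

definition zetaS :: "complex \<Rightarrow> complex" where
  "zetaS s = (\<Sum>n. of_nat (Suc n) powr (-s))"

lemma summable_zetaS_norm: "Re s > 1 \<Longrightarrow> summable (\<lambda>n. norm (of_nat (Suc n) powr (-s) :: complex))"
  using summable_powr_neg[of "Re s - 1"] by (subst norm_nat_powr) (auto simp: algebra_simps)

lemma zetaZ_eq:
  assumes "Re s > 1" shows "zetaZ s = (s - 1) * zetaS s"
proof -
  have s: "summable (\<lambda>n. of_nat (Suc n) powr (-s) :: complex)"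
    by (rule summable_norm_cancel[OF summable_zetaS_norm[OF assms]])
  have 1: "(\<lambda>N. \<Sum>n<N. zeta_diff (Suc n) s) \<longlonglongrightarrow> (\<Sum>n. zeta_diff (Suc n) s)"
    using assms by (intro summable_LIMSEQ summable_zeta_diff) simp
  have "(\<lambda>N. real (Suc N) powr (1 - Re s)) \<longlonglongrightarrow> 0" using assms by real_asymp
  then have "(\<lambda>N. norm (of_nat (Suc N) powr (1 - s) :: complex)) \<longlonglongrightarrow> 0"
    by (subst norm_nat_powr) auto
  then have "(\<lambda>N. of_nat (Suc N) powr (1 - s) :: complex) \<longlonglongrightarrow> 0" by (rule tendsto_norm_zero_cancel)
  then have "(\<lambda>N. (s - 1) * (\<Sum>n<N. of_nat (Suc n) powr (-s)) + of_nat (Suc N) powr (1 - s) - 1) \<longlonglongrightarrow> (s - 1) * zetaS s + 0 - 1"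
    unfolding zetaS_def by (intro tendsto_intros summable_LIMSEQ s)
  then have "(\<lambda>N. \<Sum>n<N. zeta_diff (Suc n) s) \<longlonglongrightarrow> (s - 1) * zetaS s + 0 - 1"
    unfolding sum_zeta_diff .
  from LIMSEQ_unique[OF 1 this] show ?thesis by (simp add: zetaZ_def)
qed

lemma zetaZ_split:
  assumes "Re s > 0"
  shows "zetaZ s = (s - 1) * (\<Sum>n<N. of_nat (Suc n) powr (-s)) + of_nat (Suc N) powr (1 - s) + (\<Sum>n. zeta_diff (Suc (n + N)) s)"
  unfolding zetaZ_def suminf_split_initial_segment[OF summable_zeta_diff[OF assms], of N] sum_zeta_diff
  by simp

text \<open>The series is cut at \<open>N\<close> of the size of \<open>r = 2 + |Im s|\<close>. The
  first \<open>N\<close> terms are bounded individually, the boundary term directly, and the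
  differences beyond \<open>N\<close> by \<open>r^2\<close> times a tail of size
  \<open>N powr (b-1)\<close>. All three pieces have size \<open>r powr (1+b)\<close>.\<close>

lemma zetaZ_growth:
  fixes b :: real
  assumes b: "0 < b" "b < 1"
  obtains C where "C > 0" "\<And>s. 1 - b \<le> Re s \<Longrightarrow> Re s \<le> 3 \<Longrightarrow> norm (zetaZ s) \<le> C * (2 + \<bar>Im s\<bar>) powr (1 + b)"
proof
  define C where "C = 2 powr b / b + 3 powr b + 2 / (1 - b)"
  show "C > 0" using b by (auto simp: C_def intro!: add_pos_pos)
  fix s assume s: "1 - b \<le> Re s" "Re s \<le> 3"
  define r where "r = 2 + \<bar>Im s\<bar>"
  have r: "r \<ge> 2" by (simp add: r_def)
  define N where "N = nat \<lceil>r\<rceil>"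
  have N: "real N \<ge> r" "real N \<le> r + 1" "N > 0" using r unfolding N_def by linarith+
  have N2: "real N \<le> 2 * r" "real (Suc N) \<le> 3 * r" using N r by auto
  have n1: "norm s \<le> 2 * r" using cmod_le[of s] s b by (simp add: r_def)
  have "\<bar>Re (s - 1)\<bar> \<le> 2" using s b by (simp add: abs_le_iff)
  then have n2: "norm (s - 1) \<le> r" using cmod_le[of "s - 1"] by (simp add: r_def)
  have "norm (\<Sum>n<N. of_nat (Suc n) powr (-s) :: complex) \<le> (\<Sum>n<N. real (Suc n) powr (b - 1))"
  proof (rule order_trans[OF norm_sum], rule sum_mono)
    fix n
    have "norm (of_nat (Suc n) powr (-s) :: complex) = real (Suc n) powr (- Re s)"
      by (subst norm_nat_powr) auto
    also have "\<dots> \<le> real (Suc n) powr (b - 1)" using s by (intro powr_mono) auto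
    finally show "norm (of_nat (Suc n) powr (-s) :: complex) \<le> real (Suc n) powr (b - 1)" .
  qed
  also have "\<dots> \<le> real N powr b / b" using b by (intro sum_powr_le) auto
  also have "\<dots> \<le> (2 * r) powr b / b" using b N2 by (intro divide_right_mono powr_mono2) auto
  finally have 1: "norm (\<Sum>n<N. of_nat (Suc n) powr (-s) :: complex) \<le> (2 * r) powr b / b" .
  have "norm (of_nat (Suc N) powr (1 - s) :: complex) = real (Suc N) powr (1 - Re s)" by (subst norm_nat_powr) auto
  also have "\<dots> \<le> real (Suc N) powr b" using s by (intro powr_mono) auto
  also have "\<dots> \<le> (3 * r) powr b" using N2 b by (intro powr_mono2) auto
  finally have 2: "norm (of_nat (Suc N) powr (1 - s) :: complex) \<le> (3 * r) powr b" .
  have sm: "summable (\<lambda>n. 2 * r * r * real (n + Suc N) powr (-(1-b) - 1))"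
    using b N by (intro summable_mult powr_tail) auto
  have le: "norm (zeta_diff (Suc (n + N)) s) \<le> 2 * r * r * real (n + Suc N) powr (-(1-b) - 1)" for n
  proof -
    have "norm (zeta_diff (Suc (n + N)) s) \<le> norm s * norm (s - 1) * real (Suc (n + N)) powr (-Re s - 1)"
      using s b by (intro norm_zeta_diff_le) auto
    also have "\<dots> \<le> (2 * r) * r * real (Suc (n + N)) powr (-(1-b) - 1)"
      using n1 n2 s r by (intro mult_mono powr_mono) auto
    finally show ?thesis by simp
  qed
  have "norm (\<Sum>n. zeta_diff (Suc (n + N)) s) \<le> (\<Sum>n. 2 * r * r * real (n + Suc N) powr (-(1-b) - 1))"
    by (rule order_trans[OF summable_norm suminf_le])
       (use le sm in \<open>auto intro: summable_comparison_test'[OF sm, of 0]\<close>)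
  also have "\<dots> = 2 * r * r * (\<Sum>n. real (n + Suc N) powr (-(1-b) - 1))"
    using b N by (intro suminf_mult powr_tail) auto
  also have "\<dots> \<le> 2 * r * r * (real N powr (-(1-b)) / (1-b))"
    using b N r by (intro mult_left_mono powr_tail) auto
  also have "\<dots> \<le> 2 * r * r * (r powr (-(1-b)) / (1-b))"
    using b N r by (intro mult_left_mono divide_right_mono powr_mono2') auto
  also have "\<dots> = r * (2 / (1-b)) * (r powr 1 * r powr (-(1-b)))" using r by simp
  also have "r powr 1 * r powr (-(1-b)) = r powr b" by (subst powr_add[symmetric]) simp
  finally have 3: "norm (\<Sum>n. zeta_diff (Suc (n + N)) s) \<le> r * (2 / (1-b)) * r powr b" .
  have "norm (zetaZ s) \<le> norm (s - 1) * norm (\<Sum>n<N. of_nat (Suc n) powr (-s) :: complex) + norm (of_nat (Suc N) powr (1 - s) :: complex) + norm (\<Sum>n. zeta_diff (Suc (n + N)) s)"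
    unfolding norm_mult[symmetric] using s b by (subst zetaZ_split[of s N]) (auto intro!: norm_triangle_mono)
  also have "\<dots> \<le> r * ((2 * r) powr b / b) + r * (3 * r) powr b + r * (2 / (1-b)) * r powr b"
  proof (intro add_mono mult_mono 1 3 n2)
    show "norm (of_nat (Suc N) powr (1 - s) :: complex) \<le> r * (3 * r) powr b"
      using 2 mult_right_mono[of 1 r "(3 * r) powr b"] r powr_ge_zero[of "3 * r" b] by linarith
  qed (use r in auto)
  also have "\<dots> = C * (r * r powr b)" using r b by (simp add: C_def powr_mult field_simps)
  also have "r * r powr b = r powr (1 + b)" using r by (simp add: powr_add)
  finally show "norm (zetaZ s) \<le> C * (2 + \<bar>Im s\<bar>) powr (1 + b)" unfolding r_def .
qed

section \<open>The Euler product and its logarithmic derivative for Re s > 1\<close>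

lemma summable_on_nat_powr:
  assumes "Re s > 1" shows "(\<lambda>n. of_nat n powr (-s) :: complex) summable_on A"
proof -
  have "summable (\<lambda>n. norm (of_nat n powr (-s) :: complex))"
    using summable_zetaS_norm[OF assms] by (subst (asm) summable_Suc_iff)
  then show ?thesis by (intro summable_on_subset_banach[OF norm_summable_imp_summable_on]) auto
qed

lemma zetaS_eq_infsum:
  assumes "Re s > 1" shows "zetaS s = infsum (\<lambda>n. of_nat n powr (-s)) {0<..}"
proof -
  have "((\<lambda>n. of_nat (Suc n) powr (-s)) has_sum zetaS s) UNIV"
    unfolding zetaS_def
    by (intro norm_summable_imp_has_sum summable_sums summable_norm_cancel[OF summable_zetaS_norm] summable_zetaS_norm assms)
  then have "zetaS s = infsum (\<lambda>n. of_nat (Suc n) powr (-s)) UNIV" by (simp add: infsumI)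
  also have "\<dots> = infsum (\<lambda>n. of_nat n powr (-s)) {0<..}"
    by (rule infsum_reindex_bij_betw) (auto simp: bij_betw_def greaterThan_0)
  finally show ?thesis .
qed

text \<open>The sieve of Eratosthenes: among the integers free of primes in \<open>P\<close>, the
  multiples of a further prime \<open>q\<close> are exactly \<open>q\<close> times such integers, so
  a factor \<open>1 - q powr (-s)\<close> removes them. Unordered sums make the regrouping
  legitimate.\<close>

lemma zetaS_sieve:
  assumes "Re s > 1" "finite P" "\<And>p. p \<in> P \<Longrightarrow> prime p"
  shows "(\<Prod>p\<in>P. 1 - of_nat p powr (-s)) * zetaS s =
    infsum (\<lambda>n. of_nat n powr (-s)) {n. n > 0 \<and> (\<forall>p\<in>P. \<not> p dvd n)}"
  using assms(2,3)
proof (induction P rule: finite_induct)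
  case empty
  then show ?case using zetaS_eq_infsum[OF assms(1)] by (simp add: greaterThan_def)
next
  case (insert q P)
  let ?f = "\<lambda>n::nat. of_nat n powr (-s) :: complex"
  let ?A = "{n. n > 0 \<and> (\<forall>p\<in>P. \<not> p dvd n)}"
  let ?B = "{n. n > 0 \<and> (\<forall>p\<in>insert q P. \<not> p dvd n)}"
  have q: "prime q" "q > 0" using insert by (auto dest: prime_gt_0_nat)
  have ndvd: "p dvd q * n \<longleftrightarrow> p dvd n" if "p \<in> P" for p n
    using that insert by (metis insertCI prime_dvd_multD primes_dvd_imp_eq dvd_mult q(1) insertE)
  have im: "(\<lambda>n. q * n) ` ?A = ?A - ?B"
  proof (intro equalityI subsetI)
    fix n assume n: "n \<in> ?A - ?B"
    then have "q dvd n" by auto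
    then obtain m where "n = q * m" by (elim dvdE)
    with n ndvd show "n \<in> (\<lambda>n. q * n) ` ?A" by (intro image_eqI[of _ _ m]) auto
  qed (use q ndvd in auto)
  have "infsum ?f ?A = infsum ?f (?B \<union> (\<lambda>n. q * n) ` ?A)"
    unfolding im by (rule arg_cong[of _ _ "infsum ?f"]) auto
  also have "\<dots> = infsum ?f ?B + infsum ?f ((\<lambda>n. q * n) ` ?A)"
    unfolding im by (intro infsum_Un_disjoint summable_on_nat_powr assms(1)) auto
  also have "infsum ?f ((\<lambda>n. q * n) ` ?A) = infsum (?f \<circ> (\<lambda>n. q * n)) ?A"
    by (rule infsum_reindex) (use q in \<open>auto simp: inj_on_def\<close>)
  also have "\<dots> = infsum (\<lambda>n. of_nat q powr (-s) * ?f n) ?A"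
    by (rule infsum_cong) (simp add: powr_times_real)
  also have "\<dots> = of_nat q powr (-s) * infsum ?f ?A" by (rule infsum_cmult_right')
  finally have "(1 - of_nat q powr (-s)) * infsum ?f ?A = infsum ?f ?B" by (simp add: algebra_simps)
  moreover have "(\<Prod>p\<in>P. 1 - of_nat p powr (-s)) * zetaS s = infsum ?f ?A"
    using insert by auto
  ultimately show ?case using insert.hyps by (simp add: mult.assoc)
qed

definition euler_inv :: "nat \<Rightarrow> complex \<Rightarrow> complex" where
  "euler_inv N s = (\<Prod>p\<in>{p. prime p \<and> p \<le> N}. 1 - of_nat p powr (-s))"

text \<open>After sieving by all primes up to \<open>N\<close>, every surviving integer other than 1
  exceeds \<open>N\<close>, so the defect is bounded by a tail of the zeta series. The explicit rate
  is what later gives local uniformity.\<close>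

lemma euler_inv_bound:
  assumes "Re s > 1" "N > 0"
  shows "norm (euler_inv N s * zetaS s - 1) \<le> real N powr (1 - Re s) / (Re s - 1)"
proof -
  let ?f = "\<lambda>n::nat. of_nat n powr (-s) :: complex"
  let ?A = "{n::nat. n > 0 \<and> (\<forall>p\<in>{p. prime p \<and> p \<le> N}. \<not> p dvd n)}"
  have one: "?A = insert 1 (?A - {1})" by auto
  have sub: "?A - {1} \<subseteq> {N<..}"
  proof
    fix n assume n: "n \<in> ?A - {1}"
    then obtain p where "prime p" "p dvd n" using prime_factor_nat[of n] by auto
    moreover from this n have "\<not> p \<le> N" by auto
    moreover have "p \<le> n" using n \<open>p dvd n\<close> by (intro dvd_imp_le) auto
    ultimately show "n \<in> {N<..}" by auto
  qed
  have "euler_inv N s * zetaS s = infsum ?f ?A"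
    unfolding euler_inv_def by (rule zetaS_sieve) (use assms in auto)
  also have "\<dots> = ?f 1 + infsum ?f (?A - {1})"
    by (subst one, rule infsum_insert) (auto intro: summable_on_nat_powr assms)
  finally have e: "euler_inv N s * zetaS s - 1 = infsum ?f (?A - {1})" by simp
  let ?g = "\<lambda>n. real (n + Suc N) powr (-(Re s - 1) - 1)"
  have "(?g has_sum (\<Sum>n. ?g n)) UNIV"
    by (intro sums_nonneg_imp_has_sum summable_sums powr_tail(1)) (use assms in auto)
  then have hs: "((\<lambda>n. real n powr (- Re s)) has_sum (\<Sum>n. ?g n)) {N<..}"
  proof -
    have "(\<lambda>n. n + Suc N) ` UNIV = {N<..}"
      by (auto intro!: image_eqI[of n _ "n - Suc N" for n])
    then have "((\<lambda>n. real n powr (- Re s)) has_sum (\<Sum>n. ?g n)) {N<..} \<longleftrightarrow> (((\<lambda>n. real n powr (- Re s)) \<circ> (\<lambda>n. n + Suc N)) has_sum (\<Sum>n. ?g n)) UNIV"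
      by (metis has_sum_reindex inj_on_add')
    then show ?thesis using \<open>(?g has_sum (\<Sum>n. ?g n)) UNIV\<close> by (simp add: o_def)
  qed
  have "norm (infsum ?f (?A - {1})) \<le> infsum (\<lambda>n. norm (?f n)) (?A - {1})"
    by (intro norm_infsum_bound iffD1[OF summable_on_iff_abs_summable_on_complex] summable_on_nat_powr assms(1))
  also have "\<dots> \<le> infsum (\<lambda>n. real n powr (- Re s)) {N<..}"
  proof (rule infsum_mono_neutral)
    show "(\<lambda>n. norm (?f n)) summable_on ?A - {1}"
      by (intro iffD1[OF summable_on_iff_abs_summable_on_complex] summable_on_nat_powr assms(1))
    show "(\<lambda>n. real n powr (- Re s)) summable_on {N<..}" using hs by (auto simp: summable_on_def)
    show "norm (?f n) \<le> real n powr (- Re s)" if "n \<in> (?A - {1}) \<inter> {N<..}" for n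
      using that by (subst norm_nat_powr) auto
  qed (use sub in auto)
  also have "\<dots> = (\<Sum>n. ?g n)" using hs by (simp add: infsumI)
  also have "\<dots> \<le> real N powr (-(Re s - 1)) / (Re s - 1)" by (rule powr_tail(2)) (use assms in auto)
  finally show ?thesis unfolding e by simp
qed

lemma euler_inv_tendsto:
  assumes "Re s > 1"
  shows "(\<lambda>N. euler_inv N s * zetaS s) \<longlonglongrightarrow> 1"
proof -
  have "(\<lambda>N. real N powr (1 - Re s) / (Re s - 1)) \<longlonglongrightarrow> 0" using assms by real_asymp
  then have "(\<lambda>N. euler_inv N s * zetaS s - 1) \<longlonglongrightarrow> 0"
    by (rule Lim_null_comparison[rotated]) (auto intro!: eventually_sequentiallyI[of 1] euler_inv_bound assms)
  then show ?thesis by (simp add: LIM_zero_iff)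
qed

lemma zetaS_nonzero: "Re s > 1 \<Longrightarrow> zetaS s \<noteq> 0"
  using euler_inv_tendsto[of s] LIMSEQ_unique[of "\<lambda>_. 0" 0 "1::complex"] by auto

lemma zetaZ_nonzero: "Re s > 1 \<Longrightarrow> zetaZ s \<noteq> 0"
  using zetaS_nonzero[of s] zetaZ_eq[of s] by auto

lemma prime_powr_ne_1:
  assumes "prime p" "Re s > 0" shows "(of_nat p powr (-s) :: complex) \<noteq> 1"
proof -
  have "real p powr (- Re s) < 1" using assms prime_gt_1_nat[of p] by (intro powr_less_one) auto
  then have "norm (of_nat p powr (-s) :: complex) < 1"
    using assms by (subst norm_nat_powr) (auto dest: prime_gt_0_nat)
  then show ?thesis by auto
qed

text \<open>The logarithmic derivative in \<open>s\<close> of the factor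
  \<open>1 - p powr (-s)\<close>.\<close>

definition log_deriv_term :: "complex \<Rightarrow> nat \<Rightarrow> complex" where
  "log_deriv_term s p = of_real (ln (real p)) * of_nat p powr (-s) / (1 - of_nat p powr (-s))"

lemma euler_inv_deriv:
  assumes "Re s > 0"
  shows "(euler_inv N has_field_derivative (euler_inv N s * (\<Sum>p\<in>{p. prime p \<and> p \<le> N}. log_deriv_term s p))) (at s)"
proof -
  have "((\<lambda>s. \<Prod>p\<in>{p. prime p \<and> p \<le> N}. 1 - of_nat p powr (-s)) has_field_derivative
     (\<Prod>p\<in>{p. prime p \<and> p \<le> N}. 1 - of_nat p powr (-s)) * (\<Sum>p\<in>{p. prime p \<and> p \<le> N}. (of_real (ln (real p)) * of_nat p powr (-s)) / (1 - of_nat p powr (-s)))) (at s)"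
  proof (rule has_field_derivative_prod')
    fix p assume p: "p \<in> {p. prime p \<and> p \<le> N}"
    then show "1 - of_nat p powr (-s) \<noteq> (0::complex)" using prime_powr_ne_1[of p s] assms by auto
    have p0: "p > 0" using p by (auto dest: prime_gt_0_nat)
    then have "Ln (of_nat p) = of_real (ln (real p))"
      by (metis Ln_of_real of_nat_0_less_iff of_real_of_nat_eq)
    then show "((\<lambda>s. 1 - of_nat p powr (-s)) has_field_derivative of_real (ln (real p)) * of_nat p powr (-s)) (at s)"
      using p0 by (auto intro!: derivative_eq_intros DERIV_chain2[OF has_field_derivative_powr_right, of "of_nat p" uminus])
  qed
  then show ?thesis unfolding euler_inv_def[abs_def] log_deriv_term_def .
qed

text \<open>Locally uniform convergence is what permits differentiating the limit of the finite
  Euler products termwise. The index is shifted because \<open>euler_inv_bound\<close> asks for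
  \<open>N > 0\<close>.\<close>

lemma euler_inv_times_Z_uniform:
  assumes "Re x > 1"
  shows "\<exists>d>0. cball x d \<subseteq> {s. Re s > 1} \<and>
    uniform_limit (cball x d) (\<lambda>N s. euler_inv (Suc N) s * zetaZ s) (\<lambda>s. s - 1) sequentially"
proof (intro exI conjI)
  define d where "d = (Re x - 1) / 2"
  show d: "d > 0" using assms by (simp add: d_def)
  have re: "Re s \<ge> 1 + d" if "s \<in> cball x d" for s
  proof -
    have "\<bar>Re (x - s)\<bar> \<le> d" using that abs_Re_le_cmod[of "x - s"] by (simp add: dist_norm)
    then have "Re x - Re s \<le> d" by simp
    then show ?thesis by (simp add: d_def field_simps)
  qed
  show "cball x d \<subseteq> {s. Re s > 1}" using re d by force
  define B where "B = norm x + d + 1"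
  have nB: "norm (s - 1) \<le> B" if "s \<in> cball x d" for s
  proof -
    have "norm s \<le> norm x + d" using that norm_triangle_ineq4[of x "x - s"] by (simp add: dist_norm)
    then show ?thesis using norm_triangle_ineq4[of s 1] by (simp add: B_def)
  qed
  have "(\<lambda>N. B * (real (Suc N) powr (-d) / d)) \<longlonglongrightarrow> 0" using d by real_asymp
  then have ev: "\<forall>\<^sub>F N in sequentially. B * (real (Suc N) powr (-d) / d) < e" if "e > 0" for e
    using that order_tendstoD(2) by blast
  have le: "dist (euler_inv (Suc N) s * zetaZ s) (s - 1) \<le> B * (real (Suc N) powr (-d) / d)" if "s \<in> cball x d" for s N
  proof -
    have s: "Re s > 1" using re[OF that] d by simp
    have "dist (euler_inv (Suc N) s * zetaZ s) (s - 1) = norm (s - 1) * norm (euler_inv (Suc N) s * zetaS s - 1)"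
      by (simp add: dist_norm zetaZ_eq[OF s] norm_mult[symmetric] algebra_simps)
    also have "\<dots> \<le> norm (s - 1) * (real (Suc N) powr (1 - Re s) / (Re s - 1))"
      by (intro mult_left_mono euler_inv_bound s) auto
    also have "\<dots> \<le> B * (real (Suc N) powr (-d) / d)"
      using re[OF that] d nB[OF that] order_trans[OF norm_ge_zero nB[OF that]]
      by (intro mult_mono frac_le powr_mono) auto
    finally show ?thesis .
  qed
  show "uniform_limit (cball x d) (\<lambda>N s. euler_inv (Suc N) s * zetaZ s) (\<lambda>s. s - 1) sequentially"
    unfolding uniform_limit_iff
  proof (intro allI impI)
    fix e :: real assume "e > 0"
    from ev[OF this] show "\<forall>\<^sub>F N in sequentially. \<forall>s\<in>cball x d. dist (euler_inv (Suc N) s * zetaZ s) (s - 1) < e"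
      by eventually_elim (blast intro: le_less_trans[OF le])
  qed
qed

lemma zetaZ_deriv: "Re s > 0 \<Longrightarrow> (zetaZ has_field_derivative deriv zetaZ s) (at s)"
  using zetaZ_holomorphic by (intro holomorphic_derivI[of _ "{s. Re s > 0}"]) (auto intro: open_halfspace_Re_gt)

text \<open>The products \<open>euler_inv * zetaZ\<close> tend to \<open>s - 1\<close>, so their
  derivatives tend to 1. Dividing by the products themselves isolates the sum over primes, and the
  logarithmic derivative is obtained without choosing a branch of a logarithm.\<close>

lemma log_deriv_tendsto:
  assumes "Re s > 1"
  shows "(\<lambda>N. \<Sum>p\<in>{p. prime p \<and> p \<le> N}. log_deriv_term s p) \<longlonglongrightarrow> 1 / (s - 1) - deriv zetaZ s / zetaZ s"
proof -
  let ?L = "\<lambda>N s. \<Sum>p\<in>{p. prime p \<and> p \<le> N}. log_deriv_term s p"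
  let ?f' = "\<lambda>N s. euler_inv (Suc N) s * ?L (Suc N) s * zetaZ s + euler_inv (Suc N) s * deriv zetaZ s"
  have "\<exists>g'. \<forall>x \<in> {s. Re s > 1}. ((\<lambda>s. s - 1) has_field_derivative g' x) (at x) \<and> (\<lambda>n. ?f' n x) \<longlonglongrightarrow> g' x"
  proof (rule has_complex_derivative_uniform_sequence)
    show "((\<lambda>s. euler_inv (Suc N) s * zetaZ s) has_field_derivative ?f' N x) (at x)" if "x \<in> {s. Re s > 1}" for N x
      using that by (auto intro!: derivative_eq_intros euler_inv_deriv zetaZ_deriv)
    show "\<exists>d>0. cball x d \<subseteq> {s. Re s > 1} \<and> uniform_limit (cball x d) (\<lambda>N s. euler_inv (Suc N) s * zetaZ s) (\<lambda>s. s - 1) sequentially" 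
      if "x \<in> {s. Re s > 1}" for x using euler_inv_times_Z_uniform that by simp
  qed (rule open_halfspace_Re_gt)
  then obtain g' where g': "((\<lambda>s. s - 1) has_field_derivative g') (at s)" "(\<lambda>n. ?f' n s) \<longlonglongrightarrow> g'"
    using assms by blast
  have "((\<lambda>s. s - 1) has_field_derivative 1) (at s)" by (auto intro!: derivative_eq_intros)
  with g'(1) have "g' = 1" by (rule DERIV_unique)
  with g'(2) have 1: "(\<lambda>n. ?f' n s) \<longlonglongrightarrow> 1" by simp
  have "(\<lambda>N. euler_inv N s * zetaS s * (s - 1)) \<longlonglongrightarrow> 1 * (s - 1)"
    by (intro tendsto_intros euler_inv_tendsto assms)
  then have "(\<lambda>N. euler_inv N s * zetaZ s) \<longlonglongrightarrow> s - 1" by (simp add: zetaZ_eq[OF assms] mult_ac)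
  then have 2: "(\<lambda>N. euler_inv (Suc N) s * zetaZ s) \<longlonglongrightarrow> s - 1" by (rule LIMSEQ_Suc)
  have s1: "s - 1 \<noteq> 0" using assms by auto
  have nz: "euler_inv N s \<noteq> 0" for N
    using prime_powr_ne_1[of _ s] assms by (auto simp: euler_inv_def)
  have "(\<lambda>N. ?f' N s / (euler_inv (Suc N) s * zetaZ s) - deriv zetaZ s / zetaZ s) \<longlonglongrightarrow> 1 / (s - 1) - deriv zetaZ s / zetaZ s"
    by (intro tendsto_intros 1 2 s1)
  also have "(\<lambda>N. ?f' N s / (euler_inv (Suc N) s * zetaZ s) - deriv zetaZ s / zetaZ s) = (\<lambda>N. ?L (Suc N) s)"
    using nz zetaZ_nonzero[OF assms] by (simp add: fun_eq_iff field_simps)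
  finally show ?thesis by (subst filterlim_sequentially_Suc[symmetric])
qed

text \<open>What \<open>log_deriv_term\<close> contains beyond its leading part
  \<open>ln p * p powr (-s)\<close>, that is, the contribution of the higher powers of a
  prime.\<close>

definition prime_corr :: "nat \<Rightarrow> complex \<Rightarrow> complex" where
  "prime_corr n s = (if prime n then of_real (ln (real n)) * of_nat n powr (-(2 * s)) / (1 - of_nat n powr (-s)) else 0)"

definition prime_corr_sum :: "complex \<Rightarrow> complex" where
  "prime_corr_sum s = (\<Sum>n. prime_corr n s)"

text \<open>The 16 is a product of two fours: \<open>ln n \<le> 4 n powr (1/4)\<close>, and the
  denominator is at least \<open>1/4\<close> because
  \<open>|n powr (-s)| \<le> 1 / sqrt 2 \<le> 3/4\<close>.\<close>

lemma norm_prime_corr_le: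
  assumes "Re s \<ge> 3/4"
  shows "norm (prime_corr n s) \<le> 16 * real n powr (-(1/4)-1)"
proof (cases "prime n")
  case True
  have n2: "real n \<ge> 2" using prime_ge_2_nat[OF True] by simp
  have "norm (of_nat n powr (-s) :: complex) = real n powr (- Re s)" using n2 by (subst norm_nat_powr) auto
  also have "\<dots> \<le> real n powr (-(1/2))" using n2 assms by (intro powr_mono) auto
  also have "\<dots> \<le> 2 powr (-(1/2))" using n2 by (intro powr_mono2') auto
  also have "\<dots> = 1 / sqrt 2" by (simp add: powr_minus powr_half_sqrt field_simps)
  also have "\<dots> \<le> 3/4"
    using real_le_rsqrt[of "4/3" 2] by (simp add: power2_eq_square field_simps)
  finally have a: "norm (of_nat n powr (-s) :: complex) \<le> 3/4" by simp
  have "1 - norm (of_nat n powr (-s) :: complex) \<le> norm (1 - of_nat n powr (-s) :: complex)"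
    using norm_triangle_ineq2[of 1 "of_nat n powr (-s) :: complex"] by simp
  with a have b: "norm (1 - of_nat n powr (-s) :: complex) \<ge> 1/4" by linarith
  have "ln (real n powr (1/4)) \<le> real n powr (1/4) - 1" using n2 by (intro ln_le_minus_one) auto
  then have c: "ln (real n) \<le> 4 * real n powr (1/4)" using n2 by (simp add: ln_powr)
  have "norm (prime_corr n s) = ln (real n) * real n powr (-(2 * Re s)) / norm (1 - of_nat n powr (-s) :: complex)"
    using True n2 by (simp add: prime_corr_def norm_divide norm_mult norm_nat_powr)
  also have "\<dots> \<le> (4 * real n powr (1/4)) * real n powr (-(3/2)) / (1/4)"
    using c b n2 assms by (intro frac_le mult_mono powr_mono) auto
  also have "\<dots> = 16 * (real n powr (1/4) * real n powr (-(3/2)))" by simp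
  also have "real n powr (1/4) * real n powr (-(3/2)) = real n powr (-(1/4)-1)"
    by (subst powr_add[symmetric]) simp
  finally show ?thesis .
qed (auto simp: prime_corr_def)

lemma prime_corr_holomorphic: "prime_corr n holomorphic_on {s. Re s > 3/4}"
proof (cases "prime n")
  case True
  then have "n \<noteq> 0" by (auto dest: prime_gt_0_nat)
  then show ?thesis using True prime_powr_ne_1[OF True]
    by (auto simp: prime_corr_def[abs_def] intro!: holomorphic_intros)
qed (simp add: prime_corr_def[abs_def])

lemma summable_prime_corr_bound: "summable (\<lambda>n. 16 * real n powr (-(1/4)-1))"
proof -
  have "summable (\<lambda>n. real (Suc n) powr (-(1/4)-1))" by (rule summable_powr_neg) simp
  then show ?thesis by (intro summable_mult) (subst (asm) summable_Suc_iff)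
qed

lemma prime_corr_sum_holomorphic: "prime_corr_sum holomorphic_on {s. Re s > 3/4}"
proof -
  have "(\<lambda>s. \<Sum>n. prime_corr n s) holomorphic_on {s. Re s > 3/4}"
  proof (rule holomorphic_on_suminf)
    fix x assume x: "x \<in> {s. Re s > 3/4}"
    have "open {s. Re s > 3/4}" by (rule open_halfspace_Re_gt)
    then obtain d where d: "d > 0" "cball x d \<subseteq> {s. Re s > 3/4}" using x open_contains_cball by blast
    then have "norm (prime_corr n z) \<le> 16 * real n powr (-(1/4)-1)" if "z \<in> cball x d" for n z
      using that by (intro norm_prime_corr_le) auto
    then show "\<exists>d>0. \<exists>M. summable M \<and> (\<forall>n. \<forall>z\<in>cball x d. norm (prime_corr n z) \<le> M n)"
      using d(1) summable_prime_corr_bound by blast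
  qed (rule open_halfspace_Re_gt, rule prime_corr_holomorphic)
  then show ?thesis unfolding prime_corr_sum_def[abs_def] .
qed

lemma summable_prime_corr: "Re s \<ge> 3/4 \<Longrightarrow> summable (\<lambda>n. prime_corr n s)"
  by (rule summable_comparison_test'[OF summable_prime_corr_bound, of 0]) (use norm_prime_corr_le in auto)

lemma prime_corr_sum_bounded:
  obtains C where "C > 0" "\<And>s. Re s \<ge> 3/4 \<Longrightarrow> norm (prime_corr_sum s) \<le> C"
proof
  let ?C = "\<Sum>n. 16 * real n powr (-(1/4)-1)"
  have 0: "?C \<ge> 0" by (intro suminf_nonneg summable_prime_corr_bound) auto
  show "?C + 1 > 0" using 0 by simp
  fix s :: complex assume s: "Re s \<ge> 3/4"
  have sn: "summable (\<lambda>n. norm (prime_corr n s))"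
    by (rule summable_comparison_test'[OF summable_prime_corr_bound, of 0]) (use norm_prime_corr_le[OF s] in auto)
  have "norm (prime_corr_sum s) \<le> (\<Sum>n. norm (prime_corr n s))"
    unfolding prime_corr_sum_def by (rule summable_norm[OF sn])
  also have "\<dots> \<le> ?C" by (intro suminf_le norm_prime_corr_le s sn summable_prime_corr_bound)
  finally show "norm (prime_corr_sum s) \<le> ?C + 1" by simp
qed

lemma sum_primes_le_eq:
  "(\<Sum>n<Suc N. if prime n then f n else 0) = (\<Sum>p\<in>{p. prime p \<and> p \<le> N}. f p)"
  by (rule sum.mono_neutral_cong_right) auto

lemma prime_log_sum_tendsto:
  assumes "Re s > 1"
  shows "(\<lambda>N. \<Sum>p\<in>{p. prime p \<and> p \<le> N}. of_real (ln (real p)) * of_nat p powr (-s))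
    \<longlonglongrightarrow> 1 / (s - 1) - deriv zetaZ s / zetaZ s - prime_corr_sum s"
proof -
  have "(\<lambda>N. \<Sum>n<Suc N. prime_corr n s) \<longlonglongrightarrow> prime_corr_sum s"
    unfolding prime_corr_sum_def by (rule LIMSEQ_Suc[OF summable_LIMSEQ[OF summable_prime_corr]]) (use assms in simp)
  then have "(\<lambda>N. (\<Sum>p\<in>{p. prime p \<and> p \<le> N}. log_deriv_term s p) - (\<Sum>n<Suc N. prime_corr n s))
     \<longlonglongrightarrow> 1 / (s - 1) - deriv zetaZ s / zetaZ s - prime_corr_sum s"
    by (intro tendsto_intros log_deriv_tendsto assms)
  also have "(\<lambda>N. (\<Sum>p\<in>{p. prime p \<and> p \<le> N}. log_deriv_term s p) - (\<Sum>n<Suc N. prime_corr n s)) =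
     (\<lambda>N. \<Sum>p\<in>{p. prime p \<and> p \<le> N}. of_real (ln (real p)) * of_nat p powr (-s))"
  proof
    fix N
    have "log_deriv_term s p - of_real (ln (real p)) * of_nat p powr (-(2 * s)) / (1 - of_nat p powr (-s)) = of_real (ln (real p)) * of_nat p powr (-s)"
      if "prime p" for p
    proof -
      have "of_nat p powr (-(2 * s)) = (of_nat p powr (-s) * of_nat p powr (-s) :: complex)"
        by (simp flip: powr_add)
      moreover have "c * a / (1 - a) - c * (a * a) / (1 - a) = c * a" if "a \<noteq> 1" for a c :: complex
      proof -
        have "c * a / (1 - a) - c * (a * a) / (1 - a) = c * a * (1 - a) / (1 - a)"
          by (simp add: diff_divide_distrib[symmetric] algebra_simps)
        then show ?thesis using that by simp
      qed
      ultimately show ?thesis using prime_powr_ne_1[OF that, of s] assms by (simp add: log_deriv_term_def)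
    qed
    then show "(\<Sum>p\<in>{p. prime p \<and> p \<le> N}. log_deriv_term s p) - (\<Sum>n<Suc N. prime_corr n s) = (\<Sum>p\<in>{p. prime p \<and> p \<le> N}. of_real (ln (real p)) * of_nat p powr (-s))"
      unfolding prime_corr_def sum_primes_le_eq sum_subtractf[symmetric] by (intro sum.cong) auto
  qed
  finally show ?thesis .
qed

section \<open>The 3-4-1 inequality and a zero-free region of polynomial width\<close>

lemma ln_norm_one_minus_sums:
  assumes "norm z < 1"
  shows "(\<lambda>n. - Re (z ^ n / of_nat n)) sums ln (norm (1 - z))"
proof -
  have "(\<lambda>n. - (z ^ n) / of_nat n) sums Ln (1 - z)"
    using Ln_series'[of "-z"] assms by simp
  then have "(\<lambda>n. Re (- (z ^ n) / of_nat n)) sums Re (Ln (1 - z))" using sums_Re by blast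
  moreover have "1 - z \<noteq> 0" using assms by auto
  ultimately show ?thesis by (simp add: Re_divide_of_nat)
qed

text \<open>In the power series of the logarithm, the coefficients combine to
  \<open>-(x^n / n) (3 + 4 Re u + Re (u^2))\<close> with \<open>|u| = 1\<close>, and the bracket
  equals \<open>2 (1 + Re u)^2\<close>. Applying this to each Euler factor and passing to the limit
  gives the inequality for zeta.\<close>

lemma three_four_one:
  fixes x :: real and w :: complex
  assumes "0 \<le> x" "x < 1" "norm w = 1"
  shows "norm (1 - of_real x :: complex) ^ 3 * norm (1 - x *\<^sub>R w) ^ 4 * norm (1 - x *\<^sub>R w ^ 2) \<le> 1"
proof -
  have n: "norm (of_real x :: complex) < 1" "norm (x *\<^sub>R w) < 1" "norm (x *\<^sub>R w ^ 2) < 1"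
    using assms by (auto simp: norm_power)
  have nz: "norm (1 - of_real x :: complex) > 0" "norm (1 - x *\<^sub>R w) > 0" "norm (1 - x *\<^sub>R w ^ 2) > 0"
    using n by (auto simp only: zero_less_norm_iff right_minus_eq) (auto simp: norm_power)
  let ?S = "3 * ln (norm (1 - of_real x :: complex)) + 4 * ln (norm (1 - x *\<^sub>R w)) + ln (norm (1 - x *\<^sub>R w ^ 2))"
  have "(\<lambda>n. 3 * (- Re ((of_real x) ^ n / of_nat n)) + 4 * (- Re ((x *\<^sub>R w) ^ n / of_nat n)) + (- Re ((x *\<^sub>R w ^ 2) ^ n / of_nat n))) sums ?S"
    by (intro sums_add sums_mult ln_norm_one_minus_sums n)
  moreover have "3 * (- Re ((of_real x) ^ n / of_nat n)) + 4 * (- Re ((x *\<^sub>R w) ^ n / of_nat n)) + (- Re ((x *\<^sub>R w ^ 2) ^ n / of_nat n)) \<le> 0" for n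
  proof -
    define u where "u = w ^ n"
    have u: "norm u = 1" using assms by (simp add: u_def norm_power)
    then have "(Re u)\<^sup>2 + (Im u)\<^sup>2 = 1" by (metis cmod_power2 one_power2)
    then have "Re (u ^ 2) = 2 * (Re u)\<^sup>2 - 1" by (simp add: power2_eq_square)
    then have e: "3 + 4 * Re u + Re (u ^ 2) = 2 * (1 + Re u)\<^sup>2" by (simp add: power2_eq_square algebra_simps)
    have "3 * (- Re ((of_real x) ^ n / of_nat n)) + 4 * (- Re ((x *\<^sub>R w) ^ n / of_nat n)) + (- Re ((x *\<^sub>R w ^ 2) ^ n / of_nat n))
       = - (x ^ n / real n) * (3 + 4 * Re u + Re (u ^ 2))"
    proof -
      have p: "(x *\<^sub>R w) ^ n = of_real (x ^ n) * u" "(x *\<^sub>R w ^ 2) ^ n = of_real (x ^ n) * u ^ 2"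
        by (simp_all add: u_def scaleR_conv_of_real power_mult_distrib power_mult[symmetric] mult.commute)
      have q: "Re (of_real a * v / of_nat n) = a / real n * Re v" for a v
        by (simp add: Re_divide_of_nat)
      show ?thesis
        using q[of "x ^ n" 1] unfolding p q by (simp add: algebra_simps add_divide_distrib)
    qed
    also have "\<dots> \<le> 0" unfolding e using assms by (simp add: mult_nonneg_nonneg)
    finally show ?thesis .
  qed
  ultimately have "?S \<le> 0" by (metis (no_types, lifting) sums_le sums_zero)
  then have "exp ?S \<le> 1" by simp
  also have "exp ?S = norm (1 - of_real x :: complex) ^ 3 * norm (1 - x *\<^sub>R w) ^ 4 * norm (1 - x *\<^sub>R w ^ 2)"
    using nz by (simp add: exp_add exp_of_nat_mult[of 3, simplified] exp_of_nat_mult[of 4, simplified])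
  finally show ?thesis .
qed

lemma euler_inv_three_four_one:
  assumes "\<sigma> > 0"
  shows "norm (euler_inv N (of_real \<sigma>)) ^ 3 * norm (euler_inv N (Complex \<sigma> t)) ^ 4 * norm (euler_inv N (Complex \<sigma> (2 * t))) \<le> 1"
proof -
  have "norm (euler_inv N (of_real \<sigma>)) ^ 3 * norm (euler_inv N (Complex \<sigma> t)) ^ 4 * norm (euler_inv N (Complex \<sigma> (2 * t)))
    = (\<Prod>p\<in>{p. prime p \<and> p \<le> N}. norm (1 - of_nat p powr (- of_real \<sigma>) :: complex) ^ 3 * norm (1 - of_nat p powr (- Complex \<sigma> t)) ^ 4 * norm (1 - of_nat p powr (- Complex \<sigma> (2*t)) :: complex))"
    by (simp only: euler_inv_def prod.distrib prod_power_distrib prod_norm[symmetric])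
  also have "\<dots> \<le> (\<Prod>p\<in>{p. prime p \<and> p \<le> N}. 1)"
  proof (rule prod_mono)
    fix p assume "p \<in> {p. prime p \<and> p \<le> N}"
    then have p: "prime p" "p > 0" by (auto dest: prime_gt_0_nat)
    define x where "x = real p powr (-\<sigma>)"
    define w where "w = of_nat p powr (- \<i> * of_real t)"
    have x: "0 \<le> x" "x < 1" using p assms prime_gt_1_nat[OF p(1)] unfolding x_def by (auto intro!: powr_less_one)
    have w: "norm w = 1" using p by (simp add: w_def norm_nat_powr)
    have x': "of_nat p powr (- of_real \<sigma>) = complex_of_real x" using p by (simp add: x_def powr_of_real[symmetric])
    have 1: "of_nat p powr (- Complex \<sigma> t) = x *\<^sub>R w"
      unfolding scaleR_conv_of_real x'[symmetric] w_def powr_add[symmetric] by (simp add: Complex_eq)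
    have 2: "of_nat p powr (- Complex \<sigma> (2*t)) = x *\<^sub>R w ^ 2"
      unfolding scaleR_conv_of_real x'[symmetric] w_def power2_eq_square powr_add[symmetric] by (simp add: Complex_eq algebra_simps)
    show "0 \<le> norm (1 - of_nat p powr (- of_real \<sigma>) :: complex) ^ 3 * norm (1 - of_nat p powr (- Complex \<sigma> t)) ^ 4 * norm (1 - of_nat p powr (- Complex \<sigma> (2*t)) :: complex) \<and>
      norm (1 - of_nat p powr (- of_real \<sigma>) :: complex) ^ 3 * norm (1 - of_nat p powr (- Complex \<sigma> t)) ^ 4 * norm (1 - of_nat p powr (- Complex \<sigma> (2*t)) :: complex) \<le> 1"
      unfolding x' 1 2 using three_four_one[OF x w] by simp
  qed
  finally show ?thesis by simp
qed

lemma zetaS_three_four_one: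
  assumes "\<sigma> > 1"
  shows "norm (zetaS (of_real \<sigma>)) ^ 3 * norm (zetaS (Complex \<sigma> t)) ^ 4 * norm (zetaS (Complex \<sigma> (2 * t))) \<ge> 1"
proof -
  let ?e = "\<lambda>N s. euler_inv N s * zetaS s"
  let ?P = "norm (zetaS (of_real \<sigma>)) ^ 3 * norm (zetaS (Complex \<sigma> t)) ^ 4 * norm (zetaS (Complex \<sigma> (2 * t)))"
  have "(\<lambda>N. norm (?e N (of_real \<sigma>)) ^ 3 * norm (?e N (Complex \<sigma> t)) ^ 4 * norm (?e N (Complex \<sigma> (2*t)))) \<longlonglongrightarrow> norm (1::complex) ^ 3 * norm (1::complex) ^ 4 * norm (1::complex)"
    by (intro tendsto_intros euler_inv_tendsto) (use assms in auto)
  then have "(\<lambda>N. norm (?e N (of_real \<sigma>)) ^ 3 * norm (?e N (Complex \<sigma> t)) ^ 4 * norm (?e N (Complex \<sigma> (2*t)))) \<longlonglongrightarrow> 1" by simp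
  moreover have "norm (?e N (of_real \<sigma>)) ^ 3 * norm (?e N (Complex \<sigma> t)) ^ 4 * norm (?e N (Complex \<sigma> (2*t))) \<le> ?P" for N
  proof -
    have "norm (?e N (of_real \<sigma>)) ^ 3 * norm (?e N (Complex \<sigma> t)) ^ 4 * norm (?e N (Complex \<sigma> (2*t))) =
       (norm (euler_inv N (of_real \<sigma>)) ^ 3 * norm (euler_inv N (Complex \<sigma> t)) ^ 4 * norm (euler_inv N (Complex \<sigma> (2 * t)))) * ?P"
      by (simp add: norm_mult power_mult_distrib mult_ac)
    also have "\<dots> \<le> 1 * ?P" using assms by (intro mult_right_mono euler_inv_three_four_one) auto
    finally show ?thesis by simp
  qed
  ultimately show ?thesis by (meson LIMSEQ_le_const2)
qed

text \<open>Cauchy's estimate on a disc of radius \<open>b/2\<close>, which stays inside the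
  half-plane where \<open>zetaZ_growth\<close> applies.\<close>

lemma zetaZ_deriv_growth:
  assumes b: "0 < b" "b < 1"
  obtains C where "C > 0" "\<And>s. 1 - b/2 \<le> Re s \<Longrightarrow> Re s \<le> 2 \<Longrightarrow> norm (deriv zetaZ s) \<le> C * (2 + \<bar>Im s\<bar>) powr (1 + b)"
proof -
  obtain C where C: "C > 0" "\<And>s. 1 - b \<le> Re s \<Longrightarrow> Re s \<le> 3 \<Longrightarrow> norm (zetaZ s) \<le> C * (2 + \<bar>Im s\<bar>) powr (1 + b)"
    using zetaZ_growth[OF b] by blast
  show ?thesis
  proof (rule that)
    show "8 * C / b > 0" using C b by simp
    fix s assume s: "1 - b/2 \<le> Re s" "Re s \<le> 2"
    define \<rho> where "\<rho> = 2 + \<bar>Im s\<bar>"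
    have \<rho>: "\<rho> \<ge> 2" by (simp add: \<rho>_def)
    have near: "1 - b \<le> Re x \<and> Re x \<le> 3 \<and> 2 + \<bar>Im x\<bar> \<le> 2 * \<rho>" if "norm (s - x) \<le> b/2" for x
    proof -
      have "\<bar>Re s - Re x\<bar> \<le> b/2" "\<bar>Im s - Im x\<bar> \<le> b/2"
        using that abs_Re_le_cmod[of "s - x"] abs_Im_le_cmod[of "s - x"] by auto
      then show ?thesis using s b \<rho>_def \<rho> by (auto simp: abs_if split: if_splits)
    qed
    have sub: "cball s (b/2) \<subseteq> {s. Re s > 0}" using near b by (force simp: dist_norm)
    have hol: "zetaZ holomorphic_on cball s (b/2)" by (rule holomorphic_on_subset[OF zetaZ_holomorphic sub])
    have "norm ((deriv ^^ 1) zetaZ s) \<le> fact 1 * (C * (2 * \<rho>) powr (1 + b)) / (b/2) ^ 1"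
    proof (rule Cauchy_inequality)
      show "zetaZ holomorphic_on ball s (b/2)" by (rule holomorphic_on_subset[OF hol]) auto
      show "continuous_on (cball s (b/2)) zetaZ" by (rule holomorphic_on_imp_continuous_on[OF hol])
      fix x assume "norm (s - x) = b/2"
      then have n: "1 - b \<le> Re x" "Re x \<le> 3" "2 + \<bar>Im x\<bar> \<le> 2 * \<rho>" using near[of x] by auto
      have "norm (zetaZ x) \<le> C * (2 + \<bar>Im x\<bar>) powr (1 + b)" by (rule C) (use n in auto)
      also have "\<dots> \<le> C * (2 * \<rho>) powr (1 + b)" using n b C by (intro mult_left_mono powr_mono2) auto
      finally show "norm (zetaZ x) \<le> C * (2 * \<rho>) powr (1 + b)" .
    qed (use b in auto)
    also have "\<dots> = 2 * C / b * (2 powr (1 + b) * \<rho> powr (1 + b))" using \<rho> by (simp add: powr_mult)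
    also have "\<dots> \<le> 2 * C / b * (2 powr 2 * \<rho> powr (1 + b))"
      using C b by (intro mult_left_mono mult_right_mono powr_mono) auto
    also have "\<dots> = 8 * C / b * \<rho> powr (1 + b)" by simp
    finally show "norm (deriv zetaZ s) \<le> 8 * C / b * (2 + \<bar>Im s\<bar>) powr (1 + b)" by (simp add: \<rho>_def)
  qed
qed

lemma zetaZ_mvt:
  assumes "0 < a" "a \<le> x" "x \<le> y"
    and "\<And>u. a \<le> u \<Longrightarrow> u \<le> y \<Longrightarrow> norm (deriv zetaZ (Complex u t)) \<le> B"
  shows "norm (zetaZ (Complex y t) - zetaZ (Complex x t)) \<le> B * (y - x)"
proof -
  let ?S = "closed_segment (Complex x t) (Complex y t)"
  have S: "Re z \<in> {a..y} \<and> Im z = t" if "z \<in> ?S" for z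
    using that assms by (auto simp: closed_segment_same_Im closed_segment_eq_real_ivl)
  have "norm (zetaZ (Complex y t) - zetaZ (Complex x t)) \<le> B * norm (Complex y t - Complex x t)"
  proof (rule field_differentiable_bound[of ?S])
    fix z assume "z \<in> ?S"
    from S[OF this] have z: "Re z \<in> {a..y} \<and> Im z = t" .
    show "(zetaZ has_field_derivative deriv zetaZ z) (at z within ?S)"
      by (rule has_field_derivative_at_within[OF zetaZ_deriv]) (use z assms(1) in auto)
    have "Complex (Re z) t = z" using z by (simp add: complex_eq_iff)
    moreover have "a \<le> Re z" "Re z \<le> y" using z by auto
    ultimately show "norm (deriv zetaZ z) \<le> B" using assms(4)[of "Re z"] by simp
  qed auto
  also have "norm (Complex y t - Complex x t) = y - x" using assms by (simp add: cmod_def)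
  finally show ?thesis .
qed

text \<open>Multiplying the 3-4-1 inequality by the powers of \<open>|s - 1|\<close> belonging to
  its three points puts \<open>\<eta>^3 |t|^5\<close>, up to a constant, on the left:
  \<open>\<eta>^3\<close> from the pole and five factors of size \<open>|t|\<close>. On the right
  the value at \<open>1 + \<eta>\<close> is bounded and the value at height \<open>2 t\<close> costs
  \<open>|t| powr (1+b)\<close>. Keeping \<open>|t| \<ge> t0\<close> makes \<open>|t|\<close>
  comparable with \<open>2 + |t|\<close>.\<close>

lemma zetaZ_lower_right:
  assumes b: "0 < b" "b < 1" and t0: "t0 > 0"
  obtains c where "c > 0" "\<And>\<eta> t. 0 < \<eta> \<Longrightarrow> \<eta> \<le> 1 \<Longrightarrow> \<bar>t\<bar> \<ge> t0 \<Longrightarrow>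
     norm (zetaZ (Complex (1 + \<eta>) t)) ^ 4 \<ge> c * \<eta> ^ 3 * (2 + \<bar>t\<bar>) powr (4 - b)"
proof -
  obtain C where C: "C > 0" "\<And>s. 1 - b \<le> Re s \<Longrightarrow> Re s \<le> 3 \<Longrightarrow> norm (zetaZ s) \<le> C * (2 + \<bar>Im s\<bar>) powr (1 + b)"
    using zetaZ_growth[OF b] by blast
  define C0 where "C0 = C * 4"
  \<comment> \<open>The value at \<open>t0\<close> of the increasing function
    \<open>t / (2 + t)\<close>.\<close>
  define k where "k = t0 / (2 + t0)"
  have C0: "C0 > 0" using C by (simp add: C0_def)
  have k: "k > 0" using t0 by (simp add: k_def)
  define c where "c = k ^ 4 * (2 * k) / (C0 ^ 3 * (C * 4))"
  show ?thesis
  proof (rule that)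
    show "c > 0" using C C0 k by (simp add: c_def)
    fix \<eta> t :: real assume \<eta>: "0 < \<eta>" "\<eta> \<le> 1" and t: "\<bar>t\<bar> \<ge> t0"
    define \<rho> where "\<rho> = 2 + \<bar>t\<bar>"
    have \<rho>: "\<rho> \<ge> 2" by (simp add: \<rho>_def)
    have tk: "\<bar>t\<bar> \<ge> k * \<rho>" using t t0 by (simp add: k_def \<rho>_def field_simps)
    let ?s = "Complex (1 + \<eta>) t" and ?r = "complex_of_real (1 + \<eta>)" and ?u = "Complex (1 + \<eta>) (2 * t)"
    have "norm (zetaZ ?r) \<le> C * 2 powr (1 + b)" using C(2)[of ?r] \<eta> b by simp
    also have "\<dots> \<le> C * 2 powr 2" using C b by (intro mult_left_mono powr_mono) auto
    finally have A: "norm (zetaZ ?r) \<le> C0" by (simp add: C0_def)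
    have "norm (zetaZ ?u) \<le> C * (2 + \<bar>2 * t\<bar>) powr (1 + b)" using C(2)[of ?u] \<eta> b by simp
    also have "\<dots> \<le> C * (2 * \<rho>) powr (1 + b)" using C b by (intro mult_left_mono powr_mono2) (auto simp: \<rho>_def)
    also have "\<dots> = C * (2 powr (1 + b) * \<rho> powr (1 + b))" using \<rho> by (simp add: powr_mult)
    also have "\<dots> \<le> C * (2 powr 2 * \<rho> powr (1 + b))" using C b by (intro mult_left_mono mult_right_mono powr_mono) auto
    finally have B: "norm (zetaZ ?u) \<le> C * 4 * \<rho> powr (1 + b)" by simp
    have d1: "norm (?r - 1) = \<eta>" using \<eta> by simp
    have d2: "norm (?s - 1) \<ge> k * \<rho>" using abs_Im_le_cmod[of "?s - 1"] tk by simp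
    have d3: "norm (?u - 1) \<ge> 2 * k * \<rho>" using abs_Im_le_cmod[of "?u - 1"] tk by simp
    have eqs: "norm (zetaZ ?r) = \<eta> * norm (zetaS ?r)" "norm (zetaZ ?s) = norm (?s - 1) * norm (zetaS ?s)"
       "norm (zetaZ ?u) = norm (?u - 1) * norm (zetaS ?u)"
      using \<eta> zetaZ_eq[of ?r] zetaZ_eq[of ?s] zetaZ_eq[of ?u] d1 by (simp_all add: norm_mult)
    have "1 \<le> norm (zetaS ?r) ^ 3 * norm (zetaS ?s) ^ 4 * norm (zetaS ?u)"
      using zetaS_three_four_one[of "1 + \<eta>" t] \<eta> by simp
    then have "\<eta> ^ 3 * norm (?s - 1) ^ 4 * norm (?u - 1) * 1 \<le> \<eta> ^ 3 * norm (?s - 1) ^ 4 * norm (?u - 1) * (norm (zetaS ?r) ^ 3 * norm (zetaS ?s) ^ 4 * norm (zetaS ?u))"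
      using \<eta> by (intro mult_left_mono) auto
    also have "\<dots> = norm (zetaZ ?r) ^ 3 * norm (zetaZ ?s) ^ 4 * norm (zetaZ ?u)"
      unfolding eqs power_mult_distrib by (simp only: mult_ac)
    also have "\<dots> \<le> C0 ^ 3 * norm (zetaZ ?s) ^ 4 * (C * 4 * \<rho> powr (1 + b))"
      using A B C0 C by (intro mult_mono power_mono) auto
    finally have 1: "\<eta> ^ 3 * norm (?s - 1) ^ 4 * norm (?u - 1) \<le> C0 ^ 3 * (C * 4) * \<rho> powr (1 + b) * norm (zetaZ ?s) ^ 4"
      by (simp add: mult_ac)
    have "\<eta> ^ 3 * (k * \<rho>) ^ 4 * (2 * k * \<rho>) \<le> \<eta> ^ 3 * norm (?s - 1) ^ 4 * norm (?u - 1)"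
      using d2 d3 k \<rho> \<eta> by (intro mult_mono power_mono) auto
    with 1 have 2: "\<eta> ^ 3 * (k * \<rho>) ^ 4 * (2 * k * \<rho>) \<le> C0 ^ 3 * (C * 4) * \<rho> powr (1 + b) * norm (zetaZ ?s) ^ 4" by linarith
    have p5: "\<rho> ^ 5 = \<rho> powr (4 - b) * \<rho> powr (1 + b)"
      using \<rho> by (simp flip: powr_add add: powr_numeral)
    have "\<eta> ^ 3 * (k * \<rho>) ^ 4 * (2 * k * \<rho>) = \<eta> ^ 3 * (k ^ 4 * (2 * k)) * \<rho> ^ 5" by (simp add: power_mult_distrib eval_nat_numeral)
    also have "\<dots> = c * \<eta> ^ 3 * \<rho> powr (4 - b) * (C0 ^ 3 * (C * 4) * \<rho> powr (1 + b))"
      using C0 C by (simp add: p5 c_def)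
    finally have e: "\<eta> ^ 3 * (k * \<rho>) ^ 4 * (2 * k * \<rho>) = c * \<eta> ^ 3 * \<rho> powr (4 - b) * (C0 ^ 3 * (C * 4) * \<rho> powr (1 + b))" .
    have "c * \<eta> ^ 3 * \<rho> powr (4 - b) * (C0 ^ 3 * (C * 4) * \<rho> powr (1 + b)) \<le> norm (zetaZ ?s) ^ 4 * (C0 ^ 3 * (C * 4) * \<rho> powr (1 + b))"
      using 2 unfolding e by (subst mult.commute[of "norm (zetaZ ?s) ^ 4"])
    then show "c * \<eta> ^ 3 * (2 + \<bar>t\<bar>) powr (4 - b) \<le> norm (zetaZ (Complex (1 + \<eta>) t)) ^ 4"
      using C0 C \<rho> by (subst (asm) mult_le_cancel_right_pos) (auto simp: \<rho>_def)
  qed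
qed

text \<open>Moving from \<open>1 + \<eta>\<close> to a point with real part at least
  \<open>1 - \<eta>\<close> changes \<open>zetaZ\<close> by at most
  \<open>2 D \<eta> \<rho> powr (1+b)\<close>. The fourth power of twice this change is below the
  lower bound \<open>c1 \<eta>^3 \<rho> powr (4-b)\<close> as soon as \<open>\<eta>\<close> is at
  most a constant times \<open>\<rho> powr (-5b)\<close>. The exponent \<open>1/8\<close> is
  \<open>5 b\<close> for \<open>b = 1/40\<close>.\<close>

lemma zetaZ_zero_free:
  obtains c K where "0 < c" "c \<le> 1/100" "K > 0"
    "\<And>s. 1 - c * (2 + \<bar>Im s\<bar>) powr (-(1/8)) \<le> Re s \<Longrightarrow> Re s \<le> 1 \<Longrightarrow>
       zetaZ s \<noteq> 0 \<and> norm (deriv zetaZ s / zetaZ s) \<le> K * (2 + \<bar>Im s\<bar>) powr (1/8)"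
proof -
  define b :: real where "b = 1/40"
  have b: "0 < b" "b < 1" by (simp_all add: b_def)
  obtain D where D: "D > 0" "\<And>s. 1 - b/2 \<le> Re s \<Longrightarrow> Re s \<le> 2 \<Longrightarrow> norm (deriv zetaZ s) \<le> D * (2 + \<bar>Im s\<bar>) powr (1 + b)"
    using zetaZ_deriv_growth[OF b] by blast
  have "isCont zetaZ 1" using zetaZ_deriv[of 1] DERIV_isCont by fastforce
  then obtain r where r: "r > 0" "\<And>s. dist s 1 < r \<Longrightarrow> dist (zetaZ s) (zetaZ 1) < 1/2"
    unfolding continuous_at_eps_delta by (metis half_gt_zero zero_less_one)
  have near1: "norm (zetaZ s) \<ge> 1/2" if "dist s 1 < r" for s
    using r(2)[OF that] norm_triangle_ineq2[of 1 "1 - zetaZ s"] by (simp add: zetaZ_1 dist_norm norm_minus_commute)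
  obtain c1 where c1: "c1 > 0" "\<And>\<eta> t. 0 < \<eta> \<Longrightarrow> \<eta> \<le> 1 \<Longrightarrow> \<bar>t\<bar> \<ge> r/2 \<Longrightarrow>
     norm (zetaZ (Complex (1 + \<eta>) t)) ^ 4 \<ge> c1 * \<eta> ^ 3 * (2 + \<bar>t\<bar>) powr (4 - b)"
    using zetaZ_lower_right[OF b, of "r/2"] r(1) by auto
  \<comment> \<open>The bound \<open>1/100\<close> keeps \<open>1 - c\<close> inside the strip of
    width \<open>b/2 = 1/80\<close> where the derivative is controlled, \<open>r/4\<close> puts the
    points with small \<open>|t|\<close> into the disc around 1, and the third entry is the
    comparison of fourth powers.\<close>
  define c where "c = Min {1/100, r/4, c1 / (256 * D ^ 4)}"
  have c: "c > 0" "c \<le> 1/100" "c < r/2" "c * (256 * D ^ 4) \<le> c1"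
  proof -
    show "c > 0" using r c1 D by (simp add: c_def)
    show "c \<le> 1/100" by (simp add: c_def)
    have "c \<le> r/4" by (simp add: c_def)
    then show "c < r/2" using r by simp
    have "c \<le> c1 / (256 * D ^ 4)" by (simp add: c_def)
    then show "c * (256 * D ^ 4) \<le> c1" using D by (simp add: pos_le_divide_eq)
  qed
  define K where "K = Max {1 / (2 * c), 2 * D * 3 powr (1 + b), 2 * D * (2 + r) powr (1 + b)}"
  have K: "K \<ge> 1 / (2 * c)" "K \<ge> 2 * D * (2 + r) powr (1 + b)" by (simp_all add: K_def)
  have K0: "K > 0" using K(1) c less_le_trans[of 0 "1/(2*c)" K] by simp
  show ?thesis
  proof (rule that[OF c(1,2) K0])
    fix s assume s: "1 - c * (2 + \<bar>Im s\<bar>) powr (-(1/8)) \<le> Re s" "Re s \<le> 1"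
    define t where "t = Im s"
    define \<rho> where "\<rho> = 2 + \<bar>t\<bar>"
    define \<eta> where "\<eta> = c * \<rho> powr (-(1/8))"
    have \<rho>: "\<rho> \<ge> 2" by (simp add: \<rho>_def)
    have "\<rho> powr (-(1/8)) \<le> 1" using powr_mono[of "-(1/8)" 0 \<rho>] \<rho> by simp
    then have ec: "\<eta> \<le> c * 1" unfolding \<eta>_def using c by (intro mult_left_mono) auto
    have "0 < \<eta>" using c \<rho> by (simp add: \<eta>_def)
    with ec c have \<eta>: "0 < \<eta>" "\<eta> \<le> c" "\<eta> \<le> 1/100" by auto
    have re: "1 - \<eta> \<le> Re s" using s by (simp add: \<eta>_def \<rho>_def t_def)
    have dZ: "norm (deriv zetaZ s) \<le> D * \<rho> powr (1 + b)"
      using D(2)[of s] re s \<eta> by (simp add: \<rho>_def t_def b_def)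
    show "zetaZ s \<noteq> 0 \<and> norm (deriv zetaZ s / zetaZ s) \<le> K * (2 + \<bar>Im s\<bar>) powr (1/8)"
    proof (cases "\<bar>t\<bar> \<ge> r/2")
      \<comment> \<open>Close to the real axis the lower bound from the Euler product degenerates;
        here continuity at \<open>s = 1\<close>, where \<open>zetaZ\<close> equals 1, replaces
        it.\<close>
      case False
      have "dist s 1 \<le> \<bar>Re s - 1\<bar> + \<bar>t\<bar>" using cmod_le[of "s - 1"] by (simp add: dist_norm t_def)
      also have "\<dots> < r" using False re s \<eta> c by simp
      finally have l: "norm (zetaZ s) \<ge> 1/2" by (rule near1)
      have "norm (deriv zetaZ s / zetaZ s) \<le> D * (2 + r) powr (1 + b) / (1/2)"
        unfolding norm_divide
      proof (rule frac_le)
        have "D * \<rho> powr (1 + b) \<le> D * (2 + r) powr (1 + b)" using D False b by (intro mult_left_mono powr_mono2) (auto simp: \<rho>_def)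
        with dZ show "norm (deriv zetaZ s) \<le> D * (2 + r) powr (1 + b)" by simp
      qed (use D l in auto)
      also have "\<dots> \<le> K * 1" using K by simp
      also have "\<dots> \<le> K * \<rho> powr (1/8)" using K0 \<rho> by (intro mult_left_mono ge_one_powr_ge_zero) auto
      finally show ?thesis using l by (auto simp: \<rho>_def t_def)
    next
      case True
      define E where "E = 2 * D * \<eta> * \<rho> powr (1 + b)"
      have E0: "E > 0" using D \<eta> \<rho> by (simp add: E_def)
      let ?A = "norm (zetaZ (Complex (1 + \<eta>) t))"
      have "(2 * E) ^ 4 = 256 * D ^ 4 * \<eta> ^ 4 * (\<rho> powr (1 + b)) ^ 4" by (simp add: E_def power_mult_distrib)
      also have "(\<rho> powr (1 + b)) ^ 4 = \<rho> powr (4 + 4 * b)" using \<rho> by (simp add: powr_power field_simps)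
      also have "\<eta> ^ 4 = c * \<rho> powr (-(1/8)) * \<eta> ^ 3" by (simp add: \<eta>_def eval_nat_numeral)
      also have "256 * D ^ 4 * (c * \<rho> powr (-(1/8)) * \<eta> ^ 3) * \<rho> powr (4 + 4 * b) = c * (256 * D ^ 4) * \<eta> ^ 3 * (\<rho> powr (-(1/8)) * \<rho> powr (4 + 4 * b))"
        by (simp add: mult_ac)
      also have "\<rho> powr (-(1/8)) * \<rho> powr (4 + 4 * b) = \<rho> powr (4 - b)"
        by (simp flip: powr_add add: b_def)
      also have "c * (256 * D ^ 4) * \<eta> ^ 3 * \<rho> powr (4 - b) \<le> c1 * \<eta> ^ 3 * \<rho> powr (4 - b)"
        using c \<eta> by (intro mult_right_mono) auto
      also have "\<dots> \<le> ?A ^ 4" using c1(2)[of \<eta> t] \<eta> True by (simp add: \<rho>_def)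
      finally have A: "2 * E \<le> ?A" by (rule power_le_imp_le_base[of _ 3, simplified]) auto
      have "norm (zetaZ (Complex (1 + \<eta>) t) - zetaZ (Complex (Re s) t)) \<le> D * \<rho> powr (1 + b) * (1 + \<eta> - Re s)"
      proof (rule zetaZ_mvt[of "1 - b/2"])
        show "norm (deriv zetaZ (Complex u t)) \<le> D * \<rho> powr (1 + b)" if "1 - b/2 \<le> u" "u \<le> 1 + \<eta>" for u
          using D(2)[of "Complex u t"] that \<eta> by (simp add: \<rho>_def)
      qed (use \<eta> re s b in \<open>auto simp: b_def\<close>)
      also have "\<dots> \<le> D * \<rho> powr (1 + b) * (2 * \<eta>)" using D re by (intro mult_left_mono) auto
      also have "\<dots> = E" by (simp add: E_def)
      finally have "?A - norm (zetaZ (Complex (Re s) t)) \<le> E"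
        using norm_triangle_ineq2[of "zetaZ (Complex (1 + \<eta>) t)" "zetaZ (Complex (Re s) t)"] by linarith
      with A have l: "norm (zetaZ s) \<ge> E" by (simp add: t_def)
      have "norm (deriv zetaZ s / zetaZ s) \<le> D * \<rho> powr (1 + b) / E"
        unfolding norm_divide by (rule frac_le) (use D dZ l E0 in auto)
      also have "\<dots> = 1 / (2 * c) * \<rho> powr (1/8)" using D \<rho> by (simp add: E_def \<eta>_def powr_minus field_simps)
      also have "\<dots> \<le> K * \<rho> powr (1/8)" using K by (intro mult_right_mono) auto
      finally show ?thesis using l E0 by (auto simp: \<rho>_def t_def)
    qed
  qed
qed

section \<open>The prime number theorem with an error term\<close>

text \<open>Cauchy's formula with the horizontal sides cut at the imaginary axis, because the two
  halves of the contour are estimated by different means.\<close>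

lemma contour_integral_rectangle:
  fixes F :: "complex \<Rightarrow> complex"
  assumes S: "convex S" "open S" "F holomorphic_on S" and l: "l > 0" and R: "R > 0"
    and sub: "\<And>z. -l \<le> Re z \<Longrightarrow> Re z \<le> R \<Longrightarrow> \<bar>Im z\<bar> \<le> R \<Longrightarrow> z \<in> S"
  defines "f \<equiv> \<lambda>z. F z / z"
  shows "2 * pi * \<i> * F 0 =
      contour_integral (linepath (Complex (-l) (-R)) (Complex 0 (-R))) f
    + contour_integral (linepath (Complex 0 (-R)) (Complex R (-R))) f
    + contour_integral (linepath (Complex R (-R)) (Complex R R)) f
    + contour_integral (linepath (Complex R R) (Complex 0 R)) f
    + contour_integral (linepath (Complex 0 R) (Complex (-l) R)) f
    + contour_integral (linepath (Complex (-l) R) (Complex (-l) (-R))) f" (is "_ = ?rhs")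
    and "\<And>a b. \<forall>z\<in>closed_segment a b. -l \<le> Re z \<and> Re z \<le> R \<and> \<bar>Im z\<bar> \<le> R \<and> z \<noteq> 0 \<Longrightarrow> f contour_integrable_on linepath a b"
proof -
  let ?g = "rectpath (Complex (-l) (-R)) (Complex R R)"
  have cont: "continuous_on (closed_segment a b) f" if "\<forall>z\<in>closed_segment a b. -l \<le> Re z \<and> Re z \<le> R \<and> \<bar>Im z\<bar> \<le> R \<and> z \<noteq> 0" for a b
  proof -
    have "continuous_on (closed_segment a b) F"
      by (rule continuous_on_subset[OF holomorphic_on_imp_continuous_on[OF S(3)]]) (use that sub in auto)
    then show ?thesis unfolding f_def using that by (intro continuous_intros) auto
  qed
  show ci: "f contour_integrable_on linepath a b" if "\<forall>z\<in>closed_segment a b. -l \<le> Re z \<and> Re z \<le> R \<and> \<bar>Im z\<bar> \<le> R \<and> z \<noteq> 0" for a b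
    by (rule contour_integrable_continuous_linepath[OF cont[OF that]])
  have box: "0 \<in> box (Complex (-l) (-R)) (Complex R R)" using l R by (simp add: in_box_complex_iff)
  have pi: "path_image ?g \<subseteq> S - {0}"
  proof
    fix z assume z: "z \<in> path_image ?g"
    then have "z \<in> cbox (Complex (-l) (-R)) (Complex R R)" "z \<notin> box (Complex (-l) (-R)) (Complex R R)"
      using l R path_image_rectpath_cbox_minus_box[of "Complex (-l) (-R)" "Complex R R"] by auto
    then show "z \<in> S - {0}" using box sub by (auto simp: in_cbox_complex_iff)
  qed
  have "((\<lambda>w. F w / (w - 0)) has_contour_integral (2 * pi * \<i> * winding_number ?g 0 * F 0)) ?g"
    by (rule Cauchy_integral_formula_convex_simple[OF S(1,3) _ _ pi]) (use l R sub S(2) in \<open>auto simp: interior_open\<close>)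
  then have 1: "contour_integral ?g f = 2 * pi * \<i> * F 0"
    unfolding f_def using winding_number_rectpath[OF box] by (auto dest: contour_integral_unique)
  have seg: "\<forall>z\<in>closed_segment (Complex (-l) (-R)) (Complex R (-R)). -l \<le> Re z \<and> Re z \<le> R \<and> \<bar>Im z\<bar> \<le> R \<and> z \<noteq> 0"
    "\<forall>z\<in>closed_segment (Complex R (-R)) (Complex R R). -l \<le> Re z \<and> Re z \<le> R \<and> \<bar>Im z\<bar> \<le> R \<and> z \<noteq> 0"
    "\<forall>z\<in>closed_segment (Complex R R) (Complex (-l) R). -l \<le> Re z \<and> Re z \<le> R \<and> \<bar>Im z\<bar> \<le> R \<and> z \<noteq> 0"
    "\<forall>z\<in>closed_segment (Complex (-l) R) (Complex (-l) (-R)). -l \<le> Re z \<and> Re z \<le> R \<and> \<bar>Im z\<bar> \<le> R \<and> z \<noteq> 0"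
    using l R by (auto simp: closed_segment_same_Im closed_segment_same_Re closed_segment_eq_real_ivl)
  have "contour_integral ?g f = contour_integral (linepath (Complex (-l) (-R)) (Complex R (-R))) f + 
     (contour_integral (linepath (Complex R (-R)) (Complex R R)) f +
     (contour_integral (linepath (Complex R R) (Complex (-l) R)) f + contour_integral (linepath (Complex (-l) R) (Complex (-l) (-R))) f))"
    unfolding rectpath_def Let_def using seg[THEN ci] by (simp add: contour_integrable_join)
  also have "contour_integral (linepath (Complex (-l) (-R)) (Complex R (-R))) f = 
      contour_integral (linepath (Complex (-l) (-R)) (Complex 0 (-R))) f + contour_integral (linepath (Complex 0 (-R)) (Complex R (-R))) f"
    by (rule contour_integral_split_linepath[OF cont[OF seg(1)]])
       (use l R in \<open>auto simp: closed_segment_same_Im closed_segment_eq_real_ivl\<close>)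
  also have "contour_integral (linepath (Complex R R) (Complex (-l) R)) f = 
      contour_integral (linepath (Complex R R) (Complex 0 R)) f + contour_integral (linepath (Complex 0 R) (Complex (-l) R)) f"
    by (rule contour_integral_split_linepath[OF cont[OF seg(3)]])
       (use l R in \<open>auto simp: closed_segment_same_Im closed_segment_eq_real_ivl\<close>)
  finally show "2 * pi * \<i> * F 0 = ?rhs" unfolding 1 by (simp add: add_ac)
qed

text \<open>When \<open>(Im z)^2 = R^2\<close>, the number \<open>1 + z^2 / R^2\<close> loses its
  constant term and vanishes linearly in \<open>Re z\<close>. This compensates the factor
  \<open>1 / |Re z|\<close> in the bounds for tails and partial sums.\<close>

lemma newman_kernel_horizontal:
  fixes R :: real assumes "R > 0" "\<bar>Im z\<bar> = R" "\<bar>Re z\<bar> \<le> R"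
  shows "norm ((1 + z\<^sup>2 / of_real (R\<^sup>2)) / z) \<le> 3 * \<bar>Re z\<bar> / R\<^sup>2"
proof -
  have "(Im z)\<^sup>2 = R\<^sup>2" using assms by (metis power2_abs)
  then have "1 + z\<^sup>2 / of_real (R\<^sup>2) = (of_real ((Re z)\<^sup>2) + 2 * \<i> * of_real (Re z) * of_real (Im z)) / of_real (R\<^sup>2)"
    using assms(1) by (simp add: complex_eq_iff field_simps power2_eq_square)
  then have "norm (1 + z\<^sup>2 / of_real (R\<^sup>2)) = norm (of_real ((Re z)\<^sup>2) + 2 * \<i> * of_real (Re z) * of_real (Im z)) / R\<^sup>2"
    by (simp add: norm_divide norm_power)
  also have "norm (of_real ((Re z)\<^sup>2) + 2 * \<i> * of_real (Re z) * of_real (Im z)) \<le> \<bar>Re z\<bar> * \<bar>Re z\<bar> + 2 * \<bar>Re z\<bar> * R"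
    by (rule order_trans[OF norm_triangle_ineq]) (use assms in \<open>simp add: norm_mult power2_eq_square\<close>)
  also have "\<dots> \<le> \<bar>Re z\<bar> * R + 2 * \<bar>Re z\<bar> * R" using assms by (intro add_right_mono mult_left_mono) auto
  finally have "norm (1 + z\<^sup>2 / of_real (R\<^sup>2)) \<le> (3 * \<bar>Re z\<bar> * R) / R\<^sup>2" using assms(1) by (simp add: divide_right_mono algebra_simps)
  moreover have "norm z \<ge> R" using abs_Im_le_cmod[of z] assms by simp
  ultimately have "norm ((1 + z\<^sup>2 / of_real (R\<^sup>2)) / z) \<le> ((3 * \<bar>Re z\<bar> * R) / R\<^sup>2) / R"
    unfolding norm_divide by (intro frac_le) (use assms(1) in auto)
  also have "\<dots> = 3 * \<bar>Re z\<bar> / R\<^sup>2" using assms(1) by (simp add: power2_eq_square)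
  finally show ?thesis .
qed

lemma newman_kernel_vertical:
  fixes R :: real assumes "0 < d" "d \<le> R" "\<bar>Re z\<bar> = d" "\<bar>Im z\<bar> \<le> R"
  shows "norm ((1 + z\<^sup>2 / of_real (R\<^sup>2)) / z) \<le> 3 / d"
proof -
  have R: "R > 0" using assms by simp
  have "(norm z)\<^sup>2 \<le> R\<^sup>2 + R\<^sup>2"
    unfolding cmod_power2 using assms by (intro add_mono) (metis abs_ge_zero power2_abs power_mono)+
  then have "norm (z\<^sup>2 / of_real (R\<^sup>2)) \<le> 2" using R by (simp add: norm_divide norm_power field_simps)
  then have "norm (1 + z\<^sup>2 / of_real (R\<^sup>2)) \<le> 3" using norm_triangle_ineq[of 1 "z\<^sup>2 / of_real (R\<^sup>2)"] by simp
  moreover have "norm z \<ge> d" using abs_Re_le_cmod[of z] assms by simp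
  ultimately show ?thesis unfolding norm_divide by (intro frac_le) (use assms in auto)
qed

lemma norm_triangle9:
  fixes a :: "'a :: real_normed_vector"
  shows "norm (a + b + c + d + e + f - x - y - z) \<le>
    norm a + norm b + norm c + norm d + norm e + norm f + norm x + norm y + norm z"
  using norm_triangle_ineq[of a b] norm_triangle_ineq[of "a + b" c] norm_triangle_ineq[of "a + b + c" d]
    norm_triangle_ineq[of "a + b + c + d" e] norm_triangle_ineq[of "a + b + c + d + e" f]
    norm_triangle_ineq4[of "a + b + c + d + e + f" x] norm_triangle_ineq4[of "a + b + c + d + e + f - x" y]
    norm_triangle_ineq4[of "a + b + c + d + e + f - x - y" z]
  by linarith

text \<open>Newman's contour argument on rectangles. Keeping the width \<open>\<delta>\<close> of the strip and the height \<open>R\<close> explicit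
  turns a polynomial zero-free region into a rate of convergence.\<close>
lemma newman_quantitative:
  fixes v :: "nat \<Rightarrow> complex \<Rightarrow> complex" and g :: "complex \<Rightarrow> complex"
  assumes hol: "\<And>n. v (Suc n) holomorphic_on UNIV"
    and bd: "\<And>n z. Re z \<noteq> 0 \<Longrightarrow> norm (v (Suc n) z) \<le> A * ((real (Suc n) powr (-Re z) - real (Suc (Suc n)) powr (-Re z)) / Re z)"
    and par: "A \<ge> 0" "0 < \<delta>" "\<delta> \<le> R" "R > 0" "G \<ge> 0"
    and g_hol: "g holomorphic_on {z. Re z > -2*\<delta> \<and> \<bar>Im z\<bar> < 2*R}"
    and g_bd: "\<And>z. -\<delta> \<le> Re z \<Longrightarrow> Re z \<le> 0 \<Longrightarrow> \<bar>Im z\<bar> \<le> R \<Longrightarrow> norm (g z) \<le> G"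
    and g_sums: "\<And>z. Re z > 0 \<Longrightarrow> (\<lambda>n. v (Suc n) z) sums g z"
  shows "norm (g 0 - (\<Sum>n<N. v (Suc n) 0)) \<le> 4 * A / R + G * \<delta>\<^sup>2 / R\<^sup>2 + G * R * real (Suc N) powr (-\<delta>) / \<delta>"
proof -
  define m where "m = real (Suc N)"
  have m: "m \<ge> 1" by (simp add: m_def)
  \<comment> \<open>Newman's kernel. The power of \<open>m\<close> offsets both the decay
    \<open>m powr (-Re z)\<close> of the tails on the right and the growth of the partial sum on the
    left, and \<open>k 0 = 1\<close> keeps the residue.\<close>
  define k where "k z = (1 + z\<^sup>2 / of_real (R\<^sup>2)) * of_real m powr z" for z :: complex
  define s where "s z = (\<Sum>n<N. v (Suc n) z)" for z
  define hg where "hg z = g z * k z / z" for z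
  define hs where "hs z = s z * k z / z" for z
  have k_hol: "k holomorphic_on T" for T unfolding k_def using m par by (intro holomorphic_intros) auto
  have k0: "k 0 = 1" using m by (simp add: k_def powr_zero_eq_one)
  have s_hol: "s holomorphic_on T" for T
    unfolding s_def by (intro holomorphic_intros holomorphic_on_subset[OF hol]) auto
  have nm: "norm (of_real m powr z :: complex) = m powr Re z" for z using m by (subst norm_real_powr) auto
  have telescope: "(\<Sum>n<M. A * ((real (Suc n) powr (-x) - real (Suc (Suc n)) powr (-x)) / x)) = A * ((1 - real (Suc M) powr (-x)) / x)" for M x
  proof (induction M)
    case (Suc M)
    have "A * ((1 - a) / x) + A * ((a - b) / x) = A * ((1 - b) / x)" for a b
      by (simp add: diff_divide_distrib algebra_simps)
    with Suc show ?case by (simp only: sum.lessThan_Suc)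
  qed simp
  have s_le: "norm (s z) \<le> A * (m powr (-Re z) / (- Re z))" if "Re z < 0" for z
  proof -
    have "norm (s z) \<le> (\<Sum>n<N. A * ((real (Suc n) powr (-Re z) - real (Suc (Suc n)) powr (-Re z)) / Re z))"
      unfolding s_def by (rule order_trans[OF norm_sum sum_mono]) (use bd that in auto)
    also have "\<dots> = A * ((m powr (-Re z) - 1) / (- Re z))" unfolding telescope m_def using that by (simp add: field_simps)
    also have "\<dots> \<le> A * (m powr (-Re z) / (- Re z))" using par that by (intro mult_left_mono divide_right_mono) auto
    finally show ?thesis .
  qed
  have gs_le: "norm (g z - s z) \<le> A * (m powr (-Re z) / Re z)" if "Re z > 0" for z
  proof -
    have "(\<lambda>M. \<Sum>n<M. v (Suc n) z) \<longlonglongrightarrow> g z" using g_sums[OF that] by (simp add: sums_def)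
    then have "(\<lambda>M. norm ((\<Sum>n<M. v (Suc n) z) - s z)) \<longlonglongrightarrow> norm (g z - s z)" by (intro tendsto_intros)
    moreover have "norm ((\<Sum>n<M. v (Suc n) z) - s z) \<le> A * (m powr (-Re z) / Re z)" if M: "M \<ge> N" for M
    proof -
      have "(\<Sum>n<M. v (Suc n) z) - s z = (\<Sum>n\<in>{N..<M}. v (Suc n) z)"
        unfolding s_def using M by (simp add: sum_diff_nat_ivl[of 0 N M, unfolded atLeast0LessThan])
      also have "norm \<dots> \<le> (\<Sum>n\<in>{N..<M}. A * ((real (Suc n) powr (-Re z) - real (Suc (Suc n)) powr (-Re z)) / Re z))"
        by (rule order_trans[OF norm_sum sum_mono]) (use bd \<open>Re z > 0\<close> in auto)
      also have "\<dots> = A * ((1 - real (Suc M) powr (-Re z)) / Re z) - A * ((1 - real (Suc N) powr (-Re z)) / Re z)"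
        using M sum_diff_nat_ivl[of 0 N M "\<lambda>n. A * ((real (Suc n) powr (-Re z) - real (Suc (Suc n)) powr (-Re z)) / Re z)", unfolded atLeast0LessThan telescope] by simp
      also have "\<dots> = A * ((m powr (-Re z) - real (Suc M) powr (-Re z)) / Re z)" by (simp add: m_def field_simps diff_divide_distrib)
      also have "\<dots> \<le> A * (m powr (-Re z) / Re z)" using par \<open>Re z > 0\<close> by (intro mult_left_mono divide_right_mono) auto
      finally show ?thesis .
    qed
    ultimately show ?thesis by (intro LIMSEQ_le_const2) auto
  qed
  have kz: "norm (k z / z) = norm ((1 + z\<^sup>2 / of_real (R\<^sup>2)) / z) * m powr Re z" for z
    by (simp add: k_def norm_mult norm_divide nm)
  have R0: "R > 0" by fact
  let ?U = "{z::complex. Re z > -2*\<delta> \<and> \<bar>Im z\<bar> < 2*R}"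
  have U: "convex ?U" "open ?U"
  proof -
    have "?U = {z. Re z > -2*\<delta>} \<inter> ({z. Im z < 2*R} \<inter> {z. Im z > -2*R})" by auto
    then show "convex ?U" "open ?U"
      by (auto intro!: convex_Int convex_halfspace_Re_gt convex_halfspace_Im_lt convex_halfspace_Im_gt open_halfspace_Re_gt open_halfspace_Im_lt open_halfspace_Im_gt)
  qed
  note Ig = contour_integral_rectangle[OF U holomorphic_on_mult[OF g_hol k_hol] par(2) R0, folded hg_def]
  \<comment> \<open>The partial sum is entire, so its contour may extend to \<open>-R\<close> on the
    left, whereas \<open>g\<close> is available only up to \<open>-\<delta>\<close>.\<close>
  note Is = contour_integral_rectangle[OF convex_UNIV open_UNIV holomorphic_on_mult[OF s_hol k_hol] R0 R0, folded hs_def]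
  have dR: "\<delta> \<le> R" by fact
  have sub: "z \<in> ?U" if "- \<delta> \<le> Re z" "Re z \<le> R" "\<bar>Im z\<bar> \<le> R" for z using that par by auto
  let ?I = "\<lambda>a b f. contour_integral (linepath a b) f"
  let ?p = "Complex 0 (-R)" and ?a2 = "Complex R (-R)" and ?a3 = "Complex R R" and ?q = "Complex 0 R"
  let ?a1 = "Complex (-\<delta>) (-R)" and ?a4 = "Complex (-\<delta>) R" and ?b1 = "Complex (-R) (-R)" and ?b4 = "Complex (-R) R"
  have segs: "closed_segment (Complex a y) (Complex b y) = {z. Im z = y \<and> Re z \<in> closed_segment a b}"
    "closed_segment (Complex y a) (Complex y b) = {z. Re z = y \<and> Im z \<in> closed_segment a b}" for a b y
    by (simp_all add: closed_segment_same_Im closed_segment_same_Re)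
  have right: "norm (?I a b hg - ?I a b hs) \<le> 3 * A / R\<^sup>2 * norm (b - a)"
    if ab: "\<forall>z\<in>closed_segment a b. 0 \<le> Re z \<and> Re z \<le> R \<and> \<bar>Im z\<bar> \<le> R \<and> (Re z = R \<or> \<bar>Im z\<bar> = R)" for a b
  proof -
    have ci: "hg contour_integrable_on linepath a b" "hs contour_integrable_on linepath a b"
      using ab par by (auto intro!: Ig(2) Is(2) sub)
    have "?I a b hg - ?I a b hs = ?I a b (\<lambda>z. hg z - hs z)" by (rule contour_integral_diff[symmetric, OF ci])
    also have "norm \<dots> \<le> 3 * A / R\<^sup>2 * norm (b - a)"
    proof (rule contour_integral_bound_linepath)
      fix z assume "z \<in> closed_segment a b"
      then have z: "0 \<le> Re z" "Re z \<le> R" "\<bar>Im z\<bar> \<le> R" "Re z = R \<or> \<bar>Im z\<bar> = R" using ab by auto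
      have K: "norm ((1 + z\<^sup>2 / of_real (R\<^sup>2)) / z) \<le> 3 * Re z / R\<^sup>2"
      proof (cases "\<bar>Im z\<bar> = R")
        case True
        then show ?thesis using newman_kernel_horizontal[OF R0 True] z by simp
      next
        case False
        then have "Re z = R" using z by simp
        then show ?thesis using newman_kernel_vertical[of R R z] z R0 by (simp add: power2_eq_square)
      qed
      have e: "hg z - hs z = (g z - s z) * (k z / z)" by (simp add: hg_def hs_def algebra_simps diff_divide_distrib)
      show "norm (hg z - hs z) \<le> 3 * A / R\<^sup>2"
      proof (cases "Re z = 0")
        \<comment> \<open>This happens only at the corners \<open>z = R * \<i>\<close> and
          \<open>z = - R * \<i>\<close>, where the bound on the tail has a zero denominator but the
          kernel vanishes.\<close>
        case True
        then have "norm ((1 + z\<^sup>2 / of_real (R\<^sup>2)) / z) = 0" using K by simp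
        then have "norm (hg z - hs z) = 0" unfolding e norm_mult kz by simp
        then show ?thesis using par by simp
      next
        case False
        with z have x: "Re z > 0" by simp
        have "norm (hg z - hs z) \<le> A * (m powr (-Re z) / Re z) * (3 * Re z / R\<^sup>2 * m powr Re z)"
          unfolding e norm_mult kz using par m x K by (intro mult_mono gs_le mult_right_mono) auto
        also have "\<dots> = 3 * A / R\<^sup>2 * (m powr (-Re z) * m powr Re z)" using x by (simp add: field_simps)
        also have "m powr (-Re z) * m powr Re z = 1" using m by (simp flip: powr_add)
        finally show ?thesis by simp
      qed
    qed (use par ci in \<open>auto intro: contour_integrable_diff\<close>)
    finally show ?thesis .
  qed
  have left_s: "norm (?I a b hs) \<le> 3 * A / R\<^sup>2 * norm (b - a)"
    if ab: "\<forall>z\<in>closed_segment a b. -R \<le> Re z \<and> Re z \<le> 0 \<and> \<bar>Im z\<bar> \<le> R \<and> (Re z = -R \<or> \<bar>Im z\<bar> = R)" for a b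
  proof (rule contour_integral_bound_linepath)
    show "hs contour_integrable_on linepath a b" using ab par by (auto intro!: Is(2))
    fix z assume "z \<in> closed_segment a b"
    then have z: "-R \<le> Re z" "Re z \<le> 0" "\<bar>Im z\<bar> \<le> R" "Re z = -R \<or> \<bar>Im z\<bar> = R" using ab by auto
    have K: "norm ((1 + z\<^sup>2 / of_real (R\<^sup>2)) / z) \<le> 3 * (- Re z) / R\<^sup>2"
    proof (cases "\<bar>Im z\<bar> = R")
      case True
      then show ?thesis using newman_kernel_horizontal[OF R0 True] z by simp
    next
      case False
      then have "Re z = -R" using z by simp
      then show ?thesis using newman_kernel_vertical[of R R z] z R0 by (simp add: power2_eq_square)
    qed
    have e: "hs z = s z * (k z / z)" by (simp add: hs_def)
    show "norm (hs z) \<le> 3 * A / R\<^sup>2"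
    proof (cases "Re z = 0")
      case True
      then have "norm ((1 + z\<^sup>2 / of_real (R\<^sup>2)) / z) = 0" using K by simp
      then have "norm (hs z) = 0" unfolding e norm_mult kz by simp
      then show ?thesis using par by simp
    next
      case False
      with z have x: "Re z < 0" by simp
      have "norm (hs z) \<le> A * (m powr (-Re z) / (-Re z)) * (3 * (-Re z) / R\<^sup>2 * m powr Re z)"
        unfolding e norm_mult kz using par m x K by (intro mult_mono s_le mult_right_mono) (auto simp: zero_le_mult_iff divide_nonneg_neg divide_nonpos_neg mult_nonneg_nonpos divide_nonpos_nonneg)
      also have "\<dots> = 3 * A / R\<^sup>2 * (m powr (-Re z) * m powr Re z)" using x by (simp add: field_simps)
      also have "m powr (-Re z) * m powr Re z = 1" using m by (simp flip: powr_add)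
      finally show ?thesis by simp
    qed
  qed (use par in auto)
  have left_g_h: "norm (?I a b hg) \<le> G * (3 * \<delta> / R\<^sup>2) * norm (b - a)"
    if ab: "\<forall>z\<in>closed_segment a b. -\<delta> \<le> Re z \<and> Re z \<le> 0 \<and> \<bar>Im z\<bar> = R" for a b
  proof (rule contour_integral_bound_linepath)
    show "hg contour_integrable_on linepath a b" using ab par by (auto intro!: Ig(2) sub)
    fix z assume "z \<in> closed_segment a b"
    then have z: "-\<delta> \<le> Re z" "Re z \<le> 0" "\<bar>Im z\<bar> = R" using ab by auto
    have K: "norm ((1 + z\<^sup>2 / of_real (R\<^sup>2)) / z) \<le> 3 * \<bar>Re z\<bar> / R\<^sup>2"
      by (rule newman_kernel_horizontal[OF R0 z(3)]) (use z dR in auto)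
    also have "\<dots> \<le> 3 * \<delta> / R\<^sup>2" using z by (intro divide_right_mono) auto
    finally have K: "norm ((1 + z\<^sup>2 / of_real (R\<^sup>2)) / z) \<le> 3 * \<delta> / R\<^sup>2" .
    have e: "hg z = g z * (k z / z)" by (simp add: hg_def)
    have "m powr Re z \<le> 1" using m z powr_mono[of "Re z" 0 m] by simp
    then have "norm (hg z) \<le> G * (3 * \<delta> / R\<^sup>2 * 1)"
      unfolding e norm_mult kz using K z par by (intro mult_mono g_bd) auto
    then show "norm (hg z) \<le> G * (3 * \<delta> / R\<^sup>2)" by simp
  qed (use par in auto)
  have left_g_v: "norm (?I ?a4 ?a1 hg) \<le> G * (3 / \<delta> * m powr (-\<delta>)) * norm (?a1 - ?a4)"
  proof (rule contour_integral_bound_linepath)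
    show "hg contour_integrable_on linepath ?a4 ?a1" using par by (auto intro!: Ig(2) sub simp: segs closed_segment_eq_real_ivl)
    fix z assume "z \<in> closed_segment ?a4 ?a1"
    then have z: "Re z = -\<delta>" "\<bar>Im z\<bar> \<le> R" using R0 by (auto simp: segs closed_segment_eq_real_ivl)
    have K: "norm ((1 + z\<^sup>2 / of_real (R\<^sup>2)) / z) \<le> 3 / \<delta>"
      by (rule newman_kernel_vertical) (use par z in auto)
    have e: "hg z = g z * (k z / z)" by (simp add: hg_def)
    show "norm (hg z) \<le> G * (3 / \<delta> * m powr (-\<delta>))"
      unfolding e norm_mult kz using K z par by (intro mult_mono g_bd) auto
  qed (use par in auto)
  have len: "norm (?a2 - ?p) = R" "norm (?a3 - ?a2) = 2 * R" "norm (?q - ?a3) = R"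
    "norm (?p - ?a1) = \<delta>" "norm (?a4 - ?q) = \<delta>" "norm (?a1 - ?a4) = 2 * R"
    "norm (?p - ?b1) = R" "norm (?b4 - ?q) = R" "norm (?b1 - ?b4) = 2 * R"
    using par by (simp_all add: cmod_eq_Re cmod_eq_Im)
  have G1: "2 * pi * \<i> * (g 0 * k 0) = ?I ?a1 ?p hg + ?I ?p ?a2 hg + ?I ?a2 ?a3 hg + ?I ?a3 ?q hg + ?I ?q ?a4 hg + ?I ?a4 ?a1 hg"
    by (rule Ig(1), rule sub)
  have rearrange: "a + b + c + d + e + f - (x + b' + c' + d' + y + z) = (b - b') + (c - c') + (d - d') + a + e + f - x - y - z"
    for a b c d e f x y z b' c' d' :: complex by simp
  have "2 * pi * \<i> * (g 0 - s 0) = 2 * pi * \<i> * (g 0 * k 0) - 2 * pi * \<i> * (s 0 * k 0)" by (simp add: k0 algebra_simps)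
  then have E: "2 * pi * \<i> * (g 0 - s 0) = (?I ?p ?a2 hg - ?I ?p ?a2 hs) + (?I ?a2 ?a3 hg - ?I ?a2 ?a3 hs) + (?I ?a3 ?q hg - ?I ?a3 ?q hs)
      + ?I ?a1 ?p hg + ?I ?q ?a4 hg + ?I ?a4 ?a1 hg - ?I ?b1 ?p hs - ?I ?q ?b4 hs - ?I ?b4 ?b1 hs"
    unfolding G1 Is(1)[OF UNIV_I] rearrange .
  have "norm (2 * pi * \<i> * (g 0 - s 0)) \<le> norm (?I ?p ?a2 hg - ?I ?p ?a2 hs) + norm (?I ?a2 ?a3 hg - ?I ?a2 ?a3 hs) + norm (?I ?a3 ?q hg - ?I ?a3 ?q hs)
      + norm (?I ?a1 ?p hg) + norm (?I ?q ?a4 hg) + norm (?I ?a4 ?a1 hg) + norm (?I ?b1 ?p hs) + norm (?I ?q ?b4 hs) + norm (?I ?b4 ?b1 hs)"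
    unfolding E by (rule norm_triangle9)
  also have "\<dots> \<le> 3 * A / R\<^sup>2 * R + 3 * A / R\<^sup>2 * (2 * R) + 3 * A / R\<^sup>2 * R
      + G * (3 * \<delta> / R\<^sup>2) * \<delta> + G * (3 * \<delta> / R\<^sup>2) * \<delta> + G * (3 / \<delta> * m powr (-\<delta>)) * (2 * R)
      + 3 * A / R\<^sup>2 * R + 3 * A / R\<^sup>2 * R + 3 * A / R\<^sup>2 * (2 * R)"
  proof (intro add_mono)
    show "norm (?I ?p ?a2 hg - ?I ?p ?a2 hs) \<le> 3 * A / R\<^sup>2 * R"
      using right[of ?p ?a2] par unfolding len segs by (auto simp: closed_segment_eq_real_ivl)
    show "norm (?I ?a2 ?a3 hg - ?I ?a2 ?a3 hs) \<le> 3 * A / R\<^sup>2 * (2 * R)"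
      using right[of ?a2 ?a3] par unfolding len segs by (auto simp: closed_segment_eq_real_ivl abs_le_iff)
    show "norm (?I ?a3 ?q hg - ?I ?a3 ?q hs) \<le> 3 * A / R\<^sup>2 * R"
      using right[of ?a3 ?q] par unfolding len segs by (auto simp: closed_segment_eq_real_ivl)
    show "norm (?I ?a1 ?p hg) \<le> G * (3 * \<delta> / R\<^sup>2) * \<delta>"
      using left_g_h[of ?a1 ?p] par unfolding len segs by (auto simp: closed_segment_eq_real_ivl)
    show "norm (?I ?q ?a4 hg) \<le> G * (3 * \<delta> / R\<^sup>2) * \<delta>"
      using left_g_h[of ?q ?a4] par unfolding len segs by (auto simp: closed_segment_eq_real_ivl)
    show "norm (?I ?a4 ?a1 hg) \<le> G * (3 / \<delta> * m powr (-\<delta>)) * (2 * R)"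
      using left_g_v unfolding len .
    show "norm (?I ?b1 ?p hs) \<le> 3 * A / R\<^sup>2 * R"
      using left_s[of ?b1 ?p] par unfolding len segs by (auto simp: closed_segment_eq_real_ivl)
    show "norm (?I ?q ?b4 hs) \<le> 3 * A / R\<^sup>2 * R"
      using left_s[of ?q ?b4] par unfolding len segs by (auto simp: closed_segment_eq_real_ivl)
    show "norm (?I ?b4 ?b1 hs) \<le> 3 * A / R\<^sup>2 * (2 * R)"
      using left_s[of ?b4 ?b1] par unfolding len segs by (auto simp: closed_segment_eq_real_ivl abs_le_iff)
  qed
  \<comment> \<open>The six integrals bounded through \<open>A\<close> run over a total length
    \<open>8 * R\<close>, which gives \<open>24 * A / R\<close>. The factor 6 is pulled out because
    it is below \<open>2 * pi\<close>.\<close>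
  also have "\<dots> = 6 * (4 * A / R + G * \<delta>\<^sup>2 / R\<^sup>2 + G * R * m powr (-\<delta>) / \<delta>)"
    using par by (simp add: field_simps power2_eq_square)
  finally have "2 * pi * norm (g 0 - s 0) \<le> 6 * (4 * A / R + G * \<delta>\<^sup>2 / R\<^sup>2 + G * R * m powr (-\<delta>) / \<delta>)"
    by (simp add: norm_mult)
  moreover have "6 * norm (g 0 - s 0) \<le> 2 * pi * norm (g 0 - s 0)" using pi_gt3 by (intro mult_right_mono) auto
  ultimately show ?thesis by (simp add: m_def s_def)
qed

text \<open>The piece over \<open>[n, n+1]\<close> of the Mellin-type integral of
  \<open>(theta x - x) x powr (-z-2)\<close>, with \<open>theta\<close> constant on the piece. The
  power is spelled out as an exponential so that differentiation under the integral in
  \<open>z\<close> is immediate.\<close>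

definition newman_term :: "nat \<Rightarrow> complex \<Rightarrow> complex" where
  "newman_term n z = integral (cbox (real n) (real n + 1)) (\<lambda>x. of_real (theta n - x) * exp (- (z + 2) * of_real (ln x)))"

lemma exp_ln_powr: "x > 0 \<Longrightarrow> exp (w * of_real (ln x)) = (of_real x :: complex) powr w"
  by (simp add: powr_def Ln_of_real)

lemma newman_integrand_continuous:
  "n > 0 \<Longrightarrow> continuous_on (cbox (real n) (real n + 1)) (\<lambda>x. of_real (theta n - x) * exp (- (z + 2) * complex_of_real (ln x)))"
  by (intro continuous_intros) auto

lemma newman_term_holomorphic: "newman_term (Suc n) holomorphic_on UNIV"
proof -
  have "(\<lambda>z. newman_term (Suc n) z) holomorphic_on UNIV"
    unfolding newman_term_def
  proof (rule leibniz_rule_holomorphic[where fx = "\<lambda>z x. of_real (theta (Suc n) - x) * (exp (- (z + 2) * of_real (ln x)) * (- of_real (ln x)))"])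
    show "((\<lambda>z. of_real (theta (Suc n) - t) * exp (- (z + 2) * of_real (ln t))) has_field_derivative
        of_real (theta (Suc n) - t) * (exp (- (z + 2) * of_real (ln t)) * (- of_real (ln t)))) (at z within UNIV)" for z :: complex and t
      by (auto intro!: derivative_eq_intros)
    show "continuous_on (UNIV \<times> cbox (real (Suc n)) (real (Suc n) + 1)) (\<lambda>(z, x). of_real (theta (Suc n) - x) * (exp (- (z + 2) * complex_of_real (ln x)) * (- of_real (ln x))))"
      unfolding case_prod_unfold by (intro continuous_intros) auto
    show "(\<lambda>x. of_real (theta (Suc n) - x) * exp (- (z + 2) * complex_of_real (ln x))) integrable_on cbox (real (Suc n)) (real (Suc n) + 1)" for z
      by (rule integrable_continuous, rule newman_integrand_continuous) auto
  qed auto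
  then show ?thesis by simp
qed

lemma has_integral_real_powr:
  fixes a x :: real
  assumes "a > 0" "x \<noteq> 0"
  shows "((\<lambda>u. u powr (-x-1)) has_integral (a powr (-x) - (a+1) powr (-x)) / x) {a..a+1}"
proof -
  have "((\<lambda>u. u powr (-x-1)) has_integral (- ((a+1) powr (-x)) / x - (- (a powr (-x)) / x))) {a..a+1}"
  proof (rule fundamental_theorem_of_calculus)
    fix u assume "u \<in> {a..a+1}"
    then have "((\<lambda>u. - (u powr (-x)) / x) has_real_derivative u powr (-x-1)) (at u)"
      using assms by (auto intro!: derivative_eq_intros)
    then show "((\<lambda>u. - (u powr (-x)) / x) has_vector_derivative u powr (-x-1)) (at u within {a..a+1})"
      by (simp add: has_real_derivative_iff_has_vector_derivative has_vector_derivative_at_within)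
  qed auto
  then show ?thesis by (simp add: diff_divide_distrib)
qed

lemma theta_minus_abs_le:
  assumes "real n \<le> x" shows "\<bar>theta n - x\<bar> \<le> 2 * x"
proof -
  have l: "ln (4::real) \<le> 2"
  proof -
    have "ln (4::real) = 2 * ln 2" using ln_realpow[of 2 2] by simp
    then show ?thesis using ln_2_less_1 by simp
  qed
  have "theta n \<ge> 0" unfolding theta_def by (intro sum_nonneg) (auto dest: prime_ge_1_nat)
  moreover have "theta n \<le> real n * 2" using theta_le[of n] l mult_left_mono[of "ln 4" 2 "real n"] by linarith
  ultimately show ?thesis using assms by (auto simp: abs_le_iff)
qed

text \<open>Chebyshev's bound gives \<open>|theta n - x| \<le> 2 * x\<close>, so the term is at most
  twice the integral of \<open>x powr (-Re z - 1)\<close>. This is the hypothesis of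
  \<open>newman_quantitative\<close> with \<open>A = 2\<close>.\<close>

lemma norm_newman_term_le:
  assumes "Re z \<noteq> 0"
  shows "norm (newman_term (Suc n) z) \<le> 2 * ((real (Suc n) powr (-Re z) - real (Suc (Suc n)) powr (-Re z)) / Re z)"
proof -
  let ?a = "real (Suc n)"
  have hi: "((\<lambda>u. 2 * u powr (-Re z-1)) has_integral 2 * ((?a powr (-Re z) - (?a+1) powr (-Re z)) / Re z)) {?a..?a+1}"
    by (intro has_integral_mult_right has_integral_real_powr) (use assms in auto)
  have "norm (newman_term (Suc n) z) \<le> integral (cbox ?a (?a+1)) (\<lambda>u. 2 * u powr (-Re z-1))"
    unfolding newman_term_def
  proof (rule integral_norm_bound_integral)
    show "(\<lambda>x. of_real (theta (Suc n) - x) * exp (- (z + 2) * complex_of_real (ln x))) integrable_on cbox ?a (?a + 1)"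
      by (rule integrable_continuous, rule newman_integrand_continuous) auto
    show "(\<lambda>u. 2 * u powr (-Re z-1)) integrable_on cbox ?a (?a+1)" using hi by (auto simp: has_integral_iff)
    fix x assume x: "x \<in> cbox ?a (?a + 1)"
    then have x0: "x > 0" by auto
    have "norm (of_real (theta (Suc n) - x) * exp (- (z + 2) * complex_of_real (ln x))) = \<bar>theta (Suc n) - x\<bar> * x powr (-Re z - 2)"
      using x0 unfolding exp_ln_powr[OF x0] norm_mult norm_of_real by (simp add: norm_real_powr)
    also have "\<dots> \<le> 2 * x * x powr (-Re z - 2)" using x by (intro mult_right_mono theta_minus_abs_le) auto
    also have "\<dots> = 2 * (x powr 1 * x powr (-Re z - 2))" using x0 by simp
    also have "x powr 1 * x powr (-Re z - 2) = x powr (-Re z - 1)"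
      by (subst powr_add[symmetric]) (rule arg_cong[of _ _ "\<lambda>e. x powr e"], simp)
    finally show "norm (of_real (theta (Suc n) - x) * exp (- (z + 2) * complex_of_real (ln x))) \<le> 2 * x powr (-Re z-1)" .
  qed
  also have "\<dots> = 2 * ((?a powr (-Re z) - (?a+1) powr (-Re z)) / Re z)" using hi by (simp add: has_integral_iff)
  finally show ?thesis by (simp add: add_ac)
qed

lemma has_integral_complex_powr:
  assumes "a > 0" "w \<noteq> 0"
  shows "((\<lambda>u. of_real u powr (-w-1)) has_integral (complex_of_real a powr (-w) - of_real (a+1) powr (-w)) / w) {a..a+1}"
proof -
  have "((\<lambda>u. of_real u powr (-w-1)) has_integral (- (complex_of_real (a+1) powr (-w)) / w - (- (of_real a powr (-w)) / w))) {a..a+1}"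
  proof (rule fundamental_theorem_of_calculus)
    fix u assume u: "u \<in> {a..a+1}"
    have "((\<lambda>u. - (u powr (-w)) / w) has_field_derivative of_real u powr (-w-1)) (at (of_real u))"
      using u assms by (auto intro!: derivative_eq_intros simp: complex_nonpos_Reals_iff)
    then show "((\<lambda>u. - (complex_of_real u powr (-w)) / w) has_vector_derivative of_real u powr (-w-1)) (at u within {a..a+1})"
      by (rule has_vector_derivative_real_field)
  qed auto
  then show ?thesis by (simp add: diff_divide_distrib)
qed

lemma newman_term_eq:
  assumes "z \<noteq> 0" "z \<noteq> -1"
  shows "newman_term (Suc n) z = of_real (theta (Suc n)) * ((of_nat (Suc n) powr (-(z+1)) - of_nat (Suc (Suc n)) powr (-(z+1))) / (z + 1))
     - (of_nat (Suc n) powr (-z) - of_nat (Suc (Suc n)) powr (-z)) / z"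
proof -
  let ?a = "real (Suc n)"
  have z1: "z + 1 \<noteq> 0" using assms(2) by (metis add_eq_0_iff2)
  have "((\<lambda>u. of_real (theta (Suc n)) * of_real u powr (-(z+1)-1) - of_real u powr (-z-1)) has_integral
     of_real (theta (Suc n)) * ((complex_of_real ?a powr (-(z+1)) - of_real (?a+1) powr (-(z+1))) / (z+1)) -
     (complex_of_real ?a powr (-z) - of_real (?a+1) powr (-z)) / z) {?a..?a+1}"
    by (intro has_integral_diff has_integral_mult_right has_integral_complex_powr z1 assms) auto
  also have "?this \<longleftrightarrow> ((\<lambda>x. of_real (theta (Suc n) - x) * exp (- (z + 2) * complex_of_real (ln x))) has_integral
     of_real (theta (Suc n)) * ((complex_of_real ?a powr (-(z+1)) - of_real (?a+1) powr (-(z+1))) / (z+1)) -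
     (complex_of_real ?a powr (-z) - of_real (?a+1) powr (-z)) / z) {?a..?a+1}"
  proof (rule has_integral_cong)
    fix x assume "x \<in> {?a..?a+1}"
    then have x0: "x > 0" by auto
    have "of_real x powr (-z-1) = of_real x powr 1 * complex_of_real x powr (-(z+2))"
      by (subst powr_add[symmetric]) (rule arg_cong[of _ _ "\<lambda>e. of_real x powr e"], simp)
    also have "of_real x powr 1 = complex_of_real x" using x0 by simp
    finally have "of_real x powr (-z-1) = of_real x * complex_of_real x powr (-(z+2))" .
    moreover have "-(z+1)-1 = -(z+2)" by simp
    ultimately show "of_real (theta (Suc n)) * of_real x powr (-(z+1)-1) - of_real x powr (-z-1) = of_real (theta (Suc n) - x) * exp (- (z + 2) * complex_of_real (ln x))"
      unfolding exp_ln_powr[OF x0] by (simp only: of_real_diff left_diff_distrib)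
  qed
  finally show ?thesis unfolding newman_term_def by (simp add: has_integral_iff add_ac)
qed

lemma theta_abel_sum:
  fixes f :: "nat \<Rightarrow> complex"
  shows "(\<Sum>n<N. of_real (theta (Suc n)) * (f (Suc n) - f (Suc (Suc n)))) =
    (\<Sum>p\<in>{p. prime p \<and> p \<le> N}. of_real (ln (real p)) * f p) - of_real (theta N) * f (Suc N)"
proof (induction N)
  case 0
  have "{p::nat. prime p \<and> p = 0} = {}" by auto
  then show ?case by (simp add: theta_def)
next
  case (Suc N)
  have "{p. prime p \<and> p \<le> Suc N} = (if prime (Suc N) then insert (Suc N) {p. prime p \<and> p \<le> N} else {p. prime p \<and> p \<le> N})"
    by (auto simp: le_Suc_eq)
  then have e: "(\<Sum>p\<in>{p. prime p \<and> p \<le> Suc N}. of_real (ln (real p)) * f p) =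
     (\<Sum>p\<in>{p. prime p \<and> p \<le> N}. of_real (ln (real p)) * f p) + of_real (theta (Suc N) - theta N) * f (Suc N)"
    by (simp add: theta_Suc)
  show ?case unfolding sum.lessThan_Suc Suc.IH e by (simp add: algebra_simps)
qed

text \<open>The continuation of the sum of all \<open>newman_term\<close>. For
  \<open>Re z > 0\<close> that sum is the prime sum divided by \<open>1 + z\<close>, minus
  \<open>1/z\<close>; the pole of the prime sum at \<open>z = 0\<close> cancels against
  \<open>1/z\<close>, and only the logarithmic derivative of the pole-free \<open>zetaZ\<close>
  remains.\<close>

definition newman_g :: "complex \<Rightarrow> complex" where
  "newman_g z = - (1 + deriv zetaZ (1 + z) / zetaZ (1 + z) + prime_corr_sum (1 + z)) / (1 + z)"

lemma newman_sums:
  assumes z: "Re z > 0"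
  shows "(\<lambda>n. newman_term (Suc n) z) sums newman_g z"
proof -
  have z0: "z \<noteq> 0" "z \<noteq> -1" "z + 1 \<noteq> 0" "1 + z \<noteq> 0" using z by (auto simp: complex_eq_iff)
  let ?P = "\<lambda>N. \<Sum>p\<in>{p. prime p \<and> p \<le> N}. of_real (ln (real p)) * of_nat p powr (-(z+1)) :: complex"
  have tel: "(\<Sum>n<N. of_nat (Suc n) powr (-z) - of_nat (Suc (Suc n)) powr (-z)) = 1 - (of_nat (Suc N) powr (-z) :: complex)" for N
    by (induction N) simp_all
  have part: "(\<Sum>n<N. newman_term (Suc n) z) = (?P N - of_real (theta N) * of_nat (Suc N) powr (-(z+1))) / (z+1) - (1 - of_nat (Suc N) powr (-z)) / z" for N
  proof -
    have "(\<Sum>n<N. newman_term (Suc n) z) = (\<Sum>n<N. of_real (theta (Suc n)) * (of_nat (Suc n) powr (-(z+1)) - of_nat (Suc (Suc n)) powr (-(z+1)))) / (z + 1)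
       - (\<Sum>n<N. of_nat (Suc n) powr (-z) - of_nat (Suc (Suc n)) powr (-z)) / z"
      unfolding sum_divide_distrib sum_subtractf[symmetric] by (intro sum.cong refl) (subst newman_term_eq, use z0 in auto)
    then show ?thesis unfolding theta_abel_sum[of "\<lambda>n. of_nat n powr (-(z+1))"] tel .
  qed
  have "(\<lambda>N. real (Suc N) powr (-Re z)) \<longlonglongrightarrow> 0" using z by real_asymp
  then have "(\<lambda>N. norm (of_nat (Suc N) powr (-z) :: complex)) \<longlonglongrightarrow> 0" by (subst norm_nat_powr) auto
  then have l1: "(\<lambda>N. of_nat (Suc N) powr (-z) :: complex) \<longlonglongrightarrow> 0" by (rule tendsto_norm_zero_cancel)
  have "(\<lambda>N. real N * ln 4 * real (Suc N) powr (-(Re z+1))) \<longlonglongrightarrow> 0" using z by real_asymp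
  then have l2: "(\<lambda>N. of_real (theta N) * of_nat (Suc N) powr (-(z+1)) :: complex) \<longlonglongrightarrow> 0"
  proof (rule Lim_null_comparison[rotated])
    have "norm (of_real (theta N) * of_nat (Suc N) powr (-(z+1)) :: complex) \<le> real N * ln 4 * real (Suc N) powr (-(Re z+1))" for N
    proof -
      have "theta N \<ge> 0" unfolding theta_def by (intro sum_nonneg) (auto dest: prime_ge_1_nat)
      then have "norm (of_real (theta N) * of_nat (Suc N) powr (-(z+1)) :: complex) = theta N * real (Suc N) powr (-(Re z+1))"
        unfolding norm_mult by (subst norm_nat_powr) auto
      then show ?thesis using theta_le[of N] by (simp only: mult_right_mono powr_ge_zero)
    qed
    then show "\<forall>\<^sub>F N in sequentially. norm (of_real (theta N) * of_nat (Suc N) powr (-(z+1)) :: complex) \<le> real N * ln 4 * real (Suc N) powr (-(Re z+1))"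
      by simp
  qed
  have l3: "?P \<longlonglongrightarrow> 1 / (z + 1 - 1) - deriv zetaZ (z+1) / zetaZ (z+1) - prime_corr_sum (z+1)"
    by (rule prime_log_sum_tendsto) (use z in simp)
  have "(\<lambda>N. \<Sum>n<N. newman_term (Suc n) z) \<longlonglongrightarrow> (1 / (z + 1 - 1) - deriv zetaZ (z+1) / zetaZ (z+1) - prime_corr_sum (z+1) - 0) / (z+1) - (1 - 0) / z"
    unfolding part by (intro tendsto_intros l1 l2 l3 z0)
  also have "(1 / (z + 1 - 1) - deriv zetaZ (z+1) / zetaZ (z+1) - prime_corr_sum (z+1) - 0) / (z+1) - (1 - 0) / z = newman_g z"
  proof -
    have *: "(1 / z - d - q) / (z+1) - 1 / z = - (1 + d + q) / (z+1)" for d q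
    proof -
      have "1 / z = (1 / z) * (z + 1) / (z + 1)" using z0 by simp
      then have "(1 / z - d - q) / (z+1) - 1 / z = (1 / z - d - q - (1 / z) * (z + 1)) / (z+1)" by (metis diff_divide_distrib)
      also have "(1 / z) * (z + 1) = 1 + 1 / z" using z0 by (simp add: field_simps)
      also have "1 / z - d - q - (1 + 1 / z) = - (1 + d + q)" by simp
      finally show ?thesis .
    qed
    show ?thesis using *[of "deriv zetaZ (z+1) / zetaZ (z+1)" "prime_corr_sum (z+1)"] by (simp add: newman_g_def add.commute)
  qed
  finally show ?thesis by (simp add: sums_def)
qed

text \<open>The zero-free region narrows with the height, so on a rectangle of height of order
  \<open>R\<close> its width is replaced by the smallest one occurring there.\<close>

lemma newman_g_strip:
  obtains c K where "0 < c" "c \<le> 1/100" "K > 0"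
    "\<And>R. R \<ge> 1 \<Longrightarrow> newman_g holomorphic_on {z. Re z > -2 * (c * R powr (-(1/8))) \<and> \<bar>Im z\<bar> < 2*R}"
    "\<And>R z. R \<ge> 1 \<Longrightarrow> - (c * R powr (-(1/8))) \<le> Re z \<Longrightarrow> Re z \<le> 0 \<Longrightarrow> \<bar>Im z\<bar> \<le> R \<Longrightarrow> norm (newman_g z) \<le> K * R powr (1/8)"
proof -
  obtain c K where cK: "0 < c" "c \<le> 1/100" "K > 0"
    "\<And>s. 1 - c * (2 + \<bar>Im s\<bar>) powr (-(1/8)) \<le> Re s \<Longrightarrow> Re s \<le> 1 \<Longrightarrow>
       zetaZ s \<noteq> 0 \<and> norm (deriv zetaZ s / zetaZ s) \<le> K * (2 + \<bar>Im s\<bar>) powr (1/8)"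
    using zetaZ_zero_free by blast
  obtain Q where Q: "Q > 0" "\<And>s. Re s \<ge> 3/4 \<Longrightarrow> norm (prime_corr_sum s) \<le> Q"
    using prime_corr_sum_bounded by blast
  \<comment> \<open>For \<open>t \<le> 2 * R\<close> one has \<open>2 + t \<le> 4 * R\<close>, which
    explains \<open>4 powr (-(1/8))\<close>; the half is there because holomorphy is required on
    twice the width of the contour.\<close>
  define c' where "c' = c / 2 * 4 powr (-(1/8))"
  have four: "4 powr (-(1/8)) \<le> (1::real)" using powr_mono[of "-(1/8)" 0 "4::real"] by simp
  have c': "0 < c'" "c' \<le> 1/200" using cK mult_mono[of "c/2" "1/200" "4 powr (-(1/8))" "1::real"] four by (auto simp: c'_def)
  have small: "2 * (c' * R powr (-(1/8))) \<le> c * (2 + t) powr (-(1/8))" if "R \<ge> 1" "t \<le> 2 * R" "t \<ge> 0" for R t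
  proof -
    have "(4 * R) powr (-(1/8)) \<le> (2 + t) powr (-(1/8))" using that by (intro powr_mono2') auto
    then show ?thesis using cK that by (simp add: c'_def powr_mult)
  qed
  have R1: "R powr (-(1/8)) \<le> 1" if "R \<ge> 1" for R :: real using powr_mono[of "-(1/8)" 0 R] that by simp
  have re: "Re z > -1/100" if "R \<ge> 1" "Re z > -2 * (c' * R powr (-(1/8)))" for R z
  proof -
    have "c' * R powr (-(1/8)) \<le> (1/200) * 1" using c' R1 that by (intro mult_mono) auto
    then show ?thesis using that by simp
  qed
  have nz: "zetaZ (1 + z) \<noteq> 0" if "R \<ge> 1" "Re z > -2 * (c' * R powr (-(1/8)))" "\<bar>Im z\<bar> < 2*R" for R z
  proof (cases "Re z > 0")
    case True
    then show ?thesis by (intro zetaZ_nonzero) auto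
  next
    case False
    then show ?thesis using cK(4)[of "1 + z"] small[of R "\<bar>Im z\<bar>"] that by auto
  qed
  define K' where "K' = 2 * (1 + K * 3 powr (1/8) + Q)"
  have K': "K' > 0" using cK Q by (auto simp: K'_def intro!: add_pos_pos)
  show ?thesis
  proof (rule that)
    show "0 < c'" "c' \<le> 1/100" "K' > 0" using c' K' by auto
    fix R :: real assume R: "R \<ge> 1"
    let ?U = "{z. Re z > -2 * (c' * R powr (-(1/8))) \<and> \<bar>Im z\<bar> < 2*R}"
    have sub: "(\<lambda>z. 1 + z) ` ?U \<subseteq> {s. Re s > 3/4}" using re[OF R] by fastforce
    have z1: "zetaZ holomorphic_on (\<lambda>z. 1 + z) ` ?U" 
      by (rule holomorphic_on_subset[OF zetaZ_holomorphic]) (use sub in force)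
    have z2: "deriv zetaZ holomorphic_on (\<lambda>z. 1 + z) ` ?U" 
      by (rule holomorphic_on_subset[OF holomorphic_deriv[OF zetaZ_holomorphic open_halfspace_Re_gt]]) (use sub in force)
    have z3: "prime_corr_sum holomorphic_on (\<lambda>z. 1 + z) ` ?U" 
      by (rule holomorphic_on_subset[OF prime_corr_sum_holomorphic sub])
    have pl: "(\<lambda>z. 1 + z) holomorphic_on ?U" by (intro holomorphic_intros)
    have "1 + z \<noteq> 0" if "z \<in> ?U" for z using re[OF R, of z] that by (auto simp: complex_eq_iff)
    then show "newman_g holomorphic_on ?U"
      unfolding newman_g_def using nz[OF R]
        holomorphic_on_compose[OF pl z1] holomorphic_on_compose[OF pl z2] holomorphic_on_compose[OF pl z3]
      by (intro holomorphic_intros) (auto simp: o_def)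
    fix z assume z: "- (c' * R powr (-(1/8))) \<le> Re z" "Re z \<le> 0" "\<bar>Im z\<bar> \<le> R"
    have pos: "c' * R powr (-(1/8)) > 0" using c' R by simp
    have zr: "Re z > -1/100" using re[OF R, of z] z pos by simp
    have "norm (deriv zetaZ (1+z) / zetaZ (1+z)) \<le> K * (2 + \<bar>Im z\<bar>) powr (1/8)"
      using cK(4)[of "1 + z"] small[of R "\<bar>Im z\<bar>"] z R pos by simp
    also have "\<dots> \<le> K * (3 * R) powr (1/8)" using z R cK by (intro mult_left_mono powr_mono2) auto
    finally have d: "norm (deriv zetaZ (1+z) / zetaZ (1+z)) \<le> K * 3 powr (1/8) * R powr (1/8)" using R by (simp add: powr_mult)
    have R8: "R powr (1/8) \<ge> 1" using R by (intro ge_one_powr_ge_zero) auto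
    have q: "norm (prime_corr_sum (1+z)) \<le> Q" using zr by (intro Q) auto
    have "norm (1 + z) \<ge> 1/2" using complex_Re_le_cmod[of "1 + z"] zr by simp
    moreover have "norm (1 + deriv zetaZ (1 + z) / zetaZ (1 + z) + prime_corr_sum (1 + z)) \<le> (1 + K * 3 powr (1/8) + Q) * R powr (1/8)"
    proof -
      have "norm (1 + deriv zetaZ (1 + z) / zetaZ (1 + z) + prime_corr_sum (1 + z)) \<le> 1 + norm (deriv zetaZ (1 + z) / zetaZ (1 + z)) + norm (prime_corr_sum (1 + z))"
        using norm_triangle_ineq[of "1 + deriv zetaZ (1 + z) / zetaZ (1 + z)" "prime_corr_sum (1 + z)"]
          norm_triangle_ineq[of 1 "deriv zetaZ (1 + z) / zetaZ (1 + z)"] by simp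
      also have "\<dots> \<le> R powr (1/8) + K * 3 powr (1/8) * R powr (1/8) + Q * R powr (1/8)"
        using d q R8 Q mult_left_mono[OF R8, of Q] by linarith
      finally show ?thesis by (simp add: algebra_simps)
    qed
    ultimately have "norm (newman_g z) \<le> (1 + K * 3 powr (1/8) + Q) * R powr (1/8) / (1/2)"
      unfolding newman_g_def norm_divide norm_minus_cancel
      by (intro frac_le mult_nonneg_nonneg add_nonneg_nonneg) (use cK Q in auto)
    then show "norm (newman_g z) \<le> K' * R powr (1/8)" by (simp add: K'_def algebra_simps)
  qed
qed

text \<open>With \<open>T = ln (N+1)\<close> and \<open>R = T^4\<close>, the bound for
  \<open>g\<close> is of size \<open>sqrt T\<close> and the strip has width
  \<open>\<delta> = c / sqrt T\<close>. Then \<open>(N+1) powr (-\<delta>)\<close> equals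
  \<open>exp (- c * sqrt T)\<close>, which beats every power of \<open>T\<close>, and what is left
  is \<open>O(1/R)\<close>.\<close>

lemma newman_partial_sums:
  obtains C N0 where "C > 0" "\<And>N. N \<ge> N0 \<Longrightarrow> norm (newman_g 0 - (\<Sum>n<N. newman_term (Suc n) 0)) \<le> C / ln (real (Suc N)) ^ 4"
proof -
  obtain c K where cK: "0 < c" "c \<le> 1/100" "K > 0"
    "\<And>R. R \<ge> 1 \<Longrightarrow> newman_g holomorphic_on {z. Re z > -2 * (c * R powr (-(1/8))) \<and> \<bar>Im z\<bar> < 2*R}"
    "\<And>R z. R \<ge> 1 \<Longrightarrow> - (c * R powr (-(1/8))) \<le> Re z \<Longrightarrow> Re z \<le> 0 \<Longrightarrow> \<bar>Im z\<bar> \<le> R \<Longrightarrow> norm (newman_g z) \<le> K * R powr (1/8)"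
    using newman_g_strip by blast
  \<comment> \<open>The last term of \<open>newman_quantitative\<close> is a constant times
    \<open>T * R * exp (- c * sqrt T)\<close>; measured against \<open>1/R\<close> this has the
    power \<open>T * R^2 = T^9\<close>.\<close>
  have "((\<lambda>T::real. T ^ 9 * exp (- c * sqrt T)) \<longlongrightarrow> 0) at_top" using cK(1) by real_asymp
  then have "\<forall>\<^sub>F T in at_top. T ^ 9 * exp (- c * sqrt T) < 1" by (rule order_tendstoD) simp
  then obtain T0 where T0: "\<And>T. T \<ge> T0 \<Longrightarrow> T ^ 9 * exp (- c * sqrt T) < 1" by (auto simp: eventually_at_top_linorder)
  define N0 where "N0 = nat \<lceil>exp (max T0 1)\<rceil>"
  define C where "C = 8 + K + K / c"
  show ?thesis
  proof (rule that)
    show "C > 0" using cK by (simp add: C_def add_pos_pos)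
    fix N assume N: "N \<ge> N0"
    define T where "T = ln (real (Suc N))"
    have "exp (max T0 1) \<le> real N0" unfolding N0_def by (rule real_nat_ceiling_ge)
    also have "\<dots> \<le> real (Suc N)" using N by simp
    finally have "max T0 1 \<le> T" unfolding T_def by (subst ln_ge_iff) auto
    then have T: "T \<ge> T0" "T \<ge> 1" by auto
    define R where "R = T ^ 4"
    have R: "R \<ge> 1" using T by (simp add: R_def)
    define \<delta> where "\<delta> = c * R powr (-(1/8))"
    have R8: "R powr (1/8) = sqrt T"
    proof -
      have "R = T powr 4" using T by (simp add: R_def)
      then have "R powr (1/8) = (T powr 4) powr (1/8)" by (rule arg_cong)
      also have "\<dots> = T powr (1/2)" by (simp add: powr_powr)
      also have "\<dots> = sqrt T" using T by (intro powr_half_sqrt) simp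
      finally show ?thesis .
    qed
    have \<delta>: "\<delta> = c / sqrt T" unfolding \<delta>_def powr_minus R8 by (simp only: divide_inverse)
    have sT: "sqrt T \<ge> 1" using T by simp
    have \<delta>0: "0 < \<delta>" "\<delta> \<le> 1"
    proof -
      show "0 < \<delta>" using cK sT by (simp add: \<delta>)
      have "c / sqrt T \<le> c / 1" using cK sT by (intro divide_left_mono) auto
      then show "\<delta> \<le> 1" using cK by (simp add: \<delta>)
    qed
    have "norm (newman_g 0 - (\<Sum>n<N. newman_term (Suc n) 0)) \<le> 4 * 2 / R + (K * R powr (1/8)) * \<delta>\<^sup>2 / R\<^sup>2 + (K * R powr (1/8)) * R * real (Suc N) powr (-\<delta>) / \<delta>"
    proof (rule newman_quantitative)
      show "newman_g holomorphic_on {z. - 2 * \<delta> < Re z \<and> \<bar>Im z\<bar> < 2 * R}" unfolding \<delta>_def by (rule cK(4)[OF R])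
      show "norm (newman_g z) \<le> K * R powr (1/8)" if "- \<delta> \<le> Re z" "Re z \<le> 0" "\<bar>Im z\<bar> \<le> R" for z
        using cK(5)[OF R _ that(2,3)] that(1) by (simp add: \<delta>_def)
    qed (use newman_term_holomorphic norm_newman_term_le newman_sums \<delta>0 R cK(3) in auto)
    also have "\<dots> \<le> 8 / R + K / R + (K / c) / R"
    proof (intro add_mono)
      have "sqrt T \<le> R" using T real_sqrt_le_mono[of T "T ^ 2"] power_increasing[of 1 4 T] power_increasing[of 1 2 T]
        by (simp add: R_def)
      then have "K * R powr (1/8) * \<delta>\<^sup>2 \<le> K * R * 1\<^sup>2"
        unfolding R8 using cK(3) \<delta>0 R sT by (intro mult_mono power_mono mult_nonneg_nonneg order_trans[OF zero_le_one R]) auto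
      then have "K * R powr (1/8) * \<delta>\<^sup>2 / R\<^sup>2 \<le> K * R * 1\<^sup>2 / R\<^sup>2" by (intro divide_right_mono) auto
      then show "K * R powr (1/8) * \<delta>\<^sup>2 / R\<^sup>2 \<le> K / R" using R by (simp add: power2_eq_square)
      have "real (Suc N) powr (-\<delta>) = exp (- c * sqrt T)"
      proof -
        have "real (Suc N) powr (-\<delta>) = exp (- \<delta> * T)" by (simp add: powr_def T_def)
        moreover have "\<delta> * T = c * (T / sqrt T)" by (simp add: \<delta>)
        then have "\<delta> * T = c * sqrt T" using T by (simp only: real_div_sqrt)
        ultimately show ?thesis by simp
      qed
      then have "K * R powr (1/8) * R * real (Suc N) powr (-\<delta>) / \<delta> = K / c * (sqrt T * sqrt T) * R * exp (- c * sqrt T)"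
        unfolding R8 using sT by (simp add: \<delta>)
      also have "sqrt T * sqrt T = T" using T by simp
      also have "K / c * T * R * exp (- c * sqrt T) = K / c / R * (T ^ 9 * exp (- c * sqrt T))"
        using T by (simp add: R_def field_simps eval_nat_numeral)
      also have "\<dots> \<le> K / c / R * 1" using T0[OF T(1)] cK R by (intro mult_left_mono) auto
      finally show "K * R powr (1/8) * R * real (Suc N) powr (-\<delta>) / \<delta> \<le> K / c / R" by simp
    qed auto
    also have "\<dots> = C / ln (real (Suc N)) ^ 4" by (simp add: C_def R_def T_def add_divide_distrib)
    finally show "norm (newman_g 0 - (\<Sum>n<N. newman_term (Suc n) 0)) \<le> C / ln (real (Suc N)) ^ 4" .
  qed
qed

lemma Re_newman_term_0:
  assumes "n > 0"
  shows "((\<lambda>x. (theta n - x) / x\<^sup>2) has_integral Re (newman_term n 0)) {real n..real n + 1}"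
proof -
  let ?f = "\<lambda>x. of_real (theta n - x) * exp (- (0 + 2) * complex_of_real (ln x))"
  have "(?f has_integral newman_term n 0) {real n..real n + 1}"
    using integrable_integral[OF integrable_continuous[OF newman_integrand_continuous[OF assms, of 0]]]
    by (simp add: newman_term_def)
  then have "((Re \<circ> ?f) has_integral Re (newman_term n 0)) {real n..real n + 1}"
    by (rule has_integral_linear[OF _ bounded_linear_Re])
  also have "?this \<longleftrightarrow> ?thesis"
  proof (rule has_integral_cong)
    fix x assume "x \<in> {real n..real n + 1}"
    then have x: "x > 0" using assms by auto
    have "exp (- (0 + 2) * complex_of_real (ln x)) = of_real (exp (- (2 * ln x)))" by (simp flip: exp_of_real)
    also have "exp (- (2 * ln x)) = 1 / x\<^sup>2" using x by (simp add: exp_minus exp_double inverse_eq_divide)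
    finally show "(Re \<circ> ?f) x = (theta n - x) / x\<^sup>2" by simp
  qed
  finally show ?thesis .
qed

lemma Re_newman_term_0_ge:
  assumes "n > 0" "a \<ge> 0" "\<And>x. real n \<le> x \<Longrightarrow> x \<le> real n + 1 \<Longrightarrow> theta n - x \<ge> a" 
  shows "Re (newman_term n 0) \<ge> a / (real n + 1)\<^sup>2"
proof -
  have c: "((\<lambda>x. a / (real n + 1)\<^sup>2) has_integral a / (real n + 1)\<^sup>2) {real n..real n + 1}"
    using has_integral_const_real[of "a / (real n + 1)\<^sup>2" "real n" "real n + 1"] by simp
  show ?thesis
  proof (rule has_integral_le[OF c Re_newman_term_0[OF assms(1)]])
    fix x assume "x \<in> {real n..real n + 1}"
    then have x: "x \<ge> real n" "x \<le> real n + 1" "x > 0" using assms(1) by auto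
    show "a / (real n + 1)\<^sup>2 \<le> (theta n - x) / x\<^sup>2"
    proof (rule frac_le)
      show "a \<le> theta n - x" "0 \<le> theta n - x" using assms(3)[OF x(1,2)] assms(2) by linarith+
      show "x\<^sup>2 \<le> (real n + 1)\<^sup>2" using x by (intro power_mono) auto
    qed (use x in auto)
  qed
qed

lemma Re_newman_term_0_le:
  assumes "n > 0" "a \<ge> 0" "\<And>x. real n \<le> x \<Longrightarrow> x \<le> real n + 1 \<Longrightarrow> theta n - x \<le> -a" 
  shows "Re (newman_term n 0) \<le> - (a / (real n + 1)\<^sup>2)"
proof -
  have c: "((\<lambda>x. - (a / (real n + 1)\<^sup>2)) has_integral - (a / (real n + 1)\<^sup>2)) {real n..real n + 1}"
    using has_integral_const_real[of "- (a / (real n + 1)\<^sup>2)" "real n" "real n + 1"] by simp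
  show ?thesis
  proof (rule has_integral_le[OF Re_newman_term_0[OF assms(1)] c])
    fix x assume "x \<in> {real n..real n + 1}"
    then have x: "x \<ge> real n" "x \<le> real n + 1" "x > 0" using assms(1) by auto
    have "a / (real n + 1)\<^sup>2 \<le> - (theta n - x) / x\<^sup>2"
    proof (rule frac_le)
      show "a \<le> - (theta n - x)" "0 \<le> - (theta n - x)" using assms(3)[OF x(1,2)] assms(2) by linarith+
      show "x\<^sup>2 \<le> (real n + 1)\<^sup>2" using x by (intro power_mono) auto
    qed (use x in auto)
    then show "(theta n - x) / x\<^sup>2 \<le> - (a / (real n + 1)\<^sup>2)"
      using minus_divide_left[of "theta n - x" "x\<^sup>2"] by linarith
  qed
qed


text \<open>If \<open>theta m\<close> exceeds \<open>m\<close> by the fraction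
  \<open>\<epsilon>\<close>, monotonicity keeps \<open>theta n - x\<close> above
  \<open>m \<epsilon> / 2\<close> on a block to the right of \<open>m\<close> of length about
  \<open>m \<epsilon> / 4\<close>. The block sum of \<open>D\<close> is then at least
  \<open>\<epsilon>^2 / 64\<close>, while the Cauchy tails are \<open>O(1 / ln^4 m)\<close>. A
  deficit is treated in the same way on a block to the left of \<open>m\<close>.\<close>

theorem theta_asymptotic:
  obtains C where "C > 0" "\<And>n. n \<ge> 2 \<Longrightarrow> \<bar>theta n - real n\<bar> \<le> C * real n / (ln (real n))\<^sup>2"
proof -
  obtain C0 N0 where C0: "C0 > 0" "\<And>N. N \<ge> N0 \<Longrightarrow> norm (newman_g 0 - (\<Sum>n<N. newman_term (Suc n) 0)) \<le> C0 / ln (real (Suc N)) ^ 4"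
    using newman_partial_sums by blast
  define D where "D n = Re (newman_term n 0)" for n
  have D_sum: "\<bar>\<Sum>n\<in>{M..<N}. D n\<bar> \<le> 2 * C0 / ln (real M) ^ 4" if M: "M \<ge> Suc N0" "M \<ge> 2" "M \<le> N" for M N
  proof -
    obtain M' N' where MN: "M = Suc M'" "N = Suc N'" "M' \<le> N'" using M by (cases M; cases N) auto
    let ?S = "\<lambda>N. \<Sum>n<N. newman_term (Suc n) 0"
    have "(\<Sum>n\<in>{M..<N}. newman_term n 0) = (\<Sum>n\<in>{M'..<N'}. newman_term (Suc n) 0)"
      unfolding MN by (rule sum.shift_bounds_Suc_ivl)
    also have "\<dots> = ?S N' - ?S M'"
      using sum_diff_nat_ivl[of 0 M' N' "\<lambda>n. newman_term (Suc n) 0"] MN by (simp add: atLeast0LessThan)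
    also have "norm \<dots> \<le> C0 / ln (real (Suc N')) ^ 4 + C0 / ln (real (Suc M')) ^ 4"
      using C0(2)[of M'] C0(2)[of N'] M MN norm_triangle_ineq4[of "newman_g 0 - ?S M'" "newman_g 0 - ?S N'"] by simp
    also have "C0 / ln (real (Suc N')) ^ 4 \<le> C0 / ln (real (Suc M')) ^ 4"
      using M MN C0 by (intro divide_left_mono power_mono mult_pos_pos) auto
    finally have "norm (\<Sum>n\<in>{M..<N}. newman_term n 0) \<le> 2 * C0 / ln (real M) ^ 4" by (simp add: MN)
    moreover have "(\<Sum>n\<in>{M..<N}. D n) = Re (\<Sum>n\<in>{M..<N}. newman_term n 0)" by (simp add: D_def Re_sum)
    ultimately show ?thesis using abs_Re_le_cmod order_trans by metis
  qed
  \<comment> \<open>The two contradictions below yield \<open>B^2 \<le> 128 * C0\<close> and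
    \<open>B^2 \<le> 512 * C0\<close>.\<close>
  define B where "B = 40 * (C0 + 1)"
  have B: "B > 0" "B\<^sup>2 > 1024 * C0"
  proof -
    show "B > 0" using C0 by (simp add: B_def)
    have "B\<^sup>2 = 1600 * (C0 + 1)\<^sup>2" unfolding B_def power_mult_distrib by simp
    moreover have "(C0 + 1)\<^sup>2 \<ge> C0" using C0 by (simp add: power2_eq_square algebra_simps)
    ultimately show "B\<^sup>2 > 1024 * C0" using C0 by simp
  qed
  have "((\<lambda>m. B / (ln (real m))\<^sup>2) \<longlongrightarrow> 0) at_top" by real_asymp
  then have e1: "\<forall>\<^sub>F m in at_top. B / (ln (real m))\<^sup>2 < 1" by (rule order_tendstoD) simp
  \<comment> \<open>With \<open>m \<epsilon> \<ge> 8\<close>, rounding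
    \<open>m \<epsilon> / 4\<close> down to the block length loses at most half of it.\<close>
  have "filterlim (\<lambda>m. real m * (B / (ln (real m))\<^sup>2)) at_top at_top" using B(1) by real_asymp
  then have e2: "\<forall>\<^sub>F m in at_top. real m * (B / (ln (real m))\<^sup>2) \<ge> 8" by (auto simp: filterlim_at_top)
  from eventually_conj[OF e1 e2] obtain N1 where N1: "\<And>m. m \<ge> N1 \<Longrightarrow> B / (ln (real m))\<^sup>2 < 1 \<and> real m * (B / (ln (real m))\<^sup>2) \<ge> 8"
    by (auto simp: eventually_at_top_linorder)
  define N2 where "N2 = max N1 (max (2 * Suc N0) 6)"
  have main: "\<bar>theta m - real m\<bar> \<le> B * real m / (ln (real m))\<^sup>2" if m: "m \<ge> N2" for m
  proof -
    define \<epsilon> where "\<epsilon> = B / (ln (real m))\<^sup>2"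
    have m': "m \<ge> N1" "m \<ge> 2 * Suc N0" "m \<ge> 6" using m by (auto simp: N2_def)
    have lm: "ln (real m) > 0" using m' by simp
    have \<epsilon>: "0 < \<epsilon>" "\<epsilon> < 1" "real m * \<epsilon> \<ge> 8" using N1[OF m'(1)] lm B by (auto simp: \<epsilon>_def)
    define k where "k = nat \<lfloor>real m * \<epsilon> / 4\<rfloor>"
    have k: "real k \<le> real m * \<epsilon> / 4" "real k \<ge> real m * \<epsilon> / 4 - 1" "real k \<ge> real m * \<epsilon> / 8"
      using \<epsilon>(3) unfolding k_def by linarith+
    have "real k \<le> real m * 1 / 4" using k(1) \<epsilon>(2) mult_left_mono[of \<epsilon> 1 "real m"] by linarith
    then have k4: "4 * k \<le> m" by linarith
    have eps4: "\<epsilon>\<^sup>2 * ln (real m) ^ 4 = B\<^sup>2" using lm by (simp add: \<epsilon>_def power_divide field_simps flip: power_mult)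
    have up: "theta m \<le> real m * (1 + \<epsilon>)"
    proof (rule ccontr)
      assume "\<not> theta m \<le> real m * (1 + \<epsilon>)"
      then have th: "theta m > real m + real m * \<epsilon>" by (simp add: algebra_simps)
      have Dn: "D n \<ge> \<epsilon> / (8 * real m)" if n: "n \<in> {m..<m+k}" for n
      proof -
        have "D n \<ge> (real m * \<epsilon> / 2) / (real n + 1)\<^sup>2"
          unfolding D_def
        proof (rule Re_newman_term_0_ge)
          fix x assume "x \<le> real n + 1"
          then have "x \<le> real m + real k" using n by simp
          moreover have "theta m \<le> theta n" using n by (intro theta_mono) auto
          ultimately show "real m * \<epsilon> / 2 \<le> theta n - x" using th k(1) \<epsilon>(3) by linarith
        qed (use n m' \<epsilon> in auto)
        moreover have "(real m * \<epsilon> / 2) / (2 * real m)\<^sup>2 \<le> (real m * \<epsilon> / 2) / (real n + 1)\<^sup>2"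
        proof (intro divide_left_mono power_mono)
          show "real n + 1 \<le> 2 * real m" using n k4 m' by simp
        qed (use m' \<epsilon> in auto)
        moreover have "(real m * \<epsilon> / 2) / (2 * real m)\<^sup>2 = \<epsilon> / (8 * real m)" using m' by (simp add: power2_eq_square)
        ultimately show ?thesis by linarith
      qed
      have "real k * (\<epsilon> / (8 * real m)) \<le> (\<Sum>n\<in>{m..<m+k}. D n)"
        using sum_mono[of "{m..<m+k}" "\<lambda>_. \<epsilon> / (8 * real m)" D] Dn by simp
      also have "\<dots> \<le> 2 * C0 / ln (real m) ^ 4" using D_sum[of m "m + k"] m' by (simp add: abs_le_iff)
      finally have "real k * (\<epsilon> / (8 * real m)) \<le> 2 * C0 / ln (real m) ^ 4" .
      moreover have "(real m * \<epsilon> / 8) * (\<epsilon> / (8 * real m)) \<le> real k * (\<epsilon> / (8 * real m))" using k(3) \<epsilon> by (intro mult_right_mono) auto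
      moreover have "(real m * \<epsilon> / 8) * (\<epsilon> / (8 * real m)) = \<epsilon>\<^sup>2 / 64" using m' by (simp add: power2_eq_square)
      ultimately have "\<epsilon>\<^sup>2 / 64 \<le> 2 * C0 / ln (real m) ^ 4" by linarith
      then have "\<epsilon>\<^sup>2 * ln (real m) ^ 4 \<le> 128 * C0" using lm by (simp add: field_simps)
      then show False using eps4 B C0 by simp
    qed
    have lo: "theta m \<ge> real m * (1 - \<epsilon>)"
    proof (rule ccontr)
      assume "\<not> theta m \<ge> real m * (1 - \<epsilon>)"
      then have th: "theta m < real m - real m * \<epsilon>" by (simp add: algebra_simps)
      have Dn: "D n \<le> - (\<epsilon> / (2 * real m))" if n: "n \<in> {m-k..<m}" for n
      proof -
        have n0: "n > 0" using n k4 m' by auto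
        have "D n \<le> - ((real m * \<epsilon> / 2) / (real n + 1)\<^sup>2)"
          unfolding D_def
        proof (rule Re_newman_term_0_le)
          fix x assume "real n \<le> x"
          then have "x \<ge> real m - real k" using n k4 by (simp add: of_nat_diff) linarith
          moreover have "theta n \<le> theta m" using n by (intro theta_mono) auto
          ultimately show "theta n - x \<le> - (real m * \<epsilon> / 2)" using th k(1) \<epsilon>(3) by linarith
        qed (use n0 \<epsilon> in auto)
        moreover have "(real m * \<epsilon> / 2) / (real m)\<^sup>2 \<le> (real m * \<epsilon> / 2) / (real n + 1)\<^sup>2"
          using n \<epsilon> by (intro divide_left_mono power_mono) auto
        moreover have "(real m * \<epsilon> / 2) / (real m)\<^sup>2 = \<epsilon> / (2 * real m)" using m' by (simp add: power2_eq_square)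
        ultimately show ?thesis by linarith
      qed
      have "(\<Sum>n\<in>{m-k..<m}. D n) \<le> (\<Sum>n\<in>{m-k..<m}. - (\<epsilon> / (2 * real m)))" by (rule sum_mono) (rule Dn)
      also have "\<dots> = - (real k * (\<epsilon> / (2 * real m)))" using k4 by simp
      finally have a: "(\<Sum>n\<in>{m-k..<m}. D n) \<le> - (real k * (\<epsilon> / (2 * real m)))" .
      have "\<bar>\<Sum>n\<in>{m-k..<m}. D n\<bar> \<le> 2 * C0 / ln (real (m - k)) ^ 4"
        by (rule D_sum) (use m' k4 in auto)
      also have "\<dots> \<le> 2 * C0 / (ln (real m) / 2) ^ 4"
      proof -
        have "ln (real m) \<le> ln (real (m - k) * real (m - k))"
        proof (subst ln_le_cancel_iff)
          have "4 * (m - k) \<ge> 3 * m" using k4 by auto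
          then have 1: "4 * real (m - k) \<ge> 3 * real m" by linarith
          have "m - k \<ge> 2" using k4 m' by auto
          then have "2 * real (m - k) \<le> real (m - k) * real (m - k)" by (intro mult_right_mono) auto
          with 1 show "real m \<le> real (m - k) * real (m - k)" by linarith
        qed (use k4 m' in auto)
        also have "\<dots> = 2 * ln (real (m - k))" using k4 m' by (subst ln_mult) auto
        finally have "ln (real m) / 2 \<le> ln (real (m - k))" by simp
        then show ?thesis using C0 lm by (intro divide_left_mono power_mono mult_pos_pos) auto
      qed
      finally have "\<bar>\<Sum>n\<in>{m-k..<m}. D n\<bar> \<le> 2 * C0 / (ln (real m) / 2) ^ 4" .
      with a have b: "real k * (\<epsilon> / (2 * real m)) \<le> 2 * C0 / (ln (real m) / 2) ^ 4" by linarith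
      moreover have "(real m * \<epsilon> / 8) * (\<epsilon> / (2 * real m)) \<le> real k * (\<epsilon> / (2 * real m))" using k(3) \<epsilon> by (intro mult_right_mono) auto
      moreover have "(real m * \<epsilon> / 8) * (\<epsilon> / (2 * real m)) = \<epsilon>\<^sup>2 / 16" using m' by (simp add: power2_eq_square)
      ultimately have "\<epsilon>\<^sup>2 / 16 \<le> 2 * C0 / (ln (real m) / 2) ^ 4" by linarith
      then have "\<epsilon>\<^sup>2 * ln (real m) ^ 4 \<le> 512 * C0" using lm by (simp add: field_simps power_divide)
      then show False using eps4 B C0 by simp
    qed
    have "\<bar>theta m - real m\<bar> \<le> real m * \<epsilon>" using up lo by (simp add: abs_le_iff algebra_simps)
    then show ?thesis by (simp add: \<epsilon>_def mult.commute)
  qed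
  define C where "C = max B (2 * (ln (real N2))\<^sup>2)"
  show ?thesis
  proof (rule that)
    show "C > 0" using B by (simp add: C_def)
    fix n :: nat assume n: "n \<ge> 2"
    then have l: "ln (real n) > 0" by simp
    show "\<bar>theta n - real n\<bar> \<le> C * real n / (ln (real n))\<^sup>2"
    proof (cases "n \<ge> N2")
      case True
      have "B * real n / (ln (real n))\<^sup>2 \<le> C * real n / (ln (real n))\<^sup>2" by (intro divide_right_mono mult_right_mono) (auto simp: C_def)
      with main[OF True] show ?thesis by linarith
    next
      case False
      have "(ln (real n))\<^sup>2 \<le> (ln (real N2))\<^sup>2" using False n by (intro power_mono) auto
      then have "2 * (ln (real n))\<^sup>2 \<le> C" by (simp add: C_def)
      then have "2 \<le> C / (ln (real n))\<^sup>2" using l by (simp add: field_simps)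
      then have "2 * real n \<le> C / (ln (real n))\<^sup>2 * real n" by (intro mult_right_mono) auto
      with theta_minus_abs_le[of n "real n"] show ?thesis by simp
    qed
  qed
qed

section \<open>Mertens' theorem\<close>

lemma abel_sum_by_parts:
  fixes f g :: "nat \<Rightarrow> real"
  assumes "m > 0" "m \<le> N"
  shows "(\<Sum>n\<in>{m..N}. f n * (g n - g (n-1))) = f N * g N - f m * g (m-1) + (\<Sum>n\<in>{m..<N}. g n * (f n - f (Suc n)))"
  using assms(2)
proof (induction N rule: dec_induct)
  case base
  then show ?case by (simp add: algebra_simps)
next
  case (step n)
  then show ?case by (simp add: algebra_simps)
qed

text \<open>Partial summation is used twice. The first brings in the error
  \<open>E n = theta n - n\<close> against the decrements of \<open>\<phi>\<close>; there it is
  replaced by its majorant \<open>w n = C n / ln^2 n\<close>. The second undoes the summation, and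
  since the increments of \<open>w\<close> are at most \<open>C / ln^2 n\<close>, the final error
  involves \<open>\<phi>\<close> itself and not its variation.\<close>

lemma prime_sum_compare:
  obtains C where "C > 0"
    "\<And>m N \<phi>. 2 \<le> m \<Longrightarrow> m \<le> N \<Longrightarrow> (\<And>n. m \<le> n \<Longrightarrow> n \<le> N \<Longrightarrow> \<phi> n \<ge> (0::real)) \<Longrightarrow>
       (\<And>n. m \<le> n \<Longrightarrow> n < N \<Longrightarrow> \<phi> (Suc n) \<le> \<phi> n) \<Longrightarrow>
       \<bar>(\<Sum>p\<in>{p. prime p \<and> m \<le> p \<and> p \<le> N}. \<phi> p * ln (real p)) - (\<Sum>n\<in>{m..N}. \<phi> n)\<bar>
         \<le> C * (real m * \<phi> m / (ln (real m))\<^sup>2 + (\<Sum>n\<in>{m..N}. \<phi> n / (ln (real n))\<^sup>2))"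
proof -
  obtain C where C: "C > 0" "\<And>n. n \<ge> 2 \<Longrightarrow> \<bar>theta n - real n\<bar> \<le> C * real n / (ln (real n))\<^sup>2"
    using theta_asymptotic by blast
  have "((\<lambda>m. (ln (real m) + 1) * (ln (real m))\<^sup>2 / real m) \<longlongrightarrow> 0) at_top" by real_asymp
  then have "Bseq (\<lambda>m. (ln (real m) + 1) * (ln (real m))\<^sup>2 / real m)"
    using convergent_imp_Bseq convergent_def by blast
  then obtain B where B: "B > 0" "\<And>m. \<bar>(ln (real m) + 1) * (ln (real m))\<^sup>2 / real m\<bar> \<le> B"
    unfolding Bseq_def by auto
  define w where "w n = C * (real n / (ln (real n))\<^sup>2)" for n
  show ?thesis
  proof (rule that)
    show "2 * C + B > 0" using C B by simp
    fix m N :: nat and \<phi> :: "nat \<Rightarrow> real"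
    assume m: "2 \<le> m" "m \<le> N" and pos: "\<And>n. m \<le> n \<Longrightarrow> n \<le> N \<Longrightarrow> \<phi> n \<ge> 0"
      and dec: "\<And>n. m \<le> n \<Longrightarrow> n < N \<Longrightarrow> \<phi> (Suc n) \<le> \<phi> n"
    define E where "E n = theta n - real n" for n
    have E_w: "\<bar>E n\<bar> \<le> w n" if "n \<ge> 2" for n using C(2)[OF that] by (simp add: E_def w_def)
    have lm: "ln (real m) > 0" using m by simp
    have E_step: "E n - E (n-1) = (if prime n then ln (real n) else 0) - 1" if "n \<ge> 1" for n
      using theta_Suc[of "n-1"] that by (simp add: E_def of_nat_diff)
    have "(\<Sum>p\<in>{p. prime p \<and> m \<le> p \<and> p \<le> N}. \<phi> p * ln (real p)) = (\<Sum>n\<in>{m..N}. \<phi> n * (if prime n then ln (real n) else 0))"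
      by (rule sum.mono_neutral_cong_left) auto
    then have "(\<Sum>p\<in>{p. prime p \<and> m \<le> p \<and> p \<le> N}. \<phi> p * ln (real p)) - (\<Sum>n\<in>{m..N}. \<phi> n) = (\<Sum>n\<in>{m..N}. \<phi> n * ((if prime n then ln (real n) else 0) - 1))"
      by (simp only: sum_subtractf right_diff_distrib mult_1_right)
    also have "\<dots> = (\<Sum>n\<in>{m..N}. \<phi> n * (E n - E (n-1)))" using m by (intro sum.cong refl) (subst E_step, auto)
    also have "\<dots> = \<phi> N * E N - \<phi> m * E (m-1) + (\<Sum>n\<in>{m..<N}. E n * (\<phi> n - \<phi> (Suc n)))"
      by (rule abel_sum_by_parts) (use m in auto)
    finally have eq: "(\<Sum>p\<in>{p. prime p \<and> m \<le> p \<and> p \<le> N}. \<phi> p * ln (real p)) - (\<Sum>n\<in>{m..N}. \<phi> n) = \<dots>" .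
    \<comment> \<open>For \<open>m = 2\<close> the index \<open>m - 1\<close> is 1, where the bound
      on \<open>E\<close> does not apply. Hence \<open>E (m-1)\<close> is compared with
      \<open>E m\<close>, from which it differs by at most \<open>ln m + 1\<close>.\<close>
    have Em: "\<bar>E (m-1)\<bar> \<le> w m + B * (real m / (ln (real m))\<^sup>2)"
    proof -
      have "\<bar>E (m-1)\<bar> \<le> \<bar>E m\<bar> + (ln (real m) + 1)" using E_step[of m] m lm by (cases "prime m"; simp; linarith)
      moreover have "ln (real m) + 1 \<le> B * (real m / (ln (real m))\<^sup>2)"
        using B(2)[of m] lm m by (simp add: field_simps)
      ultimately show ?thesis using E_w[OF m(1)] by linarith
    qed
    have "\<bar>\<phi> N * E N - \<phi> m * E (m-1) + (\<Sum>n\<in>{m..<N}. E n * (\<phi> n - \<phi> (Suc n)))\<bar>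
       \<le> \<bar>\<phi> N * E N\<bar> + \<bar>\<phi> m * E (m-1)\<bar> + \<bar>\<Sum>n\<in>{m..<N}. E n * (\<phi> n - \<phi> (Suc n))\<bar>" by linarith
    also have "\<dots> \<le> \<phi> N * w N + \<phi> m * (w m + B * (real m / (ln (real m))\<^sup>2)) + (\<Sum>n\<in>{m..<N}. w n * (\<phi> n - \<phi> (Suc n)))"
    proof (intro add_mono)
      show "\<bar>\<phi> N * E N\<bar> \<le> \<phi> N * w N" using pos[of N] m E_w[of N] by (simp add: abs_mult mult_left_mono)
      show "\<bar>\<phi> m * E (m-1)\<bar> \<le> \<phi> m * (w m + B * (real m / (ln (real m))\<^sup>2))"
        using pos[of m] m Em by (simp add: abs_mult mult_left_mono)
      show "\<bar>\<Sum>n\<in>{m..<N}. E n * (\<phi> n - \<phi> (Suc n))\<bar> \<le> (\<Sum>n\<in>{m..<N}. w n * (\<phi> n - \<phi> (Suc n)))"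
      proof (rule order_trans[OF sum_abs sum_mono])
        fix n assume "n \<in> {m..<N}"
        then show "\<bar>E n * (\<phi> n - \<phi> (Suc n))\<bar> \<le> w n * (\<phi> n - \<phi> (Suc n))"
          using dec[of n] m E_w[of n] by (simp add: abs_mult mult_right_mono)
      qed
    qed
    also have "\<dots> = \<phi> m * w (m-1) + \<phi> m * (w m + B * (real m / (ln (real m))\<^sup>2)) + (\<Sum>n\<in>{m..N}. \<phi> n * (w n - w (n-1)))"
      using abel_sum_by_parts[of m N \<phi> w] m by simp
    \<comment> \<open>The first term is split off because for \<open>m = 2\<close> it contains
      \<open>w 1\<close>, a division by \<open>ln 1 = 0\<close>. It cancels against the boundary
      term \<open>\<phi> m * w (m-1)\<close>.\<close>
    also have "(\<Sum>n\<in>{m..N}. \<phi> n * (w n - w (n-1))) = \<phi> m * (w m - w (m-1)) + (\<Sum>n\<in>{Suc m..N}. \<phi> n * (w n - w (n-1)))"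
      using m by (simp add: sum.atLeast_Suc_atMost)
    also have "(\<Sum>n\<in>{Suc m..N}. \<phi> n * (w n - w (n-1))) \<le> (\<Sum>n\<in>{Suc m..N}. C * (\<phi> n / (ln (real n))\<^sup>2))"
    proof (rule sum_mono)
      fix n assume n: "n \<in> {Suc m..N}"
      have l: "ln (real (n-1)) > 0" "ln (real n) > 0" "ln (real (n-1)) \<le> ln (real n)" using n m by (auto simp: of_nat_diff)
      have "real (n-1) / (ln (real n))\<^sup>2 \<le> real (n-1) / (ln (real (n-1)))\<^sup>2"
        using l by (intro divide_left_mono power_mono) auto
      then have "real n / (ln (real n))\<^sup>2 - real (n-1) / (ln (real (n-1)))\<^sup>2 \<le> real n / (ln (real n))\<^sup>2 - real (n-1) / (ln (real n))\<^sup>2" by linarith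
      also have "\<dots> = 1 / (ln (real n))\<^sup>2" using n by (simp add: of_nat_diff diff_divide_distrib[symmetric])
      finally have "w n - w (n-1) \<le> C * (1 / (ln (real n))\<^sup>2)" using C(1)
        unfolding w_def right_diff_distrib[symmetric] by (intro mult_left_mono) auto
      then have "\<phi> n * (w n - w (n-1)) \<le> \<phi> n * (C * (1 / (ln (real n))\<^sup>2))" using pos[of n] n by (intro mult_left_mono) auto
      then show "\<phi> n * (w n - w (n-1)) \<le> C * (\<phi> n / (ln (real n))\<^sup>2)" by (simp add: mult_ac)
    qed
    also have "\<dots> \<le> (\<Sum>n\<in>{m..N}. C * (\<phi> n / (ln (real n))\<^sup>2))"
      by (rule sum_mono2) (use C pos in auto)
    also have "\<dots> = C * (\<Sum>n\<in>{m..N}. \<phi> n / (ln (real n))\<^sup>2)" by (simp add: sum_distrib_left)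
    also have "\<phi> m * w (m-1) + \<phi> m * (w m + B * (real m / (ln (real m))\<^sup>2)) + (\<phi> m * (w m - w (m-1)) + C * (\<Sum>n\<in>{m..N}. \<phi> n / (ln (real n))\<^sup>2))
       = (2 * C + B) * (real m * \<phi> m / (ln (real m))\<^sup>2) + C * (\<Sum>n\<in>{m..N}. \<phi> n / (ln (real n))\<^sup>2)"
      by (simp add: w_def algebra_simps add_divide_distrib)
    also have "\<dots> \<le> (2 * C + B) * (real m * \<phi> m / (ln (real m))\<^sup>2 + (\<Sum>n\<in>{m..N}. \<phi> n / (ln (real n))\<^sup>2))"
    proof -
      have "(\<Sum>n\<in>{m..N}. \<phi> n / (ln (real n))\<^sup>2) \<ge> 0" using pos by (intro sum_nonneg) auto
      then have "C * (\<Sum>n\<in>{m..N}. \<phi> n / (ln (real n))\<^sup>2) \<le> (2 * C + B) * (\<Sum>n\<in>{m..N}. \<phi> n / (ln (real n))\<^sup>2)"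
        using C B by (intro mult_right_mono) auto
      then show ?thesis by (simp add: distrib_left)
    qed
    finally show "\<bar>(\<Sum>p\<in>{p. prime p \<and> m \<le> p \<and> p \<le> N}. \<phi> p * ln (real p)) - (\<Sum>n\<in>{m..N}. \<phi> n)\<bar>
         \<le> (2 * C + B) * (real m * \<phi> m / (ln (real m))\<^sup>2 + (\<Sum>n\<in>{m..N}. \<phi> n / (ln (real n))\<^sup>2))"
      unfolding eq by simp
  qed
qed

lemma sum_le_telescope:
  fixes f g :: "nat \<Rightarrow> real"
  assumes "m \<le> N" "\<And>n. m < n \<Longrightarrow> n \<le> N \<Longrightarrow> f n \<le> g (n-1) - g n"
  shows "(\<Sum>n\<in>{Suc m..N}. f n) \<le> g m - g N"
  using assms
proof (induction N rule: dec_induct)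
  case (step n)
  have "(\<Sum>n\<in>{Suc m..n}. f n) \<le> g m - g n" by (rule step.IH) (use step.prems in auto)
  moreover have "f (Suc n) \<le> g n - g (Suc n)" using step.prems[of "Suc n"] step.hyps by simp
  ultimately show ?case using step.hyps by simp
qed auto

lemma inverse_ln_bounds:
  fixes n :: real assumes "n \<ge> 2"
  shows "1 / ((n + 1) * ln (n + 1)) \<le> ln (ln (n + 1)) - ln (ln n)"
    and "ln (ln (n + 1)) - ln (ln n) \<le> 1 / (n * ln n)"
    and "2 / ((n + 1) * ln (n + 1) ^ 3) \<le> 1 / (ln n)\<^sup>2 - 1 / (ln (n + 1))\<^sup>2"
proof -
  have "\<exists>z. n < z \<and> z < n + 1 \<and> ln (ln (n + 1)) - ln (ln n) = (n + 1 - n) * (1 / (z * ln z))"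
    by (rule MVT2) (use assms in \<open>auto intro!: derivative_eq_intros simp: field_simps\<close>)
  then obtain z where z: "n < z" "z < n + 1" "ln (ln (n + 1)) - ln (ln n) = 1 / (z * ln z)" by auto
  show "1 / ((n + 1) * ln (n + 1)) \<le> ln (ln (n + 1)) - ln (ln n)"
    unfolding z(3) using assms z by (intro divide_left_mono mult_mono) auto
  show "ln (ln (n + 1)) - ln (ln n) \<le> 1 / (n * ln n)"
    unfolding z(3) using assms z by (intro divide_left_mono mult_mono) auto
  have "\<exists>z. n < z \<and> z < n + 1 \<and> - 1 / (ln (n+1))\<^sup>2 - (- 1 / (ln n)\<^sup>2) = (n + 1 - n) * (2 / (z * ln z ^ 3))"
    by (rule MVT2) (use assms in \<open>auto intro!: derivative_eq_intros simp: field_simps eval_nat_numeral\<close>)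
  then obtain y where y: "n < y" "y < n + 1" "1 / (ln n)\<^sup>2 - 1 / (ln (n+1))\<^sup>2 = 2 / (y * ln y ^ 3)" by auto
  show "2 / ((n + 1) * ln (n + 1) ^ 3) \<le> 1 / (ln n)\<^sup>2 - 1 / (ln (n + 1))\<^sup>2"
    unfolding y(3) using assms y by (intro divide_left_mono mult_mono power_mono) auto
qed


lemma ln_power_le_bound:
  obtains B where "B > 0" "\<And>m. m \<ge> 2 \<Longrightarrow> 1 / real m \<le> B / (ln (real m))\<^sup>2"
proof -
  have "((\<lambda>m. (ln (real m))\<^sup>2 / real m) \<longlongrightarrow> 0) at_top" by real_asymp
  then have "Bseq (\<lambda>m. (ln (real m))\<^sup>2 / real m)"
    using convergent_imp_Bseq convergent_def by blast
  then obtain B where B: "B > 0" "\<And>m. \<bar>(ln (real m))\<^sup>2 / real m\<bar> \<le> B"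
    unfolding Bseq_def by auto
  show ?thesis
  proof (rule that[OF B(1)])
    fix m :: nat assume "m \<ge> 2"
    then have "ln (real m) > 0" by simp
    then show "1 / real m \<le> B / (ln (real m))\<^sup>2" using B(2)[of m] \<open>m \<ge> 2\<close> by (simp add: field_simps)
  qed
qed

text \<open>With \<open>\<phi> n = 1 / (n ln n)\<close> the error of
  \<open>prime_sum_compare\<close> is a tail of \<open>1 / (n ln^3 n)\<close>, hence of size
  \<open>1 / ln^2 m\<close>; this is where the square in the prime number theorem is used up. The
  main sum telescopes against \<open>ln ln\<close>.\<close>

lemma prime_reciprocal_diff:
  obtains C where "C > 0" "\<And>m N. 2 \<le> m \<Longrightarrow> m \<le> N \<Longrightarrow>
     \<bar>(\<Sum>p\<in>{p. prime p \<and> m < p \<and> p \<le> N}. 1 / real p) - (ln (ln (real N)) - ln (ln (real m)))\<bar> \<le> C / (ln (real m))\<^sup>2"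
proof -
  obtain C where C: "C > 0"
    "\<And>m N \<phi>. 2 \<le> m \<Longrightarrow> m \<le> N \<Longrightarrow> (\<And>n. m \<le> n \<Longrightarrow> n \<le> N \<Longrightarrow> \<phi> n \<ge> (0::real)) \<Longrightarrow>
       (\<And>n. m \<le> n \<Longrightarrow> n < N \<Longrightarrow> \<phi> (Suc n) \<le> \<phi> n) \<Longrightarrow>
       \<bar>(\<Sum>p\<in>{p. prime p \<and> m \<le> p \<and> p \<le> N}. \<phi> p * ln (real p)) - (\<Sum>n\<in>{m..N}. \<phi> n)\<bar>
         \<le> C * (real m * \<phi> m / (ln (real m))\<^sup>2 + (\<Sum>n\<in>{m..N}. \<phi> n / (ln (real n))\<^sup>2))"
    using prime_sum_compare by blast
  obtain B where B: "B > 0" "\<And>m. m \<ge> 2 \<Longrightarrow> 1 / real m \<le> B / (ln (real m))\<^sup>2" using ln_power_le_bound by blast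
  show ?thesis
  proof (rule that)
    show "C * (2 / ln 2 + 1) + B / ln 2 + B > 0" using B C by (intro add_pos_pos mult_pos_pos) auto
    fix m N :: nat assume m: "2 \<le> m" "m \<le> N"
    define L where "L = ln (real m)"
    define \<phi> where "\<phi> n = 1 / (real n * ln (real n))" for n :: nat
    have L: "L \<ge> ln 2" "L > 0" using m by (auto simp: L_def)
    have Lm: "1 / L \<le> 1 / ln 2" using L by (intro divide_left_mono) auto
    have \<phi>0: "\<phi> n \<ge> 0" if "n \<ge> 2" for n using that by (simp add: \<phi>_def)
    have "\<bar>(\<Sum>p\<in>{p. prime p \<and> m \<le> p \<and> p \<le> N}. \<phi> p * ln (real p)) - (\<Sum>n\<in>{m..N}. \<phi> n)\<bar>
         \<le> C * (real m * \<phi> m / (ln (real m))\<^sup>2 + (\<Sum>n\<in>{m..N}. \<phi> n / (ln (real n))\<^sup>2))"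
    proof (rule C(2)[OF m])
      fix n assume "m \<le> n" "n < N"
      then show "\<phi> (Suc n) \<le> \<phi> n" using m unfolding \<phi>_def
        by (intro divide_left_mono mult_mono mult_pos_pos) auto
    qed (use \<phi>0 m in auto)
    also have "\<dots> \<le> C * (1 / ln 2 * (1 / L\<^sup>2) + (1 / ln 2 + 1) * (1 / L\<^sup>2))"
    proof (intro mult_left_mono add_mono)
      show "real m * \<phi> m / (ln (real m))\<^sup>2 \<le> 1 / ln 2 * (1 / L\<^sup>2)"
        using divide_right_mono[OF Lm, of "L\<^sup>2"] L m by (simp add: \<phi>_def L_def[symmetric])
      have "(\<Sum>n\<in>{m..N}. \<phi> n / (ln (real n))\<^sup>2) = \<phi> m / L\<^sup>2 + (\<Sum>n\<in>{Suc m..N}. \<phi> n / (ln (real n))\<^sup>2)"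
        using m by (simp add: sum.atLeast_Suc_atMost L_def)
      also have "(\<Sum>n\<in>{Suc m..N}. \<phi> n / (ln (real n))\<^sup>2) \<le> 1 / (ln (real m))\<^sup>2 - 1 / (ln (real N))\<^sup>2"
      proof (rule sum_le_telescope[OF m(2)])
        fix n assume n: "m < n" "n \<le> N"
        then have "2 / ((real (n-1) + 1) * ln (real (n-1) + 1) ^ 3) \<le> 1 / (ln (real (n-1)))\<^sup>2 - 1 / (ln (real (n-1) + 1))\<^sup>2"
          using m by (intro inverse_ln_bounds) auto
        moreover have "real (n-1) + 1 = real n" using n by auto
        ultimately have "2 / (real n * ln (real n) ^ 3) \<le> 1 / (ln (real (n-1)))\<^sup>2 - 1 / (ln (real n))\<^sup>2" by simp
        moreover have "\<phi> n / (ln (real n))\<^sup>2 = 1 / (real n * ln (real n) ^ 3)" by (simp add: \<phi>_def eval_nat_numeral)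
        moreover have "1 / (real n * ln (real n) ^ 3) \<le> 2 / (real n * ln (real n) ^ 3)"
          using n m by (intro divide_right_mono) auto
        ultimately show "\<phi> n / (ln (real n))\<^sup>2 \<le> 1 / (ln (real (n-1)))\<^sup>2 - 1 / (ln (real n))\<^sup>2" by linarith
      qed
      also have "\<dots> \<le> 1 / L\<^sup>2" by (simp add: L_def)
      also have "\<phi> m \<le> 1 / ln 2"
      proof -
        have "1 / (real m * ln (real m)) \<le> 1 / (1 * ln 2)" using m by (intro divide_left_mono mult_mono) auto
        then show ?thesis by (simp add: \<phi>_def)
      qed
      then have "\<phi> m / L\<^sup>2 \<le> 1 / ln 2 / L\<^sup>2" by (intro divide_right_mono) auto
      then have "\<phi> m / L\<^sup>2 + 1 / L\<^sup>2 \<le> (1 / ln 2 + 1) * (1 / L\<^sup>2)" by (simp add: algebra_simps)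
      finally show "(\<Sum>n\<in>{m..N}. \<phi> n / (ln (real n))\<^sup>2) \<le> (1 / ln 2 + 1) * (1 / L\<^sup>2)" by simp
    qed (use C in auto)
    finally have 1: "\<bar>(\<Sum>p\<in>{p. prime p \<and> m \<le> p \<and> p \<le> N}. \<phi> p * ln (real p)) - (\<Sum>n\<in>{m..N}. \<phi> n)\<bar>
        \<le> C * (2 / ln 2 + 1) * (1 / L\<^sup>2)" by (simp add: algebra_simps)
    have "(\<Sum>p\<in>{p. prime p \<and> m \<le> p \<and> p \<le> N}. \<phi> p * ln (real p)) = (\<Sum>p\<in>{p. prime p \<and> m \<le> p \<and> p \<le> N}. 1 / real p)"
      using m by (intro sum.cong) (auto simp: \<phi>_def)
    moreover have "(\<Sum>p\<in>{p. prime p \<and> m \<le> p \<and> p \<le> N}. 1 / real p) = (\<Sum>p\<in>{p. prime p \<and> m < p \<and> p \<le> N}. 1 / real p) + (if prime m then 1 / real m else 0)"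
    proof -
      have fin: "finite {p. prime p \<and> m < p \<and> p \<le> N}" by (rule finite_subset[of _ "{..N}"]) auto
      have "{p. prime p \<and> m \<le> p \<and> p \<le> N} = (if prime m then insert m {p. prime p \<and> m < p \<and> p \<le> N} else {p. prime p \<and> m < p \<and> p \<le> N})"
        using m by (auto simp: le_less)
      then show ?thesis using fin by simp
    qed
    moreover have "\<bar>if prime m then 1 / real m else 0\<bar> \<le> B * (1 / L\<^sup>2)" using B(2)[OF m(1)] B(1) by (auto simp: L_def)
    moreover have "\<bar>(\<Sum>n\<in>{m..N}. \<phi> n) - (ln (ln (real N)) - ln (ln (real m)))\<bar> \<le> B / ln 2 * (1 / L\<^sup>2)"
    proof -
      have e: "(\<Sum>n\<in>{m..N}. \<phi> n) = \<phi> m + (\<Sum>n\<in>{Suc m..N}. \<phi> n)" using m by (simp add: sum.atLeast_Suc_atMost)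
      have s: "real (n-1) + 1 = real n" if "m < n" for n using that by auto
      have "(\<Sum>n\<in>{Suc m..N}. \<phi> n) \<le> - ln (ln (real m)) - (- ln (ln (real N)))"
      proof (rule sum_le_telescope[OF m(2)])
        fix n assume n: "m < n" "n \<le> N"
        then show "\<phi> n \<le> - ln (ln (real (n-1))) - (- ln (ln (real n)))"
          using inverse_ln_bounds(1)[of "real (n-1)"] m s[OF n(1)] by (simp add: \<phi>_def)
      qed
      moreover have "(\<Sum>n\<in>{Suc m..N}. - \<phi> (n-1)) \<le> ln (ln (real m)) - ln (ln (real N))"
      proof (rule sum_le_telescope[OF m(2)])
        fix n assume n: "m < n" "n \<le> N"
        then show "- \<phi> (n-1) \<le> ln (ln (real (n-1))) - ln (ln (real n))"
          using inverse_ln_bounds(2)[of "real (n-1)"] m s[OF n(1)] by (simp add: \<phi>_def)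
      qed
      moreover have "(\<Sum>n\<in>{Suc m..N}. - \<phi> (n-1)) = - (\<Sum>n\<in>{m..<N}. \<phi> n)"
        unfolding sum_negf[symmetric] by (rule sum.reindex_bij_witness[of _ Suc "\<lambda>n. n - 1"]) auto
      moreover have "(\<Sum>n\<in>{m..<N}. \<phi> n) \<le> (\<Sum>n\<in>{m..N}. \<phi> n)" by (rule sum_mono2) (use \<phi>0 m in auto)
      moreover have "\<phi> m \<le> B / ln 2 * (1 / L\<^sup>2)"
      proof -
        have "\<phi> m = 1 / real m * (1 / L)" by (simp add: \<phi>_def L_def)
        also have "\<dots> \<le> B / L\<^sup>2 * (1 / ln 2)" using B(2)[OF m(1)] Lm L B(1) by (intro mult_mono) (auto simp: L_def)
        finally show ?thesis by (simp add: mult.commute)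
      qed
      ultimately show ?thesis using \<phi>0[OF m(1)] e B L by (auto simp: abs_le_iff intro: order_trans[OF _ mult_nonneg_nonneg])
    qed
    ultimately have "\<bar>(\<Sum>p\<in>{p. prime p \<and> m < p \<and> p \<le> N}. 1 / real p) - (ln (ln (real N)) - ln (ln (real m)))\<bar>
       \<le> C * (2 / ln 2 + 1) * (1 / L\<^sup>2) + B / ln 2 * (1 / L\<^sup>2) + B * (1 / L\<^sup>2)"
      using 1 by linarith
    also have "\<dots> = (C * (2 / ln 2 + 1) + B / ln 2 + B) * (1 / L\<^sup>2)" by (simp add: algebra_simps)
    finally show "\<bar>(\<Sum>p\<in>{p. prime p \<and> m < p \<and> p \<le> N}. 1 / real p) - (ln (ln (real N)) - ln (ln (real m)))\<bar> \<le> 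
       (C * (2 / ln 2 + 1) + B / ln 2 + B) / (ln (real m))\<^sup>2" by (simp add: L_def)
  qed
qed


lemma sum_inverse_square_tail:
  assumes "m > 0" "finite A" "A \<subseteq> {m<..}"
  shows "(\<Sum>n\<in>A. 1 / (real n)\<^sup>2) \<le> 1 / real m"
proof (cases "A = {}")
  case False
  define N where "N = Max A"
  have A: "A \<subseteq> {Suc m..N}" using assms by (auto simp: N_def Suc_le_eq)
  then have mN: "m \<le> N" using False by auto
  have "(\<Sum>n\<in>A. 1 / (real n)\<^sup>2) \<le> (\<Sum>n\<in>{Suc m..N}. 1 / (real n)\<^sup>2)" by (rule sum_mono2) (use A in auto)
  also have "\<dots> \<le> 1 / real m - 1 / real N"
  proof (rule sum_le_telescope[OF mN])
    fix n assume n: "m < n" "n \<le> N"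
    then have "real n > 1" "real (n-1) = real n - 1" using assms by (auto simp: of_nat_diff)
    then show "1 / (real n)\<^sup>2 \<le> 1 / real (n-1) - 1 / real n" by (simp add: field_simps power2_eq_square)
  qed
  also have "\<dots> \<le> 1 / real m" by simp
  finally show ?thesis .
qed (use assms in auto)

text \<open>Allowing any \<open>a p = 1/p + O(1/p^2)\<close> lets the same statement serve both
  kinds of Euler factor. Existence and rate come from a Cauchy argument; the value of the constant
  is found separately.\<close>

lemma mertens_constant:
  fixes a :: "nat \<Rightarrow> real"
  assumes a: "\<And>p. prime p \<Longrightarrow> \<bar>a p - 1 / real p\<bar> \<le> A / (real p)\<^sup>2"
  obtains c K where "K > 0" "\<And>N. N \<ge> 2 \<Longrightarrow> \<bar>(\<Sum>p\<in>{p. prime p \<and> p \<le> N}. a p) - ln (ln (real N)) - c\<bar> \<le> K / (ln (real N))\<^sup>2"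
proof -
  obtain C where C: "C > 0" "\<And>m N. 2 \<le> m \<Longrightarrow> m \<le> N \<Longrightarrow>
     \<bar>(\<Sum>p\<in>{p. prime p \<and> m < p \<and> p \<le> N}. 1 / real p) - (ln (ln (real N)) - ln (ln (real m)))\<bar> \<le> C / (ln (real m))\<^sup>2"
    using prime_reciprocal_diff by blast
  obtain B where B: "B > 0" "\<And>m. m \<ge> 2 \<Longrightarrow> 1 / real m \<le> B / (ln (real m))\<^sup>2" using ln_power_le_bound by blast
  have "0 \<le> A / (real 2)\<^sup>2" using a[OF two_is_prime_nat] abs_ge_zero order_trans by blast
  then have A0: "A \<ge> 0" by simp
  define u where "u N = (\<Sum>p\<in>{p. prime p \<and> p \<le> N}. a p) - ln (ln (real N))" for N
  define K where "K = C + A * B"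
  have K: "K > 0" using C A0 B by (simp add: K_def add_pos_nonneg)
  have diff: "\<bar>u N - u m\<bar> \<le> K / (ln (real m))\<^sup>2" if m: "2 \<le> m" "m \<le> N" for m N
  proof -
    let ?P = "{p. prime p \<and> m < p \<and> p \<le> N}"
    have fin: "finite ?P" by (rule finite_subset[of _ "{..N}"]) auto
    have "{p. prime p \<and> p \<le> N} = {p. prime p \<and> p \<le> m} \<union> ?P" using m by auto
    then have "(\<Sum>p\<in>{p. prime p \<and> p \<le> N}. a p) = (\<Sum>p\<in>{p. prime p \<and> p \<le> m}. a p) + (\<Sum>p\<in>?P. a p)"
      using fin by (subst sum.union_disjoint[symmetric]) auto
    moreover have "(\<Sum>p\<in>?P. a p) = (\<Sum>p\<in>?P. 1 / real p) + (\<Sum>p\<in>?P. a p - 1 / real p)"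
      by (simp add: sum_subtractf)
    moreover have "\<bar>\<Sum>p\<in>?P. a p - 1 / real p\<bar> \<le> A * B / (ln (real m))\<^sup>2"
    proof -
      have "\<bar>\<Sum>p\<in>?P. a p - 1 / real p\<bar> \<le> (\<Sum>p\<in>?P. A * (1 / (real p)\<^sup>2))"
        by (rule order_trans[OF sum_abs sum_mono]) (use a in auto)
      also have "\<dots> = A * (\<Sum>p\<in>?P. 1 / (real p)\<^sup>2)" by (simp add: sum_distrib_left)
      also have "\<dots> \<le> A * (1 / real m)" using m by (intro mult_left_mono sum_inverse_square_tail fin A0) auto
      also have "\<dots> \<le> A * (B / (ln (real m))\<^sup>2)" by (intro mult_left_mono B(2) A0 m)
      finally show ?thesis by simp
    qed
    ultimately have "\<bar>u N - u m\<bar> \<le> C / (ln (real m))\<^sup>2 + A * B / (ln (real m))\<^sup>2"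
      using C(2)[OF m] unfolding u_def by linarith
    then show ?thesis by (simp add: K_def add_divide_distrib)
  qed
  have "Cauchy u"
  proof (rule CauchyI')
    fix e :: real assume e: "e > 0"
    have "((\<lambda>m. K / (ln (real m))\<^sup>2) \<longlongrightarrow> 0) at_top" by real_asymp
    then have "\<forall>\<^sub>F m in at_top. K / (ln (real m))\<^sup>2 < e" using e by (rule order_tendstoD)
    then obtain M where M: "\<And>m. m \<ge> M \<Longrightarrow> K / (ln (real m))\<^sup>2 < e" by (auto simp: eventually_at_top_linorder)
    show "\<exists>M. \<forall>m\<ge>M. \<forall>n>m. dist (u m) (u n) < e"
    proof (intro exI[of _ "max M 2"] allI impI)
      fix m n assume "m \<ge> max M 2" "n > m"
      then show "dist (u m) (u n) < e" using diff[of m n] M[of m] by (simp add: dist_real_def abs_minus_commute)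
    qed
  qed
  then obtain c where c: "u \<longlonglongrightarrow> c" using Cauchy_convergent_iff convergent_def by blast
  show ?thesis
  proof (rule that[OF K])
    fix N :: nat assume N: "N \<ge> 2"
    have "(\<lambda>n. \<bar>u N - u n\<bar>) \<longlonglongrightarrow> \<bar>u N - c\<bar>" by (intro tendsto_intros c)
    then have "\<bar>u N - c\<bar> \<le> K / (ln (real N))\<^sup>2"
      by (rule LIMSEQ_le_const2) (use diff[OF N] in \<open>auto simp: abs_minus_commute\<close>)
    then show "\<bar>(\<Sum>p\<in>{p. prime p \<and> p \<le> N}. a p) - ln (ln (real N)) - c\<bar> \<le> K / (ln (real N))\<^sup>2" by (simp add: u_def)
  qed
qed

section \<open>Identification of Euler's constant by an Abelian comparison\<close>

lemma exponential_step_integral: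
  fixes w v :: "nat \<Rightarrow> real"
  assumes d: "d > 0" and w: "\<And>n. w n \<ge> 0" and v: "\<And>n. v n \<ge> 0" and fin: "\<And>x. finite {n. v n < x}"
    and sm: "summable (\<lambda>n. w n * exp (- (d * v n)))"
  shows "has_bochner_integral (density lborel (exponential_density d)) (\<lambda>x. \<Sum>n\<in>{n. v n < x}. w n) (\<Sum>n. w n * exp (- (d * v n)))"
proof (rule has_bochner_integral_nn_integral)
  let ?\<mu> = "density lborel (exponential_density d)"
  interpret prob_space ?\<mu> by (rule prob_space_exponential_density[OF d])
  have D: "distributed ?\<mu> lborel (\<lambda>x. x) (exponential_density d)"
    by (auto simp: distributed_def distr_id2 intro: measure_eqI)
  have em: "emeasure ?\<mu> {v n<..} = ennreal (exp (- (d * v n)))" for n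
    using exponential_distributedD_gt[OF D v d, of n] by (simp add: emeasure_eq_measure mult.commute greaterThan_def)
  \<comment> \<open>The step function is a superposition of indicators of half-lines
    \<open>(v n, \<infinity>)\<close>, whose measure under the exponential law is
    \<open>exp (- d * v n)\<close>.\<close>
  have eq: "ennreal (\<Sum>n\<in>{n. v n < x}. w n) = (\<Sum>n. ennreal (w n) * indicator {v n<..} x)" for x
  proof -
    have "(\<lambda>n. if n \<in> {n. v n < x} then ennreal (w n) else 0) sums (\<Sum>n\<in>{n. v n < x}. ennreal (w n))"
      by (rule sums_If_finite_set[OF fin])
    also have "(\<lambda>n. if n \<in> {n. v n < x} then ennreal (w n) else 0) = (\<lambda>n. ennreal (w n) * indicator {v n<..} x)"
      by (auto simp: fun_eq_iff)
    finally show ?thesis using w by (simp add: sums_iff sum_ennreal)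
  qed
  have "(\<lambda>x. ennreal (\<Sum>n\<in>{n. v n < x}. w n)) \<in> borel_measurable ?\<mu>" unfolding eq by simp
  then have "(\<lambda>x. enn2real (ennreal (\<Sum>n\<in>{n. v n < x}. w n))) \<in> borel_measurable ?\<mu>" by simp
  then show "(\<lambda>x. \<Sum>n\<in>{n. v n < x}. w n) \<in> borel_measurable ?\<mu>" using w by (simp add: sum_nonneg)
  have "(\<integral>\<^sup>+ x. ennreal (\<Sum>n\<in>{n. v n < x}. w n) \<partial>?\<mu>) = (\<Sum>n. \<integral>\<^sup>+ x. ennreal (w n) * indicator {v n<..} x \<partial>?\<mu>)"
    unfolding eq by (rule nn_integral_suminf) simp
  also have "\<dots> = (\<Sum>n. ennreal (w n * exp (- (d * v n))))"
    using w by (simp add: nn_integral_cmult em ennreal_mult'')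
  also have "\<dots> = ennreal (\<Sum>n. w n * exp (- (d * v n)))" by (rule suminf_ennreal2) (use w sm in auto)
  finally show "(\<integral>\<^sup>+ x. ennreal (\<Sum>n\<in>{n. v n < x}. w n) \<partial>?\<mu>) = ennreal (\<Sum>n. w n * exp (- (d * v n)))" .
  show "0 \<le> (\<Sum>n. w n * exp (- (d * v n)))" by (rule suminf_nonneg[OF sm]) (use w in auto)
qed (use w in \<open>auto intro: sum_nonneg\<close>)

text \<open>As the rate tends to 0, the exponential law moves its mass to infinity, where
  \<open>D\<close> is close to \<open>L\<close>. The interval up to \<open>V'\<close> has mass
  \<open>1 - exp (- d * V')\<close>, which vanishes in the limit, and \<open>D\<close> is bounded
  there.\<close>

lemma exponential_abelian:
  fixes D :: "real \<Rightarrow> real"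
  assumes int: "\<And>d. d > 0 \<Longrightarrow> integrable (density lborel (exponential_density d)) D"
    and lim: "(D \<longlongrightarrow> L) at_top" and bdd: "\<And>V. \<exists>C. \<forall>x\<le>V. \<bar>D x\<bar> \<le> C"
  shows "(\<lambda>j. integral\<^sup>L (density lborel (exponential_density (1 / real (Suc j)))) D) \<longlonglongrightarrow> L"
proof (rule tendstoI)
  fix e :: real assume e: "e > 0"
  have "\<forall>\<^sub>F x in at_top. dist (D x) L < e / 2" using lim e by (intro tendstoD) auto
  then obtain V where V: "\<And>x. x \<ge> V \<Longrightarrow> \<bar>D x - L\<bar> < e / 2" by (auto simp: eventually_at_top_linorder dist_real_def)
  define V' where "V' = max V 0"
  obtain C where C: "\<And>x. x \<le> V' \<Longrightarrow> \<bar>D x\<bar> \<le> C" using bdd by blast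
  define B where "B = \<bar>C\<bar> + \<bar>L\<bar>"
  have B: "\<bar>D x - L\<bar> \<le> e / 2 + B * indicator {..V'} x" for x
  proof (cases "x \<le> V'")
    case True
    then show ?thesis using C[OF True] e unfolding B_def by (simp add: indicator_def)
  next
    case False
    then have "x \<ge> V" "\<not> x \<le> V'" by (auto simp: V'_def)
    then show ?thesis using V[of x] by simp
  qed
  have "((\<lambda>j. e / 2 + B * (1 - exp (- (1 / real (Suc j) * V')))) \<longlongrightarrow> e / 2 + B * (1 - exp (- (0 * V')))) sequentially"
    by (intro tendsto_intros LIMSEQ_Suc[OF lim_1_over_n])
  then have "\<forall>\<^sub>F j in sequentially. e / 2 + B * (1 - exp (- (1 / real (Suc j) * V'))) < e"
    by (rule order_tendstoD) (use e in simp)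
  then show "\<forall>\<^sub>F j in sequentially. dist (integral\<^sup>L (density lborel (exponential_density (1 / real (Suc j)))) D) L < e"
  proof eventually_elim
    case (elim j)
    define d where "d = 1 / real (Suc j)"
    have d: "d > 0" by (simp add: d_def)
    let ?\<mu> = "density lborel (exponential_density d)"
    interpret prob_space ?\<mu> by (rule prob_space_exponential_density[OF d])
    have meas: "measure ?\<mu> {..V'} = 1 - exp (- (d * V'))"
    proof -
      have "emeasure ?\<mu> {..V'} = ennreal (1 - exp (- (d * V')))"
        using emeasure_erlang_density[OF d, of 0 V'] by (simp add: erlang_CDF_0 V'_def)
      moreover have "1 - exp (- (d * V')) \<ge> 0" using d by (simp add: V'_def)
      ultimately show ?thesis by (simp add: measure_def)
    qed
    have pu: "prob UNIV = 1" using prob_space by simp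
    have ii: "integrable ?\<mu> (indicat_real {..V'})"
      by (rule integrable_real_indicator) (auto simp: emeasure_eq_measure)
    have "\<bar>integral\<^sup>L ?\<mu> D - L\<bar> = \<bar>\<integral>x. D x - L \<partial>?\<mu>\<bar>" using int[OF d] by (simp add: pu)
    also have "\<dots> \<le> (\<integral>x. \<bar>D x - L\<bar> \<partial>?\<mu>)" using integral_norm_bound[of ?\<mu> "\<lambda>x. D x - L"] by simp
    also have "\<dots> \<le> (\<integral>x. e / 2 + B * indicator {..V'} x \<partial>?\<mu>)"
      by (rule integral_mono) (use int[OF d] B ii in auto)
    also have "\<dots> = e / 2 + B * (1 - exp (- (d * V')))"
      using ii by (simp add: pu meas)
    finally show ?case using elim by (simp add: d_def dist_real_def)
  qed
qed


lemma abs_ln_one_minus_le: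
  fixes x :: real assumes "0 \<le> x" "x \<le> 1/2"
  shows "\<bar>- ln (1 - x) - x\<bar> \<le> 2 * x\<^sup>2"
  using ln_one_minus_pos_lower_bound[of x] ln_one_minus_pos_upper_bound[of x] assms by (simp add: abs_le_iff)

lemma summable_inverse_square: "summable (\<lambda>n. c / (real n)\<^sup>2)"
proof -
  have "summable (\<lambda>n. 1 / (real n) ^ 2)" using inverse_power_summable[of 2, where 'a=real] by (simp add: inverse_eq_divide)
  then have "summable (\<lambda>n. c * (1 / (real n) ^ 2))" by (rule summable_mult)
  then show ?thesis by simp
qed

text \<open>The logarithm of the Euler factor of zeta at \<open>1 + d\<close>. The value
  \<open>d = 0\<close> gives the factors of Mertens' product, \<open>d = 2\<close> those of
  \<open>zeta 3\<close>.\<close>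

definition prime_log_term :: "real \<Rightarrow> nat \<Rightarrow> real" where
  "prime_log_term d n = (if prime n then - ln (1 - real n powr (-(1 + d))) else 0)"

lemma prime_powr_le_half:
  assumes "prime n" "d \<ge> 0" shows "0 \<le> real n powr (-(1 + d))" "real n powr (-(1 + d)) \<le> 1 / real n" "1 / real n \<le> 1/2"
proof -
  have n: "real n \<ge> 2" using prime_ge_2_nat[OF assms(1)] by simp
  show "real n powr (-(1 + d)) \<le> 1 / real n"
    using powr_mono[of "-(1 + d)" "-1" "real n"] n assms by (simp add: powr_minus_divide)
  show "1 / real n \<le> 1/2" using n by (simp add: field_simps)
qed simp

lemma prime_log_term_nonneg: "d \<ge> 0 \<Longrightarrow> prime_log_term d n \<ge> 0"
  using prime_powr_le_half[of n d] by (auto simp: prime_log_term_def)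

text \<open>The sum is \<open>ln zeta (1 + d)\<close>; writing it through \<open>zetaZ\<close>
  exposes the singular part \<open>- ln d\<close> as \<open>d\<close> tends to 0.\<close>

lemma prime_log_zeta:
  assumes d: "d > 0"
  shows "prime_log_term d sums (ln (norm (zetaZ (of_real (1 + d)))) - ln d)"
proof -
  let ?s = "complex_of_real (1 + d)"
  have s: "Re ?s > 1" using d by simp
  have nz: "zetaS ?s \<noteq> 0" by (rule zetaS_nonzero[OF s])
  have pr: "norm (euler_inv N ?s) = (\<Prod>p\<in>{p. prime p \<and> p \<le> N}. 1 - real p powr (-(1 + d)))" for N
    unfolding euler_inv_def prod_norm[symmetric]
  proof (rule prod.cong[OF refl])
    fix p assume "p \<in> {p. prime p \<and> p \<le> N}"
    then have p: "prime p" "p > 0" by (auto dest: prime_gt_0_nat)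
    have "of_nat p powr (- ?s) = complex_of_real (real p powr (-(1 + d)))"
      using p powr_of_real[of "real p" "-(1 + d)"] by simp
    then have "norm (1 - of_nat p powr (- ?s) :: complex) = \<bar>1 - real p powr (-(1 + d))\<bar>"
      by (metis norm_of_real of_real_1 of_real_diff)
    then show "norm (1 - of_nat p powr (- ?s) :: complex) = 1 - real p powr (-(1 + d))"
      using prime_powr_le_half[OF p(1), of d] d by simp
  qed
  have "(\<lambda>N. ln (norm (euler_inv N ?s * zetaS ?s))) \<longlonglongrightarrow> ln (norm (1::complex))"
    by (intro tendsto_intros euler_inv_tendsto s) auto
  then have 1: "(\<lambda>N. ln (norm (zetaS ?s)) - ln (norm (euler_inv N ?s * zetaS ?s))) \<longlonglongrightarrow> ln (norm (zetaS ?s)) - ln (norm (1::complex))"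
    by (rule tendsto_diff[OF tendsto_const])
  have "ln (norm (zetaS ?s)) - ln (norm (euler_inv N ?s * zetaS ?s)) = (\<Sum>n<Suc N. prime_log_term d n)" for N
  proof -
    have pos: "1 - real p powr (-(1 + d)) > 0" if "prime p" for p
      using prime_powr_le_half[OF that, of d] d by simp
    then have pp: "(\<Prod>p\<in>{p. prime p \<and> p \<le> N}. 1 - real p powr (-(1 + d))) > 0" by (intro prod_pos) auto
    have lm: "ln (a * b) = ln a + ln b" if "a > 0" "b > 0" for a b :: real using that by (simp add: ln_mult)
    have "ln (norm (zetaS ?s)) - ln (norm (euler_inv N ?s * zetaS ?s)) = - ln (\<Prod>p\<in>{p. prime p \<and> p \<le> N}. 1 - real p powr (-(1 + d)))"
      using lm[OF pp, of "norm (zetaS ?s)"] nz unfolding norm_mult pr by simp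
    also have "\<dots> = (\<Sum>p\<in>{p. prime p \<and> p \<le> N}. - ln (1 - real p powr (-(1 + d))))"
    proof -
      have "ln (\<Prod>p\<in>{p. prime p \<and> p \<le> N}. 1 - real p powr (-(1 + d))) = (\<Sum>p\<in>{p. prime p \<and> p \<le> N}. ln (1 - real p powr (-(1 + d))))"
      proof (rule ln_prod)
        show "1 - real p powr (-(1 + d)) \<noteq> 0" if "p \<in> {p. prime p \<and> p \<le> N}" for p using pos[of p] that by simp
      qed simp
      then show ?thesis by (simp only: sum_negf)
    qed
    also have "\<dots> = (\<Sum>n<Suc N. prime_log_term d n)" unfolding prime_log_term_def by (rule sum_primes_le_eq[symmetric])
    finally show ?thesis .
  qed
  with 1 have "(\<lambda>N. \<Sum>n<Suc N. prime_log_term d n) \<longlonglongrightarrow> ln (norm (zetaS ?s))" by simp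
  then have "prime_log_term d sums ln (norm (zetaS ?s))" unfolding sums_def by (subst filterlim_sequentially_Suc[symmetric])
  moreover have "norm (zetaZ ?s) = d * norm (zetaS ?s)" using zetaZ_eq[OF s] d by (simp add: norm_mult)
  then have "ln (norm (zetaZ ?s)) = ln d + ln (norm (zetaS ?s))" using d nz by (simp add: ln_mult)
  ultimately show ?thesis by simp
qed

lemma exp_harmonic_sums:
  assumes d: "d > 0"
  shows "(\<lambda>n. 1 / real (Suc n) * exp (- (d * real (Suc n)))) sums (- ln (1 - exp (- d)))"
proof -
  have "\<bar>- exp (- d)\<bar> < 1" using d by simp
  from ln_series'[OF this] have "(\<lambda>n. - ((exp (-d)) ^ n) / real n) sums ln (1 - exp (- d))" by simp
  then have "(\<lambda>n. (exp (-d)) ^ n / real n) sums (- ln (1 - exp (- d)))" by (auto dest: sums_minus)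
  then have "(\<lambda>n. (exp (-d)) ^ Suc n / real (Suc n)) sums (- ln (1 - exp (- d)))"
    by (subst sums_Suc_iff) simp
  moreover have "(exp (-d)) ^ Suc n / real (Suc n) = 1 / real (Suc n) * exp (- (d * real (Suc n)))" for n
    using exp_of_nat_mult[of "Suc n" "-d"] by (simp add: mult.commute)
  ultimately show ?thesis by simp
qed


lemma prime_log_zeta_3: "(\<Sum>n. prime_log_term 2 n) = ln (\<Sum>n. 1 / (real (Suc n)) ^ 3)"
  "summable (prime_log_term 2)"
proof -
  have s: "Re (complex_of_real (1 + 2)) > 1" by simp
  have e: "of_nat (Suc n) powr (- complex_of_real (1 + 2)) = complex_of_real (1 / (real (Suc n)) ^ 3)" for n
  proof -
    have "of_nat (Suc n) powr (- complex_of_real (1 + 2)) = complex_of_real (real (Suc n) powr (-3))"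
      using powr_of_real[of "real (Suc n)" "-3"] by simp
    then show ?thesis by (simp add: powr_minus_divide powr_numeral del: of_nat_Suc)
  qed
  have sm: "summable (\<lambda>n. 1 / (real (Suc n)) ^ 3)"
    using summable_zetaS_norm[OF s] unfolding e norm_of_real by (rule summable_rabs_cancel)
  have z: "zetaS (of_real (1 + 2)) = of_real (\<Sum>n. 1 / (real (Suc n)) ^ 3)"
    unfolding zetaS_def e by (rule suminf_of_real[OF sm, symmetric])
  have pos: "(\<Sum>n. 1 / (real (Suc n)) ^ 3) > 0" by (rule suminf_pos[OF sm]) simp
  have "norm (zetaZ (of_real (1 + 2))) = 2 * (\<Sum>n. 1 / (real (Suc n)) ^ 3)"
    using zetaZ_eq[OF s] pos unfolding z by (simp add: norm_mult)
  then have "ln (norm (zetaZ (of_real (1 + 2)))) = ln 2 + ln (\<Sum>n. 1 / (real (Suc n)) ^ 3)" using pos by (simp add: ln_mult)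
  then have "prime_log_term 2 sums ln (\<Sum>n. 1 / (real (Suc n)) ^ 3)" using prime_log_zeta[of 2] by simp
  then show "(\<Sum>n. prime_log_term 2 n) = ln (\<Sum>n. 1 / (real (Suc n)) ^ 3)" "summable (prime_log_term 2)"
    by (auto simp: sums_iff)
qed

text \<open>The weights on both sides are integrated against the same exponential law:
  a prime \<open>p\<close> enters at \<open>ln p\<close> with weight \<open>- ln (1 - 1/p)\<close>, an integer \<open>n\<close> at \<open>n\<close> with weight \<open>1/n\<close>.
  The transforms are \<open>ln \<zeta>(1+\<delta>) + o(1)\<close> and \<open>- ln (1 - exp (-\<delta>))\<close>, which agree up to \<open>o(1)\<close>.\<close>
lemma mertens_gamma:
  assumes lim: "(\<lambda>N. (\<Sum>p\<in>{p. prime p \<and> p \<le> N}. - ln (1 - 1 / real p)) - ln (ln (real N))) \<longlonglongrightarrow> c"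
  shows "c = euler_mascheroni"
proof -
  define w where "w n = prime_log_term 0 n" for n
  define A where "A d = (\<Sum>n. w n * exp (- (d * ln (real n))))" for d
  define B where "B d = - ln (1 - exp (- d))" for d :: real
  define S where "S x = (\<Sum>n\<in>{n. ln (real n) < x}. w n)" for x
  define H where "H x = (\<Sum>n\<in>{n. real (Suc n) < x}. 1 / real (Suc n))" for x
  have w0: "w n \<ge> 0" for n unfolding w_def by (rule prime_log_term_nonneg) simp
  have wp: "w n = (if prime n then - ln (1 - 1 / real n) else 0)" for n
    by (auto simp: w_def prime_log_term_def powr_minus_divide dest: prime_gt_0_nat)
  have pexp: "exp (- (d * ln (real n))) = real n powr (-d)" if "prime n" for n d
    using prime_gt_0_nat[OF that] by (simp add: powr_def)
  \<comment> \<open>Both logarithmic terms are within \<open>2 / n^2\<close> of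
    \<open>n powr (-(1+d))\<close>. The majorant does not depend on \<open>d\<close>, so Tannery's
    theorem applies as \<open>d\<close> tends to 0.\<close>
  have close: "\<bar>prime_log_term d n - w n * exp (- (d * ln (real n)))\<bar> \<le> 4 / (real n)\<^sup>2" if d: "d \<ge> 0" for d n
  proof (cases "prime n")
    case True
    define x y where "x = 1 / real n" and "y = real n powr (-(1 + d))"
    have n0: "real n > 0" using True by (simp add: prime_gt_0_nat)
    have y: "0 \<le> y" "y \<le> x" "x \<le> 1/2" using prime_powr_le_half[OF True d] by (auto simp: x_def y_def)
    have yx: "y = x * real n powr (-d)" using n0 by (simp add: x_def y_def powr_diff powr_minus_divide powr_add field_simps)
    have e1: "0 \<le> real n powr (-d)" "real n powr (-d) \<le> 1"
      using powr_mono[of "-d" 0 "real n"] d True prime_ge_1_nat[OF True] by auto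
    have a: "\<bar>- ln (1 - y) - y\<bar> \<le> 2 * x\<^sup>2"
      using abs_ln_one_minus_le[of y] y power_mono[of y x 2] by linarith
    have "\<bar>(- ln (1 - x) - x) * real n powr (-d)\<bar> \<le> 2 * x\<^sup>2 * 1"
      unfolding abs_mult using abs_ln_one_minus_le[of x] y e1 by (intro mult_mono) auto
    then have b: "\<bar>- ln (1 - x) * real n powr (-d) - y\<bar> \<le> 2 * x\<^sup>2" unfolding yx by (simp add: left_diff_distrib)
    have "prime_log_term d n = - ln (1 - y)" "w n * exp (- (d * ln (real n))) = - ln (1 - x) * real n powr (-d)"
      using True by (simp_all add: prime_log_term_def y_def wp x_def pexp)
    then have "\<bar>prime_log_term d n - w n * exp (- (d * ln (real n)))\<bar> \<le> 4 * x\<^sup>2" using a b by linarith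
    then show ?thesis by (simp add: x_def power_divide)
  qed (simp add: wp prime_log_term_def)
  have smA: "summable (\<lambda>n. w n * exp (- (d * ln (real n))))" if d: "d > 0" for d
  proof -
    have "summable (\<lambda>n. prime_log_term d n - w n * exp (- (d * ln (real n))))"
      by (rule summable_comparison_test'[OF summable_inverse_square[of 4], of 0]) (use close d in auto)
    from summable_diff[OF sums_summable[OF prime_log_zeta[OF d]] this] show ?thesis by simp
  qed
  define dj where "dj j = 1 / real (Suc j)" for j
  have dj: "dj j > 0" for j by (simp add: dj_def)
  have dj0: "dj \<longlonglongrightarrow> 0" unfolding dj_def by (rule LIMSEQ_Suc[OF lim_1_over_n])
  have "(\<lambda>j. \<Sum>n. prime_log_term (dj j) n - w n * exp (- (dj j * ln (real n)))) \<longlonglongrightarrow> (\<Sum>n. 0)"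
  proof (rule tannerys_theorem[THEN conjunct2, THEN conjunct2])
    fix n
    show "(\<lambda>j. prime_log_term (dj j) n - w n * exp (- (dj j * ln (real n)))) \<longlonglongrightarrow> 0"
    proof (cases "prime n")
      case True
      have h: "real n powr (- (1 + 0)) \<le> 1/2" using prime_powr_le_half[OF True, of 0] by auto
      have "(\<lambda>j. - ln (1 - real n powr (-(1 + dj j))) - w n * exp (- (dj j * ln (real n)))) \<longlonglongrightarrow>
         - ln (1 - real n powr (-(1 + 0))) - w n * exp (- (0 * ln (real n)))"
        by (intro tendsto_intros dj0) (use h True in \<open>auto dest: prime_gt_0_nat\<close>)
      moreover have "- ln (1 - real n powr (-(1 + 0))) - w n * exp (- (0 * ln (real n))) = 0"
        using True by (simp add: w_def prime_log_term_def)
      ultimately show ?thesis using True by (simp add: prime_log_term_def)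
    qed (simp add: wp prime_log_term_def)
    show "\<forall>\<^sub>F (n, j) in sequentially \<times>\<^sub>F sequentially. norm (prime_log_term (dj j) n - w n * exp (- (dj j * ln (real n)))) \<le> 4 / (real n)\<^sup>2"
      using close[OF less_imp_le[OF dj]] by (intro always_eventually) auto
  qed (use summable_inverse_square in auto)
  moreover have "(\<Sum>n. prime_log_term (dj j) n - w n * exp (- (dj j * ln (real n)))) = ln (norm (zetaZ (of_real (1 + dj j)))) - ln (dj j) - A (dj j)" for j
    unfolding A_def using prime_log_zeta[OF dj, of j] smA[OF dj, of j] by (subst suminf_diff[symmetric]) (auto simp: sums_iff)
  ultimately have l1: "(\<lambda>j. ln (norm (zetaZ (of_real (1 + dj j)))) - ln (dj j) - A (dj j)) \<longlonglongrightarrow> 0" by simp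
  have "isCont zetaZ 1" using zetaZ_deriv[of 1] DERIV_isCont by fastforce
  moreover have "(\<lambda>j. complex_of_real (1 + dj j)) \<longlonglongrightarrow> of_real (1 + 0)" by (intro tendsto_intros dj0)
  ultimately have "(\<lambda>j. zetaZ (of_real (1 + dj j))) \<longlonglongrightarrow> zetaZ 1" by (intro isCont_tendsto_compose[of 1 zetaZ]) auto
  then have "(\<lambda>j. ln (norm (zetaZ (of_real (1 + dj j))))) \<longlonglongrightarrow> ln (norm (zetaZ 1))" by (intro tendsto_intros) (auto simp: zetaZ_1)
  then have l2: "(\<lambda>j. ln (norm (zetaZ (of_real (1 + dj j))))) \<longlonglongrightarrow> 0" by (simp add: zetaZ_1)
  have "((\<lambda>d. ln (1 - exp (- d)) - ln d) \<longlongrightarrow> 0) (at_right (0::real))" by real_asymp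
  moreover have "filterlim dj (at_right 0) sequentially" 
    unfolding filterlim_at using dj0 dj by (auto intro!: always_eventually simp: less_imp_neq[OF dj, symmetric])
  ultimately have l3: "(\<lambda>j. ln (1 - exp (- dj j)) - ln (dj j)) \<longlonglongrightarrow> 0" by (rule filterlim_compose)
  have AB: "(\<lambda>j. A (dj j) - B (dj j)) \<longlonglongrightarrow> 0"
  proof -
    have "(\<lambda>j. ln (norm (zetaZ (of_real (1 + dj j)))) + (ln (1 - exp (- dj j)) - ln (dj j)) - (ln (norm (zetaZ (of_real (1 + dj j)))) - ln (dj j) - A (dj j))) \<longlonglongrightarrow> 0 + 0 - 0"
      by (intro tendsto_intros l1 l2 l3)
    then show ?thesis by (simp add: B_def add.commute)
  qed
  have finS: "finite {n. ln (real n) < x}" for x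
  proof (rule finite_subset[of _ "{..nat \<lceil>exp x\<rceil>}"])
    show "{n. ln (real n) < x} \<subseteq> {..nat \<lceil>exp x\<rceil>}"
    proof
      fix n assume "n \<in> {n. ln (real n) < x}"
      then have "n = 0 \<or> real n < exp x" using ln_less_cancel_iff[of "real n" "exp x"] by (cases "n = 0") auto
      then show "n \<in> {..nat \<lceil>exp x\<rceil>}" by (auto simp: le_nat_iff) linarith
    qed
  qed simp
  have finH: "finite {n. real (Suc n) < x}" for x
    by (rule finite_subset[of _ "{..nat \<lceil>x\<rceil>}"]) (auto, linarith)
  have hbS: "has_bochner_integral (density lborel (exponential_density d)) S (A d)" if d: "d > 0" for d
    unfolding S_def[abs_def] A_def by (rule exponential_step_integral[OF d w0 _ finS smA[OF d]]) (metis ln_ge_zero ln_0 of_nat_0 of_nat_1 of_nat_le_iff One_nat_def Suc_leI gr0I order_refl)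
  have hbH: "has_bochner_integral (density lborel (exponential_density d)) H (B d)" if d: "d > 0" for d
    unfolding H_def[abs_def] B_def sums_unique[OF exp_harmonic_sums[OF d]]
    by (rule exponential_step_integral[OF d _ _ finH sums_summable[OF exp_harmonic_sums[OF d]]]) auto
  have hb: "has_bochner_integral (density lborel (exponential_density d)) (\<lambda>x. S x - H x) (A d - B d)" if d: "d > 0" for d
    by (intro has_bochner_integral_diff hbS hbH d)
  have Smono: "0 \<le> S x \<and> S x \<le> S y" if "x \<le> y" for x y
    unfolding S_def using that w0 finS by (auto intro!: sum_nonneg sum_mono2)
  have Hmono: "0 \<le> H x \<and> H x \<le> H y" if "x \<le> y" for x y
    unfolding H_def using that finH by (auto intro!: sum_nonneg sum_mono2)
  \<comment> \<open>For \<open>x > 0\<close> this is the largest natural number strictly below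
    \<open>x\<close>, matching the strict inequalities in \<open>S\<close> and
    \<open>H\<close>.\<close>
  define N where "N x = nat \<lceil>x\<rceil> - 1" for x :: real
  have N_iff: "n \<le> N x \<longleftrightarrow> real n < x" if "x > 0" for n x
    using that unfolding N_def by linarith
  have N_bounds: "x - 1 \<le> real (N x)" "real (N x) \<le> x" if "x > 0" for x
    using that unfolding N_def by linarith+
  have N_lim: "filterlim N at_top at_top"
  proof (rule filterlim_at_top[THEN iffD2], rule allI)
    fix Z
    show "\<forall>\<^sub>F x in at_top. Z \<le> N x"
      using eventually_gt_at_top[of "real Z"] by eventually_elim (subst N_iff, auto)
  qed
  have limS: "((\<lambda>x. S x - ln x) \<longlongrightarrow> c) at_top"
  proof -
    have "filterlim (\<lambda>x. N (exp x)) at_top at_top" by (rule filterlim_compose[OF N_lim exp_at_top])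
    then have 1: "((\<lambda>x. (\<Sum>p\<in>{p. prime p \<and> p \<le> N (exp x)}. - ln (1 - 1 / real p)) - ln (ln (real (N (exp x))))) \<longlongrightarrow> c) at_top"
      by (rule filterlim_compose[OF lim])
    have 2: "((\<lambda>x. ln (ln (real (N (exp x)))) - ln x) \<longlongrightarrow> 0) at_top"
    proof (rule tendsto_sandwich)
      have ev: "\<forall>\<^sub>F x in at_top. ln (ln (exp x - 1)) - ln x \<le> ln (ln (real (N (exp x)))) - ln x \<and> ln (ln (real (N (exp x)))) - ln x \<le> 0"
        using eventually_ge_at_top[of "2::real"]
      proof eventually_elim
        case (elim x)
        have "exp x \<ge> 1 + x" by (rule exp_ge_add_one_self)
        then have e: "exp x - 1 \<ge> 2" using elim by linarith
        have l1: "exp x - 1 \<le> real (N (exp x))" "real (N (exp x)) \<le> exp x" using N_bounds[of "exp x"] by auto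
        have a: "ln (exp x - 1) \<le> ln (real (N (exp x)))" using l1 e by (subst ln_le_cancel_iff) linarith+
        have b: "ln (exp x - 1) > 0" using e by (intro ln_gt_zero) linarith
        have "ln (real (N (exp x))) \<le> ln (exp x)" using l1 e by (subst ln_le_cancel_iff) linarith+
        then have c: "ln (real (N (exp x))) \<le> x" by simp
        have "ln (ln (exp x - 1)) \<le> ln (ln (real (N (exp x))))" using a b by (subst ln_le_cancel_iff) linarith+
        moreover have "ln (ln (real (N (exp x)))) \<le> ln x" using a b c by (subst ln_le_cancel_iff) linarith+
        ultimately show ?case by simp
      qed
      show "\<forall>\<^sub>F x in at_top. ln (ln (exp x - 1)) - ln x \<le> ln (ln (real (N (exp x)))) - ln x" using ev by eventually_elim simp
      show "\<forall>\<^sub>F x in at_top. ln (ln (real (N (exp x)))) - ln x \<le> 0" using ev by eventually_elim simp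
      show "((\<lambda>x::real. ln (ln (exp x - 1)) - ln x) \<longlongrightarrow> 0) at_top" by real_asymp
    qed simp
    have "((\<lambda>x. (\<Sum>p\<in>{p. prime p \<and> p \<le> N (exp x)}. - ln (1 - 1 / real p)) - ln x) \<longlongrightarrow> c + 0) at_top"
      using tendsto_add[OF 1 2] by simp
    moreover have "\<forall>\<^sub>F x in at_top. (\<Sum>p\<in>{p. prime p \<and> p \<le> N (exp x)}. - ln (1 - 1 / real p)) - ln x = S x - ln x"
      using eventually_gt_at_top[of "0::real"]
    proof eventually_elim
      case (elim x)
      have "{n. ln (real n) < x} = {..N (exp x)}"
      proof (intro set_eqI)
        fix n
        have "ln (real n) < x \<longleftrightarrow> real n < exp x"
          using elim ln_less_cancel_iff[of "real n" "exp x"] by (cases "n = 0") auto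
        then show "n \<in> {n. ln (real n) < x} \<longleftrightarrow> n \<in> {..N (exp x)}" using N_iff[of "exp x" n] by simp
      qed
      then have "S x = (\<Sum>n<Suc (N (exp x)). if prime n then - ln (1 - 1 / real n) else 0)"
        by (simp add: S_def wp lessThan_Suc_atMost)
      then show ?case unfolding sum_primes_le_eq by simp
    qed
    ultimately show ?thesis by (simp add: tendsto_cong)
  qed
  have limH: "((\<lambda>x. H x - ln x) \<longlongrightarrow> euler_mascheroni) at_top"
  proof -
    have 1: "((\<lambda>x. harm (N x) - ln (real (N x))) \<longlongrightarrow> (euler_mascheroni :: real)) at_top"
      by (rule filterlim_compose[OF euler_mascheroni_LIMSEQ N_lim])
    have 2: "((\<lambda>x. ln (real (N x)) - ln x) \<longlongrightarrow> 0) at_top"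
    proof (rule tendsto_sandwich)
      show "\<forall>\<^sub>F x in at_top. ln (x - 1) - ln x \<le> ln (real (N x)) - ln x" using eventually_ge_at_top[of "2::real"]
      proof eventually_elim
        case (elim x)
        then show ?case using N_bounds[of x] by simp
      qed
      show "\<forall>\<^sub>F x in at_top. ln (real (N x)) - ln x \<le> 0" using eventually_ge_at_top[of "2::real"]
      proof eventually_elim
        case (elim x)
        then have "real (N x) > 0" using N_bounds[of x] by simp
        then show ?case using N_bounds[of x] elim by simp
      qed
      show "((\<lambda>x::real. ln (x - 1) - ln x) \<longlongrightarrow> 0) at_top" by real_asymp
    qed simp
    have "((\<lambda>x. harm (N x) - ln x) \<longlongrightarrow> euler_mascheroni + 0) at_top"
      using tendsto_add[OF 1 2] by simp
    moreover have "\<forall>\<^sub>F x in at_top. harm (N x) - ln x = H x - ln x"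
      using eventually_gt_at_top[of "0::real"]
    proof eventually_elim
      case (elim x)
      have "{n. real (Suc n) < x} = {..<N x}"
        by (intro set_eqI) (simp add: N_iff[OF elim, symmetric] Suc_le_eq del: of_nat_Suc)
      then have "H x = (\<Sum>n<N x. 1 / real (Suc n))" by (simp add: H_def)
      also have "\<dots> = harm (N x)" unfolding harm_def
        by (rule sum.reindex_bij_witness[of _ "\<lambda>k. k - 1" Suc]) (auto simp: inverse_eq_divide)
      finally show ?case by simp
    qed
    ultimately show ?thesis by (simp add: tendsto_cong)
  qed
  have "((\<lambda>x. (S x - ln x) - (H x - ln x)) \<longlongrightarrow> c - euler_mascheroni) at_top" by (intro tendsto_intros limS limH)
  then have limD: "((\<lambda>x. S x - H x) \<longlongrightarrow> c - euler_mascheroni) at_top" by simp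
  have "(\<lambda>j. integral\<^sup>L (density lborel (exponential_density (1 / real (Suc j)))) (\<lambda>x. S x - H x)) \<longlonglongrightarrow> c - euler_mascheroni"
  proof (rule exponential_abelian[OF _ limD])
    show "integrable (density lborel (exponential_density d)) (\<lambda>x. S x - H x)" if "d > 0" for d
      using hb[OF that] by (rule integrable.intros)
    show "\<exists>C. \<forall>x\<le>V. \<bar>S x - H x\<bar> \<le> C" for V
    proof (intro exI[of _ "S V + H V"] allI impI)
      fix x assume "x \<le> V"
      then show "\<bar>S x - H x\<bar> \<le> S V + H V" using Smono[of x V] Hmono[of x V] by (auto simp: abs_le_iff)
    qed
  qed
  also have "(\<lambda>j. integral\<^sup>L (density lborel (exponential_density (1 / real (Suc j)))) (\<lambda>x. S x - H x)) = (\<lambda>j. A (dj j) - B (dj j))"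
    using has_bochner_integral_integral_eq[OF hb[OF dj]] by (simp add: dj_def)
  finally have "c - euler_mascheroni = 0" using AB LIMSEQ_unique by blast
  then show ?thesis by simp
qed

section \<open>Sums over primes of a rescaled function\<close>

text \<open>This is the price of replacing the slowly varying weight \<open>1 / ln n\<close> by
  \<open>1 / ln s\<close>. With \<open>x = ln (s/n)\<close> and \<open>ln n \<ge> 1/2\<close> the
  loss is at most quadratic in \<open>x\<close>, hence below a multiple of
  \<open>exp (x/2) = sqrt (s/n)\<close>, and the sum of these roots over \<open>n \<le> s\<close> is
  still \<open>O(s)\<close>. The 32 matches the quadratic coefficient \<open>1/8\<close> in the
  Taylor bound for \<open>exp (x/2)\<close>.\<close>

lemma inverse_ln_weight_le:
  fixes n s :: real
  assumes "2 \<le> n" "n \<le> s"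
  shows "1 / (ln n)\<^sup>2 \<le> 32 / (ln s)\<^sup>2 * (s / n) powr (1/2)"
    and "1 / ln n - 1 / ln s \<le> 32 / (ln s)\<^sup>2 * (s / n) powr (1/2)" "1 / ln n - 1 / ln s \<ge> 0"
proof -
  define x where "x = ln (s / n)"
  have x0: "x \<ge> 0" using assms by (simp add: x_def)
  have l: "ln n \<ge> 1/2" "ln s \<ge> 1/2" "ln s = ln n + x"
  proof -
    have "ln 2 \<le> ln n" "ln 2 \<le> ln s" using assms by auto
    then show "ln n \<ge> 1/2" "ln s \<ge> 1/2" using ln2_ge_two_thirds by auto
    show "ln s = ln n + x" using assms by (simp add: x_def ln_div)
  qed
  have e: "(s / n) powr (1/2) = exp (x / 2)" using assms by (simp add: powr_def x_def)
  have "1 + x / 2 + (x / 2)\<^sup>2 / 2 \<le> exp (x / 2)" using x0 by (intro exp_lower_Taylor_quadratic) simp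
  then have q: "1 + x / 2 + x * x / 8 \<le> exp (x / 2)" "x * x \<ge> 0" by (simp_all add: power2_eq_square)
  have "(1 + 2 * x)\<^sup>2 = 1 + 4 * x + 4 * (x * x)" "x * (1 + 2 * x) = x + 2 * (x * x)"
    by (simp_all add: power2_eq_square algebra_simps)
  then have t: "(1 + 2 * x)\<^sup>2 \<le> 32 * exp (x / 2)" "x * (1 + 2 * x) \<le> 32 * exp (x / 2)"
    using x0 q by linarith+
  have r: "ln s / ln n \<le> 1 + 2 * x"
  proof -
    have "x / ln n \<le> x / (1/2)" using x0 l by (intro divide_left_mono) auto
    moreover have "ln s / ln n = 1 + x / ln n" using l by (simp add: add_divide_distrib)
    ultimately show ?thesis by simp
  qed
  have "(ln s / ln n)\<^sup>2 \<le> (1 + 2 * x)\<^sup>2" using r l by (intro power_mono) auto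
  with t have "(ln s / ln n)\<^sup>2 \<le> 32 * exp (x / 2)" by linarith
  then show "1 / (ln n)\<^sup>2 \<le> 32 / (ln s)\<^sup>2 * (s / n) powr (1/2)" using l unfolding e by (simp add: field_simps power_divide)
  have "1 / a - 1 / b = (b - a) * (b / a) / b\<^sup>2" if "a > 0" "b > 0" for a b :: real
    using that by (simp add: field_simps power2_eq_square)
  from this[of "ln n" "ln s"] have "1 / ln n - 1 / ln s = x * (ln s / ln n) / (ln s)\<^sup>2" using l by simp
  also have "\<dots> \<le> 32 * exp (x / 2) / (ln s)\<^sup>2"
    using mult_left_mono[OF r x0] t by (intro divide_right_mono) auto
  finally show "1 / ln n - 1 / ln s \<le> 32 / (ln s)\<^sup>2 * (s / n) powr (1/2)" unfolding e by simp
  show "1 / ln n - 1 / ln s \<ge> 0" using l x0 by (simp add: field_simps)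
qed

text \<open>The counterpart above \<open>s\<close>: the factor \<open>sqrt (n/s)\<close> is
  affordable because it meets \<open>f (s/n) = O((s/n)^2)\<close>, which leaves a summable power
  \<open>-3/2\<close> of \<open>n\<close>.\<close>

lemma inverse_ln_weight_ge:
  fixes n s :: real
  assumes "2 \<le> s" "s \<le> n"
  shows "1 / ln s - 1 / ln n \<le> 2 / (ln s)\<^sup>2 * (n / s) powr (1/2)" "1 / ln s - 1 / ln n \<ge> 0"
proof -
  define x where "x = ln (n / s)"
  have x0: "x \<ge> 0" using assms by (simp add: x_def)
  have l: "ln s > 0" "ln n = ln s + x" using assms by (auto simp: x_def ln_div)
  have e: "(n / s) powr (1/2) = exp (x / 2)" using assms by (simp add: powr_def x_def)
  have "1 / ln s - 1 / ln n = x / (ln s * ln n)" using l x0 by (simp add: field_simps)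
  also have "\<dots> \<le> x / (ln s * ln s)" using l x0 by (intro divide_left_mono mult_left_mono mult_pos_pos) auto
  also have "x \<le> 2 * exp (x / 2)" using exp_ge_add_one_self[of "x / 2"] by linarith
  then have "x / (ln s * ln s) \<le> 2 * exp (x / 2) / (ln s * ln s)" using l by (intro divide_right_mono) auto
  finally show "1 / ln s - 1 / ln n \<le> 2 / (ln s)\<^sup>2 * (n / s) powr (1/2)" unfolding e by (simp add: power2_eq_square)
  show "1 / ln s - 1 / ln n \<ge> 0" using l x0 by (simp add: field_simps)
qed

lemma sum_sqrt_le: "s \<ge> 0 \<Longrightarrow> real m \<le> s \<Longrightarrow> (\<Sum>n\<in>{1..m}. (s / real n) powr (1/2)) \<le> 2 * s"
proof -
  assume s: "s \<ge> 0" "real m \<le> s"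
  have "(\<Sum>n\<in>{1..m}. (s / real n) powr (1/2)) = s powr (1/2) * (\<Sum>n\<in>{1..m}. real n powr (1/2 - 1))"
    unfolding sum_distrib_left by (intro sum.cong) (use s in \<open>auto simp: powr_divide powr_minus_divide\<close>)
  also have "(\<Sum>n\<in>{1..m}. real n powr (1/2 - 1)) = (\<Sum>n<m. real (Suc n) powr (1/2 - 1))"
    by (rule sum.reindex_bij_witness[of _ Suc "\<lambda>k. k - 1"]) auto
  also have "\<dots> \<le> real m powr (1/2) / (1/2)" by (rule sum_powr_le) auto
  also have "\<dots> \<le> s powr (1/2) / (1/2)" using s by (intro divide_right_mono powr_mono2) auto
  also have "s powr (1/2) * (s powr (1/2) / (1/2)) = 2 * s" using s powr_half_sqrt[of s] by simp
  finally show ?thesis using s by (simp add: mult_left_mono)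
qed

lemma sum_tail_powr_le:
  assumes "m > 0" "finite A" "A \<subseteq> {m<..}" "x > 0"
  shows "(\<Sum>n\<in>A. real n powr (-x-1)) \<le> real m powr (-x) / x"
proof -
  have "(\<Sum>n\<in>A. real n powr (-x-1)) = (\<Sum>k\<in>(\<lambda>n. n - Suc m) ` A. real (k + Suc m) powr (-x-1))"
  proof (subst sum.reindex)
    show "inj_on (\<lambda>n. n - Suc m) A"
    proof (rule inj_onI)
      fix a b assume ab: "a \<in> A" "b \<in> A" "a - Suc m = b - Suc m"
      then have "a > m" "b > m" using assms(3) by auto
      with ab(3) show "a = b" by arith
    qed
    show "(\<Sum>n\<in>A. real n powr (-x-1)) = sum ((\<lambda>k. real (k + Suc m) powr (-x-1)) \<circ> (\<lambda>n. n - Suc m)) A"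
    proof (rule sum.cong[OF refl])
      fix n assume "n \<in> A"
      then have "n - Suc m + Suc m = n" using assms by force
      then show "real n powr (-x-1) = ((\<lambda>k. real (k + Suc m) powr (-x-1)) \<circ> (\<lambda>n. n - Suc m)) n" by (simp del: of_nat_Suc of_nat_add)
    qed
  qed
  also have "\<dots> \<le> (\<Sum>k. real (k + Suc m) powr (-x-1))"
    by (rule sum_le_suminf[OF powr_tail(1)]) (use assms in auto)
  also have "\<dots> \<le> real m powr (-x) / x" by (rule powr_tail(2)) (use assms in auto)
  finally show ?thesis .
qed

lemma indefinite_integral_DERIV:
  fixes h :: "real \<Rightarrow> real"
  assumes "continuous_on {a..b} h" "a < t" "t < b"
  shows "((\<lambda>x. integral {a..x} h) has_real_derivative h t) (at t)"
proof -
  have "((\<lambda>x. integral {a..x} h) has_real_derivative h t) (at t within {a..b})"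
    by (rule integral_has_real_derivative) (use assms in auto)
  then show ?thesis using at_within_interior[of t "{a..b}"] assms by simp
qed

lemma integrable_on_left_open:
  fixes h :: "real \<Rightarrow> real"
  assumes "continuous_on {a<..b} h" "\<And>x. a < x \<Longrightarrow> x \<le> b \<Longrightarrow> \<bar>h x\<bar> \<le> B"
  shows "h integrable_on {a..b}"
proof -
  have "h integrable_on {a<..b}"
  proof (rule measurable_bounded_by_integrable_imp_integrable)
    show "h \<in> borel_measurable (lebesgue_on {a<..b})"
      by (rule continuous_imp_measurable_on_sets_lebesgue[OF assms(1)]) simp
    show "(\<lambda>x. B) integrable_on {a<..b}"
      by (rule integrable_spike_set[OF integrable_const_ivl[of B a b]]) (auto intro: negligible_subset[of "{a}"])
  qed (use assms in auto)
  then show ?thesis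
    by (rule integrable_spike_set) (auto intro: negligible_subset[of "{a}"])
qed


text \<open>The centred law with mass \<open>q\<close> at \<open>1\<close> and \<open>1 - q\<close> at \<open>-(\<kappa> - 1)\<close>: below, \<open>f\<close> is its cumulant generating function,
  quadratic at \<open>0\<close>, and \<open>l u = u - f u\<close> is bounded at infinity.\<close>
locale two_point =
  fixes q :: real
  assumes q: "0 < q" "q < 1"
begin

definition \<kappa> :: real where "\<kappa> = 1 / (1 - q)"
definition den :: "real \<Rightarrow> real" where "den u = q + (1 - q) * exp (- (\<kappa> * u))"
definition l :: "real \<Rightarrow> real" where "l u = - ln (den u)"
definition f :: "real \<Rightarrow> real" where "f u = u - l u"
definition dl :: "real \<Rightarrow> real" where "dl u = exp (- (\<kappa> * u)) / den u"
definition df :: "real \<Rightarrow> real" where "df u = 1 - dl u"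

lemma \<kappa>: "\<kappa> > 1" "\<kappa> > 0" "\<kappa> * (1 - q) = 1"
  using q by (simp_all add: \<kappa>_def field_simps)

lemma den_bounds: "den u > q" "u \<ge> 0 \<Longrightarrow> den u \<le> 1" "den u > 0"
proof -
  have e: "(1 - q) * exp (- (\<kappa> * u)) > 0" using q by simp
  then show dq: "den u > q" by (simp add: den_def)
  show "den u > 0" using dq q by linarith
  assume "u \<ge> 0"
  then have "exp (- (\<kappa> * u)) \<le> 1" using \<kappa> by simp
  then have "(1 - q) * exp (- (\<kappa> * u)) \<le> (1 - q) * 1" using q by (intro mult_left_mono) auto
  then show "den u \<le> 1" by (simp add: den_def)
qed

lemma l_DERIV: "(l has_real_derivative dl u) (at u)"
proof -
  have "(l has_real_derivative - ((\<kappa> * (1 - q)) * (- exp (- (\<kappa> * u))) / den u)) (at u)"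
    unfolding l_def[abs_def] den_def
    using den_bounds(3)[of u] by (auto intro!: derivative_eq_intros simp: den_def)
  then show ?thesis using \<kappa>(3) by (simp add: dl_def)
qed

lemma f_DERIV: "(f has_real_derivative df u) (at u)"
  unfolding f_def[abs_def] df_def by (auto intro!: derivative_eq_intros l_DERIV)

lemma dl_nonneg: "dl u \<ge> 0" using den_bounds(3)[of u] by (simp add: dl_def)

lemma df_eq: "df u = q * (1 - exp (- (\<kappa> * u))) / den u"
proof -
  have "df u = (den u - exp (- (\<kappa> * u))) / den u" using den_bounds(3)[of u] by (simp add: df_def dl_def diff_divide_distrib)
  also have "den u - exp (- (\<kappa> * u)) = q * (1 - exp (- (\<kappa> * u)))" by (simp add: den_def algebra_simps)
  finally show ?thesis .
qed

lemma df_bounds: assumes "u \<ge> 0" shows "0 \<le> df u" "df u \<le> \<kappa> * u" "df u \<le> 1"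
proof -
  have e: "exp (- (\<kappa> * u)) \<le> 1" using assms \<kappa> by simp
  show "0 \<le> df u" unfolding df_eq using e q den_bounds(3)[of u] by simp
  show "df u \<le> 1" using dl_nonneg[of u] by (simp add: df_def)
  have "q * (1 - exp (- (\<kappa> * u))) / den u \<le> q * (\<kappa> * u) / q"
  proof (rule frac_le)
    show "q * (1 - exp (- (\<kappa> * u))) \<le> q * (\<kappa> * u)"
      using q exp_ge_add_one_self[of "- (\<kappa> * u)"] by (intro mult_left_mono) auto
  qed (use q assms \<kappa> den_bounds(1)[of u] in auto)
  then show "df u \<le> \<kappa> * u" unfolding df_eq using q by simp
qed

lemma l_0: "l 0 = 0" "f 0 = 0" by (simp_all add: l_def den_def f_def)

lemma l_mono: "u \<le> v \<Longrightarrow> l u \<le> l v"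
  by (rule DERIV_nonneg_imp_nondecreasing) (use l_DERIV dl_nonneg in auto)

lemma f_mono: assumes "0 \<le> u" "u \<le> v" shows "f u \<le> f v"
proof (rule DERIV_nonneg_imp_nondecreasing[OF assms(2)])
  fix x assume "u \<le> x" "x \<le> v"
  then show "\<exists>y. DERIV f x :> y \<and> 0 \<le> y" using f_DERIV[of x] df_bounds(1)[of x] assms by auto
qed

lemma l_bounds: "u \<ge> 0 \<Longrightarrow> l u \<ge> 0" "l u \<le> - ln q"
  using l_mono[of 0 u] den_bounds(1,3)[of u] q by (auto simp: l_0) (simp add: l_def)

lemma f_bounds: assumes "u \<ge> 0" shows "f u \<ge> 0" "f u \<le> \<kappa> * u\<^sup>2"
proof -
  show "f u \<ge> 0" using f_mono[of 0 u] assms by (simp add: l_0)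
  show "f u \<le> \<kappa> * u\<^sup>2"
  proof (cases "u = 0")
    case False
    then have "u > 0" using assms by simp
    then obtain z where z: "0 < z" "z < u" "f u - f 0 = (u - 0) * df z"
      using MVT2[of 0 u f df] f_DERIV by blast
    have "f u = u * df z" using z l_0 by simp
    also have "\<dots> \<le> u * (\<kappa> * u)" using z df_bounds(2)[of z] \<kappa> by (intro mult_left_mono) (auto intro: order_trans[OF _ mult_left_mono])
    finally show ?thesis by (simp add: power2_eq_square mult_ac)
  qed (simp add: l_0)
qed

lemma dl_le: "dl u \<le> exp (- (\<kappa> * u)) / q"
  unfolding dl_def using q den_bounds(1)[of u] by (intro divide_left_mono) auto

lemma continuous_dl: "continuous_on S dl"
  unfolding dl_def[abs_def] den_def using den_bounds(3) by (intro continuous_intros) (auto simp: den_def less_imp_neq[symmetric])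

lemma continuous_df: "continuous_on S df"
  unfolding df_def[abs_def] by (intro continuous_intros continuous_dl)

text \<open>These constants come from integrating by parts: the integral of \<open>f v / v^2\<close>
  over \<open>[0,1]\<close> is \<open>I0 - f 1\<close>, and that of \<open>l v / v^2\<close> over
  \<open>[1, \<infinity>)\<close> is \<open>l 1 + I1\<close>. Such integrals are the densities of
  the sums of \<open>f (s/n)\<close> over \<open>n > s\<close> and of \<open>l (s/n)\<close> over
  \<open>n \<le> s\<close>.\<close>

definition I0 :: real where "I0 = integral {0..1} (\<lambda>v. df v / v)"
definition I1 :: real where "I1 = integral {1..} (\<lambda>v. dl v / v)"

lemma I0_integrable: "b \<ge> 0 \<Longrightarrow> (\<lambda>v. df v / v) integrable_on {0..b}"
proof (rule integrable_on_left_open[where B = \<kappa>])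
  show "continuous_on {0<..b} (\<lambda>v. df v / v)" by (intro continuous_intros continuous_df) auto
  show "\<bar>df x / x\<bar> \<le> \<kappa>" if "0 < x" "x \<le> b" for x using df_bounds[of x] that by (simp add: field_simps)
qed

lemma I0_tail:
  assumes "0 < a" "a \<le> 1"
  shows "\<bar>I0 - integral {a..1} (\<lambda>v. df v / v)\<bar> \<le> \<kappa> * a"
proof -
  have "I0 = integral {0..a} (\<lambda>v. df v / v) + integral {a..1} (\<lambda>v. df v / v)"
    unfolding I0_def using assms I0_integrable[of 1] by (intro Henstock_Kurzweil_Integration.integral_combine[symmetric]) auto
  moreover have "norm (integral {0..a} (\<lambda>v. df v / v)) \<le> integral {0..a} (\<lambda>v. \<kappa>)"
  proof (rule integral_norm_bound_integral)
    show "norm (df x / x) \<le> \<kappa>" if "x \<in> {0..a}" for x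
      using df_bounds[of x] that \<kappa> by (cases "x = 0") (auto simp: field_simps)
  qed (use I0_integrable assms in auto)
  ultimately show ?thesis using assms by (simp add: mult.commute)
qed

lemma exp_has_integral: "((\<lambda>v. exp (- (\<kappa> * v)) / q) has_integral exp (- (\<kappa> * a)) / (q * \<kappa>)) {a..}"
proof -
  have "((\<lambda>v. exp (- \<kappa> * v)) has_integral exp (- \<kappa> * a) / \<kappa>) {a..}"
    by (rule has_integral_exp_minus_to_infinity) (use \<kappa> in auto)
  then have "((\<lambda>v. exp (- \<kappa> * v) * (1 / q)) has_integral exp (- \<kappa> * a) / \<kappa> * (1 / q)) {a..}"
    by (rule has_integral_mult_left)
  then show ?thesis by (simp add: mult.commute)
qed

lemma dl_div_bounds: "v \<ge> 1 \<Longrightarrow> 0 \<le> dl v / v \<and> dl v / v \<le> exp (- (\<kappa> * v)) / q"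
  using dl_nonneg[of v] dl_le[of v] divide_left_mono[of 1 v "dl v"] by auto

lemma I1_integrable: "a \<ge> 1 \<Longrightarrow> (\<lambda>v. dl v / v) integrable_on {a..}"
proof (rule measurable_bounded_by_integrable_imp_integrable)
  assume a: "a \<ge> 1"
  show "(\<lambda>v. dl v / v) \<in> borel_measurable (lebesgue_on {a..})"
    by (rule continuous_imp_measurable_on_sets_lebesgue) (use a in \<open>auto intro!: continuous_intros continuous_dl\<close>)
  show "(\<lambda>v. exp (- (\<kappa> * v)) / q) integrable_on {a..}" using exp_has_integral by blast
  show "norm (dl x / x) \<le> exp (- (\<kappa> * x)) / q" if "x \<in> {a..}" for x using dl_div_bounds[of x] that a by auto
qed simp

lemma I1_split:
  assumes "b \<ge> 1"
  shows "I1 = integral {1..b} (\<lambda>v. dl v / v) + integral {b..} (\<lambda>v. dl v / v)"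
proof -
  have i: "(\<lambda>v. dl v / v) integrable_on {1..b}" "(\<lambda>v. dl v / v) integrable_on {b..}"
    using I1_integrable[of b] assms by (auto intro!: integrable_continuous_interval continuous_intros continuous_dl)
  have "((\<lambda>v. dl v / v) has_integral (integral {1..b} (\<lambda>v. dl v / v) + integral {b..} (\<lambda>v. dl v / v))) ({1..b} \<union> {b..})"
    by (rule has_integral_Un) (use i assms in \<open>auto intro: negligible_subset[of "{b}"]\<close>)
  moreover have "{1..b} \<union> {b..} = {1..}" using assms by auto
  ultimately show ?thesis unfolding I1_def by (simp add: integral_unique)
qed

lemma I1_tail:
  assumes "b \<ge> 1"
  shows "\<bar>I1 - integral {1..b} (\<lambda>v. dl v / v)\<bar> \<le> 1 / (q * b)"
proof -
  have "norm (integral {b..} (\<lambda>v. dl v / v)) \<le> integral {b..} (\<lambda>v. exp (- (\<kappa> * v)) / q)"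
  proof (rule integral_norm_bound_integral[OF I1_integrable[OF assms]])
    show "(\<lambda>v. exp (- (\<kappa> * v)) / q) integrable_on {b..}" using exp_has_integral by blast
    show "norm (dl x / x) \<le> exp (- (\<kappa> * x)) / q" if "x \<in> {b..}" for x
      using dl_div_bounds[of x] that assms dl_nonneg[of x] by auto
  qed
  also have "\<dots> = exp (- (\<kappa> * b)) / (q * \<kappa>)" using exp_has_integral by (rule integral_unique)
  also have "\<dots> \<le> (1 / b) / (q * 1)"
  proof (rule frac_le)
    have "b * 1 \<le> \<kappa> * b" using \<kappa> assms by simp
    then have "b \<le> exp (\<kappa> * b)" using exp_ge_add_one_self[of "\<kappa> * b"] by linarith
    then show "exp (- (\<kappa> * b)) \<le> 1 / b" using assms by (simp add: exp_minus field_simps)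
  qed (use q \<kappa> assms in auto)
  finally show ?thesis using I1_split[OF assms] by (simp add: mult.commute)
qed

end

text \<open>Monotone comparison of a sum with an integral, the integral being given by an
  antiderivative. The real upper end \<open>s\<close> lies between \<open>m\<close> and
  \<open>m + 1\<close>, so the last partial interval contributes at most one more value of
  \<open>h\<close>.\<close>

lemma decreasing_sum_antiderivative:
  fixes h G :: "real \<Rightarrow> real"
  assumes km: "k \<le> m" "real m \<le> s" "s \<le> real m + 1"
    and G: "\<And>x. real k \<le> x \<Longrightarrow> x \<le> s \<Longrightarrow> DERIV G x :> h x"
    and dec: "\<And>x y. real k \<le> x \<Longrightarrow> x \<le> y \<Longrightarrow> y \<le> s \<Longrightarrow> h y \<le> h x"
    and pos: "\<And>x. real k \<le> x \<Longrightarrow> x \<le> s \<Longrightarrow> h x \<ge> 0"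
  shows "\<bar>(\<Sum>n\<in>{Suc k..m}. h (real n)) - (G s - G (real k))\<bar> \<le> h (real k)"
proof -
  have step: "h y * (y - x) \<le> G y - G x \<and> G y - G x \<le> h x * (y - x)" if "real k \<le> x" "x \<le> y" "y \<le> s" for x y
  proof (cases "x = y")
    case False
    then have "\<exists>z>x. z < y \<and> G y - G x = (y - x) * h z" using that by (intro MVT2 G) auto
    then obtain z where z: "x < z" "z < y" "G y - G x = (y - x) * h z" by blast
    have "h y \<le> h z" "h z \<le> h x" using dec[of z y] dec[of x z] z that by auto
    then show ?thesis using z that by (simp add: mult.commute mult_left_mono)
  qed simp
  have "(\<Sum>n\<in>{Suc k..m}. h (real n)) \<le> - G (real k) - (- G (real m))"
  proof (rule sum_le_telescope[OF km(1)])
    fix n assume n: "k < n" "n \<le> m"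
    have "real (n-1) = real n - 1" using n by (simp add: of_nat_diff)
    then show "h (real n) \<le> - G (real (n-1)) - (- G (real n))" using step[of "real (n-1)" "real n"] n km by simp
  qed
  moreover have "G (real m) \<le> G s"
  proof -
    have "0 \<le> h s * (s - real m)" using pos[of s] km by simp
    then show ?thesis using step[of "real m" s] km by linarith
  qed
  moreover have "(\<Sum>n\<in>{Suc k..m}. - h (real (n-1))) \<le> G (real k) - G (real m)"
  proof (rule sum_le_telescope[OF km(1)])
    fix n assume n: "k < n" "n \<le> m"
    have "real (n-1) = real n - 1" using n by (simp add: of_nat_diff)
    then show "- h (real (n-1)) \<le> G (real (n-1)) - G (real n)" using step[of "real (n-1)" "real n"] n km by simp
  qed
  moreover have "(\<Sum>n\<in>{Suc k..m}. - h (real (n-1))) = - (\<Sum>n\<in>{k..<m}. h (real n))"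
    unfolding sum_negf[symmetric] by (rule sum.reindex_bij_witness[of _ Suc "\<lambda>n. n - 1"]) auto
  moreover have "(\<Sum>n\<in>{k..<m}. h (real n)) + h (real m) = h (real k) + (\<Sum>n\<in>{Suc k..m}. h (real n))"
  proof -
    have "(\<Sum>n\<in>{k..<m}. h (real n)) + h (real m) = (\<Sum>n\<in>{k..m}. h (real n))" using km(1) by (simp add: sum.last_plus add.commute)
    also have "\<dots> = h (real k) + (\<Sum>n\<in>{Suc k..m}. h (real n))" using km(1) by (simp add: sum.atLeast_Suc_atMost)
    finally show ?thesis .
  qed
  moreover have "G s - G (real m) \<le> h (real m)"
  proof -
    have "h (real m) * (s - real m) \<le> h (real m) * 1" using pos[of "real m"] km by (intro mult_left_mono) auto
    then show ?thesis using step[of "real m" s] km by simp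
  qed
  moreover have "h (real k) \<ge> 0" using pos[of "real k"] km by simp
  ultimately show ?thesis by (simp add: abs_le_iff)
qed

text \<open>Used to absorb errors of size 1 and of size \<open>1 / ln s\<close> into the admissible
  \<open>s / (ln s)^2\<close>.\<close>

lemma ln_sq_le: "s \<ge> 2 \<Longrightarrow> 1 \<le> 4 * s / (ln s)\<^sup>2" "s \<ge> 2 \<Longrightarrow> 1 / ln s \<le> s / (ln s)\<^sup>2" for s :: real
proof -
  assume s: "s \<ge> 2"
  then have l: "ln s > 0" by simp
  have "ln s = 2 * ln (sqrt s)" using s by (simp add: ln_sqrt)
  also have "ln (sqrt s) \<le> sqrt s" using ln_le_minus_one[of "sqrt s"] s by simp
  finally have "(ln s)\<^sup>2 \<le> (2 * sqrt s)\<^sup>2" using l by (intro power_mono) auto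
  also have "\<dots> = 4 * s" using s by (simp add: power_mult_distrib)
  finally show "1 \<le> 4 * s / (ln s)\<^sup>2" using l by simp
  have "ln s \<le> s" using ln_le_minus_one[of s] s by simp
  then show "1 / ln s \<le> s / (ln s)\<^sup>2" using l by (simp add: field_simps power2_eq_square)
qed

context two_point
begin

text \<open>The derivative of \<open>x * l (s/x)\<close> is
  \<open>l (s/x) - (s/x) * dl (s/x)\<close>, and the integral term restores the second summand. The
  base point \<open>1/2\<close> only has to lie below \<open>s/x\<close>, whence
  \<open>x < 2 * s\<close>; this leaves room around the range \<open>x \<le> s\<close>.\<close>

lemma l_antiderivative:
  assumes "s > 0" "0 < x" "x < 2 * s"
  shows "DERIV (\<lambda>x. x * l (s / x) - s * integral {1/2..s / x} (\<lambda>v. dl v / v)) x :> l (s / x)"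
proof -
  have c: "continuous_on {1/2..s / x + 1} (\<lambda>v. dl v / v)" by (intro continuous_intros continuous_dl) auto
  have I: "((\<lambda>u. integral {1/2..u} (\<lambda>v. dl v / v)) has_real_derivative dl (s / x) / (s / x)) (at (s / x))"
    by (rule indefinite_integral_DERIV[OF c]) (use assms in \<open>auto simp: field_simps\<close>)
  have sx: "((\<lambda>x. s / x) has_real_derivative - (s / x\<^sup>2)) (at x)"
    using assms by (auto intro!: derivative_eq_intros simp: power2_eq_square)
  have 1: "((\<lambda>x. l (s / x)) has_real_derivative dl (s / x) * - (s / x\<^sup>2)) (at x)"
    by (rule DERIV_chain2[OF l_DERIV sx])
  have 2: "((\<lambda>x. integral {1/2..s / x} (\<lambda>v. dl v / v)) has_real_derivative dl (s / x) / (s / x) * - (s / x\<^sup>2)) (at x)"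
    by (rule DERIV_chain2[OF I sx])
  have "((\<lambda>x. x * l (s / x) - s * integral {1/2..s / x} (\<lambda>v. dl v / v)) has_real_derivative
     (1 * l (s / x) + dl (s / x) * - (s / x\<^sup>2) * x) - s * (dl (s / x) / (s / x) * - (s / x\<^sup>2))) (at x)"
    by (rule DERIV_diff[OF DERIV_mult[OF DERIV_ident 1] DERIV_cmult[OF 2]])
  also have "(1 * l (s / x) + dl (s / x) * - (s / x\<^sup>2) * x) - s * (dl (s / x) / (s / x) * - (s / x\<^sup>2)) = l (s / x)"
    using assms by (simp add: field_simps power2_eq_square)
  finally show ?thesis .
qed

lemma f_antiderivative:
  assumes "s > 0" "0 < x" "0 < a" "a < s / x"
  shows "DERIV (\<lambda>x. x * f (s / x) - s * integral {a..s / x} (\<lambda>v. df v / v)) x :> f (s / x)"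
proof -
  have c: "continuous_on {a..s / x + 1} (\<lambda>v. df v / v)" using assms by (intro continuous_intros continuous_df) auto
  have I: "((\<lambda>u. integral {a..u} (\<lambda>v. df v / v)) has_real_derivative df (s / x) / (s / x)) (at (s / x))"
    by (rule indefinite_integral_DERIV[OF c]) (use assms in auto)
  have sx: "((\<lambda>x. s / x) has_real_derivative - (s / x\<^sup>2)) (at x)"
    using assms by (auto intro!: derivative_eq_intros simp: power2_eq_square)
  have 1: "((\<lambda>x. f (s / x)) has_real_derivative df (s / x) * - (s / x\<^sup>2)) (at x)"
    by (rule DERIV_chain2[OF f_DERIV sx])
  have 2: "((\<lambda>x. integral {a..s / x} (\<lambda>v. df v / v)) has_real_derivative df (s / x) / (s / x) * - (s / x\<^sup>2)) (at x)"
    by (rule DERIV_chain2[OF I sx])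
  have "((\<lambda>x. x * f (s / x) - s * integral {a..s / x} (\<lambda>v. df v / v)) has_real_derivative
     (1 * f (s / x) + df (s / x) * - (s / x\<^sup>2) * x) - s * (df (s / x) / (s / x) * - (s / x\<^sup>2))) (at x)"
    by (rule DERIV_diff[OF DERIV_mult[OF DERIV_ident 1] DERIV_cmult[OF 2]])
  also have "(1 * f (s / x) + df (s / x) * - (s / x\<^sup>2) * x) - s * (df (s / x) / (s / x) * - (s / x\<^sup>2)) = f (s / x)"
    using assms by (simp add: field_simps power2_eq_square)
  finally show ?thesis .
qed

text \<open>Three replacements, each costing \<open>O(s / ln^2 s)\<close>: the sum over primes
  becomes a sum over integers with weight \<open>1 / ln n\<close>, this weight becomes
  \<open>1 / ln s\<close>, and the unweighted sum becomes \<open>s\<close> times the integral of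
  \<open>l v / v^2\<close> over \<open>[1, \<infinity>)\<close>. Boundedness of \<open>l\<close>
  controls all of them.\<close>

lemma sum_small_primes:
  obtains C where "C > 0" "\<And>s m. s \<ge> 2 \<Longrightarrow> real m \<le> s \<Longrightarrow> s < real m + 1 \<Longrightarrow>
    \<bar>(\<Sum>p\<in>{p. prime p \<and> p \<le> m}. l (s / real p)) - s / ln s * (l 1 + I1)\<bar> \<le> C * s / (ln s)\<^sup>2"
proof -
  obtain C0 where C0: "C0 > 0"
    "\<And>m N \<phi>. 2 \<le> m \<Longrightarrow> m \<le> N \<Longrightarrow> (\<And>n. m \<le> n \<Longrightarrow> n \<le> N \<Longrightarrow> \<phi> n \<ge> (0::real)) \<Longrightarrow>
       (\<And>n. m \<le> n \<Longrightarrow> n < N \<Longrightarrow> \<phi> (Suc n) \<le> \<phi> n) \<Longrightarrow>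
       \<bar>(\<Sum>p\<in>{p. prime p \<and> m \<le> p \<and> p \<le> N}. \<phi> p * ln (real p)) - (\<Sum>n\<in>{m..N}. \<phi> n)\<bar>
         \<le> C0 * (real m * \<phi> m / (ln (real m))\<^sup>2 + (\<Sum>n\<in>{m..N}. \<phi> n / (ln (real n))\<^sup>2))"
    using prime_sum_compare by blast
  define L where "L = - ln q"
  have L: "L > 0" using q by (simp add: L_def)
  define K1 where "K1 = C0 * (2 * (L / ln 2) / (ln 2)\<^sup>2 * 4 + L / ln 2 * 64)"
  have K1: "K1 > 0" unfolding K1_def using C0 L by (intro mult_pos_pos add_pos_pos) auto
  show ?thesis
  proof (rule that)
    show "K1 + 64 * L + (3 * L + 1 / q) > 0" using K1 L q by (intro add_pos_pos) auto
    fix s :: real and m :: nat assume s: "s \<ge> 2" "real m \<le> s" "s < real m + 1"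
    have m2: "m \<ge> 2" using s by linarith
    have ls: "ln s > 0" using s by simp
    define w where "w = s / (ln s)\<^sup>2"
    have w: "w > 0" using s ls by (simp add: w_def)
    define \<phi> where "\<phi> n = l (s / real n) / ln (real n)" for n
    have l0: "0 \<le> l (s / real n)" "l (s / real n) \<le> L" for n using l_bounds[of "s / real n"] s by (auto simp: L_def)
    have sumw: "(\<Sum>n\<in>{2..m}. 32 / (ln s)\<^sup>2 * (s / real n) powr (1/2)) \<le> 64 * w"
    proof -
      have "(\<Sum>n\<in>{2..m}. 32 / (ln s)\<^sup>2 * (s / real n) powr (1/2)) \<le> (\<Sum>n\<in>{1..m}. 32 / (ln s)\<^sup>2 * (s / real n) powr (1/2))"
        by (rule sum_mono2) auto
      also have "\<dots> = 32 / (ln s)\<^sup>2 * (\<Sum>n\<in>{1..m}. (s / real n) powr (1/2))" by (simp add: sum_distrib_left)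
      also have "\<dots> \<le> 32 / (ln s)\<^sup>2 * (2 * s)" using s by (intro mult_left_mono sum_sqrt_le) auto
      finally show ?thesis by (simp add: w_def)
    qed
    have "\<bar>(\<Sum>p\<in>{p. prime p \<and> 2 \<le> p \<and> p \<le> m}. \<phi> p * ln (real p)) - (\<Sum>n\<in>{2..m}. \<phi> n)\<bar>
         \<le> C0 * (real 2 * \<phi> 2 / (ln (real 2))\<^sup>2 + (\<Sum>n\<in>{2..m}. \<phi> n / (ln (real n))\<^sup>2))"
    proof (rule C0(2))
      show "\<phi> n \<ge> 0" if "2 \<le> n" for n using l0[of n] that by (simp add: \<phi>_def)
      show "\<phi> (Suc n) \<le> \<phi> n" if "2 \<le> n" for n
        unfolding \<phi>_def
      proof (rule frac_le)
        show "l (s / real (Suc n)) \<le> l (s / real n)" using that s by (intro l_mono divide_left_mono) auto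
      qed (use that l0 in auto)
    qed (use m2 in auto)
    also have "\<dots> \<le> C0 * (2 * (L / ln 2) / (ln 2)\<^sup>2 * (4 * w) + L / ln 2 * (64 * w))"
    proof (intro mult_left_mono add_mono)
      have "\<phi> 2 \<le> L / ln 2" unfolding \<phi>_def using l0[of 2] by (intro frac_le) auto
      then have "2 * \<phi> 2 \<le> 2 * (L / ln 2)" by simp
      then have "2 * \<phi> 2 / (ln 2)\<^sup>2 \<le> 2 * (L / ln 2) / (ln 2)\<^sup>2" by (intro divide_right_mono) auto
      then have "real 2 * \<phi> 2 / (ln (real 2))\<^sup>2 \<le> 2 * (L / ln 2) / (ln 2)\<^sup>2" by simp
      also have "\<dots> \<le> 2 * (L / ln 2) / (ln 2)\<^sup>2 * (4 * w)"
        using ln_sq_le(1)[OF s(1)] L mult_left_mono[of 1 "4 * w" "2 * (L / ln 2) / (ln 2)\<^sup>2"] by (simp add: w_def)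
      finally show "real 2 * \<phi> 2 / (ln (real 2))\<^sup>2 \<le> 2 * (L / ln 2) / (ln 2)\<^sup>2 * (4 * w)" .
      have "(\<Sum>n\<in>{2..m}. \<phi> n / (ln (real n))\<^sup>2) \<le> (\<Sum>n\<in>{2..m}. L / ln 2 * (32 / (ln s)\<^sup>2 * (s / real n) powr (1/2)))"
      proof (rule sum_mono)
        fix n assume n: "n \<in> {2..m}"
        have "\<phi> n * (1 / (ln (real n))\<^sup>2) \<le> L / ln 2 * (32 / (ln s)\<^sup>2 * (s / real n) powr (1/2))"
        proof (rule mult_mono)
          show "\<phi> n \<le> L / ln 2" unfolding \<phi>_def using l0[of n] n L by (intro frac_le) auto
          show "1 / (ln (real n))\<^sup>2 \<le> 32 / (ln s)\<^sup>2 * (s / real n) powr (1/2)" using n s by (intro inverse_ln_weight_le) auto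
        qed (use L in auto)
        then show "\<phi> n / (ln (real n))\<^sup>2 \<le> L / ln 2 * (32 / (ln s)\<^sup>2 * (s / real n) powr (1/2))" by simp
      qed
      also have "\<dots> = L / ln 2 * (\<Sum>n\<in>{2..m}. 32 / (ln s)\<^sup>2 * (s / real n) powr (1/2))" by (rule sum_distrib_left[symmetric])
      also have "\<dots> \<le> L / ln 2 * (64 * w)" using L by (intro mult_left_mono sumw) auto
      finally show "(\<Sum>n\<in>{2..m}. \<phi> n / (ln (real n))\<^sup>2) \<le> L / ln 2 * (64 * w)" .
    qed (use C0 in auto)
    also have "\<dots> = K1 * w" by (simp add: K1_def algebra_simps)
    also have "(\<Sum>p\<in>{p. prime p \<and> 2 \<le> p \<and> p \<le> m}. \<phi> p * ln (real p)) = (\<Sum>p\<in>{p. prime p \<and> p \<le> m}. l (s / real p))"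
      by (intro sum.cong) (auto simp: \<phi>_def dest: prime_ge_2_nat)
    finally have E1: "\<bar>(\<Sum>p\<in>{p. prime p \<and> p \<le> m}. l (s / real p)) - (\<Sum>n\<in>{2..m}. \<phi> n)\<bar> \<le> K1 * w" .
    have "(\<Sum>n\<in>{2..m}. \<phi> n) - 1 / ln s * (\<Sum>n\<in>{2..m}. l (s / real n)) = (\<Sum>n\<in>{2..m}. l (s / real n) * (1 / ln (real n) - 1 / ln s))"
      by (simp add: \<phi>_def sum_distrib_left sum_subtractf[symmetric] algebra_simps)
    also have "\<bar>\<dots>\<bar> \<le> (\<Sum>n\<in>{2..m}. L * (32 / (ln s)\<^sup>2 * (s / real n) powr (1/2)))"
    proof (rule order_trans[OF sum_abs sum_mono])
      fix n assume "n \<in> {2..m}"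
      then have n: "2 \<le> real n" "real n \<le> s" using s by auto
      show "\<bar>l (s / real n) * (1 / ln (real n) - 1 / ln s)\<bar> \<le> L * (32 / (ln s)\<^sup>2 * (s / real n) powr (1/2))"
        unfolding abs_mult using l0[of n] L inverse_ln_weight_le(2,3)[OF n] by (intro mult_mono) auto
    qed
    also have "\<dots> = L * (\<Sum>n\<in>{2..m}. 32 / (ln s)\<^sup>2 * (s / real n) powr (1/2))" by (rule sum_distrib_left[symmetric])
    also have "\<dots> \<le> L * (64 * w)" using L by (intro mult_left_mono sumw) auto
    finally have E2: "\<bar>(\<Sum>n\<in>{2..m}. \<phi> n) - 1 / ln s * (\<Sum>n\<in>{2..m}. l (s / real n))\<bar> \<le> 64 * L * w" by simp
    define G where "G x = x * l (s / x) - s * integral {1/2..s / x} (\<lambda>v. dl v / v)" for x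
    have "\<bar>(\<Sum>n\<in>{Suc 1..m}. l (s / real n)) - (G s - G (real 1))\<bar> \<le> l (s / real 1)"
    proof (rule decreasing_sum_antiderivative[where h = "\<lambda>x. l (s / x)"])
      show "DERIV G x :> l (s / x)" if "real 1 \<le> x" "x \<le> s" for x
        unfolding G_def by (rule l_antiderivative) (use that s in auto)
      show "l (s / y) \<le> l (s / x)" if "real 1 \<le> x" "x \<le> y" "y \<le> s" for x y
        using that s by (intro l_mono divide_left_mono) auto
      show "0 \<le> l (s / x)" if "real 1 \<le> x" "x \<le> s" for x using that s by (intro l_bounds) auto
    qed (use m2 s in auto)
    then have a: "\<bar>(\<Sum>n\<in>{2..m}. l (s / real n)) - (G s - G 1)\<bar> \<le> L" using l0[of 1] by (simp add: numeral_2_eq_2)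
    have ic: "integral {1/2..s} (\<lambda>v. dl v / v) = integral {1/2..1} (\<lambda>v. dl v / v) + integral {1..s} (\<lambda>v. dl v / v)"
      by (rule Henstock_Kurzweil_Integration.integral_combine[symmetric])
         (use s in \<open>auto intro!: integrable_continuous_interval continuous_intros continuous_dl\<close>)
    have e: "G s - G 1 = s * (l 1 + integral {1..s} (\<lambda>v. dl v / v)) - l s"
      using s by (simp add: G_def ic algebra_simps)
    have "\<bar>I1 - integral {1..s} (\<lambda>v. dl v / v)\<bar> \<le> 1 / (q * s)" using s by (intro I1_tail) auto
    then have "s * \<bar>I1 - integral {1..s} (\<lambda>v. dl v / v)\<bar> \<le> s * (1 / (q * s))" using s by (intro mult_left_mono) auto
    then have "\<bar>s * I1 - s * integral {1..s} (\<lambda>v. dl v / v)\<bar> \<le> 1 / q" using s by (simp add: abs_mult right_diff_distrib[symmetric])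
    with a e have E3: "\<bar>(\<Sum>n\<in>{2..m}. l (s / real n)) - s * (l 1 + I1)\<bar> \<le> 3 * L + 1 / q"
      using l0[of 1] L by (simp add: algebra_simps)
    have "\<bar>1 / ln s * (\<Sum>n\<in>{2..m}. l (s / real n)) - s / ln s * (l 1 + I1)\<bar> = 1 / ln s * \<bar>(\<Sum>n\<in>{2..m}. l (s / real n)) - s * (l 1 + I1)\<bar>"
    proof -
      have "1 / ln s * a - s / ln s * b = 1 / ln s * (a - s * b)" for a b by (simp add: algebra_simps)
      then show ?thesis using ls by (simp only: abs_mult) simp
    qed
    also have "\<dots> \<le> w * (3 * L + 1 / q)"
      using E3 ln_sq_le(2)[OF s(1), folded w_def] w by (intro mult_mono) auto
    finally have E4: "\<bar>1 / ln s * (\<Sum>n\<in>{2..m}. l (s / real n)) - s / ln s * (l 1 + I1)\<bar> \<le> (3 * L + 1 / q) * w" by (simp add: mult.commute)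
    have "\<bar>(\<Sum>p\<in>{p. prime p \<and> p \<le> m}. l (s / real p)) - s / ln s * (l 1 + I1)\<bar> \<le> K1 * w + 64 * L * w + (3 * L + 1 / q) * w"
      using E1 E2 E4 by linarith
    then show "\<bar>(\<Sum>p\<in>{p. prime p \<and> p \<le> m}. l (s / real p)) - s / ln s * (l 1 + I1)\<bar> \<le> (K1 + 64 * L + (3 * L + 1 / q)) * s / (ln s)\<^sup>2"
      by (simp add: w_def algebra_simps add_divide_distrib)
  qed
qed

lemma f_le_sq: "s > 0 \<Longrightarrow> n > 0 \<Longrightarrow> f (s / real n) \<le> \<kappa> * s\<^sup>2 * (1 / (real n)\<^sup>2)"
  using f_bounds(2)[of "s / real n"] by (simp add: power_divide)

text \<open>The same three replacements above \<open>s\<close>, where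
  \<open>f u \<le> \<kappa> u^2\<close> supplies the decay. The term with \<open>s^2 / N\<close>
  accounts for stopping at \<open>N\<close> and disappears as \<open>N\<close> grows.\<close>

lemma sum_large_primes:
  obtains C where "C > 0" "\<And>s m N. s \<ge> 2 \<Longrightarrow> real m \<le> s \<Longrightarrow> s < real m + 1 \<Longrightarrow> m < N \<Longrightarrow>
    \<bar>(\<Sum>p\<in>{p. prime p \<and> m < p \<and> p \<le> N}. f (s / real p)) - s / ln s * (I0 - f 1)\<bar> \<le> C * s / (ln s)\<^sup>2 + C * s\<^sup>2 / real N"
proof -
  obtain C0 where C0: "C0 > 0"
    "\<And>m N \<phi>. 2 \<le> m \<Longrightarrow> m \<le> N \<Longrightarrow> (\<And>n. m \<le> n \<Longrightarrow> n \<le> N \<Longrightarrow> \<phi> n \<ge> (0::real)) \<Longrightarrow>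
       (\<And>n. m \<le> n \<Longrightarrow> n < N \<Longrightarrow> \<phi> (Suc n) \<le> \<phi> n) \<Longrightarrow>
       \<bar>(\<Sum>p\<in>{p. prime p \<and> m \<le> p \<and> p \<le> N}. \<phi> p * ln (real p)) - (\<Sum>n\<in>{m..N}. \<phi> n)\<bar>
         \<le> C0 * (real m * \<phi> m / (ln (real m))\<^sup>2 + (\<Sum>n\<in>{m..N}. \<phi> n / (ln (real n))\<^sup>2))"
    using prime_sum_compare by blast
  define K1 where "K1 = C0 * (2 / ln 2 + 2 * \<kappa> / ln 2)"
  have K1: "K1 > 0" unfolding K1_def using C0 \<kappa> by (intro mult_pos_pos add_pos_pos) auto
  define C where "C = K1 + 8 * \<kappa> + 3 + 4 * \<kappa>"
  show ?thesis
  proof (rule that)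
    show "C > 0" unfolding C_def using K1 \<kappa> by (intro add_pos_pos) auto
    fix s :: real and m N :: nat assume s: "s \<ge> 2" "real m \<le> s" "s < real m + 1" and N: "m < N"
    have m2: "m \<ge> 2" using s by linarith
    have ls: "ln s > 0" "ln 2 \<le> ln s" using s by auto
    have il: "1 / ln s \<le> 1 / ln 2" using ls by (intro divide_left_mono) auto
    define w where "w = s / (ln s)\<^sup>2"
    have w: "w > 0" using s ls by (simp add: w_def)
    define \<phi> where "\<phi> n = f (s / real n) / ln (real n)" for n
    have sn: "s \<le> real n" if "n \<ge> Suc m" for n using that s by linarith
    have f0: "0 \<le> f (s / real n)" "f (s / real n) \<le> 1" if "n \<ge> Suc m" for n
    proof -
      have "0 \<le> s / real n" "s / real n \<le> 1" using sn[OF that] s by auto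
      then show "0 \<le> f (s / real n)" "f (s / real n) \<le> 1"
        using f_bounds(1)[of "s / real n"] l_bounds(1)[of "s / real n"] by (auto simp: f_def)
    qed
    have lns: "ln s \<le> ln (real n)" if "n \<ge> Suc m" for n using sn[OF that] s by simp
    have \<phi>0: "\<phi> n \<ge> 0" if "n \<ge> Suc m" for n using f0[OF that] lns[OF that] ls by (simp add: \<phi>_def)
    have set: "{Suc m..N} \<subseteq> {m<..}" by auto
    have "\<bar>(\<Sum>p\<in>{p. prime p \<and> Suc m \<le> p \<and> p \<le> N}. \<phi> p * ln (real p)) - (\<Sum>n\<in>{Suc m..N}. \<phi> n)\<bar>
         \<le> C0 * (real (Suc m) * \<phi> (Suc m) / (ln (real (Suc m)))\<^sup>2 + (\<Sum>n\<in>{Suc m..N}. \<phi> n / (ln (real n))\<^sup>2))"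
    proof (rule C0(2))
      show "\<phi> (Suc n) \<le> \<phi> n" if "Suc m \<le> n" for n
        unfolding \<phi>_def
      proof (rule frac_le)
        show "f (s / real (Suc n)) \<le> f (s / real n)" using that s by (intro f_mono divide_left_mono) auto
        show "0 < ln (real n)" using lns[OF that] ls by linarith
      qed (use that f0 in auto)
    qed (use m2 N \<phi>0 in auto)
    also have "\<dots> \<le> C0 * (2 / ln 2 * w + 2 * \<kappa> / ln 2 * w)"
    proof (intro mult_left_mono add_mono)
      have "\<phi> (Suc m) \<le> 1 / ln 2" unfolding \<phi>_def using f0[of "Suc m"] lns[of "Suc m"] ls m2 by (intro frac_le) auto
      moreover have "real (Suc m) \<le> 2 * s" using s by simp
      ultimately have "real (Suc m) * \<phi> (Suc m) / (ln (real (Suc m)))\<^sup>2 \<le> 2 * s * (1 / ln 2) / (ln s)\<^sup>2"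
        using \<phi>0[of "Suc m"] lns[of "Suc m"] ls s by (intro frac_le mult_mono power_mono) auto
      then show "real (Suc m) * \<phi> (Suc m) / (ln (real (Suc m)))\<^sup>2 \<le> 2 / ln 2 * w" by (simp add: w_def)
      have "(\<Sum>n\<in>{Suc m..N}. \<phi> n / (ln (real n))\<^sup>2) \<le> (\<Sum>n\<in>{Suc m..N}. \<kappa> * s\<^sup>2 / (ln 2 * (ln s)\<^sup>2) * (1 / (real n)\<^sup>2))"
      proof (rule sum_mono)
        fix n assume n: "n \<in> {Suc m..N}"
        have "\<phi> n / (ln (real n))\<^sup>2 \<le> (\<kappa> * s\<^sup>2 * (1 / (real n)\<^sup>2) / ln 2) / (ln s)\<^sup>2"
          unfolding \<phi>_def using n f0[of n] f_le_sq[of s n] lns[of n] ls s \<kappa>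
          by (intro frac_le power_mono) (auto intro!: divide_nonneg_pos)
        then show "\<phi> n / (ln (real n))\<^sup>2 \<le> \<kappa> * s\<^sup>2 / (ln 2 * (ln s)\<^sup>2) * (1 / (real n)\<^sup>2)" by (simp add: mult_ac)
      qed
      also have "\<dots> = \<kappa> * s\<^sup>2 / (ln 2 * (ln s)\<^sup>2) * (\<Sum>n\<in>{Suc m..N}. 1 / (real n)\<^sup>2)" by (rule sum_distrib_left[symmetric])
      also have "\<dots> \<le> \<kappa> * s\<^sup>2 / (ln 2 * (ln s)\<^sup>2) * (1 / real m)"
        using \<kappa> m2 by (intro mult_left_mono sum_inverse_square_tail) auto
      also have "\<dots> \<le> \<kappa> * s\<^sup>2 / (ln 2 * (ln s)\<^sup>2) * (2 / s)"
      proof (intro mult_left_mono)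
        show "1 / real m \<le> 2 / s" using s m2 by (simp add: field_simps)
      qed (use \<kappa> in auto)
      also have "\<dots> = 2 * \<kappa> / ln 2 * w" using s by (simp add: w_def power2_eq_square)
      finally show "(\<Sum>n\<in>{Suc m..N}. \<phi> n / (ln (real n))\<^sup>2) \<le> 2 * \<kappa> / ln 2 * w" .
    qed (use C0 in auto)
    also have "\<dots> = K1 * w" by (simp add: K1_def algebra_simps)
    also have "(\<Sum>p\<in>{p. prime p \<and> Suc m \<le> p \<and> p \<le> N}. \<phi> p * ln (real p)) = (\<Sum>p\<in>{p. prime p \<and> m < p \<and> p \<le> N}. f (s / real p))"
      using m2 by (intro sum.cong) (auto simp: \<phi>_def)
    finally have E1: "\<bar>(\<Sum>p\<in>{p. prime p \<and> m < p \<and> p \<le> N}. f (s / real p)) - (\<Sum>n\<in>{Suc m..N}. \<phi> n)\<bar> \<le> K1 * w" .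
    have weights: "(\<Sum>n\<in>{Suc m..N}. \<phi> n) - 1 / ln s * (\<Sum>n\<in>{Suc m..N}. f (s / real n)) = (\<Sum>n\<in>{Suc m..N}. f (s / real n) * (1 / ln (real n) - 1 / ln s))"
      by (simp add: \<phi>_def sum_distrib_left sum_subtractf[symmetric] algebra_simps)
    have "\<bar>(\<Sum>n\<in>{Suc m..N}. \<phi> n) - 1 / ln s * (\<Sum>n\<in>{Suc m..N}. f (s / real n))\<bar>
        \<le> (\<Sum>n\<in>{Suc m..N}. 2 * \<kappa> / (ln s)\<^sup>2 * s powr (3/2) * real n powr (-(1/2) - 1))"
      unfolding weights
    proof (rule order_trans[OF sum_abs sum_mono])
      fix n assume n: "n \<in> {Suc m..N}"
      have n': "s \<le> real n" "real n > 0" "n \<ge> Suc m" using n sn by auto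
      have ab: "\<bar>1 / ln (real n) - 1 / ln s\<bar> = 1 / ln s - 1 / ln (real n)"
        using inverse_ln_weight_ge(2)[OF s(1) n'(1)] by simp
      have "\<bar>f (s / real n) * (1 / ln (real n) - 1 / ln s)\<bar> \<le> \<kappa> * (s / real n)\<^sup>2 * (2 / (ln s)\<^sup>2 * (real n / s) powr (1/2))"
        unfolding abs_mult ab using f0[OF n'(3)] f_bounds(2)[of "s / real n"] \<kappa> s inverse_ln_weight_ge[OF s(1) n'(1)]
        by (intro mult_mono) auto
      also have "\<dots> = 2 * \<kappa> / (ln s)\<^sup>2 * ((s / real n)\<^sup>2 * (real n / s) powr (1/2))" by simp
      also have "(s / real n)\<^sup>2 * (real n / s) powr (1/2) = s powr (3/2) * real n powr (-(1/2) - 1)"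
      proof -
        have p2: "s powr 2 = s\<^sup>2" "real n powr 2 = (real n)\<^sup>2" using n' s by (auto intro: powr_numeral)
        have "(s / real n)\<^sup>2 = s powr 2 * real n powr (-2)"
          unfolding p2 power_divide powr_minus_divide by simp
        moreover have "(real n / s) powr (1/2) = real n powr (1/2) * s powr (-(1/2))"
          unfolding powr_minus_divide using n' s by (subst powr_divide) auto
        moreover have "a * b * (c * d) = (a * d) * (b * c)" for a b c d :: real by simp
        ultimately have "(s / real n)\<^sup>2 * (real n / s) powr (1/2) = (s powr 2 * s powr (-(1/2))) * (real n powr (-2) * real n powr (1/2))"
          by (simp only:)
        also have "s powr 2 * s powr (-(1/2)) = s powr (2 + -(1/2))" by (rule powr_add[symmetric])
        also have "2 + -(1/2) = (3/2 :: real)" by simp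
        also have "real n powr (-2) * real n powr (1/2) = real n powr (-2 + 1/2)" by (rule powr_add[symmetric])
        also have "-2 + 1/2 = (-(1/2) - 1 :: real)" by simp
        finally show ?thesis .
      qed
      finally show "\<bar>f (s / real n) * (1 / ln (real n) - 1 / ln s)\<bar> \<le> 2 * \<kappa> / (ln s)\<^sup>2 * s powr (3/2) * real n powr (-(1/2) - 1)" by (simp only: mult.assoc)
    qed
    also have "\<dots> = 2 * \<kappa> / (ln s)\<^sup>2 * s powr (3/2) * (\<Sum>n\<in>{Suc m..N}. real n powr (-(1/2) - 1))" by (rule sum_distrib_left[symmetric])
    also have "\<dots> \<le> 2 * \<kappa> / (ln s)\<^sup>2 * s powr (3/2) * (real m powr (-(1/2)) / (1/2))"
      using \<kappa> m2 by (intro mult_left_mono sum_tail_powr_le) auto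
    also have "\<dots> \<le> 2 * \<kappa> / (ln s)\<^sup>2 * s powr (3/2) * ((2 * s powr (-(1/2))) / (1/2))"
    proof (intro mult_left_mono divide_right_mono)
      have "s / 4 \<le> real m" using s by linarith
      then have "real m powr (-(1/2)) \<le> (s / 4) powr (-(1/2))" using s by (intro powr_mono2') auto
      also have "\<dots> = 2 * s powr (-(1/2))" using s by (simp add: powr_divide powr_minus_divide powr_half_sqrt)
      finally show "real m powr (-(1/2)) \<le> 2 * s powr (-(1/2))" .
    qed (use \<kappa> in auto)
    also have "\<dots> = 8 * \<kappa> / (ln s)\<^sup>2 * (s powr (3/2) * s powr (-(1/2)))" by simp
    also have "s powr (3/2) * s powr (-(1/2)) = s powr (3/2 + -(1/2))" by (rule powr_add[symmetric])
    also have "\<dots> = s" using s by simp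
    finally have E2: "\<bar>(\<Sum>n\<in>{Suc m..N}. \<phi> n) - 1 / ln s * (\<Sum>n\<in>{Suc m..N}. f (s / real n))\<bar> \<le> 8 * \<kappa> * w"
      by (simp add: w_def)
    \<comment> \<open>The base point \<open>s / (N+1)\<close> is positive, which avoids the singular
      endpoint of \<open>df v / v\<close>, and stays strictly below \<open>s/x\<close> for all
      \<open>x \<le> N\<close>.\<close>
    define G where "G x = x * f (s / x) - s * integral {s / (real N + 1)..s / x} (\<lambda>v. df v / v)" for x
    have Gd: "DERIV G x :> f (s / x)" if "s \<le> x" "x \<le> real N" for x
      unfolding G_def by (rule f_antiderivative) (use that s in \<open>auto intro!: divide_strict_left_mono\<close>)
    have fdec: "f (s / y) \<le> f (s / x)" if "s \<le> x" "x \<le> y" for x y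
      using that s by (intro f_mono divide_left_mono) auto
    have fpos: "0 \<le> f (s / x)" if "s \<le> x" for x using that s by (intro f_bounds) auto
    have "\<bar>(\<Sum>n\<in>{Suc (Suc m)..N}. f (s / real n)) - (G (real N) - G (real (Suc m)))\<bar> \<le> f (s / real (Suc m))"
    proof (rule decreasing_sum_antiderivative[where h = "\<lambda>x. f (s / x)"])
      show "DERIV G x :> f (s / x)" if "real (Suc m) \<le> x" "x \<le> real N" for x using Gd that sn[of "Suc m"] by simp
      show "f (s / y) \<le> f (s / x)" if "real (Suc m) \<le> x" "x \<le> y" for x y using fdec that sn[of "Suc m"] by simp
      show "0 \<le> f (s / x)" if "real (Suc m) \<le> x" for x using fpos that sn[of "Suc m"] by simp
    qed (use N in auto)
    moreover have "(\<Sum>n\<in>{Suc m..N}. f (s / real n)) = f (s / real (Suc m)) + (\<Sum>n\<in>{Suc (Suc m)..N}. f (s / real n))"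
      using N by (simp add: sum.atLeast_Suc_atMost)
    moreover have "\<bar>G (real (Suc m)) - G s\<bar> \<le> 1"
    proof -
      have "\<exists>z>s. z < real (Suc m) \<and> G (real (Suc m)) - G s = (real (Suc m) - s) * f (s / z)"
        by (rule MVT2) (use s N in \<open>auto intro!: Gd\<close>)
      then obtain z where z: "z > s" "G (real (Suc m)) - G s = (real (Suc m) - s) * f (s / z)" by auto
      have "s / z \<le> 1" "0 \<le> s / z" using z s by auto
      then have "0 \<le> f (s / z)" "f (s / z) \<le> 1" using f_bounds(1)[of "s / z"] l_bounds(1)[of "s / z"] by (auto simp: f_def)
      then have "\<bar>(real (Suc m) - s) * f (s / z)\<bar> \<le> 1 * 1" unfolding abs_mult using s by (intro mult_mono) auto
      then show ?thesis using z(2) by simp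
    qed
    ultimately have a: "\<bar>(\<Sum>n\<in>{Suc m..N}. f (s / real n)) - (G (real N) - G s)\<bar> \<le> 3"
      using f0[of "Suc m"] by simp
    have Ns: "s \<le> real N" using sn[of N] N by simp
    define a where "a = s / (real N + 1)"
    have a0: "a > 0" "a \<le> s / real N" using s N unfolding a_def by (auto intro!: divide_left_mono)
    have ic: "integral {a..s / s} (\<lambda>v. df v / v) = integral {a..s / real N} (\<lambda>v. df v / v) + integral {s / real N..1} (\<lambda>v. df v / v)"
      using s Ns a0 by (subst Henstock_Kurzweil_Integration.integral_combine)
         (auto intro!: integrable_continuous_interval continuous_intros continuous_df divide_left_mono)
    have e: "G (real N) - G s = real N * f (s / real N) - s * f 1 + s * integral {s / real N..1} (\<lambda>v. df v / v)"
      using s unfolding G_def a_def[symmetric] ic by (simp add: algebra_simps)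
    have "\<bar>I0 - integral {s / real N..1} (\<lambda>v. df v / v)\<bar> \<le> \<kappa> * (s / real N)" using s Ns by (intro I0_tail) auto
    then have "s * \<bar>I0 - integral {s / real N..1} (\<lambda>v. df v / v)\<bar> \<le> s * (\<kappa> * (s / real N))" using s by (intro mult_left_mono) auto
    then have b: "\<bar>s * I0 - s * integral {s / real N..1} (\<lambda>v. df v / v)\<bar> \<le> \<kappa> * s\<^sup>2 / real N"
      using s by (simp add: abs_mult right_diff_distrib[symmetric] power2_eq_square mult_ac)
    have c: "0 \<le> real N * f (s / real N)" "real N * f (s / real N) \<le> \<kappa> * s\<^sup>2 / real N"
    proof -
      show "0 \<le> real N * f (s / real N)" using f0[of N] N by simp
      have "real N * f (s / real N) \<le> real N * (\<kappa> * (s / real N)\<^sup>2)" using s N by (intro mult_left_mono f_bounds) auto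
      then show "real N * f (s / real N) \<le> \<kappa> * s\<^sup>2 / real N" using N by (simp add: power2_eq_square)
    qed
    have E3: "\<bar>(\<Sum>n\<in>{Suc m..N}. f (s / real n)) - s * (I0 - f 1)\<bar> \<le> 3 + 2 * (\<kappa> * s\<^sup>2 / real N)"
      using a b c unfolding e right_diff_distrib by linarith
    have "\<bar>1 / ln s * (\<Sum>n\<in>{Suc m..N}. f (s / real n)) - s / ln s * (I0 - f 1)\<bar> = 1 / ln s * \<bar>(\<Sum>n\<in>{Suc m..N}. f (s / real n)) - s * (I0 - f 1)\<bar>"
    proof -
      have "1 / ln s * a - s / ln s * b = 1 / ln s * (a - s * b)" for a b by (simp add: algebra_simps)
      then show ?thesis using ls by (simp only: abs_mult) simp
    qed
    also have "\<dots> \<le> 1 / ln s * (3 + 2 * (\<kappa> * s\<^sup>2 / real N))" using E3 ls by (intro mult_left_mono) auto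
    also have "\<dots> = 3 * (1 / ln s) + 1 / ln s * (2 * (\<kappa> * s\<^sup>2 / real N))" by (simp add: algebra_simps)
    also have "\<dots> \<le> 3 * w + 2 * (2 * (\<kappa> * s\<^sup>2 / real N))"
    proof (intro add_mono mult_left_mono mult_right_mono)
      show "1 / ln s \<le> w" using ln_sq_le(2)[OF s(1)] by (simp add: w_def)
      have "1 / ln 2 \<le> (2::real)" using ln2_ge_two_thirds by (simp add: field_simps)
      then show "1 / ln s \<le> 2" using il by linarith
    qed (use \<kappa> in auto)
    finally have E4: "\<bar>1 / ln s * (\<Sum>n\<in>{Suc m..N}. f (s / real n)) - s / ln s * (I0 - f 1)\<bar> \<le> 3 * w + 4 * (\<kappa> * s\<^sup>2 / real N)" by simp
    have "\<bar>(\<Sum>p\<in>{p. prime p \<and> m < p \<and> p \<le> N}. f (s / real p)) - s / ln s * (I0 - f 1)\<bar> \<le> (K1 + 8 * \<kappa> + 3) * w + 4 * \<kappa> * (s\<^sup>2 / real N)"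
      using E1 E2 E4 by (simp add: algebra_simps)
    also have "\<dots> \<le> C * w + C * (s\<^sup>2 / real N)"
      using w K1 \<kappa> by (intro add_mono mult_right_mono) (auto simp: C_def)
    finally show "\<bar>(\<Sum>p\<in>{p. prime p \<and> m < p \<and> p \<le> N}. f (s / real p)) - s / ln s * (I0 - f 1)\<bar> \<le> C * s / (ln s)\<^sup>2 + C * s\<^sup>2 / real N"
      by (simp add: w_def)
  qed
qed

end

section \<open>The cumulant generating function\<close>

lemma abs_ln_diff_le:
  fixes x y m :: real assumes "m > 0" "x \<ge> m" "y \<ge> m"
  shows "\<bar>ln x - ln y\<bar> \<le> \<bar>x - y\<bar> / m"
proof -
  have *: "ln x - ln y \<le> \<bar>x - y\<bar> / m" if "x \<ge> m" "y \<ge> m" for x y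
  proof -
    have "ln x - ln y = ln (x / y)" using that assms by (simp add: ln_div)
    also have "\<dots> \<le> x / y - 1" using that assms by (intro ln_le_minus_one) auto
    also have "\<dots> = (x - y) / y" using that assms by (simp add: diff_divide_distrib)
    also have "\<dots> \<le> \<bar>x - y\<bar> / m" using that assms by (intro frac_le) auto
    finally show ?thesis .
  qed
  show ?thesis using *[of x y] *[of y x] assms by (simp add: abs_le_iff abs_minus_commute)
qed

lemma abs_exp_diff_le:
  fixes x y z :: real assumes "x \<le> z" "y \<le> z"
  shows "\<bar>exp x - exp y\<bar> \<le> \<bar>x - y\<bar> * exp z"
proof -
  have *: "exp x - exp y \<le> \<bar>x - y\<bar> * exp z" if "x \<le> z" for x y
  proof -
    have "exp x - exp y = exp x * (1 - exp (y - x))" by (simp add: exp_diff field_simps)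
    also have "1 - exp (y - x) \<le> \<bar>x - y\<bar>" using exp_ge_add_one_self[of "y - x"] by linarith
    then have "exp x * (1 - exp (y - x)) \<le> exp x * \<bar>x - y\<bar>" by (intro mult_left_mono) auto
    also have "\<dots> \<le> exp z * \<bar>x - y\<bar>" using that by (intro mult_right_mono) auto
    finally show ?thesis by (simp add: mult.commute)
  qed
  show ?thesis using *[of x y] *[of y x] assms by (simp add: abs_le_iff abs_minus_commute)
qed

text \<open>The expression equals \<open>exp y * (1 - exp (-y))^2\<close>, and it is even in
  \<open>y\<close>.\<close>

lemma cosh_bound:
  fixes y z :: real assumes "\<bar>y\<bar> \<le> z"
  shows "0 \<le> exp y + exp (-y) - 2" "exp y + exp (-y) - 2 \<le> z\<^sup>2 * exp z"
proof -
  have EF: "exp y * exp (-y) = 1" for y :: real by (simp flip: exp_add)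
  have expand: "exp y * (1 - exp (-y))\<^sup>2 = exp y - 2 * (exp y * exp (-y)) + exp y * exp (-y) * exp (-y)" for y :: real
    by (simp add: power2_eq_square algebra_simps)
  have e: "exp y + exp (-y) - 2 = exp y * (1 - exp (-y))\<^sup>2" for y :: real unfolding expand EF by simp
  show "0 \<le> exp y + exp (-y) - 2" unfolding e by simp
  have *: "exp y + exp (-y) - 2 \<le> y\<^sup>2 * exp y" if "y \<ge> 0" for y :: real
  proof -
    have "exp y + exp (-y) - 2 = exp y * (1 - exp (-y))\<^sup>2" by (rule e)
    also have "\<dots> \<le> exp y * y\<^sup>2" using that exp_ge_add_one_self[of "-y"] by (intro mult_left_mono power_mono) auto
    finally show ?thesis by (simp add: mult.commute)
  qed
  have "exp y + exp (-y) - 2 \<le> \<bar>y\<bar>\<^sup>2 * exp \<bar>y\<bar>" using *[of y] *[of "-y"] by (cases "y \<ge> 0") (auto simp: add.commute)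
  also have "\<dots> \<le> z\<^sup>2 * exp z" using assms by (intro mult_mono power_mono) auto
  finally show "exp y + exp (-y) - 2 \<le> z\<^sup>2 * exp z" .
qed

text \<open>For \<open>n \<le> s\<close> the exponential compensates \<open>1/n^2\<close>: each of
  at most \<open>s\<close> terms is below \<open>2 / (c s)^2\<close>. For \<open>n > s\<close> the
  tail of \<open>1/n^2\<close> alone is \<open>O(1/s)\<close>.\<close>

lemma sum_inverse_sq_exp_le:
  fixes c s :: real
  assumes "c > 0" "s \<ge> 1" "finite A" "0 \<notin> A"
  shows "(\<Sum>n\<in>A. 1 / (real n)\<^sup>2 * exp (- (c * s / real n))) \<le> (2 / c\<^sup>2 + 2) / s"
proof -
  define m where "m = nat \<lfloor>s\<rfloor>"
  have m: "real m \<le> s" "s < real m + 1" "m > 0" using assms unfolding m_def by linarith+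
  have "(\<Sum>n\<in>A. 1 / (real n)\<^sup>2 * exp (- (c * s / real n))) = (\<Sum>n\<in>A \<inter> {..m}. 1 / (real n)\<^sup>2 * exp (- (c * s / real n))) + (\<Sum>n\<in>A \<inter> {m<..}. 1 / (real n)\<^sup>2 * exp (- (c * s / real n)))"
    using assms by (subst sum.union_disjoint[symmetric]) (auto intro!: sum.cong)
  also have "(\<Sum>n\<in>A \<inter> {..m}. 1 / (real n)\<^sup>2 * exp (- (c * s / real n))) \<le> (\<Sum>n\<in>A \<inter> {..m}. 2 / (c\<^sup>2 * s\<^sup>2))"
  proof (rule sum_mono)
    fix n assume "n \<in> A \<inter> {..m}"
    then have n: "real n > 0" using assms by (auto intro: ccontr)
    define x where "x = c * s / real n"
    have x: "x > 0" using n assms by (simp add: x_def)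
    have "x\<^sup>2 / 2 \<le> exp x" using exp_lower_Taylor_quadratic[of x] x by simp
    then have "exp (-x) \<le> 2 / x\<^sup>2" using x by (simp add: exp_minus field_simps)
    then have "1 / (real n)\<^sup>2 * exp (-x) \<le> 1 / (real n)\<^sup>2 * (2 / x\<^sup>2)" by (intro mult_left_mono) auto
    also have "\<dots> = 2 / (c\<^sup>2 * s\<^sup>2)" using n by (simp add: x_def power_divide power_mult_distrib)
    finally show "1 / (real n)\<^sup>2 * exp (- (c * s / real n)) \<le> 2 / (c\<^sup>2 * s\<^sup>2)" by (simp add: x_def)
  qed
  also have "\<dots> = real (card (A \<inter> {..m})) * (2 / (c\<^sup>2 * s\<^sup>2))" by simp
  also have "\<dots> \<le> s * (2 / (c\<^sup>2 * s\<^sup>2))"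
  proof (intro mult_right_mono)
    have "card (A \<inter> {..m}) \<le> card {1..m}"
      using assms by (intro card_mono) (auto simp: Suc_le_eq intro: ccontr)
    then show "real (card (A \<inter> {..m})) \<le> s" using m by simp
  qed auto
  also have "s * (2 / (c\<^sup>2 * s\<^sup>2)) = 2 / c\<^sup>2 / s" using assms by (simp add: power2_eq_square)
  also have "(\<Sum>n\<in>A \<inter> {m<..}. 1 / (real n)\<^sup>2 * exp (- (c * s / real n))) \<le> (\<Sum>n\<in>A \<inter> {m<..}. 1 / (real n)\<^sup>2)"
    using assms by (intro sum_mono mult_left_le) auto
  also have "\<dots> \<le> 1 / real m" using assms m by (intro sum_inverse_square_tail) auto
  also have "1 / real m \<le> 2 / s" using m by (simp add: field_simps)
  finally show ?thesis by (simp add: add_divide_distrib)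
qed

text \<open>The logarithm of the local factor at \<open>p\<close> takes the values \<open>a p\<close>, \<open>b p\<close> and \<open>0\<close> with probabilities
  \<open>(1 - d p) q\<close>, \<open>(1 - d p) (1 - q)\<close> and \<open>d p\<close>.\<close>
locale prime_model = two_point q for q +
  fixes a b d :: "nat \<Rightarrow> real" and A \<delta> c0 K0 :: real
  assumes a_approx: "prime p \<Longrightarrow> \<bar>a p - 1 / real p\<bar> \<le> A / (real p)\<^sup>2"
    and b_approx: "prime p \<Longrightarrow> \<bar>b p + (\<kappa> - 1) / real p\<bar> \<le> A / (real p)\<^sup>2"
    and d_bounds: "prime p \<Longrightarrow> 0 \<le> d p" "prime p \<Longrightarrow> d p \<le> 2 / real p" "prime p \<Longrightarrow> d p \<le> 1/2"
    and \<delta>: "0 < \<delta>" "\<delta> \<le> 1"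
    and a_lower: "prime p \<Longrightarrow> a p \<ge> \<delta> / real p"
    and b_neg: "prime p \<Longrightarrow> b p \<le> 0"
    and A_pos: "A > 0"
    and mertens: "N \<ge> 2 \<Longrightarrow> \<bar>(\<Sum>p\<in>{p. prime p \<and> p \<le> N}. a p) - ln (ln (real N)) - c0\<bar> \<le> K0 / (ln (real N))\<^sup>2"
begin

definition mom :: "nat \<Rightarrow> real \<Rightarrow> real" where
  "mom p s = d p + (1 - d p) * (q * exp (s * a p) + (1 - q) * exp (s * b p))"

definition kap :: "real \<Rightarrow> nat \<Rightarrow> real" where
  "kap s n = (if prime n then ln (mom n s) else 0)"

definition cumulant :: "real \<Rightarrow> real" where
  "cumulant s = (\<Sum>n. kap s n)"

lemma mom_ge: assumes "prime p" shows "mom p s \<ge> q / 2 * exp (s * a p)" "mom p s > 0"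
proof -
  have "q / 2 * exp (s * a p) \<le> (1 - d p) * (q * exp (s * a p))"
    using d_bounds[OF assms] q by (simp add: mult_right_mono)
  moreover have "(1 - d p) * ((1 - q) * exp (s * b p)) \<ge> 0" "d p \<ge> 0" using d_bounds[OF assms] q by auto
  ultimately show 1: "mom p s \<ge> q / 2 * exp (s * a p)" by (simp add: mom_def distrib_left)
  have "q / 2 * exp (s * a p) > 0" using q by simp
  with 1 show "mom p s > 0" by linarith
qed

text \<open>After the factor \<open>exp (s * a p)\<close> is extracted, the remainder is compared
  with \<open>den (s/p)\<close>; both stay above \<open>q/2\<close>, where the logarithm is
  Lipschitz. The atom at 0 costs \<open>d p \<le> 2/p\<close>. Replacing the gap
  \<open>a p - b p\<close> by \<open>\<kappa> / p\<close> costs \<open>A s / p^2\<close> damped by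
  \<open>exp (- \<delta> s/p)\<close>, and
  \<open>u exp (- \<delta> u) \<le> 1/\<delta>\<close>.\<close>

lemma small_prime_error:
  assumes p: "prime p" "real p \<le> s"
  shows "\<bar>kap s p - (s * a p - l (s / real p))\<bar> \<le> 2 / q * (4 + 2 * A / \<delta>) / real p"
proof -
  have p0: "real p > 0" "real p \<ge> 1" using prime_ge_1_nat[OF p(1)] by auto
  have s0: "s > 0" using p p0 by linarith
  define x where "x = (a p - b p) * s"
  define y where "y = \<kappa> * (s / real p)"
  define X where "X = d p * exp (- (s * a p)) + (1 - d p) * (q + (1 - q) * exp (-x))"
  have dp: "0 \<le> d p" "d p \<le> 2 / real p" "d p \<le> 1/2" using d_bounds[OF p(1)] by auto
  have mX: "mom p s = exp (s * a p) * X"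
  proof -
    have "exp (s * a p) * X = d p * (exp (s * a p) * exp (- (s * a p))) + (1 - d p) * (q * exp (s * a p) + (1 - q) * (exp (s * a p) * exp (-x)))"
      by (simp add: X_def algebra_simps)
    also have "exp (s * a p) * exp (- (s * a p)) = 1" by (simp flip: exp_add)
    also have "exp (s * a p) * exp (-x) = exp (s * b p)" by (simp flip: exp_add add: x_def algebra_simps)
    finally show ?thesis by (simp add: mom_def)
  qed
  have Xq: "X \<ge> q / 2" using mom_ge(1)[OF p(1), of s] unfolding mX by (simp add: mult.commute)
  have kap: "kap s p = s * a p + ln X" using p Xq q by (simp add: kap_def mX ln_mult)
  have lY: "l (s / real p) = - ln (den (s / real p))" by (simp add: l_def)
  have "\<bar>ln X - ln (den (s / real p))\<bar> \<le> \<bar>X - den (s / real p)\<bar> / (q / 2)"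
    using Xq q den_bounds(1)[of "s / real p"] by (intro abs_ln_diff_le) auto
  also have "\<bar>X - den (s / real p)\<bar> \<le> 4 / real p + 2 * A / \<delta> / real p"
  proof -
    have e: "X - den (s / real p) = d p * (exp (- (s * a p)) - (q + (1 - q) * exp (-x))) + (1 - q) * (exp (-x) - exp (-y))"
      by (simp add: X_def den_def y_def algebra_simps)
    have ea: "0 \<le> exp (- (s * a p))" "exp (- (s * a p)) \<le> 1"
      using a_lower[OF p(1)] \<delta> p0 s0 order_trans[of 0 "\<delta> / real p" "a p"] by auto
    have xlow: "x \<ge> \<delta> * (s / real p)"
    proof -
      have "\<delta> / real p \<le> a p - b p" using a_lower[OF p(1)] b_neg[OF p(1)] by linarith
      then have "\<delta> / real p * s \<le> (a p - b p) * s" using s0 by (intro mult_right_mono) auto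
      then show ?thesis by (simp add: x_def)
    qed
    have ylow: "y \<ge> \<delta> * (s / real p)" unfolding y_def using \<delta> \<kappa> s0 p0 by (intro mult_right_mono) auto
    have ex: "0 \<le> exp (-x)" "exp (-x) \<le> 1" using xlow \<delta> s0 p0 order_trans[of 0 "\<delta> * (s / real p)" x] by auto
    have "(1 - q) * exp (-x) \<le> (1 - q) * 1" "0 \<le> (1 - q) * exp (-x)" using ex q by (auto intro: mult_left_le)
    moreover have "\<bar>E - (q + z)\<bar> \<le> 2" if "z \<le> (1 - q) * 1" "0 \<le> z" "0 \<le> E" "E \<le> 1" for z E
      using that q by (simp add: abs_le_iff)
    ultimately have "\<bar>exp (- (s * a p)) - (q + (1 - q) * exp (-x))\<bar> \<le> 2" using ea by blast
    then have "\<bar>d p * (exp (- (s * a p)) - (q + (1 - q) * exp (-x)))\<bar> \<le> 2 / real p * 2"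
      unfolding abs_mult using dp by (intro mult_mono) auto
    moreover have "\<bar>(1 - q) * (exp (-x) - exp (-y))\<bar> \<le> 2 * A / \<delta> / real p"
    proof -
      have "\<bar>exp (-x) - exp (-y)\<bar> \<le> \<bar>-x - -y\<bar> * exp (- (\<delta> * (s / real p)))"
        by (rule abs_exp_diff_le) (use xlow ylow in auto)
      also have "\<bar>-x - -y\<bar> \<le> 2 * A / (real p)\<^sup>2 * s"
      proof -
        have "y - x = ((1 / real p - a p) + (b p + (\<kappa> - 1) / real p)) * s" by (simp add: x_def y_def algebra_simps diff_divide_distrib)
        also have "\<bar>\<dots>\<bar> \<le> (A / (real p)\<^sup>2 + A / (real p)\<^sup>2) * s"
          unfolding abs_mult using a_approx[OF p(1)] b_approx[OF p(1)] s0 by (intro mult_mono) linarith+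
        finally show ?thesis by (simp add: abs_minus_commute)
      qed
      also have "2 * A / (real p)\<^sup>2 * s * exp (- (\<delta> * (s / real p))) = 2 * A / real p * ((s / real p) * exp (- (\<delta> * (s / real p))))"
        by (simp add: power2_eq_square)
      also have "(s / real p) * exp (- (\<delta> * (s / real p))) \<le> 1 / \<delta>"
      proof -
        have "\<delta> * (s / real p) \<le> exp (\<delta> * (s / real p))" using exp_ge_add_one_self[of "\<delta> * (s / real p)"] by linarith
        then have "\<delta> * (s / real p) * exp (- (\<delta> * (s / real p))) \<le> exp (\<delta> * (s / real p)) * exp (- (\<delta> * (s / real p)))"
          by (intro mult_right_mono) auto
        also have "\<dots> = 1" by (simp flip: exp_add)
        finally have "\<delta> * (s / real p * exp (- (\<delta> * (s / real p)))) \<le> 1" by (simp only: mult.assoc)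
        then show ?thesis using \<delta> by (simp add: pos_le_divide_eq mult.commute)
      qed
      then have "2 * A / real p * ((s / real p) * exp (- (\<delta> * (s / real p)))) \<le> 2 * A / real p * (1 / \<delta>)"
        using A_pos p0 by (intro mult_left_mono) auto
      finally have "\<bar>exp (-x) - exp (-y)\<bar> \<le> 2 * A / real p * (1 / \<delta>)" by simp
      then have "(1 - q) * \<bar>exp (-x) - exp (-y)\<bar> \<le> 1 * (2 * A / real p * (1 / \<delta>))" using q by (intro mult_mono) auto
      then show ?thesis using q by (simp add: abs_mult mult_ac)
    qed
    ultimately show ?thesis unfolding e by (simp add: abs_le_iff)
  qed
  finally have "\<bar>ln X - ln (den (s / real p))\<bar> \<le> (4 / real p + 2 * A / \<delta> / real p) / (q / 2)" using q by (simp add: divide_right_mono)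
  also have "\<dots> = 2 / q * (4 + 2 * A / \<delta>) / real p" using q p0 by (simp add: field_simps)
  finally show ?thesis unfolding kap lY by simp
qed

text \<open>Here \<open>s/p \<le> 1\<close> and all exponentials are \<open>1 + O(s/p)\<close>, so
  the atom at 0, of mass at most \<open>2/p\<close>, changes the moment only by
  \<open>O(s / p^2)\<close>. The deviations of \<open>a p\<close> and \<open>b p\<close> from their
  leading terms cost the same, and the sum of \<open>s / p^2\<close> over \<open>p > s\<close> is
  bounded.\<close>

lemma large_prime_error:
  assumes p: "prime p" "s \<le> real p" "s \<ge> 0"
  shows "\<bar>kap s p - f (s / real p)\<bar> \<le> 2 / q * (2 * ((1 + A) * exp (1 + A) + (\<kappa> + A)) + A * exp (1 + A) + A) * (s / (real p)\<^sup>2)"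
proof -
  have p0: "real p > 0" "real p \<ge> 1" using prime_ge_1_nat[OF p(1)] by auto
  define u where "u = s / real p"
  have u: "0 \<le> u" "u \<le> 1" using p p0 by (auto simp: u_def)
  have dp: "0 \<le> d p" "d p \<le> 2 / real p" "d p \<le> 1/2" using d_bounds[OF p(1)] by auto
  have sp: "A * (s / (real p)\<^sup>2) \<le> A * u" 
  proof (intro mult_left_mono)
    show "s / (real p)\<^sup>2 \<le> u" unfolding u_def using p p0 by (intro divide_left_mono) (auto simp: power2_eq_square)
  qed (use A_pos in auto)
  have au: "\<bar>s * a p - u\<bar> \<le> A * (s / (real p)\<^sup>2)"
  proof -
    have "\<bar>s * (a p - 1 / real p)\<bar> \<le> s * (A / (real p)\<^sup>2)" unfolding abs_mult using a_approx[OF p(1)] p by (intro mult_mono) auto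
    then show ?thesis by (simp add: u_def algebra_simps)
  qed
  have bu: "\<bar>s * b p + (\<kappa> - 1) * u\<bar> \<le> A * (s / (real p)\<^sup>2)"
  proof -
    have "\<bar>s * (b p + (\<kappa> - 1) / real p)\<bar> \<le> s * (A / (real p)\<^sup>2)" unfolding abs_mult using b_approx[OF p(1)] p by (intro mult_mono) auto
    then show ?thesis by (simp add: u_def algebra_simps)
  qed
  have A_u: "A * u \<le> A" using u A_pos by (simp add: mult_left_le)
  have as: "\<bar>s * a p\<bar> \<le> (1 + A) * u" "s * a p \<le> 1 + A" using au sp u A_u by (auto simp: abs_le_iff algebra_simps)
  have bs: "\<bar>s * b p\<bar> \<le> (\<kappa> + A) * u" "s * b p \<le> 0"
  proof -
    show "s * b p \<le> 0" using b_neg[OF p(1)] p by (simp add: mult_nonneg_nonpos)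
    have "\<bar>(\<kappa> - 1) * u\<bar> \<le> \<kappa> * u" using \<kappa> u by (simp add: abs_mult mult_right_mono)
    then show "\<bar>s * b p\<bar> \<le> (\<kappa> + A) * u" using bu sp by (simp add: algebra_simps abs_le_iff)
  qed
  define Y where "Y = q * exp u + (1 - q) * exp (- ((\<kappa> - 1) * u))"
  have Y: "Y = exp u * den u"
  proof -
    have "exp u * den u = q * exp u + (1 - q) * (exp u * exp (- (\<kappa> * u)))" by (simp add: den_def algebra_simps)
    also have "exp u * exp (- (\<kappa> * u)) = exp (- ((\<kappa> - 1) * u))" by (simp flip: exp_add add: algebra_simps)
    finally show ?thesis by (simp add: Y_def)
  qed
  have fY: "f u = ln Y" using den_bounds(3)[of u] unfolding Y by (simp add: ln_mult f_def l_def)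
  have Yq: "Y \<ge> q / 2"
  proof -
    have "q * 1 \<le> q * exp u" using u q by (intro mult_left_mono) auto
    moreover have "(1 - q) * exp (- ((\<kappa> - 1) * u)) \<ge> 0" using q by simp
    ultimately show ?thesis using q unfolding Y_def by linarith
  qed
  have Xq: "mom p s \<ge> q / 2"
  proof -
    have "s * a p \<ge> 0" using a_lower[OF p(1)] \<delta> p0 p(3) order_trans[of 0 "\<delta> / real p" "a p"] by (intro mult_nonneg_nonneg) auto
    then have "q / 2 * 1 \<le> q / 2 * exp (s * a p)" using q by (intro mult_left_mono) auto
    then show ?thesis using mom_ge(1)[OF p(1), of s] by linarith
  qed
  have "\<bar>ln (mom p s) - ln Y\<bar> \<le> \<bar>mom p s - Y\<bar> / (q / 2)" using Xq Yq q by (intro abs_ln_diff_le) auto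
  also have "\<bar>mom p s - Y\<bar> \<le> (2 * ((1 + A) * exp (1 + A) + (\<kappa> + A)) + A * exp (1 + A) + A) * (s / (real p)\<^sup>2)"
  proof -
    let ?E = "exp (1 + A)"
    have ea1: "\<bar>exp (s * a p) - exp 0\<bar> \<le> \<bar>s * a p - 0\<bar> * ?E" using as A_pos by (intro abs_exp_diff_le) auto
    have ea2: "\<bar>exp (s * a p) - exp u\<bar> \<le> \<bar>s * a p - u\<bar> * ?E" using as A_pos u by (intro abs_exp_diff_le) auto
    have eb1: "\<bar>exp (s * b p) - exp 0\<bar> \<le> \<bar>s * b p - 0\<bar> * exp 0" using bs by (intro abs_exp_diff_le) auto
    have eb2: "\<bar>exp (s * b p) - exp (- ((\<kappa> - 1) * u))\<bar> \<le> \<bar>s * b p - - ((\<kappa> - 1) * u)\<bar> * exp 0"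
      using bs \<kappa> u by (intro abs_exp_diff_le) auto
    have e: "mom p s - Y = d p * (q * (1 - exp (s * a p)) + (1 - q) * (1 - exp (s * b p)))
        + (q * (exp (s * a p) - exp u) + (1 - q) * (exp (s * b p) - exp (- ((\<kappa> - 1) * u))))"
      by (simp add: mom_def Y_def algebra_simps)
    have q1: "\<bar>q * z\<bar> \<le> \<bar>z\<bar>" "\<bar>(1 - q) * z\<bar> \<le> \<bar>z\<bar>" for z using q by (auto simp: abs_mult mult_left_le_one_le)
    have "\<bar>q * (1 - exp (s * a p)) + (1 - q) * (1 - exp (s * b p))\<bar> \<le> (1 + A) * u * ?E + (\<kappa> + A) * u"
    proof -
      have "\<bar>s * a p\<bar> * ?E \<le> (1 + A) * u * ?E" using as by (intro mult_right_mono) auto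
      moreover have "\<bar>exp (s * a p) - 1\<bar> \<le> \<bar>s * a p\<bar> * ?E" "\<bar>exp (s * b p) - 1\<bar> \<le> \<bar>s * b p\<bar>" using ea1 eb1 by simp_all
      ultimately show ?thesis using bs(1) q1(1)[of "1 - exp (s * a p)"] q1(2)[of "1 - exp (s * b p)"] by linarith
    qed
    then have "\<bar>d p * (q * (1 - exp (s * a p)) + (1 - q) * (1 - exp (s * b p)))\<bar> \<le> 2 / real p * ((1 + A) * u * ?E + (\<kappa> + A) * u)"
      unfolding abs_mult using dp by (intro mult_mono) auto
    also have "\<dots> = 2 * ((1 + A) * ?E + (\<kappa> + A)) * (s / (real p)\<^sup>2)" by (simp add: u_def power2_eq_square algebra_simps add_divide_distrib)
    finally have t1: "\<bar>d p * (q * (1 - exp (s * a p)) + (1 - q) * (1 - exp (s * b p)))\<bar> \<le> 2 * ((1 + A) * ?E + (\<kappa> + A)) * (s / (real p)\<^sup>2)" .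
    have "\<bar>s * a p - u\<bar> * ?E \<le> A * (s / (real p)\<^sup>2) * ?E" using au by (intro mult_right_mono) auto
    then have t2: "\<bar>q * (exp (s * a p) - exp u)\<bar> \<le> A * ?E * (s / (real p)\<^sup>2)" using ea2 q1(1)[of "exp (s * a p) - exp u"] by (simp add: mult_ac)
    have t3: "\<bar>(1 - q) * (exp (s * b p) - exp (- ((\<kappa> - 1) * u)))\<bar> \<le> A * (s / (real p)\<^sup>2)"
      using eb2 bu q1(2)[of "exp (s * b p) - exp (- ((\<kappa> - 1) * u))"] by simp
    have "\<bar>mom p s - Y\<bar> \<le> 2 * ((1 + A) * ?E + (\<kappa> + A)) * (s / (real p)\<^sup>2) + (A * ?E * (s / (real p)\<^sup>2) + A * (s / (real p)\<^sup>2))"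
      unfolding e using t1 t2 t3 by linarith
    then show ?thesis by (simp add: algebra_simps)
  qed
  finally have "\<bar>ln (mom p s) - ln Y\<bar> \<le> ((2 * ((1 + A) * exp (1 + A) + (\<kappa> + A)) + A * exp (1 + A) + A) * (s / (real p)\<^sup>2)) / (q / 2)"
    using q by (simp add: divide_right_mono)
  also have "X * Z / (q / 2) = 2 / q * X * Z" for X Z by simp
  finally show ?thesis using p(1) fY by (simp add: kap_def u_def)
qed

lemma kap_summable: assumes "s \<ge> 2" shows "summable (kap s)"
proof -
  obtain C where C: "C \<ge> 0" "\<And>p. prime p \<Longrightarrow> s \<le> real p \<Longrightarrow> \<bar>kap s p - f (s / real p)\<bar> \<le> C * (s / (real p)\<^sup>2)"
  proof (rule that)
    show "2 / q * (2 * ((1 + A) * exp (1 + A) + (\<kappa> + A)) + A * exp (1 + A) + A) \<ge> 0"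
      using q A_pos \<kappa> by (intro mult_nonneg_nonneg add_nonneg_nonneg) auto
  qed (use large_prime_error assms in auto)
  show ?thesis
  proof (rule summable_comparison_test'[OF summable_inverse_square[of "C * s + \<kappa> * s\<^sup>2"]])
    fix n assume n: "n \<ge> nat \<lceil>s\<rceil>"
    then have sn: "s \<le> real n" by linarith
    show "norm (kap s n) \<le> (C * s + \<kappa> * s\<^sup>2) / (real n)\<^sup>2"
    proof (cases "prime n")
      case True
      have "\<bar>kap s n\<bar> \<le> C * (s / (real n)\<^sup>2) + \<kappa> * s\<^sup>2 * (1 / (real n)\<^sup>2)"
        using C(2)[OF True sn] f_le_sq[of s n] f_bounds(1)[of "s / real n"] assms prime_gt_0_nat[OF True] by (simp add: abs_le_iff)
      then show ?thesis by (simp add: add_divide_distrib)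
    next
      case False
      then show ?thesis using C(1) assms \<kappa> by (simp add: kap_def)
    qed
  qed
qed

lemma cumulant_tendsto:
  assumes "s \<ge> 2" shows "(\<lambda>N. \<Sum>p\<in>{p. prime p \<and> p \<le> N}. ln (mom p s)) \<longlonglongrightarrow> cumulant s"
proof -
  have "(\<lambda>N. \<Sum>n<Suc N. kap s n) \<longlonglongrightarrow> cumulant s"
    unfolding cumulant_def by (rule LIMSEQ_Suc[OF summable_LIMSEQ[OF kap_summable[OF assms]]])
  then show ?thesis unfolding kap_def sum_primes_le_eq .
qed

text \<open>Primes up to \<open>s\<close> give \<open>s\<close> times the Mertens sum minus the sum
  of \<open>l (s/p)\<close>, larger primes give the sum of \<open>f (s/p)\<close>. For the
  \<open>O(1/p)\<close> errors of the small primes the crude bound \<open>2 * sqrt s\<close> on the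
  sum of \<open>1/p\<close> is enough, being \<open>O(s / ln^2 s)\<close>.\<close>

lemma cumulant_asymptotic:
  obtains C where "C > 0" "\<And>s. s \<ge> 4 \<Longrightarrow> \<bar>cumulant s - (s * (ln (ln s) + c0) + s / ln s * (I0 - I1 - 1))\<bar> \<le> C * s / (ln s)\<^sup>2"
proof -
  obtain C1 where C1: "C1 > 0" "\<And>s m. s \<ge> 2 \<Longrightarrow> real m \<le> s \<Longrightarrow> s < real m + 1 \<Longrightarrow>
    \<bar>(\<Sum>p\<in>{p. prime p \<and> p \<le> m}. l (s / real p)) - s / ln s * (l 1 + I1)\<bar> \<le> C1 * s / (ln s)\<^sup>2"
    using sum_small_primes by blast
  obtain C2 where C2: "C2 > 0" "\<And>s m N. s \<ge> 2 \<Longrightarrow> real m \<le> s \<Longrightarrow> s < real m + 1 \<Longrightarrow> m < N \<Longrightarrow>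
    \<bar>(\<Sum>p\<in>{p. prime p \<and> m < p \<and> p \<le> N}. f (s / real p)) - s / ln s * (I0 - f 1)\<bar> \<le> C2 * s / (ln s)\<^sup>2 + C2 * s\<^sup>2 / real N"
    using sum_large_primes by blast
  define C3 where "C3 = 2 / q * (4 + 2 * A / \<delta>)"
  define C4 where "C4 = 2 / q * (2 * ((1 + A) * exp (1 + A) + (\<kappa> + A)) + A * exp (1 + A) + A)"
  have C34: "C3 > 0" "C4 > 0" unfolding C3_def C4_def using q A_pos \<delta> \<kappa> by (auto intro!: mult_pos_pos add_pos_pos divide_pos_pos)
  have K00: "K0 \<ge> 0"
  proof -
    have "0 \<le> K0 / (ln (real 2))\<^sup>2" using mertens[of 2] by linarith
    then show ?thesis by (simp add: zero_le_divide_iff)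
  qed
  have sq: "sqrt s \<le> 16 * s / (ln s)\<^sup>2" if "s \<ge> 4" for s :: real
  proof -
    have "ln s = 4 * ln (s powr (1/4))" using that by (simp add: ln_powr)
    also have "ln (s powr (1/4)) \<le> s powr (1/4)" using ln_le_minus_one[of "s powr (1/4)"] that by simp
    finally have "(ln s)\<^sup>2 \<le> (4 * s powr (1/4))\<^sup>2" using that by (intro power_mono) auto
    also have "\<dots> = 16 * (s powr (1/4) * s powr (1/4))" by (simp add: power2_eq_square)
    also have "s powr (1/4) * s powr (1/4) = s powr (1/4 + 1/4)" by (rule powr_add[symmetric])
    also have "(1/4 + 1/4 :: real) = 1/2" by simp
    finally have "(ln s)\<^sup>2 \<le> 16 * sqrt s" using that by (simp add: powr_half_sqrt)
    then have "sqrt s * (ln s)\<^sup>2 \<le> sqrt s * (16 * sqrt s)" using that by (intro mult_left_mono) auto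
    also have "\<dots> = 16 * s" using that by simp
    finally show ?thesis using that by (simp add: pos_le_divide_eq)
  qed
  define C where "C = C1 + C2 + 32 * C3 + 8 * C4 + 4 * K0 + 4"
  have Cpos: "C > 0" using C1 C2 C34 K00 by (simp add: C_def)
  show ?thesis
  proof (rule that[OF Cpos])
    fix s :: real assume s4: "s \<ge> 4"
    then have s: "s \<ge> 2" by simp
    define m where "m = nat \<lfloor>s\<rfloor>"
    have m: "real m \<le> s" "s < real m + 1" "m \<ge> 4" using s4 unfolding m_def by linarith+
    have ls: "ln s > 0" using s by simp
    define w where "w = s / (ln s)\<^sup>2"
    have w: "w > 0" using s ls by (simp add: w_def)
    let ?P = "{p. prime p \<and> p \<le> m}"
    define main where "main = s * (ln (ln s) + c0) + s / ln s * (I0 - I1 - 1)"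
    have small: "\<bar>(\<Sum>p\<in>?P. kap s p) - (s * (\<Sum>p\<in>?P. a p) - (\<Sum>p\<in>?P. l (s / real p)))\<bar> \<le> 32 * C3 * w"
    proof -
      have "(\<Sum>p\<in>?P. kap s p) - (s * (\<Sum>p\<in>?P. a p) - (\<Sum>p\<in>?P. l (s / real p))) = (\<Sum>p\<in>?P. kap s p - (s * a p - l (s / real p)))"
        by (simp add: sum_subtractf sum_distrib_left)
      also have "\<bar>\<dots>\<bar> \<le> (\<Sum>p\<in>?P. C3 * (1 / real p))"
      proof (rule order_trans[OF sum_abs sum_mono])
        fix p assume "p \<in> ?P"
        then show "\<bar>kap s p - (s * a p - l (s / real p))\<bar> \<le> C3 * (1 / real p)"
          using small_prime_error[of p s] m by (simp add: C3_def)
      qed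
      also have "\<dots> = C3 * (\<Sum>p\<in>?P. 1 / real p)" by (simp add: sum_distrib_left)
      also have "(\<Sum>p\<in>?P. 1 / real p) \<le> 2 * sqrt s"
      proof -
        have "(\<Sum>p\<in>?P. 1 / real p) \<le> (\<Sum>n\<in>{1..m}. 1 / real n)" by (rule sum_mono2) (auto dest: prime_ge_1_nat)
        also have "\<dots> \<le> (\<Sum>n\<in>{1..m}. real n powr (1/2 - 1))"
        proof (rule sum_mono)
          fix n assume "n \<in> {1..m}"
          then show "1 / real n \<le> real n powr (1/2 - 1)" using powr_mono[of "-1" "1/2 - 1" "real n"] by (simp add: powr_minus_divide)
        qed
        also have "\<dots> = (\<Sum>n<m. real (Suc n) powr (1/2 - 1))" by (rule sum.reindex_bij_witness[of _ Suc "\<lambda>k. k - 1"]) auto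
        also have "\<dots> \<le> real m powr (1/2) / (1/2)" by (rule sum_powr_le) auto
        also have "\<dots> \<le> 2 * sqrt s" using m by (simp add: powr_half_sqrt)
        finally show ?thesis .
      qed
      also have "2 * sqrt s \<le> 32 * w" using sq[OF s4] by (simp add: w_def)
      finally show ?thesis using C34 by (simp add: mult_ac)
    qed
    have large: "\<bar>(\<Sum>p\<in>{p. prime p \<and> m < p \<and> p \<le> N}. kap s p) - (\<Sum>p\<in>{p. prime p \<and> m < p \<and> p \<le> N}. f (s / real p))\<bar> \<le> 8 * C4 * w" for N
    proof -
      let ?Q = "{p. prime p \<and> m < p \<and> p \<le> N}"
      have fin: "finite ?Q" by (rule finite_subset[of _ "{..N}"]) auto
      have "\<bar>(\<Sum>p\<in>?Q. kap s p) - (\<Sum>p\<in>?Q. f (s / real p))\<bar> \<le> (\<Sum>p\<in>?Q. C4 * s * (1 / (real p)\<^sup>2))"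
        unfolding sum_subtractf[symmetric]
      proof (rule order_trans[OF sum_abs sum_mono])
        fix p assume "p \<in> ?Q"
        then have "prime p" "s \<le> real p" using m by auto
        then show "\<bar>kap s p - f (s / real p)\<bar> \<le> C4 * s * (1 / (real p)\<^sup>2)"
          using large_prime_error[of p s] s by (simp add: C4_def)
      qed
      also have "\<dots> = C4 * s * (\<Sum>p\<in>?Q. 1 / (real p)\<^sup>2)" by (rule sum_distrib_left[symmetric])
      also have "\<dots> \<le> C4 * s * (1 / real m)" using C34 s m by (intro mult_left_mono sum_inverse_square_tail fin) auto
      also have "C4 * s * (1 / real m) = C4 * (s * (1 / real m))" by (rule mult.assoc)
      also have "\<dots> \<le> C4 * 2"
      proof (intro mult_left_mono)
        show "s * (1 / real m) \<le> 2" using m by (simp add: pos_divide_le_eq)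
      qed (use C34 in auto)
      also have "\<dots> \<le> C4 * (2 * (4 * w))" using ln_sq_le(1)[OF s] C34 by (intro mult_left_mono) (auto simp: w_def)
      finally show ?thesis by simp
    qed
    have mert: "\<bar>s * (\<Sum>p\<in>?P. a p) - s * (ln (ln s) + c0)\<bar> \<le> (4 * K0 + 4) * w"
    proof -
      have lm: "ln (real m) > 0" using m by simp
      have lms: "ln (real m) \<le> ln s" using m by simp
      have "s \<le> real m * real m"
      proof -
        have "2 * real m \<le> real m * real m" using m by (intro mult_right_mono) auto
        moreover have "real m \<ge> 4" using m by simp
        ultimately show ?thesis using m(2) by linarith
      qed
      then have "ln s \<le> ln (real m * real m)" using s m by (subst ln_le_cancel_iff) auto
      also have "\<dots> = 2 * ln (real m)" using m by (subst ln_mult) auto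
      finally have l2: "ln s / 2 \<le> ln (real m)" by simp
      have A1: "\<bar>(\<Sum>p\<in>?P. a p) - ln (ln (real m)) - c0\<bar> \<le> 4 * K0 / (ln s)\<^sup>2"
      proof -
        have "K0 / (ln (real m))\<^sup>2 \<le> K0 / (ln s / 2)\<^sup>2" using K00 l2 lm ls by (intro divide_left_mono power_mono mult_pos_pos) auto
        moreover have "K0 / (ln s / 2)\<^sup>2 = 4 * K0 / (ln s)\<^sup>2" by (simp add: power_divide)
        moreover have "\<bar>(\<Sum>p\<in>?P. a p) - ln (ln (real m)) - c0\<bar> \<le> K0 / (ln (real m))\<^sup>2" using mertens[of m] m by simp
        ultimately show ?thesis by linarith
      qed
      have A2: "0 \<le> ln (ln s) - ln (ln (real m))" "s * (ln (ln s) - ln (ln (real m))) \<le> 4 / ln s"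
      proof -
        show "0 \<le> ln (ln s) - ln (ln (real m))" using lm lms by simp
        have "ln (ln s) - ln (ln (real m)) = ln (ln s / ln (real m))" using lm ls by (simp add: ln_div)
        also have "\<dots> \<le> ln s / ln (real m) - 1" using lm ls by (intro ln_le_minus_one) auto
        also have "\<dots> = (ln s - ln (real m)) / ln (real m)" using lm by (simp add: diff_divide_distrib)
        also have "ln s - ln (real m) = ln (s / real m)" using s m by (simp add: ln_div)
        also have "ln (s / real m) \<le> s / real m - 1" using s m by (intro ln_le_minus_one) auto
        also have "s / real m - 1 = (s - real m) / real m" using m by (simp add: diff_divide_distrib)
        also have "\<dots> \<le> 1 / real m" using m by (intro divide_right_mono) auto
        also have "1 / real m \<le> 2 / s" using m by (simp add: field_simps)
        finally have "ln (ln s) - ln (ln (real m)) \<le> 2 / s / ln (real m)" using lm by (simp add: divide_right_mono)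
        also have "\<dots> \<le> 2 / s / (ln s / 2)" using l2 ls s lm by (intro divide_left_mono mult_pos_pos) auto
        finally have "s * (ln (ln s) - ln (ln (real m))) \<le> s * (2 / s / (ln s / 2))" using s by (intro mult_left_mono) auto
        then show "s * (ln (ln s) - ln (ln (real m))) \<le> 4 / ln s" using s by simp
      qed
      have "s * \<bar>(\<Sum>p\<in>?P. a p) - ln (ln (real m)) - c0\<bar> \<le> s * (4 * K0 / (ln s)\<^sup>2)" using A1 s by (intro mult_left_mono) auto
      then have "\<bar>s * ((\<Sum>p\<in>?P. a p) - ln (ln (real m)) - c0)\<bar> \<le> s * (4 * K0 / (ln s)\<^sup>2)" using s by (simp only: abs_mult)
      moreover have "s * (4 * K0 / (ln s)\<^sup>2) = 4 * K0 * w" by (simp add: w_def)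
      moreover have "(4 * K0 + 4) * w = 4 * K0 * w + 4 * w" by (rule distrib_right)
      moreover have "4 / ln s \<le> 4 * w" using ln_sq_le(2)[OF s] by (simp add: w_def)
      moreover have "s * (\<Sum>p\<in>?P. a p) - s * (ln (ln s) + c0) = s * ((\<Sum>p\<in>?P. a p) - ln (ln (real m)) - c0) - s * (ln (ln s) - ln (ln (real m)))"
        by (simp add: algebra_simps)
      moreover have "0 \<le> s * (ln (ln s) - ln (ln (real m)))" using A2 s by simp
      ultimately show ?thesis using A2(2) by linarith
    qed
    have T1: "\<bar>(\<Sum>p\<in>?P. l (s / real p)) - s / ln s * (l 1 + I1)\<bar> \<le> C1 * w" using C1(2)[OF s m(1,2)] by (simp add: w_def)
    \<comment> \<open>The boundary values at the splitting point merge because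
      \<open>f 1 + l 1 = 1\<close>.\<close>
    have comb: "(s / ln s) * (I0 - f 1) - (s / ln s) * (l 1 + I1) = s / ln s * (I0 - I1 - 1)"
      by (simp add: f_def algebra_simps add_divide_distrib diff_divide_distrib)
    have fin: "\<bar>(\<Sum>p\<in>{p. prime p \<and> p \<le> N}. ln (mom p s)) - main\<bar> \<le> C * w + C2 * s\<^sup>2 / real N" if N: "N > m" for N
    proof -
      have T2: "\<bar>(\<Sum>p\<in>{p. prime p \<and> m < p \<and> p \<le> N}. f (s / real p)) - s / ln s * (I0 - f 1)\<bar> \<le> C2 * w + C2 * s\<^sup>2 / real N"
        using C2(2)[OF s m(1,2) N] by (simp add: w_def)
      have "{p. prime p \<and> p \<le> N} = ?P \<union> {p. prime p \<and> m < p \<and> p \<le> N}" using N by auto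
      then have "(\<Sum>p\<in>{p. prime p \<and> p \<le> N}. kap s p) = (\<Sum>p\<in>?P. kap s p) + (\<Sum>p\<in>{p. prime p \<and> m < p \<and> p \<le> N}. kap s p)"
        by (subst sum.union_disjoint[symmetric]) (auto intro: finite_subset[of _ "{..N}"])
      moreover have "(\<Sum>p\<in>{p. prime p \<and> p \<le> N}. kap s p) = (\<Sum>p\<in>{p. prime p \<and> p \<le> N}. ln (mom p s))"
        by (intro sum.cong) (auto simp: kap_def)
      ultimately have split: "(\<Sum>p\<in>{p. prime p \<and> p \<le> N}. ln (mom p s)) = (\<Sum>p\<in>?P. kap s p) + (\<Sum>p\<in>{p. prime p \<and> m < p \<and> p \<le> N}. kap s p)"
        by simp
      have Cw: "C * w = 32 * C3 * w + 8 * C4 * w + (4 * K0 + 4) * w + C1 * w + C2 * w" by (simp add: C_def algebra_simps)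
      have add: "\<bar>(P + Q) - (Y + X3)\<bar> \<le> Cw + z"
        if "\<bar>P - (sa - L)\<bar> \<le> c3" "\<bar>Q - F\<bar> \<le> c4" "\<bar>sa - Y\<bar> \<le> k0" "\<bar>L - X1\<bar> \<le> c1" "\<bar>F - X2\<bar> \<le> c2 + z" "X2 - X1 = X3"
          "Cw = c3 + c4 + k0 + c1 + c2" for P Q sa L F Y X1 X2 X3 c1 c2 c3 c4 k0 z Cw :: real
        using that by linarith
      show ?thesis unfolding split main_def by (rule add[OF small large mert T1 T2 comb Cw])
    qed
    have "(\<lambda>N. \<bar>(\<Sum>p\<in>{p. prime p \<and> p \<le> N}. ln (mom p s)) - main\<bar>) \<longlonglongrightarrow> \<bar>cumulant s - main\<bar>"
      by (intro tendsto_intros cumulant_tendsto s)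
    moreover have "(\<lambda>N. C * w + C2 * s\<^sup>2 / real N) \<longlonglongrightarrow> C * w + 0"
      by (intro tendsto_intros lim_const_over_n)
    ultimately have "\<bar>cumulant s - main\<bar> \<le> C * w + 0"
      by (rule LIMSEQ_le) (intro exI[of _ "Suc m"] allI impI fin, simp)
    then show "\<bar>cumulant s - (s * (ln (ln s) + c0) + s / ln s * (I0 - I1 - 1))\<bar> \<le> C * s / (ln s)\<^sup>2"
      by (simp add: main_def w_def)
  qed
qed

section \<open>Second differences of the cumulant\<close>

definition B :: real where "B = \<kappa> + 2 * A"

lemma B_gt_1: "B > 1" unfolding B_def using \<kappa> A_pos by simp

lemma atoms: assumes "prime p" shows "a p \<ge> 0" "b p \<le> 0" "a p - b p \<le> B / real p"
proof -
  have p0: "real p > 0" "real p \<ge> 1" using prime_ge_1_nat[OF assms] by auto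
  show "b p \<le> 0" by (rule b_neg[OF assms])
  have "0 \<le> \<delta> / real p" using \<delta> by simp
  then show "a p \<ge> 0" using a_lower[OF assms] by linarith
  have "A / (real p)\<^sup>2 \<le> A / real p" using A_pos p0 by (intro divide_left_mono) (auto simp: power2_eq_square)
  moreover have "B / real p = 1 / real p + (\<kappa> - 1) / real p + A / real p + A / real p"
    by (simp add: B_def add_divide_distrib diff_divide_distrib)
  ultimately show "a p - b p \<le> B / real p" using a_approx[OF assms] b_approx[OF assms] by linarith
qed

text \<open>In \<open>mom (s+h) * mom (s-h) - (mom s)^2\<close> the diagonal terms cancel, and each
  of the three pairs of atoms \<open>x\<close>, \<open>y\<close> leaves a multiple of
  \<open>exp (s (x+y)) (2 cosh (h (x-y)) - 2)\<close>, of order \<open>h^2 / p^2\<close>. Only one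
  atom is positive, so \<open>x + y \<le> a p\<close>, whereas the divisor \<open>(mom s)^2\<close>
  is at least \<open>(q/2)^2 exp (2 s a p)\<close>; the quotient keeps a factor
  \<open>exp (- s a p)\<close>. The condition on \<open>h\<close> spends at most half of that decay
  on \<open>exp z\<close>. The 12 is 3 pairs times 4 from \<open>q/2\<close>.\<close>

lemma mom_second_difference:
  assumes p: "prime p" and s: "s \<ge> 0" and h: "h \<ge> 0" "h * B \<le> \<delta> * s / 2"
  shows "ln (mom p (s + h)) + ln (mom p (s - h)) - 2 * ln (mom p s)
    \<le> 12 * B\<^sup>2 / q\<^sup>2 * h\<^sup>2 * (1 / (real p)\<^sup>2 * exp (- (\<delta> / 2 * s / real p)))"
proof -
  have p0: "real p > 0" "real p \<ge> 1" using prime_ge_1_nat[OF p] by auto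
  note at = atoms[OF p]
  define z where "z = h * B / real p"
  have z: "\<bar>h * x\<bar> \<le> z" if "\<bar>x\<bar> \<le> B / real p" for x
    unfolding z_def abs_mult using that h mult_left_mono[of "\<bar>x\<bar>" "B / real p" h] by simp
  define E where "E = exp (s * a p) * (z\<^sup>2 * exp z)"
  have E0: "E \<ge> 0" by (simp add: E_def)
  have pair: "0 \<le> exp (s * x) * (exp (h * y) + exp (- (h * y)) - 2)" "exp (s * x) * (exp (h * y) + exp (- (h * y)) - 2) \<le> E"
    if "x \<le> a p" "\<bar>y\<bar> \<le> B / real p" for x y
  proof -
    note c = cosh_bound[OF z[OF that(2)]]
    show "0 \<le> exp (s * x) * (exp (h * y) + exp (- (h * y)) - 2)" using c by simp
    show "exp (s * x) * (exp (h * y) + exp (- (h * y)) - 2) \<le> E"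
      unfolding E_def using c that s by (intro mult_mono) (auto simp: mult_left_mono)
  qed
  define w1 w2 w3 where "w1 = d p" and "w2 = (1 - d p) * q" and "w3 = (1 - d p) * (1 - q)"
  have w: "0 \<le> w1" "0 \<le> w2" "0 \<le> w3" "w1 \<le> 1" "w2 \<le> 1" "w3 \<le> 1"
    using d_bounds[OF p] q unfolding w1_def w2_def w3_def by (auto intro!: mult_nonneg_nonneg mult_le_one)
  have ww: "w1 * w2 \<le> 1" "w1 * w3 \<le> 1" "w2 * w3 \<le> 1" "0 \<le> w1 * w2" "0 \<le> w1 * w3" "0 \<le> w2 * w3"
    using w by (auto intro: mult_le_one)
  have m: "mom p t = w1 + w2 * exp (t * a p) + w3 * exp (t * b p)" for t
    by (simp add: mom_def w1_def w2_def w3_def algebra_simps)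
  define \<alpha> \<beta> Ea Eb where "\<alpha> = exp (s * a p)" and "\<beta> = exp (s * b p)" and "Ea = exp (h * a p)" and "Eb = exp (h * b p)"
  define Fa Fb where "Fa = exp (- (h * a p))" and "Fb = exp (- (h * b p))"
  have F: "Ea * Fa = 1" "Eb * Fb = 1" by (simp_all add: Ea_def Eb_def Fa_def Fb_def flip: exp_add)
  have plus: "mom p (s + h) = w1 + w2 * (\<alpha> * Ea) + w3 * (\<beta> * Eb)"
    by (simp add: m \<alpha>_def \<beta>_def Ea_def Eb_def distrib_right flip: exp_add)
  have minus: "mom p (s - h) = w1 + w2 * (\<alpha> * Fa) + w3 * (\<beta> * Fb)"
    by (simp add: m \<alpha>_def \<beta>_def Fa_def Fb_def left_diff_distrib flip: exp_add)
  have ms: "mom p s = w1 + w2 * \<alpha> + w3 * \<beta>" by (simp add: m \<alpha>_def \<beta>_def)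
  have "mom p (s + h) * mom p (s - h) - (mom p s)\<^sup>2
      = w1 * w2 * (\<alpha> * (Ea + Fa - 2)) + w1 * w3 * (\<beta> * (Eb + Fb - 2)) + w2 * w3 * (\<alpha> * \<beta> * (Ea * Fb + Fa * Eb - 2))
        + w2 * w2 * (\<alpha> * \<alpha>) * (Ea * Fa - 1) + w3 * w3 * (\<beta> * \<beta>) * (Eb * Fb - 1)"
    unfolding plus minus ms by (simp add: power2_eq_square algebra_simps)
  also have "\<dots> = w1 * w2 * (\<alpha> * (Ea + Fa - 2)) + w1 * w3 * (\<beta> * (Eb + Fb - 2)) + w2 * w3 * (\<alpha> * \<beta> * (Ea * Fb + Fa * Eb - 2))"
    by (simp add: F)
  also have "\<dots> \<le> 1 * E + 1 * E + 1 * E"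
  proof (intro add_mono mult_mono)
    have ab: "\<bar>a p\<bar> \<le> B / real p" "\<bar>b p\<bar> \<le> B / real p" "\<bar>a p - b p\<bar> \<le> B / real p" using at by linarith+
    show "\<alpha> * (Ea + Fa - 2) \<le> E" "0 \<le> \<alpha> * (Ea + Fa - 2)"
      using pair[of "a p" "a p"] ab by (simp_all add: \<alpha>_def Ea_def Fa_def)
    show "\<beta> * (Eb + Fb - 2) \<le> E" "0 \<le> \<beta> * (Eb + Fb - 2)"
      using pair[of "b p" "b p"] ab at by (simp_all add: \<beta>_def Eb_def Fb_def)
    have "\<alpha> * \<beta> = exp (s * (a p + b p))" "Ea * Fb = exp (h * (a p - b p))" "Fa * Eb = exp (- (h * (a p - b p)))"
      by (simp_all add: \<alpha>_def \<beta>_def Ea_def Eb_def Fa_def Fb_def algebra_simps flip: exp_add)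
    then show "\<alpha> * \<beta> * (Ea * Fb + Fa * Eb - 2) \<le> E" "0 \<le> \<alpha> * \<beta> * (Ea * Fb + Fa * Eb - 2)"
      using pair[of "a p + b p" "a p - b p"] ab at by simp_all
  qed (use ww in auto)
  finally have M: "mom p (s + h) * mom p (s - h) - (mom p s)\<^sup>2 \<le> 3 * E" by simp
  define m0 where "m0 = mom p s"
  have m0: "m0 > 0" "(q / 2 * exp (s * a p))\<^sup>2 \<le> m0\<^sup>2" using mom_ge[OF p, of s] q by (auto simp: m0_def intro!: power_mono)
  have pos: "mom p (s + h) > 0" "mom p (s - h) > 0" using mom_ge[OF p] by auto
  have "ln (mom p (s + h)) + ln (mom p (s - h)) - 2 * ln m0 = ln (mom p (s + h) * mom p (s - h) / m0\<^sup>2)"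
    using pos m0 by (simp add: ln_div ln_mult power2_eq_square)
  also have "\<dots> \<le> mom p (s + h) * mom p (s - h) / m0\<^sup>2 - 1" using pos m0 by (intro ln_le_minus_one) auto
  also have "\<dots> = (mom p (s + h) * mom p (s - h) - m0\<^sup>2) / m0\<^sup>2" using m0 by (simp add: diff_divide_distrib)
  also have "\<dots> \<le> 3 * E / m0\<^sup>2" using M by (intro divide_right_mono) (auto simp: m0_def)
  also have "\<dots> \<le> 3 * E / (q / 2 * exp (s * a p))\<^sup>2" using m0 E0 q by (intro divide_left_mono) auto
  also have "\<dots> = 12 * z\<^sup>2 / q\<^sup>2 * (exp z / exp (s * a p))" by (simp add: E_def power2_eq_square)
  also have "exp z / exp (s * a p) = exp (z - s * a p)" by (simp add: exp_diff)
  also have "12 * z\<^sup>2 / q\<^sup>2 * exp (z - s * a p) \<le> 12 * z\<^sup>2 / q\<^sup>2 * exp (- (\<delta> / 2 * s / real p))"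
  proof (intro mult_left_mono)
    have "z \<le> (\<delta> * s / 2) / real p" unfolding z_def using h by (intro divide_right_mono) auto
    moreover have "s * (\<delta> / real p) \<le> s * a p" using a_lower[OF p] s by (rule mult_left_mono)
    moreover have "s * (\<delta> / real p) = 2 * (\<delta> / 2 * s / real p)" "(\<delta> * s / 2) / real p = \<delta> / 2 * s / real p" by simp_all
    ultimately have "z - s * a p \<le> - (\<delta> / 2 * s / real p)" by linarith
    then show "exp (z - s * a p) \<le> exp (- (\<delta> / 2 * s / real p))" by simp
  qed auto
  also have "12 * z\<^sup>2 / q\<^sup>2 = 12 * B\<^sup>2 / q\<^sup>2 * h\<^sup>2 * (1 / (real p)\<^sup>2)"
    by (simp add: z_def power_divide power_mult_distrib mult_ac)
  finally show ?thesis by (simp add: m0_def mult.assoc)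
qed

lemma cumulant_second_difference:
  obtains C where "C > 0" "\<And>s h. s \<ge> 4 \<Longrightarrow> 0 \<le> h \<Longrightarrow> h * B \<le> \<delta> * s / 2 \<Longrightarrow>
    cumulant (s + h) + cumulant (s - h) - 2 * cumulant s \<le> C * h\<^sup>2 / s"
proof -
  define C where "C = 12 * B\<^sup>2 / q\<^sup>2 * (2 / (\<delta> / 2)\<^sup>2 + 2)"
  have "C > 0" unfolding C_def using B_gt_1 q \<delta> by (intro mult_pos_pos add_nonneg_pos divide_pos_pos) auto
  then show ?thesis
  proof (rule that)
    fix s h :: real assume s: "s \<ge> 4" and h: "0 \<le> h" "h * B \<le> \<delta> * s / 2"
    have "h * 1 \<le> h * B" using h B_gt_1 by (intro mult_left_mono) auto
    moreover have "\<delta> * s \<le> 1 * s" using \<delta> s by (intro mult_right_mono) auto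
    ultimately have sh: "s - h \<ge> 2" "s + h \<ge> 2" "s \<ge> 2" using s h by linarith+
    have "(\<lambda>N. (\<Sum>p\<in>{p. prime p \<and> p \<le> N}. ln (mom p (s + h))) + (\<Sum>p\<in>{p. prime p \<and> p \<le> N}. ln (mom p (s - h)))
        - 2 * (\<Sum>p\<in>{p. prime p \<and> p \<le> N}. ln (mom p s))) \<longlonglongrightarrow> cumulant (s + h) + cumulant (s - h) - 2 * cumulant s"
      by (intro tendsto_intros cumulant_tendsto sh)
    then show "cumulant (s + h) + cumulant (s - h) - 2 * cumulant s \<le> C * h\<^sup>2 / s"
    proof (rule LIMSEQ_le_const2, intro exI allI impI)
      fix N :: nat
      let ?P = "{p. prime p \<and> p \<le> N}"
      have "(\<Sum>p\<in>?P. ln (mom p (s + h))) + (\<Sum>p\<in>?P. ln (mom p (s - h))) - 2 * (\<Sum>p\<in>?P. ln (mom p s))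
        = (\<Sum>p\<in>?P. ln (mom p (s + h)) + ln (mom p (s - h)) - 2 * ln (mom p s))"
        by (simp add: sum.distrib sum_subtractf sum_distrib_left)
      also have "\<dots> \<le> (\<Sum>p\<in>?P. 12 * B\<^sup>2 / q\<^sup>2 * h\<^sup>2 * (1 / (real p)\<^sup>2 * exp (- (\<delta> / 2 * s / real p))))"
        by (rule sum_mono, rule mom_second_difference) (use s h in auto)
      also have "\<dots> = 12 * B\<^sup>2 / q\<^sup>2 * h\<^sup>2 * (\<Sum>p\<in>?P. 1 / (real p)\<^sup>2 * exp (- (\<delta> / 2 * s / real p)))"
        by (rule sum_distrib_left[symmetric])
      also have "\<dots> \<le> 12 * B\<^sup>2 / q\<^sup>2 * h\<^sup>2 * ((2 / (\<delta> / 2)\<^sup>2 + 2) / s)"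
        by (intro mult_left_mono sum_inverse_sq_exp_le) (use \<delta> s finite_primes_le in auto)
      also have "\<dots> = C * h\<^sup>2 / s" by (simp add: C_def)
      finally show "(\<Sum>p\<in>?P. ln (mom p (s + h))) + (\<Sum>p\<in>?P. ln (mom p (s - h))) - 2 * (\<Sum>p\<in>?P. ln (mom p s)) \<le> C * h\<^sup>2 / s" .
    qed
  qed
qed

end

section \<open>Large deviations\<close>

text \<open>\<open>(1+y) exp (-y)\<close> is the profile of the exponent around the saddle point,
  with its strict maximum at \<open>y = 0\<close>. The second part quantifies the loss away from the
  maximum; the threshold \<open>144 * K2\<close> for \<open>T\<close> in
  \<open>tilted_lower_bound\<close> is matched to the gap \<open>1/36\<close>.\<close>

lemma one_plus_exp_minus_bounds:
  fixes y :: real assumes "\<bar>y\<bar> \<le> 1"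
  shows "(1 + y) * exp (-y) \<le> 1" "\<bar>y\<bar> \<ge> 1/2 \<Longrightarrow> (1 + y) * exp (-y) \<le> 35/36"
proof -
  show "(1 + y) * exp (-y) \<le> 1"
    using exp_ge_add_one_self[of y] by (simp add: exp_minus pos_divide_le_eq flip: divide_inverse)
  assume y: "\<bar>y\<bar> \<ge> 1/2"
  have "(1 + y / 2)\<^sup>2 \<le> (exp (y / 2))\<^sup>2" using assms exp_ge_add_one_self[of "y / 2"] by (intro power_mono) auto
  also have "(exp (y / 2))\<^sup>2 = exp y" by (simp add: power2_eq_square flip: exp_add)
  finally have e: "1 + y + \<bar>y\<bar> * \<bar>y\<bar> / 4 \<le> exp y" by (simp add: power2_eq_square algebra_simps)
  have "1/2 * \<bar>y\<bar> \<le> \<bar>y\<bar> * \<bar>y\<bar>" using y by (intro mult_right_mono) auto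
  then have "1 + y \<le> 35/36 * exp y" using e y by linarith
  then have "(1 + y) * exp (-y) \<le> 35/36 * exp y * exp (-y)" by (intro mult_right_mono) auto
  also have "\<dots> = 35/36" by (simp flip: exp_add)
  finally show "(1 + y) * exp (-y) \<le> 35/36" .
qed

context prime_model
begin

text \<open>Write \<open>c = I0 - I1\<close> and \<open>ln u = T - c - y\<close> with
  \<open>|y| \<le> 1\<close>. Then \<open>ln (ln u) = ln T - (c+y)/T + O(1/T^2)\<close> and
  \<open>1 / ln u = 1/T + O(1/T^2)\<close>, so the terms of order \<open>u/T\<close> add up to
  \<open>-(c+y) + (c-1) = -(1+y)\<close>. The three parts of \<open>K\<close> are the error of the
  cumulant and those of these two expansions.\<close>

lemma cumulant_tilted:
  obtains K where "K > 0" "\<forall>\<^sub>F T in at_top. \<forall>u. \<bar>T - (I0 - I1) - ln u\<bar> \<le> 1 \<and> u > 0 \<longrightarrow>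
    u \<ge> 4 \<and> \<bar>cumulant u - u * (ln T + c0) + u / T * (1 + (T - (I0 - I1) - ln u))\<bar> \<le> K * u / T\<^sup>2"
proof -
  obtain C where C: "C > 0" "\<And>s. s \<ge> 4 \<Longrightarrow> \<bar>cumulant s - (s * (ln (ln s) + c0) + s / ln s * (I0 - I1 - 1))\<bar> \<le> C * s / (ln s)\<^sup>2"
    using cumulant_asymptotic by blast
  define c where "c = I0 - I1"
  define g where "g = \<bar>c\<bar> + 1"
  have g: "g > 0" "\<bar>c\<bar> \<le> g" "\<bar>c - 1\<bar> \<le> g" by (auto simp: g_def)
  define K where "K = 4 * C + 2 * g\<^sup>2 + 2 * g\<^sup>2"
  have "K > 0" using C g by (auto simp: K_def intro!: add_pos_nonneg)
  moreover have "\<forall>\<^sub>F T in at_top. \<forall>u. \<bar>T - c - ln u\<bar> \<le> 1 \<and> u > 0 \<longrightarrow>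
    u \<ge> 4 \<and> \<bar>cumulant u - u * (ln T + c0) + u / T * (1 + (T - c - ln u))\<bar> \<le> K * u / T\<^sup>2"
    using eventually_ge_at_top[of "2 * g + 8"]
  proof eventually_elim
    case (elim T)
    show ?case
    proof (intro allI impI)
      fix u :: real assume u: "\<bar>T - c - ln u\<bar> \<le> 1 \<and> u > 0"
      define y where "y = T - c - ln u"
      have y: "\<bar>y\<bar> \<le> 1" "ln u = T - (c + y)" using u by (auto simp: y_def)
      have cy: "\<bar>c + y\<bar> \<le> g" using y by (auto simp: g_def)
      have T: "T > 0" "T \<ge> 2 * g" using elim g by auto
      have lu: "ln u \<ge> T / 2" "ln u > 0" "ln u \<ge> 4" using y cy elim by linarith+
      have "u = exp (ln u)" using u by simp
      moreover have "exp (ln u) \<ge> 1 + ln u" by (rule exp_ge_add_one_self)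
      ultimately have u4: "u \<ge> 4" using lu by linarith
      have lsq: "C * u / (ln u)\<^sup>2 \<le> 4 * C * (u / T\<^sup>2)"
      proof -
        have "C * u / (ln u)\<^sup>2 \<le> C * u / (T / 2)\<^sup>2" using lu T u C by (intro divide_left_mono power_mono mult_pos_pos) auto
        then show ?thesis by (simp add: power_divide mult_ac)
      qed
      have E1: "\<bar>cumulant u - (u * (ln (ln u) + c0) + u / ln u * (c - 1))\<bar> \<le> 4 * C * (u / T\<^sup>2)"
        using C(2)[OF u4] lsq by (simp add: c_def)
      define x where "x = - ((c + y) / T)"
      have x: "\<bar>x\<bar> \<le> g / T" using cy T by (simp add: x_def divide_right_mono)
      have "g / T \<le> 1/2" using T by (simp add: pos_divide_le_eq)
      with x have "\<bar>x\<bar> \<le> 1/2" by linarith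
      then have lx: "\<bar>ln (1 + x) - x\<bar> \<le> 2 * x\<^sup>2" by (rule abs_ln_one_plus_x_minus_x_bound)
      have "\<bar>x\<bar>\<^sup>2 \<le> (g / T)\<^sup>2" using x by (intro power_mono) auto
      with lx have lx: "\<bar>ln (1 + x) - x\<bar> \<le> 2 * g\<^sup>2 / T\<^sup>2" by (simp add: power_divide)
      have "1 + x = ln u / T" using T unfolding y(2) x_def by (simp add: diff_divide_distrib)
      then have "ln (1 + x) = ln (ln u) - ln T" using T lu by (simp add: ln_div)
      with lx have "\<bar>ln (ln u) - ln T + (c + y) / T\<bar> \<le> 2 * g\<^sup>2 / T\<^sup>2" by (simp add: x_def)
      then have "u * \<bar>ln (ln u) - ln T + (c + y) / T\<bar> \<le> u * (2 * g\<^sup>2 / T\<^sup>2)" using u by (intro mult_left_mono) auto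
      then have E2: "\<bar>u * (ln (ln u) - ln T + (c + y) / T)\<bar> \<le> 2 * g\<^sup>2 * (u / T\<^sup>2)" using u by (simp add: abs_mult mult_ac)
      have "1 / ln u - 1 / T = (c + y) / (ln u * T)" using lu T y(2) by (simp add: field_simps)
      also have "\<bar>\<dots>\<bar> \<le> g / (T / 2 * T)" using cy lu T g unfolding abs_divide
        by (intro frac_le) (auto simp: abs_mult mult_right_mono)
      finally have "\<bar>1 / ln u - 1 / T\<bar> \<le> 2 * g / T\<^sup>2" by (simp add: power2_eq_square mult_ac)
      then have "\<bar>u * (c - 1)\<bar> * \<bar>1 / ln u - 1 / T\<bar> \<le> (u * g) * (2 * g / T\<^sup>2)" using u g unfolding abs_mult by (intro mult_mono) auto
      then have E3: "\<bar>u * (c - 1) * (1 / ln u - 1 / T)\<bar> \<le> 2 * g\<^sup>2 * (u / T\<^sup>2)" unfolding abs_mult power2_eq_square by (simp add: mult_ac)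
      have e: "cumulant u - u * (ln T + c0) + u / T * (1 + (T - c - ln u)) = (cumulant u - (u * (ln (ln u) + c0) + u / ln u * (c - 1)))
         + u * (ln (ln u) - ln T + (c + y) / T) + u * (c - 1) * (1 / ln u - 1 / T)"
        unfolding y_def[symmetric] by (simp add: algebra_simps add_divide_distrib diff_divide_distrib)
      have "\<bar>cumulant u - u * (ln T + c0) + u / T * (1 + (T - c - ln u))\<bar> \<le> 4 * C * (u / T\<^sup>2) + 2 * g\<^sup>2 * (u / T\<^sup>2) + 2 * g\<^sup>2 * (u / T\<^sup>2)"
        unfolding e by (rule order_trans[OF abs_triangle_ineq add_mono[OF order_trans[OF abs_triangle_ineq add_mono[OF E1 E2]] E3]])
      also have "\<dots> = K * u / T\<^sup>2" by (simp add: K_def algebra_simps add_divide_distrib)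
      finally show "u \<ge> 4 \<and> \<bar>cumulant u - u * (ln T + c0) + u / T * (1 + (T - c - ln u))\<bar> \<le> K * u / T\<^sup>2" using u4 by simp
    qed
  qed
  ultimately show ?thesis using that unfolding c_def by blast
qed


text \<open>The tilt \<open>s\<close> minimises \<open>cumulant u - u (ln T + c0 + \<eta> / 2)\<close> up to \<open>1\<close>, which needs neither continuity nor convexity.
  Minimality bounds both one-sided increments at \<open>s\<close> through the second difference, so with \<open>h\<close> of order \<open>s \<eta>\<close>
  each subtracted term is at most a quarter of \<open>exp (cumulant s)\<close>.\<close>
lemma tilted_lower_bound:
  obtains K where "K > 0" "\<forall>\<^sub>F T in at_top. \<exists>s h \<eta>. 0 < h \<and> h \<le> s - 2 \<and> 0 < \<eta> \<and>
      exp (- (exp (T - (I0 - I1)) / T * (1 + K / T))) \<le>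
      exp (- (s * (ln T + c0 + \<eta>))) * (exp (cumulant s) - exp (- (h * (ln T + c0 + \<eta>))) * exp (cumulant (s + h)) - exp (h * (ln T + c0)) * exp (cumulant (s - h)))"
proof -
  obtain K1 where K1: "K1 > 0" "\<forall>\<^sub>F T in at_top. \<forall>u. \<bar>T - (I0 - I1) - ln u\<bar> \<le> 1 \<and> u > 0 \<longrightarrow>
    u \<ge> 4 \<and> \<bar>cumulant u - u * (ln T + c0) + u / T * (1 + (T - (I0 - I1) - ln u))\<bar> \<le> K1 * u / T\<^sup>2"
    using cumulant_tilted by blast
  obtain C' where C': "C' > 0" "\<And>s h. s \<ge> 4 \<Longrightarrow> 0 \<le> h \<Longrightarrow> h * B \<le> \<delta> * s / 2 \<Longrightarrow>
    cumulant (s + h) + cumulant (s - h) - 2 * cumulant s \<le> C' * h\<^sup>2 / s"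
    using cumulant_second_difference by blast
  define C where "C = C' + 1"
  have C: "C \<ge> 1" "\<And>s h. s \<ge> 4 \<Longrightarrow> 0 \<le> h \<Longrightarrow> h * B \<le> \<delta> * s / 2 \<Longrightarrow>
    cumulant (s + h) + cumulant (s - h) - 2 * cumulant s \<le> C * h\<^sup>2 / s"
  proof -
    show "C \<ge> 1" using C' by (simp add: C_def)
    fix s h assume *: "s \<ge> 4" "0 \<le> h" "h * B \<le> \<delta> * s / 2"
    have "C' * h\<^sup>2 / s \<le> C * h\<^sup>2 / s" using * by (intro divide_right_mono mult_right_mono) (auto simp: C_def)
    then show "cumulant (s + h) + cumulant (s - h) - 2 * cumulant s \<le> C * h\<^sup>2 / s" using C'(2)[OF *] by linarith
  qed
  define c where "c = I0 - I1"
  define K2 where "K2 = 3 * K1 + 2"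
  have K2: "K2 > 0" using K1 by (simp add: K2_def)
  \<comment> \<open>The size of \<open>s\<close> behind \<open>big\<close> below: the tilt must gain
    more than the slack 1 of the approximate minimum.\<close>
  have ev1: "\<forall>\<^sub>F T in at_top. exp (T - c - 1) \<ge> 48 * C * T ^ 4" by real_asymp
  have ev2: "\<forall>\<^sub>F T in at_top. exp (T - c) / T \<ge> 100 * T" by real_asymp
  have "\<forall>\<^sub>F T in at_top. \<exists>s h \<eta>. 0 < h \<and> h \<le> s - 2 \<and> 0 < \<eta> \<and>
      exp (- (exp (T - c) / T * (1 + (K2 + 3) / T))) \<le>
      exp (- (s * (ln T + c0 + \<eta>))) * (exp (cumulant s) - exp (- (h * (ln T + c0 + \<eta>))) * exp (cumulant (s + h)) - exp (h * (ln T + c0)) * exp (cumulant (s - h)))"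
    using K1(2) ev1 ev2 eventually_ge_at_top[of "max 1 (max (144 * K2) (2 * B / \<delta>))"]
  proof eventually_elim
    case (elim T)
    have T: "T \<ge> 1" "T > 0" "T \<ge> 144 * K2" "T \<ge> 2 * B / \<delta>" using elim(4) by auto
    define W where "W = exp (T - c) / T"
    have W: "W \<ge> 100 * T" "W \<ge> 100" "W > 0" using elim(3) T by (auto simp: W_def)
    have Wu: "exp (T - c - y) = W * T * exp (-y)" for y using T by (simp add: W_def flip: exp_add)
    \<comment> \<open>The window is as wide as the error term allows: its cost
      \<open>s * \<eta> / 2\<close> is of order \<open>W / T\<close>. The minimisation below uses
      \<open>b\<close>, the midpoint of the window.\<close>
    define \<eta> where "\<eta> = 1 / T\<^sup>2"
    have \<eta>: "\<eta> > 0" "\<eta> \<le> 1 / T" "\<eta> \<le> 1"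
    proof -
      show "\<eta> > 0" using T by (simp add: \<eta>_def)
      show "\<eta> \<le> 1 / T" unfolding \<eta>_def using T by (intro divide_left_mono) (auto simp: power2_eq_square)
      moreover have "1 / T \<le> 1" using T by simp
      ultimately show "\<eta> \<le> 1" by linarith
    qed
    define a where "a = ln T + c0"
    define b where "b = a + \<eta> / 2"
    define G where "G u = cumulant u - u * b" for u
    have u_le: "exp (T - c - y) \<le> 3 * W * T" if "\<bar>y\<bar> \<le> 1" for y
    proof -
      have "exp (-y) \<le> exp 1" using that by simp
      then have "exp (-y) \<le> 3" using exp_le by linarith
      then have "W * T * exp (-y) \<le> W * T * 3" using W T by (intro mult_left_mono) auto
      then show ?thesis by (simp add: Wu)
    qed
    have Gy: "exp (T - c - y) \<ge> 4" "\<bar>G (exp (T - c - y)) + W * ((1 + y) * exp (-y))\<bar> \<le> K2 * W / T" if y: "\<bar>y\<bar> \<le> 1" for y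
    proof -
      define u where "u = exp (T - c - y)"
      have u: "ln u = T - c - y" "u > 0" by (simp_all add: u_def)
      have "u \<ge> 4 \<and> \<bar>cumulant u - u * (ln T + c0) + u / T * (1 + (T - (I0 - I1) - ln u))\<bar> \<le> K1 * u / T\<^sup>2"
        using elim(1)[rule_format, of u] u y by (simp add: c_def)
      moreover have "T - (I0 - I1) - ln u = y" using u by (simp add: c_def)
      ultimately have k: "u \<ge> 4" "\<bar>cumulant u - u * a + u / T * (1 + y)\<bar> \<le> K1 * u / T\<^sup>2" by (simp_all add: a_def)
      show "exp (T - c - y) \<ge> 4" using k by (simp add: u_def)
      have ut: "u / T = W * exp (-y)" using T unfolding u_def Wu by simp
      have "u / T\<^sup>2 \<le> 3 * W * T / T\<^sup>2" using u_le[OF y] by (intro divide_right_mono) (auto simp: u_def)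
      then have u2: "u / T\<^sup>2 \<le> 3 * (W / T)" using T by (simp add: power2_eq_square)
      have "K1 * u / T\<^sup>2 \<le> K1 * (3 * (W / T))" using mult_left_mono[OF u2, of K1] K1 by simp
      moreover have "u * (\<eta> / 2) \<le> 2 * (W / T)" "0 \<le> u * (\<eta> / 2)"
      proof -
        have eq: "u * (\<eta> / 2) = (u / T\<^sup>2) / 2" by (simp add: \<eta>_def)
        have *: "x / 2 \<le> 2 * v" if "v > 0" "x \<le> 3 * v" for x v :: real using that by linarith
        show "u * (\<eta> / 2) \<le> 2 * (W / T)" unfolding eq by (rule *[OF _ u2]) (use W T in simp)
        show "0 \<le> u * (\<eta> / 2)" using u \<eta> by simp
      qed
      moreover have "G u + W * ((1 + y) * exp (-y)) = cumulant u - u * a + u / T * (1 + y) - u * (\<eta> / 2)"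
        unfolding ut by (simp add: G_def b_def algebra_simps)
      moreover have "K2 * W / T = K1 * (3 * (W / T)) + 2 * (W / T)" by (simp add: K2_def algebra_simps add_divide_distrib)
      ultimately show "\<bar>G (exp (T - c - y)) + W * ((1 + y) * exp (-y))\<bar> \<le> K2 * W / T" using k(2) unfolding u_def[symmetric] by linarith
    qed
    define V where "V = (\<lambda>y. G (exp (T - c - y))) ` {-1..1}"
    have low: "- W - K2 * W / T \<le> G (exp (T - c - y))" if "\<bar>y\<bar> \<le> 1" for y
    proof -
      have "W * ((1 + y) * exp (-y)) \<le> W * 1" using one_plus_exp_minus_bounds(1)[OF that] W by (intro mult_left_mono) auto
      then show ?thesis using Gy(2)[OF that] by linarith
    qed
    have bdd: "bdd_below V" unfolding V_def by (rule bdd_belowI2[where m = "- W - K2 * W / T"]) (use low in auto)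
    have "\<exists>v\<in>V. v < Inf V + 1"
      using cInf_lessD[of V "Inf V + 1"] by (auto simp: V_def)
    then obtain y where y: "\<bar>y\<bar> \<le> 1" "G (exp (T - c - y)) < Inf V + 1" by (auto simp: V_def abs_le_iff)
    have min: "G (exp (T - c - y)) \<le> G (exp (T - c - y')) + 1" if "\<bar>y'\<bar> \<le> 1" for y'
    proof -
      have "Inf V \<le> G (exp (T - c - y'))" by (rule cInf_lower[OF _ bdd]) (use that in \<open>auto simp: V_def abs_le_iff\<close>)
      then show ?thesis using y by linarith
    qed
    define s where "s = exp (T - c - y)"
    have s4: "s \<ge> 4" using Gy(1)[OF y(1)] by (simp add: s_def)
    \<comment> \<open>The near-minimiser lies away from the ends of \<open>[-1, 1]\<close>, so
      \<open>s + h\<close> and \<open>s - h\<close> still correspond to admissible values of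
      \<open>y\<close> and minimality can be used at both.\<close>
    have y2: "\<bar>y\<bar> < 1/2"
    proof (rule ccontr)
      assume "\<not> \<bar>y\<bar> < 1/2"
      then have "(1 + y) * exp (-y) \<le> 35/36" using one_plus_exp_minus_bounds(2)[OF y(1)] by simp
      then have "W * ((1 + y) * exp (-y)) \<le> W * (35/36)" using W by (intro mult_left_mono) auto
      moreover have "K2 * W / T \<le> W / 144"
      proof -
        have "W * (144 * K2) \<le> W * T" using T W by (intro mult_left_mono) auto
        moreover have "W * (144 * K2) = 144 * (K2 * W)" by simp
        ultimately have "K2 * W \<le> W / 144 * T" by simp
        then show ?thesis using T by (simp add: pos_divide_le_eq)
      qed
      moreover have "\<bar>G (exp (T - c)) + W\<bar> \<le> K2 * W / T" "G (exp (T - c - y)) \<le> G (exp (T - c)) + 1" using Gy(2)[of 0] min[of 0] by simp_all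
      ultimately show False using Gy(2)[OF y(1)] W(2) by linarith
    qed
    \<comment> \<open>With \<open>h = s * \<theta>\<close> the second difference costs
      \<open>C h^2 / s = s \<eta>^2 / (16 C)\<close>, half of the gain \<open>h \<eta> / 2\<close>
      from leaving the window on either side. The net gain minus the slack is at least 2, and
      \<open>exp (-2) \<le> 1/4\<close>.\<close>
    define \<theta> where "\<theta> = \<eta> / (4 * C)"
    define h where "h = s * \<theta>"
    have \<theta>: "\<theta> > 0" "\<theta> \<le> 1/4" "\<theta> \<le> 1 / T"
    proof -
      show "\<theta> > 0" using \<eta> C by (simp add: \<theta>_def)
      have "\<theta> \<le> \<eta> / 4" unfolding \<theta>_def using \<eta> C by (intro divide_left_mono) auto
      then show "\<theta> \<le> 1/4" "\<theta> \<le> 1 / T" using \<eta> by linarith+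
    qed
    have h: "h > 0" "h \<le> s / 4" using \<theta> s4 mult_left_mono[OF \<theta>(2), of s] by (auto simp: h_def)
    have hB: "h * B \<le> \<delta> * s / 2"
    proof -
      have "2 * B \<le> T * \<delta>" using T \<delta> by (simp add: pos_divide_le_eq)
      then have "B / T \<le> \<delta> / 2" using T by (simp add: pos_divide_le_eq mult.commute)
      moreover have "\<theta> * B \<le> 1 / T * B" using \<theta> B_gt_1 by (intro mult_right_mono) auto
      moreover have "1 / T * B = B / T" by simp
      ultimately have "\<theta> * B \<le> \<delta> / 2" by linarith
      then have "s * (\<theta> * B) \<le> s * (\<delta> / 2)" using s4 by (intro mult_left_mono) auto
      then show ?thesis by (simp add: h_def mult_ac)
    qed
    have near: "G s \<le> G u + 1" if u: "s * (3/4) \<le> u" "u \<le> s * (5/4)" for u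
    proof -
      have u0: "u > 0" using u s4 by linarith
      define y' where "y' = T - c - ln u"
      have ls: "ln s = T - c - y" by (simp add: s_def)
      have "ln (u / s) \<le> u / s - 1" using u0 s4 by (intro ln_le_minus_one) auto
      moreover have "ln (s / u) \<le> s / u - 1" using u0 s4 by (intro ln_le_minus_one) auto
      moreover have "u / s \<le> 3/2" "s / u \<le> 3/2" using u u0 s4 by (simp_all add: pos_divide_le_eq)
      moreover have "ln (u / s) = ln u - ln s" "ln (s / u) = ln s - ln u" using u0 s4 by (simp_all add: ln_div)
      ultimately have "\<bar>ln u - ln s\<bar> \<le> 1/2" by linarith
      then have "\<bar>y'\<bar> \<le> 1" using y2 unfolding y'_def ls by linarith
      from min[OF this] show ?thesis using u0 by (simp add: s_def y'_def)
    qed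
    have Gp: "G s \<le> G (s + h) + 1" and Gm: "G s \<le> G (s - h) + 1" using h s4 by (auto intro!: near)
    have "cumulant (s + h) + cumulant (s - h) - 2 * cumulant s \<le> C * h\<^sup>2 / s" using C(2)[OF s4 _ hB] h by simp
    moreover have "C * h\<^sup>2 / s = s * \<eta>\<^sup>2 / (16 * C)" using s4 C by (simp add: h_def \<theta>_def power2_eq_square)
    moreover have "G (s + h) + G (s - h) - 2 * G s = cumulant (s + h) + cumulant (s - h) - 2 * cumulant s" by (simp add: G_def algebra_simps)
    ultimately have sd: "G (s + h) \<le> G s + 1 + s * \<eta>\<^sup>2 / (16 * C)" "G (s - h) \<le> G s + 1 + s * \<eta>\<^sup>2 / (16 * C)" using Gp Gm by linarith+
    have big: "3 \<le> s * \<eta>\<^sup>2 / (16 * C)"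
    proof -
      have "48 * C * T ^ 4 \<le> s" using elim(2) y unfolding s_def by (elim order_trans) simp
      then have "48 * C \<le> s / T ^ 4" using T by (simp add: pos_le_divide_eq)
      also have "\<dots> = s * \<eta>\<^sup>2" by (simp add: \<eta>_def power_divide)
      finally show ?thesis using C by (simp add: pos_le_divide_eq)
    qed
    have hn: "h * \<eta> / 2 = 2 * (s * \<eta>\<^sup>2 / (16 * C))" by (simp add: h_def \<theta>_def power2_eq_square)
    have Gs: "cumulant s = G s + s * b" by (simp add: G_def)
    have q4: "exp (x - 2) \<le> exp x / 4" for x :: real
    proof -
      have "exp (2 :: real) \<ge> 4" using exp_lower_Taylor_quadratic[of "2::real"] by simp
      then have "exp x / exp 2 \<le> exp x / 4" by (intro divide_left_mono) auto
      then show ?thesis by (simp add: exp_diff)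
    qed
    have "exp (- (h * (a + \<eta>))) * exp (cumulant (s + h)) = exp (- (h * (a + \<eta>)) + cumulant (s + h))" by (rule exp_add[symmetric])
    also have "- (h * (a + \<eta>)) + cumulant (s + h) = G (s + h) + s * b - h * \<eta> / 2" by (simp add: G_def b_def field_simps)
    also have "exp (G (s + h) + s * b - h * \<eta> / 2) \<le> exp (cumulant s - 2)" using sd hn big Gs unfolding exp_le_cancel_iff by linarith
    finally have t1: "exp (- (h * (a + \<eta>))) * exp (cumulant (s + h)) \<le> exp (cumulant s) / 4" using q4[of "cumulant s"] by linarith
    have "exp (h * a) * exp (cumulant (s - h)) = exp (h * a + cumulant (s - h))" by (rule exp_add[symmetric])
    also have "h * a + cumulant (s - h) = G (s - h) + s * b - h * \<eta> / 2" by (simp add: G_def b_def field_simps)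
    also have "exp (G (s - h) + s * b - h * \<eta> / 2) \<le> exp (cumulant s - 2)" using sd hn big Gs unfolding exp_le_cancel_iff by linarith
    finally have t2: "exp (h * a) * exp (cumulant (s - h)) \<le> exp (cumulant s) / 4" using q4[of "cumulant s"] by linarith
    have "exp (- (W * (1 + (K2 + 3) / T))) \<le> exp (G s - s * \<eta> / 2 - 1)"
    proof -
      have "s / T\<^sup>2 \<le> 3 * W * T / T\<^sup>2" using u_le[OF y(1)] by (intro divide_right_mono) (auto simp: s_def)
      then have w1: "s * \<eta> / 2 \<le> 3 * (W / T) / 2" using T by (simp add: power2_eq_square \<eta>_def)
      have w2: "W / T \<ge> 100" using W T by (simp add: pos_le_divide_eq)
      have w3: "W * (1 + (K2 + 3) / T) = W + K2 * W / T + 3 * (W / T)" by (simp add: algebra_simps add_divide_distrib)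
      have fin: "- X \<le> g - z - 1" if "z \<le> 3 * v / 2" "v \<ge> 100" "X = W + k + 3 * v" "- W - k \<le> g" for X g z v k
        using that by linarith
      show ?thesis unfolding exp_le_cancel_iff s_def by (rule fin[OF w1[unfolded s_def] w2 w3 low[OF y(1)]])
    qed
    also have "\<dots> = exp (G s - s * \<eta> / 2) / exp 1" by (simp add: exp_diff)
    also have "\<dots> \<le> exp (G s - s * \<eta> / 2) / 2" using exp_ge_add_one_self[of "1::real"] by (intro divide_left_mono) auto
    also have "exp (G s - s * \<eta> / 2) / 2 = exp (- (s * (a + \<eta>))) * (exp (cumulant s) / 2)"
    proof -
      have e: "G s - s * \<eta> / 2 = - (s * (a + \<eta>)) + cumulant s" by (simp add: G_def b_def field_simps)
      show ?thesis unfolding e exp_add by simp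
    qed
    finally have l: "exp (- (W * (1 + (K2 + 3) / T))) \<le> exp (- (s * (a + \<eta>))) * (exp (cumulant s) / 2)" .
    have m: "exp (cumulant s) / 2 \<le> exp (cumulant s) - exp (- (h * (a + \<eta>))) * exp (cumulant (s + h)) - exp (h * a) * exp (cumulant (s - h))"
      using t1 t2 by linarith
    have hs: "h \<le> s - 2" using h s4 by linarith
    show ?case unfolding W_def[symmetric] a_def[symmetric]
      by (rule exI[of _ s], rule exI[of _ h], rule exI[of _ \<eta>], intro conjI h hs \<eta>(1), rule order_trans[OF l mult_left_mono[OF m exp_ge_zero]])
  qed
  then show ?thesis unfolding c_def by (rule that[rotated]) (use K2 in simp)
qed

end

context prob_space
begin

text \<open>Markov's inequality is applied to the partial sums, and the limit is taken inside a
  bounded continuous majorant of the indicator. Only limits of moments of \<open>S N\<close> enter,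
  so no exponential moment of \<open>Z\<close> has to be computed.\<close>

lemma chernoff_limit:
  fixes S :: "nat \<Rightarrow> 'a \<Rightarrow> real" and Z :: "'a \<Rightarrow> real"
  assumes [measurable]: "\<And>N. S N \<in> borel_measurable M" "Z \<in> borel_measurable M"
    and lim: "AE w in M. (\<lambda>N. S N w) \<longlonglongrightarrow> Z w"
    and int: "\<And>N. integrable M (\<lambda>w. exp (s * S N w))"
    and m: "(\<lambda>N. expectation (\<lambda>w. exp (s * S N w))) \<longlonglongrightarrow> m" and s: "s \<ge> 0"
  shows "prob {w \<in> space M. Z w > x} \<le> exp (- (s * x)) * m"
proof -
  define \<phi> where "\<phi> r = min 1 (exp (s * (r - x)))" for r :: real
  have [measurable]: "\<phi> \<in> borel_measurable borel" unfolding \<phi>_def by measurable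
  have \<phi>: "norm (\<phi> r) \<le> 1" for r by (auto simp: \<phi>_def)
  have i: "integrable M (\<lambda>w. \<phi> (f w))" if [measurable]: "f \<in> borel_measurable M" for f
    by (rule integrable_const_bound[where B = 1]) (use \<phi> in auto)
  have ind: "integrable M (indicat_real {w \<in> space M. Z w > x})"
    by (rule integrable_const_bound[where B = 1]) auto
  have "prob {w \<in> space M. Z w > x} = expectation (indicator {w \<in> space M. Z w > x})" by simp
  also have "\<dots> \<le> expectation (\<lambda>w. \<phi> (Z w))"
  proof (rule integral_mono)
    show "indicator {w \<in> space M. Z w > x} w \<le> \<phi> (Z w)" for w
      using s by (auto simp: \<phi>_def indicator_def)
  qed (use i ind in auto)
  also have "\<dots> \<le> exp (- (s * x)) * m"
  proof (rule LIMSEQ_le)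
    show "(\<lambda>N. expectation (\<lambda>w. \<phi> (S N w))) \<longlonglongrightarrow> expectation (\<lambda>w. \<phi> (Z w))"
    proof (rule integral_dominated_convergence[where w = "\<lambda>_. 1"])
      show "AE w in M. (\<lambda>N. \<phi> (S N w)) \<longlonglongrightarrow> \<phi> (Z w)"
        using lim by eventually_elim (auto simp: \<phi>_def intro!: tendsto_intros)
    qed (use \<phi> in auto)
    show "(\<lambda>N. exp (- (s * x)) * expectation (\<lambda>w. exp (s * S N w))) \<longlonglongrightarrow> exp (- (s * x)) * m"
      by (intro tendsto_intros m)
    show "\<exists>N. \<forall>n\<ge>N. expectation (\<lambda>w. \<phi> (S n w)) \<le> exp (- (s * x)) * expectation (\<lambda>w. exp (s * S n w))"
    proof (intro exI allI impI)
      fix n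
      have "expectation (\<lambda>w. \<phi> (S n w)) \<le> expectation (\<lambda>w. exp (- (s * x)) * exp (s * S n w))"
      proof (rule integral_mono)
        show "\<phi> (S n w) \<le> exp (- (s * x)) * exp (s * S n w)" for w by (simp add: \<phi>_def algebra_simps flip: exp_add)
      qed (use i int in auto)
      then show "expectation (\<lambda>w. \<phi> (S n w)) \<le> exp (- (s * x)) * expectation (\<lambda>w. exp (s * S n w))" by simp
    qed
  qed
  finally show ?thesis .
qed

text \<open>The three-term combination is at most the tilted indicator of the window \<open>(a, a + \<eta>)\<close>,
  since one of the two subtracted exponentials dominates outside of it.\<close>

lemma tilted_limit:
  fixes S :: "nat \<Rightarrow> 'a \<Rightarrow> real" and Z :: "'a \<Rightarrow> real"
  assumes [measurable]: "\<And>N. S N \<in> borel_measurable M" "Z \<in> borel_measurable M"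
    and lim: "AE w in M. (\<lambda>N. S N w) \<longlonglongrightarrow> Z w"
    and int: "\<And>N u. integrable M (\<lambda>w. exp (u * S N w))"
    and m: "(\<lambda>N. expectation (\<lambda>w. exp (s * S N w))) \<longlonglongrightarrow> m0"
      "(\<lambda>N. expectation (\<lambda>w. exp ((s + h) * S N w))) \<longlonglongrightarrow> mp"
      "(\<lambda>N. expectation (\<lambda>w. exp ((s - h) * S N w))) \<longlonglongrightarrow> mm"
    and s: "s \<ge> 0" "h \<ge> 0"
  shows "exp (- (s * (a + \<eta>))) * (m0 - exp (- (h * (a + \<eta>))) * mp - exp (h * a) * mm) \<le> prob {w \<in> space M. Z w > a}"
proof -
  define \<psi> where "\<psi> r = exp (s * r) - exp (- (h * (a + \<eta>))) * exp ((s + h) * r) - exp (h * a) * exp ((s - h) * r)" for r :: real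
  \<comment> \<open>Cutting off at 0 makes the function bounded as well as continuous, which
    dominated convergence requires; against the moments only \<open>\<psi> \<le> \<phi>\<close> is
    used.\<close>
  define \<phi> where "\<phi> r = max 0 (\<psi> r)" for r :: real
  define Q where "Q = exp (s * (a + \<eta>))"
  have [measurable]: "\<phi> \<in> borel_measurable borel" unfolding \<phi>_def \<psi>_def by measurable
  have \<psi>: "\<psi> r = exp (s * r) * (1 - exp (h * (r - a - \<eta>)) - exp (- (h * (r - a))))" for r
    by (simp add: \<psi>_def algebra_simps flip: exp_add)
  have bound: "\<phi> r \<le> Q * indicator {a<..} r" for r
  proof (cases "r > a \<and> r < a + \<eta>")
    case True
    have "\<psi> r \<le> exp (s * r) * 1" unfolding \<psi>
      using exp_gt_zero[of "h * (r - a - \<eta>)"] exp_gt_zero[of "- (h * (r - a))"] by (intro mult_left_mono) (linarith, simp)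
    also have "\<dots> \<le> Q" unfolding Q_def using True s by (simp add: mult_left_mono)
    finally show ?thesis using True by (simp add: \<phi>_def Q_def)
  next
    case False
    then have "1 \<le> exp (h * (r - a - \<eta>)) \<or> 1 \<le> exp (- (h * (r - a)))"
      using s by (auto simp: mult_nonneg_nonpos zero_le_mult_iff)
    moreover have "0 < exp (h * (r - a - \<eta>))" "0 < exp (- (h * (r - a)))" by simp_all
    ultimately have "1 - exp (h * (r - a - \<eta>)) - exp (- (h * (r - a))) \<le> 0" by linarith
    then have "\<psi> r \<le> 0" unfolding \<psi> by (intro mult_nonneg_nonpos) auto
    then show ?thesis by (auto simp: \<phi>_def Q_def indicator_def)
  qed
  have nb: "norm (\<phi> r) \<le> Q" for r
  proof -
    have "Q * indicator {a<..} r \<le> Q" "\<phi> r \<ge> 0" by (auto simp: indicator_def Q_def \<phi>_def)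
    then show ?thesis using bound[of r] by simp
  qed
  have ind: "integrable M (indicat_real {w \<in> space M. Z w > a})"
    by (rule integrable_const_bound[where B = 1]) auto
  have i: "integrable M (\<lambda>w. \<phi> (f w))" if [measurable]: "f \<in> borel_measurable M" for f
    by (rule integrable_const_bound[where B = Q]) (use nb in auto)
  have "m0 - exp (- (h * (a + \<eta>))) * mp - exp (h * a) * mm \<le> expectation (\<lambda>w. \<phi> (Z w))"
  proof (rule LIMSEQ_le)
    show "(\<lambda>N. expectation (\<lambda>w. \<phi> (S N w))) \<longlonglongrightarrow> expectation (\<lambda>w. \<phi> (Z w))"
    proof (rule integral_dominated_convergence[where w = "\<lambda>_. Q"])
      show "AE w in M. (\<lambda>N. \<phi> (S N w)) \<longlonglongrightarrow> \<phi> (Z w)"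
        using lim by eventually_elim (auto simp: \<phi>_def \<psi>_def intro!: tendsto_intros)
    qed (use nb in auto)
    show "(\<lambda>N. expectation (\<lambda>w. exp (s * S N w)) - exp (- (h * (a + \<eta>))) * expectation (\<lambda>w. exp ((s + h) * S N w)) - exp (h * a) * expectation (\<lambda>w. exp ((s - h) * S N w)))
      \<longlonglongrightarrow> m0 - exp (- (h * (a + \<eta>))) * mp - exp (h * a) * mm"
      by (intro tendsto_intros m)
    show "\<exists>N. \<forall>n\<ge>N. expectation (\<lambda>w. exp (s * S n w)) - exp (- (h * (a + \<eta>))) * expectation (\<lambda>w. exp ((s + h) * S n w)) - exp (h * a) * expectation (\<lambda>w. exp ((s - h) * S n w)) \<le> expectation (\<lambda>w. \<phi> (S n w))"
    proof (intro exI allI impI)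
      fix n
      have "expectation (\<lambda>w. exp (s * S n w)) - exp (- (h * (a + \<eta>))) * expectation (\<lambda>w. exp ((s + h) * S n w)) - exp (h * a) * expectation (\<lambda>w. exp ((s - h) * S n w))
        = expectation (\<lambda>w. \<psi> (S n w))"
        unfolding \<psi>_def using int by simp
      also have "\<dots> \<le> expectation (\<lambda>w. \<phi> (S n w))"
        by (rule integral_mono) (use i int in \<open>auto simp: \<phi>_def \<psi>_def\<close>)
      finally show "expectation (\<lambda>w. exp (s * S n w)) - exp (- (h * (a + \<eta>))) * expectation (\<lambda>w. exp ((s + h) * S n w)) - exp (h * a) * expectation (\<lambda>w. exp ((s - h) * S n w)) \<le> expectation (\<lambda>w. \<phi> (S n w))" .
    qed
  qed
  also have "\<dots> \<le> expectation (\<lambda>w. Q * indicator {w \<in> space M. Z w > a} w)"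
  proof (rule integral_mono)
    show "\<phi> (Z w) \<le> Q * indicator {w \<in> space M. Z w > a} w" if "w \<in> space M" for w
      using bound[of "Z w"] that by (simp add: indicator_def)
  qed (use i ind in auto)
  also have "\<dots> = Q * prob {w \<in> space M. Z w > a}" by simp
  finally have "exp (- (s * (a + \<eta>))) * (m0 - exp (- (h * (a + \<eta>))) * mp - exp (h * a) * mm) \<le> exp (- (s * (a + \<eta>))) * (Q * prob {w \<in> space M. Z w > a})"
    by (intro mult_left_mono) auto
  also have "\<dots> = prob {w \<in> space M. Z w > a}" by (simp add: Q_def flip: mult.assoc exp_add)
  finally show ?thesis .
qed

end

text \<open>The upper bound is Chernoff at \<open>y = 0\<close> in \<open>cumulant_tilted\<close>.
  The relative error \<open>e\<close> is read off from \<open>ln P\<close>, and the lower bound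
  guarantees that \<open>P\<close> is positive.\<close>

theorem (in prime_model) large_deviation:
  fixes M :: "'a measure" and S :: "nat \<Rightarrow> 'a \<Rightarrow> real" and Z :: "'a \<Rightarrow> real"
  assumes "prob_space M"
    and meas: "\<And>N. S N \<in> borel_measurable M" "Z \<in> borel_measurable M"
    and lim: "AE w in M. (\<lambda>N. S N w) \<longlonglongrightarrow> Z w"
    and int: "\<And>N u. integrable M (\<lambda>w. exp (u * S N w))"
    and expect: "\<And>N u. integral\<^sup>L M (\<lambda>w. exp (u * S N w)) = (\<Prod>p\<in>{p. prime p \<and> p \<le> N}. mom p u)"
  shows "\<exists>K. \<forall>\<^sub>F T in at_top. \<exists>e. \<bar>e\<bar> \<le> K / T \<and> measure M {w \<in> space M. Z w > ln T + c0} = exp (- (exp (T - (I0 - I1)) / T) * (1 + e))"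
proof -
  interpret prob_space M by fact
  have m: "(\<lambda>N. expectation (\<lambda>w. exp (u * S N w))) \<longlonglongrightarrow> exp (cumulant u)" if "u \<ge> 2" for u
  proof -
    have "expectation (\<lambda>w. exp (u * S N w)) = exp (\<Sum>p\<in>{p. prime p \<and> p \<le> N}. ln (mom p u))" for N
      unfolding expect using mom_ge(2) by (simp add: exp_sum finite_primes_le)
    then show ?thesis using tendsto_exp[OF cumulant_tendsto[OF that]] by simp
  qed
  obtain K1 where K1: "K1 > 0" "\<forall>\<^sub>F T in at_top. \<forall>u. \<bar>T - (I0 - I1) - ln u\<bar> \<le> 1 \<and> u > 0 \<longrightarrow>
    u \<ge> 4 \<and> \<bar>cumulant u - u * (ln T + c0) + u / T * (1 + (T - (I0 - I1) - ln u))\<bar> \<le> K1 * u / T\<^sup>2"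
    using cumulant_tilted by blast
  obtain K2 where K2: "K2 > 0" "\<forall>\<^sub>F T in at_top. \<exists>s h \<eta>. 0 < h \<and> h \<le> s - 2 \<and> 0 < \<eta> \<and>
      exp (- (exp (T - (I0 - I1)) / T * (1 + K2 / T))) \<le>
      exp (- (s * (ln T + c0 + \<eta>))) * (exp (cumulant s) - exp (- (h * (ln T + c0 + \<eta>))) * exp (cumulant (s + h)) - exp (h * (ln T + c0)) * exp (cumulant (s - h)))"
    using tilted_lower_bound by blast
  show ?thesis
  proof (rule exI[of _ "max K1 K2"])
    show "\<forall>\<^sub>F T in at_top. \<exists>e. \<bar>e\<bar> \<le> max K1 K2 / T \<and> measure M {w \<in> space M. Z w > ln T + c0} = exp (- (exp (T - (I0 - I1)) / T) * (1 + e))"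
      using K1(2) K2(2) eventually_gt_at_top[of 0]
    proof eventually_elim
      case (elim T)
      define P where "P = prob {w \<in> space M. Z w > ln T + c0}"
      define W where "W = exp (T - (I0 - I1)) / T"
      have T: "T > 0" by fact
      have W: "W > 0" using T by (simp add: W_def)
      define u where "u = exp (T - (I0 - I1))"
      have u: "u \<ge> 4" "\<bar>cumulant u - u * (ln T + c0) + u / T\<bar> \<le> K1 * u / T\<^sup>2"
        using elim(1)[rule_format, of u] by (simp_all add: u_def)
      have "P \<le> exp (- (u * (ln T + c0))) * exp (cumulant u)"
        unfolding P_def by (rule chernoff_limit[OF meas lim int m]) (use u in auto)
      also have "\<dots> = exp (cumulant u - u * (ln T + c0))" by (simp flip: exp_add)
      also have "\<dots> \<le> exp (- (W * (1 - K1 / T)))"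
      proof -
        have eq: "W * (1 - K1 / T) = u / T - K1 * u / T\<^sup>2" unfolding W_def u_def by (simp add: right_diff_distrib power2_eq_square)
        show ?thesis using u(2) unfolding exp_le_cancel_iff eq by linarith
      qed
      finally have up: "P \<le> exp (- (W * (1 - K1 / T)))" .
      obtain s h \<eta> where sh: "0 < h" "h \<le> s - 2" and
        lo: "exp (- (W * (1 + K2 / T))) \<le>
          exp (- (s * (ln T + c0 + \<eta>))) * (exp (cumulant s) - exp (- (h * (ln T + c0 + \<eta>))) * exp (cumulant (s + h)) - exp (h * (ln T + c0)) * exp (cumulant (s - h)))"
        using elim(2) unfolding W_def by blast
      have "exp (- (s * (ln T + c0 + \<eta>))) * (exp (cumulant s) - exp (- (h * (ln T + c0 + \<eta>))) * exp (cumulant (s + h)) - exp (h * (ln T + c0)) * exp (cumulant (s - h))) \<le> P"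
        unfolding P_def by (rule tilted_limit[OF meas lim int m m m]) (use sh in auto)
      with lo have lo: "exp (- (W * (1 + K2 / T))) \<le> P" by linarith
      then have P: "P > 0" using exp_gt_zero[of "- (W * (1 + K2 / T))"] by linarith
      have l1: "ln P \<le> - (W * (1 - K1 / T))" using up P by (metis ln_le_cancel_iff exp_gt_zero ln_exp)
      have l2: "- (W * (1 + K2 / T)) \<le> ln P" using lo P by (metis ln_le_cancel_iff exp_gt_zero ln_exp)
      define e where "e = - ln P / W - 1"
      have "- ln P \<le> (1 + K2 / T) * W" "(1 - K1 / T) * W \<le> - ln P" using l1 l2 by (simp_all add: mult.commute)
      then have "- ln P / W \<le> 1 + K2 / T" "1 - K1 / T \<le> - ln P / W"
        by (simp_all only: pos_divide_le_eq[OF W] pos_le_divide_eq[OF W])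
      moreover have "K1 / T \<le> max K1 K2 / T" "K2 / T \<le> max K1 K2 / T" using T by (auto intro!: divide_right_mono)
      ultimately have "\<bar>e\<bar> \<le> max K1 K2 / T" by (simp add: e_def abs_le_iff)
      moreover have "P = exp (- W * (1 + e))" using P W by (simp add: e_def)
      ultimately show ?case unfolding P_def W_def by blast
    qed
  qed
qed

section \<open>The random Euler product\<close>

lemma omega3_eq: "omega3 = Complex (-1/2) (sqrt 3 / 2)"
  and omega3_sq: "omega3\<^sup>2 = Complex (-1/2) (- sqrt 3 / 2)"
proof -
  have "omega3 = cis (2 * pi / 3)" by (simp add: omega3_def cis_conv_exp mult_ac)
  then show e: "omega3 = Complex (-1/2) (sqrt 3 / 2)" by (simp add: complex_eq_iff cos_120 sin_120)
  show "omega3\<^sup>2 = Complex (-1/2) (- sqrt 3 / 2)" unfolding e by (simp add: power2_eq_square complex_eq_iff)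
qed

lemma omega3_distinct:
  "omega3 \<noteq> 0" "omega3\<^sup>2 \<noteq> 0" "omega3 \<noteq> 1" "omega3\<^sup>2 \<noteq> 1" "omega3 \<noteq> omega3\<^sup>2"
  unfolding omega3_sq unfolding omega3_eq by (simp_all add: complex_eq_iff)

lemma omega3_sum: "1 + omega3 + omega3\<^sup>2 = 0"
  unfolding omega3_sq unfolding omega3_eq by (simp add: complex_eq_iff)

lemma norm_one_minus_omega3:
  assumes "z \<in> {omega3, omega3\<^sup>2}"
  shows "norm (1 - z * of_real x) = sqrt (1 + x + x\<^sup>2)" "norm z = 1"
proof -
  have z: "Re z = -1/2" "(Im z)\<^sup>2 = 3/4" using assms unfolding omega3_sq unfolding omega3_eq by (auto simp: power_divide)
  have "(1 + x / 2)\<^sup>2 + (Im z)\<^sup>2 * x\<^sup>2 = 1 + x + x\<^sup>2" unfolding z by (simp add: power2_eq_square field_simps)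
  then show "norm (1 - z * of_real x) = sqrt (1 + x + x\<^sup>2)" by (simp add: cmod_def z(1) power_mult_distrib)
  show "norm z = 1" by (simp add: cmod_def z power_divide)
qed

text \<open>Fourth powers grow slowly enough that a block between consecutive ones has harmonic mass tending to zero,
  and fast enough that the standard deviations over these blocks are summable.\<close>

lemma fourth_power_floor: "\<exists>k. k ^ 4 \<le> N \<and> N < (Suc k) ^ 4" for N :: nat
proof (induction N)
  case (Suc N)
  then obtain k where k: "k ^ 4 \<le> N" "N < (Suc k) ^ 4" by blast
  show ?case
  proof (cases "Suc N < (Suc k) ^ 4")
    case False
    then have e: "Suc N = (Suc k) ^ 4" using k by linarith
    have "(Suc k) ^ 4 < (Suc (Suc k)) ^ 4" by (rule power_strict_mono) auto
    then show ?thesis using e by (intro exI[of _ "Suc k"]) simp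
  qed (use k in \<open>auto intro!: exI[of _ k]\<close>)
qed (auto intro!: exI[of _ 0])

text \<open>Between consecutive fourth powers a partial sum moves by at most
  \<open>((k+1)^4 - k^4) / k^4\<close>, which tends to 0. Hence convergence along fourth powers
  suffices, and a maximal inequality is avoided.\<close>

lemma convergent_blocks:
  fixes x :: "nat \<Rightarrow> 'b :: banach"
  assumes x: "\<And>n. norm (x n) \<le> 1 / real n"
    and blocks: "summable (\<lambda>k. norm (\<Sum>n\<in>{k ^ 4<..(Suc k) ^ 4}. x n))"
  shows "convergent (\<lambda>N. \<Sum>n\<in>{..N}. x n)"
proof -
  define s where "s N = (\<Sum>n\<in>{..N}. x n)" for N
  have split: "s N = s M + (\<Sum>n\<in>{M<..N}. x n)" if "M \<le> N" for M N
  proof -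
    have "{..N} = {..M} \<union> {M<..N}" using that by auto
    then show ?thesis unfolding s_def by (subst sum.union_disjoint[symmetric]) auto
  qed
  have tel: "s (k ^ 4) = s 0 + (\<Sum>j<k. \<Sum>n\<in>{j ^ 4<..(Suc j) ^ 4}. x n)" for k
  proof (induction k)
    case (Suc k)
    have "k ^ 4 \<le> (Suc k) ^ 4" by (rule power_mono) auto
    from split[OF this] Suc show ?case by (simp add: add.assoc)
  qed simp
  have "(\<lambda>k. s 0 + (\<Sum>j<k. \<Sum>n\<in>{j ^ 4<..(Suc j) ^ 4}. x n)) \<longlonglongrightarrow> s 0 + (\<Sum>j. \<Sum>n\<in>{j ^ 4<..(Suc j) ^ 4}. x n)"
    by (intro tendsto_intros summable_LIMSEQ summable_norm_cancel[OF blocks])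
  then have lim: "(\<lambda>k. s (k ^ 4)) \<longlonglongrightarrow> s 0 + (\<Sum>j. \<Sum>n\<in>{j ^ 4<..(Suc j) ^ 4}. x n)" unfolding tel[symmetric] .
  define c where "c = s 0 + (\<Sum>j. \<Sum>n\<in>{j ^ 4<..(Suc j) ^ 4}. x n)"
  have gap: "(\<lambda>k. (real (Suc k) ^ 4 - real k ^ 4) / real k ^ 4) \<longlonglongrightarrow> 0" by real_asymp
  have "s \<longlonglongrightarrow> c"
  proof (rule LIMSEQ_I)
    fix \<epsilon> :: real assume \<epsilon>: "\<epsilon> > 0"
    then have "\<epsilon> / 2 > 0" by simp
    from LIMSEQ_D[OF lim this] LIMSEQ_D[OF gap this] obtain K1 K2 where
      K: "\<And>k. k \<ge> K1 \<Longrightarrow> norm (s (k ^ 4) - c) < \<epsilon> / 2" "\<And>k. k \<ge> K2 \<Longrightarrow> (real (Suc k) ^ 4 - real k ^ 4) / real k ^ 4 < \<epsilon> / 2"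
      by (auto simp: c_def abs_less_iff)
    define K where "K = max 1 (max K1 K2)"
    show "\<exists>no. \<forall>n\<ge>no. norm (s n - c) < \<epsilon>"
    proof (intro exI allI impI)
      fix N assume N: "N \<ge> K ^ 4"
      obtain k where k: "k ^ 4 \<le> N" "N < (Suc k) ^ 4" using fourth_power_floor by blast
      have "K ^ 4 < (Suc k) ^ 4" using N k by linarith
      then have "K < Suc k" by (rule power_less_imp_less_base) simp
      then have kK: "k \<ge> K1" "k \<ge> K2" "k \<ge> 1" by (auto simp: K_def)
      have k4: "real k ^ 4 > 0" using kK by simp
      have "norm (\<Sum>n\<in>{k ^ 4<..N}. x n) \<le> (\<Sum>n\<in>{k ^ 4<..N}. 1 / real k ^ 4)"
      proof (rule sum_norm_le)
        fix n assume "n \<in> {k ^ 4<..N}"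
        then have "real (k ^ 4) \<le> real n" by (subst of_nat_le_iff) auto
        moreover have "real n > 0" using \<open>n \<in> {k ^ 4<..N}\<close> by auto
        ultimately have "1 / real n \<le> 1 / real k ^ 4" using k4 by (intro divide_left_mono) auto
        then show "norm (x n) \<le> 1 / real k ^ 4" using x[of n] by linarith
      qed
      also have "\<dots> = real (N - k ^ 4) / real k ^ 4" by simp
      also have "\<dots> \<le> (real (Suc k) ^ 4 - real k ^ 4) / real k ^ 4"
      proof (rule divide_right_mono)
        have "real N \<le> real ((Suc k) ^ 4)" using k by (subst of_nat_le_iff) auto
        then show "real (N - k ^ 4) \<le> real (Suc k) ^ 4 - real k ^ 4" using k by (simp add: of_nat_diff del: of_nat_Suc)
      qed simp
      also have "\<dots> < \<epsilon> / 2" by (rule K(2)[OF kK(2)])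
      finally have t: "norm (\<Sum>n\<in>{k ^ 4<..N}. x n) < \<epsilon> / 2" .
      have e: "s N - c = (s (k ^ 4) - c) + (\<Sum>n\<in>{k ^ 4<..N}. x n)" using split[OF k(1)] by simp
      show "norm (s N - c) < \<epsilon>" unfolding e using K(1)[OF kK(1)] t norm_triangle_ineq[of "s (k ^ 4) - c" "\<Sum>n\<in>{k ^ 4<..N}. x n"] by linarith
    qed
  qed
  then show ?thesis unfolding s_def convergent_def by blast
qed

lemma borel_measurable_cnj[measurable]: "cnj \<in> borel_measurable borel"
  by (intro borel_measurable_continuous_onI continuous_on_cnj continuous_on_id)

lemma norm_square_Re: "(norm z)\<^sup>2 = Re (z * cnj z)"
  unfolding cmod_power2 by (simp add: power2_eq_square)

section \<open>The cubic random variables and almost sure convergence of their prime series\<close>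

locale cubic_model = prob_space M for M :: "'a measure" +
  fixes X :: "nat \<Rightarrow> 'a \<Rightarrow> complex"
  assumes indep: "indep_vars (\<lambda>_. borel) X {p. prime p}"
    and meas: "prime p \<Longrightarrow> X p \<in> borel_measurable M"
    and law2: "prime p \<Longrightarrow> (p mod 3 = 2 \<or> p = 3) \<Longrightarrow> c \<in> {1, omega3, omega3 ^ 2} \<Longrightarrow> prob {w \<in> space M. X p w = c} = 1 / 3"
    and law0: "prime p \<Longrightarrow> p mod 3 = 1 \<Longrightarrow> prob {w \<in> space M. X p w = 0} = 2 / (real p + 2)"
    and law1: "prime p \<Longrightarrow> p mod 3 = 1 \<Longrightarrow> c \<in> {1, omega3, omega3 ^ 2} \<Longrightarrow> prob {w \<in> space M. X p w = c} = real p / (3 * (real p + 2))"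
begin

definition d :: "nat \<Rightarrow> real" where "d p = (if p mod 3 = 1 then 2 / (real p + 2) else 0)"

lemma law: assumes "prime p" "c \<in> {1, omega3, omega3\<^sup>2}" shows "prob {w \<in> space M. X p w = c} = (1 - d p) / 3"
proof (cases "p mod 3 = 1")
  case True
  then show ?thesis using law1[OF assms(1) True assms(2)] by (simp add: d_def field_simps)
next
  case False
  have "p mod 3 = 2 \<or> p = 3"
  proof (cases "p mod 3 = 0")
    case True
    then have "3 dvd p" by (simp add: mod_eq_0_iff_dvd)
    moreover have "\<forall>m. m dvd p \<longrightarrow> m = 1 \<or> m = p" using assms(1) prime_nat_iff by blast
    ultimately have "(3::nat) = 1 \<or> 3 = p" by blast
    then show ?thesis by simp
  qed (use False in linarith)
  then show ?thesis using law2[OF assms(1) _ assms(2)] False by (simp add: d_def)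
qed

text \<open>For \<open>p\<close> not congruent to 1 modulo 3, mass zero at 0 follows because the
  three cube roots of unity already exhaust the total mass.\<close>

lemma discrete_law:
  assumes p: "prime p"
  shows "AE w in M. X p w \<in> {0, 1, omega3, omega3\<^sup>2}" "prob {w \<in> space M. X p w = 0} = d p"
proof -
  note [measurable] = meas[OF p]
  define A where "A c = {w \<in> space M. X p w = c}" for c
  have ev: "A c \<in> events" for c unfolding A_def by measurable
  let ?C = "{0, 1, omega3, omega3\<^sup>2}"
  have "prob (\<Union>c\<in>?C. A c) = (\<Sum>c\<in>?C. prob (A c))"
    by (rule finite_measure_finite_Union) (use ev in \<open>auto simp: disjoint_family_on_def A_def\<close>)
  also have "\<dots> = prob (A 0) + (1 - d p)"
  proof -
    have "prob (A c) = (1 - d p) / 3" if "c \<in> {1, omega3, omega3\<^sup>2}" for c unfolding A_def by (rule law[OF p that])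
    from this[of 1] this[of omega3] this[of "omega3\<^sup>2"] have "prob (A 1) + (prob (A omega3) + prob (A (omega3\<^sup>2))) = 1 - d p" by simp
    then show ?thesis using omega3_distinct omega3_distinct[symmetric] by simp
  qed
  finally have s: "prob (\<Union>c\<in>?C. A c) = prob (A 0) + (1 - d p)" .
  have "prob (A 0) = d p"
  proof (cases "p mod 3 = 1")
    case True then show ?thesis using law0[OF p] by (simp add: A_def d_def)
  next
    case False
    then have "d p = 0" by (simp add: d_def)
    moreover have "prob (A 0) + (1 - d p) \<le> 1" unfolding s[symmetric] by simp
    ultimately show ?thesis using measure_nonneg[of M "A 0"] by simp
  qed
  then show "prob {w \<in> space M. X p w = 0} = d p" by (simp add: A_def)
  from s \<open>prob (A 0) = d p\<close> have "prob (\<Union>c\<in>?C. A c) = 1" by simp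
  moreover have "(\<Union>c\<in>?C. A c) \<in> events" using ev by (intro sets.finite_UN) auto
  ultimately have "AE w in M. w \<in> (\<Union>c\<in>?C. A c)" by (subst prob_eq_1[symmetric]) auto
  then show "AE w in M. X p w \<in> ?C" by eventually_elim (auto simp: A_def)
qed

lemma expectation_fn:
  fixes g :: "complex \<Rightarrow> 'b :: {banach, second_countable_topology}"
  assumes p: "prime p" and [measurable]: "g \<in> borel_measurable borel"
  shows "integrable M (\<lambda>w. g (X p w))"
    and "expectation (\<lambda>w. g (X p w)) = d p *\<^sub>R g 0 + ((1 - d p) / 3) *\<^sub>R (g 1 + g omega3 + g (omega3\<^sup>2))"
proof -
  note [measurable] = meas[OF p]
  define A where "A c = {w \<in> space M. X p w = c}" for c
  have ev[measurable]: "A c \<in> events" for c unfolding A_def by measurable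
  let ?C = "{0, 1, omega3, omega3\<^sup>2}"
  define G where "G w = (\<Sum>c\<in>?C. indicat_real (A c) w *\<^sub>R g c)" for w
  have [measurable]: "G \<in> borel_measurable M" unfolding G_def by measurable
  have ae: "AE w in M. g (X p w) = G w"
    using discrete_law(1)[OF p] AE_space
  proof eventually_elim
    case (elim w)
    have "G w = (\<Sum>c\<in>?C. if c = X p w then g c else 0)"
      unfolding G_def by (intro sum.cong) (use elim in \<open>auto simp: A_def indicator_def\<close>)
    also have "\<dots> = g (X p w)" using elim by (subst sum.delta) auto
    finally show ?case by simp
  qed
  have iI: "integrable M (\<lambda>w. indicat_real (A c) w *\<^sub>R g c)" for c
    by (intro integrable_scaleR_left integrable_const_bound[where B = 1]) auto
  have "integrable M G" unfolding G_def by (intro Bochner_Integration.integrable_sum iI)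
  then show "integrable M (\<lambda>w. g (X p w))"
    using ae by (subst integrable_cong_AE[of _ _ G]) auto
  have "expectation (\<lambda>w. g (X p w)) = expectation G" by (rule integral_cong_AE) (use ae in auto)
  also have "\<dots> = (\<Sum>c\<in>?C. prob (A c) *\<^sub>R g c)"
  proof -
    have "expectation (\<lambda>w. indicat_real (A c) w *\<^sub>R g c) = prob (A c) *\<^sub>R g c" for c
      by (subst integral_scaleR_left) (auto intro!: integrable_const_bound[where B = 1])
    then show ?thesis unfolding G_def using iI by (subst Bochner_Integration.integral_sum) auto
  qed
  also have "\<dots> = prob (A 0) *\<^sub>R g 0 + (prob (A 1) *\<^sub>R g 1 + (prob (A omega3) *\<^sub>R g omega3 + prob (A (omega3\<^sup>2)) *\<^sub>R g (omega3\<^sup>2)))"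
    using omega3_distinct omega3_distinct[symmetric] by simp
  also have "\<dots> = d p *\<^sub>R g 0 + ((1 - d p) / 3) *\<^sub>R (g 1 + g omega3 + g (omega3\<^sup>2))"
  proof -
    have "prob (A c) = (1 - d p) / 3" if "c \<in> {1, omega3, omega3\<^sup>2}" for c unfolding A_def by (rule law[OF p that])
    note e = this[of 1] this[of omega3] this[of "omega3\<^sup>2"]
    have "prob (A 0) = d p" unfolding A_def by (rule discrete_law(2)[OF p])
    then show ?thesis using e by (simp only: insert_iff refl simp_thms scaleR_right_distrib add.assoc)
  qed
  finally show "expectation (\<lambda>w. g (X p w)) = d p *\<^sub>R g 0 + ((1 - d p) / 3) *\<^sub>R (g 1 + g omega3 + g (omega3\<^sup>2))" .
qed

lemma X_norm_le: "prime p \<Longrightarrow> AE w in M. norm (X p w) \<le> 1"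
  using discrete_law(1)[of p] by (rule eventually_mono) (use norm_one_minus_omega3(2) in \<open>auto simp del: norm_power\<close>)

text \<open>Independence factors the expectation, and each \<open>X p\<close> is centred because the
  cube roots of unity are equally likely and sum to 0.\<close>

lemma uncorrelated:
  assumes "prime p" "prime r" "p \<noteq> r"
  shows "integrable M (\<lambda>w. X p w * cnj (X r w))" "expectation (\<lambda>w. X p w * cnj (X r w)) = 0"
proof -
  define Y where "Y i = (if i = p then (\<lambda>z. z) else cnj)" for i
  have Ym: "Y i \<in> borel_measurable borel" for i by (simp add: Y_def)
  have ind: "indep_vars (\<lambda>_. borel) (\<lambda>i w. Y i (X i w)) {p, r}"
    by (rule indep_vars_compose2[OF indep_vars_subset[OF indep]]) (use assms Ym in auto)
  have int: "integrable M (\<lambda>w. Y i (X i w))" if "i \<in> {p, r}" for i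
    using that assms by (intro expectation_fn(1)) (auto simp: Ym)
  have prod: "(\<Prod>i\<in>{p, r}. Y i (X i w)) = X p w * cnj (X r w)" for w using assms by (simp add: Y_def)
  show "integrable M (\<lambda>w. X p w * cnj (X r w))" using indep_vars_integrable[OF _ ind int] unfolding prod by simp
  have "expectation (\<lambda>w. X p w * cnj (X r w)) = (\<Prod>i\<in>{p, r}. expectation (\<lambda>w. Y i (X i w)))"
    using indep_vars_lebesgue_integral[OF _ ind int] unfolding prod by simp
  also have "\<dots> = expectation (X p) * expectation (\<lambda>w. Y r (X r w))" using assms by (simp add: Y_def)
  also have "expectation (X p) = 0" using expectation_fn(2)[OF assms(1), of "\<lambda>z. z"] omega3_sum by simp
  finally show "expectation (\<lambda>w. X p w * cnj (X r w)) = 0" by simp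
qed

definition W :: "nat \<Rightarrow> 'a \<Rightarrow> complex" where "W n w = (if prime n then X n w / of_nat n else 0)"

lemma W_measurable[measurable]: "W n \<in> borel_measurable M"
  unfolding W_def using meas by (cases "prime n") auto

lemma second_moment:
  assumes "finite F" "0 \<notin> F"
  shows "integrable M (\<lambda>w. (norm (\<Sum>n\<in>F. W n w))\<^sup>2)" "expectation (\<lambda>w. (norm (\<Sum>n\<in>F. W n w))\<^sup>2) \<le> (\<Sum>n\<in>F. 1 / (real n)\<^sup>2)"
proof -
  have int: "integrable M (\<lambda>w. W n w * cnj (W m w))" for n m
  proof (cases "prime n \<and> prime m")
    case True
    have "integrable M (\<lambda>w. X n w * cnj (X m w))"
      by (cases "n = m") (use True uncorrelated(1) expectation_fn(1)[of n "\<lambda>z. z * cnj z"] in auto)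
    then have "integrable M (\<lambda>w. (X n w * cnj (X m w)) / (of_nat n * of_nat m))" by (rule integrable_divide)
    then show ?thesis using True by (simp add: W_def)
  qed (auto simp: W_def)
  have off: "expectation (\<lambda>w. W n w * cnj (W m w)) = 0" if "n \<noteq> m" for n m
  proof (cases "prime n \<and> prime m")
    case True
    have "expectation (\<lambda>w. (X n w * cnj (X m w)) / (of_nat n * of_nat m)) = 0"
      using uncorrelated(2)[of n m] True that by simp
    then show ?thesis using True by (simp add: W_def)
  qed (auto simp: W_def)
  have sq: "(norm (\<Sum>n\<in>F. W n w))\<^sup>2 = Re (\<Sum>n\<in>F. \<Sum>m\<in>F. W n w * cnj (W m w))" for w
    unfolding norm_square_Re cnj_sum sum_product ..
  show "integrable M (\<lambda>w. (norm (\<Sum>n\<in>F. W n w))\<^sup>2)"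
    unfolding sq by (intro integrable_Re Bochner_Integration.integrable_sum int)
  have "expectation (\<lambda>w. (norm (\<Sum>n\<in>F. W n w))\<^sup>2) = Re (expectation (\<lambda>w. \<Sum>n\<in>F. \<Sum>m\<in>F. W n w * cnj (W m w)))"
    unfolding sq by (rule integral_Re) (intro Bochner_Integration.integrable_sum int)
  also have "expectation (\<lambda>w. \<Sum>n\<in>F. \<Sum>m\<in>F. W n w * cnj (W m w)) = (\<Sum>n\<in>F. \<Sum>m\<in>F. expectation (\<lambda>w. W n w * cnj (W m w)))"
    by (simp add: Bochner_Integration.integral_sum int)
  also have "\<dots> = (\<Sum>n\<in>F. \<Sum>m\<in>F. if n = m then expectation (\<lambda>w. W n w * cnj (W n w)) else 0)"
    by (intro sum.cong) (use off in auto)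
  also have "\<dots> = (\<Sum>n\<in>F. expectation (\<lambda>w. W n w * cnj (W n w)))" using assms by (simp add: sum.delta)
  also have "Re \<dots> = (\<Sum>n\<in>F. Re (expectation (\<lambda>w. W n w * cnj (W n w))))" by simp
  also have "\<dots> \<le> (\<Sum>n\<in>F. 1 / (real n)\<^sup>2)"
  proof (rule sum_mono)
    fix n assume "n \<in> F"
    have "Re (expectation (\<lambda>w. W n w * cnj (W n w))) = expectation (\<lambda>w. Re (W n w * cnj (W n w)))" by (rule integral_Re[OF int, symmetric])
    also have "\<dots> \<le> expectation (\<lambda>_. 1 / (real n)\<^sup>2)"
    proof (rule integral_mono_AE[OF integrable_Re[OF int]])
      show "AE w in M. Re (W n w * cnj (W n w)) \<le> 1 / (real n)\<^sup>2"
      proof (cases "prime n")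
        case True
        show ?thesis using X_norm_le[OF True]
        proof eventually_elim
          case (elim w)
          have "Re (W n w * cnj (W n w)) = (norm (W n w))\<^sup>2" by (rule norm_square_Re[symmetric])
          also have "\<dots> = (norm (X n w))\<^sup>2 / (real n)\<^sup>2" using True by (simp add: W_def norm_divide power_divide)
          also have "\<dots> \<le> 1 / (real n)\<^sup>2" using elim by (intro divide_right_mono) (auto simp: power_le_one)
          finally show ?case .
        qed
      qed (simp add: W_def)
    qed auto
    finally show "Re (expectation (\<lambda>w. W n w * cnj (W n w))) \<le> 1 / (real n)\<^sup>2" by (simp add: prob_space)
  qed
  finally show "expectation (\<lambda>w. (norm (\<Sum>n\<in>F. W n w))\<^sup>2) \<le> (\<Sum>n\<in>F. 1 / (real n)\<^sup>2)" .
qed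

text \<open>By orthogonality a block beyond \<open>m^4\<close> has second moment at most the tail of
  \<open>1/n^2\<close>, that is \<open>1/m^4\<close>, so its norm has mean at most
  \<open>1/m^2\<close>. The sum of the block norms has finite expectation and is therefore finite
  almost surely.\<close>

lemma prime_series_convergent: "AE w in M. convergent (\<lambda>N. \<Sum>n\<in>{..N}. W n w)"
proof -
  define D where "D k w = norm (\<Sum>n\<in>{k ^ 4<..(Suc k) ^ 4}. W n w)" for k w
  have [measurable]: "D k \<in> borel_measurable M" for k unfolding D_def by measurable
  have i2: "integrable M (\<lambda>w. (D k w)\<^sup>2)" for k unfolding D_def by (rule second_moment) auto
  have iD: "integrable M (D k)" for k
  proof (rule Bochner_Integration.integrable_bound[of M "\<lambda>w. 1 + (D k w)\<^sup>2"])
    have "norm x \<le> norm (1 + x\<^sup>2)" for x :: real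
    proof -
      have "0 \<le> (1/2 - \<bar>x\<bar>)\<^sup>2" by simp
      then have "\<bar>x\<bar> \<le> 1/4 + \<bar>x\<bar>\<^sup>2" unfolding power2_diff by (simp add: power2_eq_square)
      then show ?thesis by simp
    qed
    then show "AE w in M. norm (D k w) \<le> norm (1 + (D k w)\<^sup>2)" by (intro AE_I2)
  qed (use i2 in auto)
  have E: "expectation (D (Suc k)) \<le> 1 / (real (Suc k))\<^sup>2" for k
  proof -
    define m where "m = real (Suc k)"
    have m: "m > 0" by (simp add: m_def)
    \<comment> \<open>The arithmetic-geometric mean inequality, weighted so that both summands have
      expectation at most \<open>1 / (2 m^2)\<close>; it takes the place of Cauchy-Schwarz.\<close>
    have "D (Suc k) w \<le> 1 / (2 * m\<^sup>2) + m\<^sup>2 / 2 * (D (Suc k) w)\<^sup>2" for w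
    proof -
      have "0 \<le> (1 / m - m * D (Suc k) w)\<^sup>2" by simp
      then show ?thesis using m by (simp add: power2_eq_square field_simps)
    qed
    then have "expectation (D (Suc k)) \<le> expectation (\<lambda>w. 1 / (2 * m\<^sup>2) + m\<^sup>2 / 2 * (D (Suc k) w)\<^sup>2)"
      by (intro integral_mono) (use iD i2 in auto)
    also have "\<dots> = 1 / (2 * m\<^sup>2) + m\<^sup>2 / 2 * expectation (\<lambda>w. (D (Suc k) w)\<^sup>2)" using i2 by (simp add: prob_space)
    also have "expectation (\<lambda>w. (D (Suc k) w)\<^sup>2) \<le> 1 / m ^ 4"
    proof -
      have "expectation (\<lambda>w. (D (Suc k) w)\<^sup>2) \<le> (\<Sum>n\<in>{Suc k ^ 4<..(Suc (Suc k)) ^ 4}. 1 / (real n)\<^sup>2)"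
        unfolding D_def by (rule second_moment) auto
      also have "\<dots> \<le> 1 / real (Suc k ^ 4)" by (rule sum_inverse_square_tail) auto
      finally show ?thesis by (simp add: m_def)
    qed
    then have "1 / (2 * m\<^sup>2) + m\<^sup>2 / 2 * expectation (\<lambda>w. (D (Suc k) w)\<^sup>2) \<le> 1 / (2 * m\<^sup>2) + m\<^sup>2 / 2 * (1 / m ^ 4)"
      by (intro add_left_mono mult_left_mono) auto
    also have "\<dots> = 1 / m\<^sup>2" using m by (simp add: field_simps power2_eq_square power4_eq_xxxx)
    finally show ?thesis by (simp add: m_def)
  qed
  have "AE w in M. (\<Sum>k. ennreal (D (Suc k) w)) \<noteq> \<infinity>"
  proof (rule nn_integral_PInf_AE)
    have "(\<integral>\<^sup>+w. (\<Sum>k. ennreal (D (Suc k) w)) \<partial>M) = (\<Sum>k. \<integral>\<^sup>+w. ennreal (D (Suc k) w) \<partial>M)"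
      by (rule nn_integral_suminf) auto
    also have "\<dots> = (\<Sum>k. ennreal (expectation (D (Suc k))))"
      by (intro suminf_cong nn_integral_eq_integral iD) (auto simp: D_def)
    also have "\<dots> \<le> (\<Sum>k. ennreal (1 / (real (Suc k))\<^sup>2))" by (intro suminf_le ennreal_leI E) auto
    also have "\<dots> < \<infinity>"
    proof -
      have "summable (\<lambda>k. 1 / (real (Suc k))\<^sup>2)" using summable_inverse_square[of 1] by (subst summable_Suc_iff)
      then show ?thesis by (simp add: suminf_ennreal_eq[OF _ summable_sums] del: of_nat_Suc)
    qed
    finally show "(\<integral>\<^sup>+w. (\<Sum>k. ennreal (D (Suc k) w)) \<partial>M) \<noteq> \<infinity>" by simp
  qed simp
  moreover have "AE w in M. \<forall>n. norm (W n w) \<le> 1 / real n"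
  proof (subst AE_all_countable, intro allI)
    fix n show "AE w in M. norm (W n w) \<le> 1 / real n"
    proof (cases "prime n")
      case True
      show ?thesis using X_norm_le[OF True] by eventually_elim (use True in \<open>auto simp: W_def norm_divide divide_right_mono\<close>)
    qed (simp add: W_def)
  qed
  ultimately show ?thesis
  proof eventually_elim
    case (elim w)
    have "summable (\<lambda>k. D (Suc k) w)" by (rule summable_suminf_not_top) (use elim in \<open>auto simp: D_def\<close>)
    then have "summable (\<lambda>k. D k w)" by (subst (asm) summable_Suc_iff)
    then show ?case using elim(2) unfolding D_def by (intro convergent_blocks) auto
  qed
qed

end

section \<open>Logarithms of the Euler factors and their Mertens constants\<close>

definition log_real :: "nat \<Rightarrow> real" where "log_real p = - ln (1 - 1 / real p)"
text \<open>Twice \<open>ln (norm (1 - omega3 / p))\<close>, since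
  \<open>|1 - omega3 x|^2 = 1 + x + x^2\<close> for real \<open>x\<close>.\<close>

definition log_cubic :: "nat \<Rightarrow> real" where "log_cubic p = ln (1 + 1 / real p + (1 / real p)\<^sup>2)"

lemma tendsto_of_ln_error:
  fixes f :: "nat \<Rightarrow> real"
  assumes "\<forall>N\<ge>2. \<bar>f N - c\<bar> \<le> K / (ln (real N))\<^sup>2"
  shows "f \<longlonglongrightarrow> c"
proof -
  have "(\<lambda>N. K / (ln (real N))\<^sup>2) \<longlonglongrightarrow> 0" by real_asymp
  then have "(\<lambda>N. f N - c) \<longlonglongrightarrow> 0"
    by (rule Lim_null_comparison[rotated]) (use assms in \<open>auto intro!: eventually_sequentiallyI[of 2]\<close>)
  then show ?thesis by (rule Lim_null[THEN iffD2])
qed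

text \<open>The last conclusion is \<open>(1 - x) (1 + x + x^2) = 1 - x^3\<close> in logarithmic
  form. Summed over primes it shifts Mertens' constant by \<open>- ln zeta3\<close>, which is the
  origin of \<open>zeta3\<close> in the lower tail.\<close>

lemma log_factors:
  assumes p: "prime p"
  shows "\<bar>log_real p - 1 / real p\<bar> \<le> 2 / (real p)\<^sup>2" "\<bar>log_cubic p - 1 / real p\<bar> \<le> 4 / (real p)\<^sup>2"
    "log_real p \<ge> 1 / real p" "log_cubic p \<ge> (1/2) / real p" "log_cubic p = log_real p - prime_log_term 2 p"
proof -
  define x where "x = 1 / real p"
  have "real p \<ge> 2" using prime_ge_2_nat[OF p] by simp
  then have x: "0 < x" "x \<le> 1/2" by (auto simp: x_def)
  show "\<bar>log_real p - 1 / real p\<bar> \<le> 2 / (real p)\<^sup>2"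
    using abs_ln_one_minus_le[of x] x by (simp add: log_real_def x_def power_divide)
  have "ln (1 - x) \<le> (1 - x) - 1" using x by (intro ln_le_minus_one) auto
  then show "log_real p \<ge> 1 / real p" by (simp add: log_real_def x_def)
  have xx: "x\<^sup>2 \<le> x / 2" using x mult_left_mono[of x "1/2" x] by (simp add: power2_eq_square)
  define y where "y = x + x\<^sup>2"
  have y: "0 < y" "y \<le> 3/2 * x" "y \<le> 1" using x xx unfolding y_def by (auto intro!: add_pos_nonneg)
  have lc: "log_cubic p = ln (1 + y)" by (simp add: log_cubic_def x_def y_def add.assoc)
  have "\<bar>ln (1 + y) - y\<bar> \<le> y\<^sup>2" using y by (intro abs_ln_one_plus_x_minus_x_bound_nonneg) auto
  also have "y\<^sup>2 \<le> (3/2 * x)\<^sup>2" using y by (intro power_mono) auto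
  also have "(3/2 * x)\<^sup>2 = 9/4 * x\<^sup>2" by (simp add: power2_eq_square)
  finally have "\<bar>ln (1 + y) - x\<bar> \<le> 4 * x\<^sup>2" using zero_le_power2[of x] unfolding y_def by linarith
  then show "\<bar>log_cubic p - 1 / real p\<bar> \<le> 4 / (real p)\<^sup>2" by (simp add: lc x_def power_divide)
  have "ln (inverse (1 + y)) \<le> inverse (1 + y) - 1" using y by (intro ln_le_minus_one) auto
  then have "ln (1 + y) \<ge> 1 - inverse (1 + y)" by (simp add: ln_inverse)
  also have "1 - inverse (1 + y) = y / (1 + y)" using y by (simp add: field_simps)
  finally have "ln (1 + y) \<ge> y / (1 + y)" .
  moreover have "y / (1 + y) \<ge> x / 2"
  proof -
    have "x / 2 * (1 + y) \<le> x / 2 * 2" using x y by (intro mult_left_mono) auto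
    also have "\<dots> \<le> y" by (simp add: y_def)
    finally show ?thesis using y by (simp add: pos_le_divide_eq)
  qed
  ultimately show "log_cubic p \<ge> (1/2) / real p" by (simp add: lc x_def)
  have c: "(1 - x) * (1 + y) = 1 - x ^ 3" by (simp add: y_def power2_eq_square power3_eq_cube algebra_simps)
  have "real p powr (-(1 + 2)) = x ^ 3"
    unfolding powr_minus_divide x_def using p by (simp add: power_divide powr_numeral prime_gt_0_nat)
  then have "prime_log_term 2 p = - ln ((1 - x) * (1 + y))" unfolding c using p by (simp add: prime_log_term_def)
  also have "\<dots> = - (ln (1 - x) + ln (1 + y))" using x y by (subst ln_mult) auto
  finally show "log_cubic p = log_real p - prime_log_term 2 p" by (simp add: lc log_real_def x_def)
qed

lemma zeta3_pos: "zeta3 > 0"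
proof -
  have "summable (\<lambda>n. 1 / (real (Suc n)) ^ 3)"
    using summable_Suc_iff[of "\<lambda>n. inverse (real n ^ 3)"] inverse_power_summable[of 3, where 'a = real] by (simp add: inverse_eq_divide del: of_nat_Suc)
  then show ?thesis unfolding zeta3_def by (intro suminf_pos) auto
qed

lemma mertens_real:
  obtains K where "\<And>N. N \<ge> 2 \<Longrightarrow> \<bar>(\<Sum>p\<in>{p. prime p \<and> p \<le> N}. log_real p) - ln (ln (real N)) - euler_mascheroni\<bar> \<le> K / (ln (real N))\<^sup>2"
    and "(\<lambda>N. (\<Sum>p\<in>{p. prime p \<and> p \<le> N}. log_real p) - ln (ln (real N))) \<longlonglongrightarrow> euler_mascheroni"
proof -
  obtain c K where K: "\<forall>N\<ge>2. \<bar>(\<Sum>p\<in>{p. prime p \<and> p \<le> N}. log_real p) - ln (ln (real N)) - c\<bar> \<le> K / (ln (real N))\<^sup>2"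
  proof (rule mertens_constant[of log_real 2, OF log_factors(1)], goal_cases)
    case (2 c K)
    show ?case by (rule 2(1)[of c K], intro allI impI, rule 2(3))
  qed
  have "(\<lambda>N. (\<Sum>p\<in>{p. prime p \<and> p \<le> N}. log_real p) - ln (ln (real N))) \<longlonglongrightarrow> c"
    by (rule tendsto_of_ln_error[where K = K]) (rule K)
  moreover from mertens_gamma[OF this[unfolded log_real_def]] have c: "c = euler_mascheroni" .
  ultimately have "(\<lambda>N. (\<Sum>p\<in>{p. prime p \<and> p \<le> N}. log_real p) - ln (ln (real N))) \<longlonglongrightarrow> euler_mascheroni" by simp
  then show ?thesis using K[rule_format, unfolded c] by (rule that[rotated])
qed

lemma mertens_cubic:
  obtains K where "\<And>N. N \<ge> 2 \<Longrightarrow> \<bar>(\<Sum>p\<in>{p. prime p \<and> p \<le> N}. log_cubic p) - ln (ln (real N)) - (euler_mascheroni - ln zeta3)\<bar> \<le> K / (ln (real N))\<^sup>2"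
proof -
  obtain c K where K: "\<forall>N\<ge>2. \<bar>(\<Sum>p\<in>{p. prime p \<and> p \<le> N}. log_cubic p) - ln (ln (real N)) - c\<bar> \<le> K / (ln (real N))\<^sup>2"
  proof (rule mertens_constant[of log_cubic 4, OF log_factors(2)], goal_cases)
    case (2 c K)
    show ?case by (rule 2(1)[of c K], intro allI impI, rule 2(3))
  qed
  have l: "(\<lambda>N. (\<Sum>p\<in>{p. prime p \<and> p \<le> N}. log_cubic p) - ln (ln (real N))) \<longlonglongrightarrow> c"
    by (rule tendsto_of_ln_error[where K = K]) (rule K)
  obtain K' where "(\<lambda>N. (\<Sum>p\<in>{p. prime p \<and> p \<le> N}. log_real p) - ln (ln (real N))) \<longlonglongrightarrow> euler_mascheroni"
    using mertens_real by blast
  moreover have "(\<lambda>N. \<Sum>n<Suc N. prime_log_term 2 n) \<longlonglongrightarrow> ln zeta3"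
    using LIMSEQ_Suc[OF summable_LIMSEQ[OF prime_log_zeta_3(2)]] unfolding prime_log_zeta_3(1) zeta3_def .
  ultimately have lim: "(\<lambda>N. (\<Sum>p\<in>{p. prime p \<and> p \<le> N}. log_real p) - ln (ln (real N)) - (\<Sum>n<Suc N. prime_log_term 2 n)) \<longlonglongrightarrow> euler_mascheroni - ln zeta3"
    by (rule tendsto_diff)
  have eq: "(\<Sum>p\<in>{p. prime p \<and> p \<le> N}. log_real p) - ln (ln (real N)) - (\<Sum>n<Suc N. prime_log_term 2 n) = (\<Sum>p\<in>{p. prime p \<and> p \<le> N}. log_cubic p) - ln (ln (real N))" for N
  proof -
    have "(\<Sum>n<Suc N. prime_log_term 2 n) = (\<Sum>n<Suc N. if prime n then prime_log_term 2 n else 0)"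
      by (intro sum.cong) (auto simp: prime_log_term_def)
    also have "\<dots> = (\<Sum>p\<in>{p. prime p \<and> p \<le> N}. prime_log_term 2 p)" by (rule sum_primes_le_eq)
    finally have e: "(\<Sum>n<Suc N. prime_log_term 2 n) = (\<Sum>p\<in>{p. prime p \<and> p \<le> N}. prime_log_term 2 p)" .
    have "(\<Sum>p\<in>{p. prime p \<and> p \<le> N}. log_cubic p) = (\<Sum>p\<in>{p. prime p \<and> p \<le> N}. log_real p - prime_log_term 2 p)"
      by (intro sum.cong) (auto simp: log_factors(5))
    then show ?thesis unfolding e by (simp add: sum_subtractf)
  qed
  have c: "c = euler_mascheroni - ln zeta3" by (rule LIMSEQ_unique[OF l lim[unfolded eq]])
  show ?thesis by (rule that[OF K[rule_format, unfolded c]])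
qed

context cubic_model
begin

lemma d_bounds: "prime p \<Longrightarrow> 0 \<le> d p" "prime p \<Longrightarrow> d p \<le> 2 / real p" "prime p \<Longrightarrow> d p \<le> 1/2"
  using prime_ge_2_nat[of p] by (auto simp: d_def intro!: divide_left_mono)

lemma prime_model_max:
  obtains K where "prime_model (1/3) log_real (\<lambda>p. - (log_cubic p / 2)) d 4 1 euler_mascheroni K"
proof -
  obtain K where K: "\<And>N. N \<ge> 2 \<Longrightarrow> \<bar>(\<Sum>p\<in>{p. prime p \<and> p \<le> N}. log_real p) - ln (ln (real N)) - euler_mascheroni\<bar> \<le> K / (ln (real N))\<^sup>2"
    using mertens_real by blast
  interpret two_point "1/3" by unfold_locales auto
  have k: "\<kappa> = 3/2" by (simp add: \<kappa>_def)
  have "prime_model (1/3) log_real (\<lambda>p. - (log_cubic p / 2)) d 4 1 euler_mascheroni K"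
  proof unfold_locales
    fix p :: nat assume p: "prime p"
    note lf = log_factors[OF p]
    have q: "2 / (real p)\<^sup>2 \<le> 4 / (real p)\<^sup>2" by (intro divide_right_mono) auto
    show "\<bar>log_real p - 1 / real p\<bar> \<le> 4 / (real p)\<^sup>2" using lf(1) q by linarith
    have eq: "- (log_cubic p / 2) + (\<kappa> - 1) / real p = - (log_cubic p - 1 / real p) / 2" unfolding k by simp
    then show "\<bar>- (log_cubic p / 2) + (\<kappa> - 1) / real p\<bar> \<le> 4 / (real p)\<^sup>2" using lf(2) unfolding eq by simp
    show "0 \<le> d p" "d p \<le> 2 / real p" "d p \<le> 1/2" using d_bounds[OF p] by auto
    show "1 / real p \<le> log_real p" by fact
    have "0 \<le> (1/2) / real p" by simp
    then show "- (log_cubic p / 2) \<le> 0" using lf(4) by linarith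
  qed (use K in auto)
  then show ?thesis by (rule that)
qed

text \<open>For \<open>1 / |L|^2\<close> the two non-real cube roots supply the positive atom, with
  conditional probability \<open>2/3\<close>, and the value 1 the negative one. Squaring turns the
  positive atom from about \<open>1 / (2 p)\<close> into about \<open>1/p\<close>; then
  \<open>\<kappa> - 1 = 2\<close> matches \<open>2 * log_real p\<close>.\<close>

lemma prime_model_min:
  obtains K where "prime_model (2/3) log_cubic (\<lambda>p. - (2 * log_real p)) d 4 (1/2) (euler_mascheroni - ln zeta3) K"
proof -
  obtain K where K: "\<And>N. N \<ge> 2 \<Longrightarrow> \<bar>(\<Sum>p\<in>{p. prime p \<and> p \<le> N}. log_cubic p) - ln (ln (real N)) - (euler_mascheroni - ln zeta3)\<bar> \<le> K / (ln (real N))\<^sup>2"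
    using mertens_cubic by blast
  interpret two_point "2/3" by unfold_locales auto
  have k: "\<kappa> = 3" by (simp add: \<kappa>_def)
  have "prime_model (2/3) log_cubic (\<lambda>p. - (2 * log_real p)) d 4 (1/2) (euler_mascheroni - ln zeta3) K"
  proof unfold_locales
    fix p :: nat assume p: "prime p"
    note lf = log_factors[OF p]
    show "\<bar>log_cubic p - 1 / real p\<bar> \<le> 4 / (real p)\<^sup>2" by fact
    have eq: "- (2 * log_real p) + (\<kappa> - 1) / real p = - 2 * (log_real p - 1 / real p)" unfolding k by simp
    show "\<bar>- (2 * log_real p) + (\<kappa> - 1) / real p\<bar> \<le> 4 / (real p)\<^sup>2" using lf(1) unfolding eq abs_mult by simp
    show "0 \<le> d p" "d p \<le> 2 / real p" "d p \<le> 1/2" using d_bounds[OF p] by auto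
    show "(1/2) / real p \<le> log_cubic p" by fact
    have "0 \<le> 1 / real p" by simp
    then show "- (2 * log_real p) \<le> 0" using lf(3) by linarith
  qed (use K in auto)
  then show ?thesis by (rule that)
qed

definition S :: "nat \<Rightarrow> 'a \<Rightarrow> real" where
  "S N w = (\<Sum>p\<in>{p. prime p \<and> p \<le> N}. - ln (norm (1 - X p w / of_nat p)))"

lemma S_measurable[measurable]: "S N \<in> borel_measurable M"
  unfolding S_def using meas by measurable

lemma L1_measurable[measurable]: "L1 X \<in> borel_measurable M"
  unfolding L1_def[abs_def] using meas by measurable

text \<open>Up to an absolutely summable \<open>O(1/p^2)\<close> the complex logarithms of the
  factors are \<open>X p / p\<close>, so their sum converges along with the prime series and
  \<open>L1\<close> is the exponential of the limit. That \<open>L1\<close> is nonzero is recorded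
  because passing from inequalities for the norm to inequalities for its \<open>ln\<close> would
  break at the junk value of \<open>ln\<close> at 0.\<close>

lemma S_tendsto: "AE w in M. L1 X w \<noteq> 0 \<and> (\<lambda>N. S N w) \<longlonglongrightarrow> ln (norm (L1 X w))"
proof -
  have "AE w in M. \<forall>p. prime p \<longrightarrow> norm (X p w) \<le> 1"
    using X_norm_le by (subst AE_all_countable) auto
  with prime_series_convergent show ?thesis
  proof eventually_elim
    case (elim w)
    define y where "y n = (if prime n then - ln (1 - X n w / of_nat n) else 0)" for n
    have small: "norm (X n w / of_nat n) \<le> 1 / real n" "1 / real n \<le> 1/2" if "prime n" for n
      using elim(2) that prime_ge_2_nat[OF that] by (auto simp: norm_divide divide_right_mono)
    have nz: "1 - X n w / of_nat n \<noteq> 0" if "prime n" for n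
    proof
      assume "1 - X n w / of_nat n = 0"
      then have "norm (X n w / of_nat n) = 1" by (metis eq_iff_diff_eq_0 norm_one)
      then show False using small[OF that] by linarith
    qed
    have yW: "norm (y n - W n w) \<le> 2 / (real n)\<^sup>2" for n
    proof (cases "prime n")
      case True
      define z where "z = - (X n w / of_nat n)"
      have z: "norm z \<le> 1 / real n" "norm z \<le> 1/2" using small[OF True] by (auto simp: z_def)
      have "norm (ln (1 + z) - z) \<le> (norm z)\<^sup>2 / (1 - norm z)" by (rule Ln_approx_linear) (use z in simp)
      also have "\<dots> \<le> (1 / real n)\<^sup>2 / (1/2)" using z by (intro frac_le power_mono) auto
      finally have "norm (ln (1 + z) - z) \<le> 2 / (real n)\<^sup>2" by (simp add: power_divide)
      moreover have "y n - W n w = - (ln (1 + z) - z)" using True by (simp add: y_def W_def z_def)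
      ultimately show ?thesis by (metis norm_minus_cancel)
    qed (simp add: y_def W_def)
    have "summable (\<lambda>n. y n - W n w)"
      by (rule summable_comparison_test'[OF summable_inverse_square[of 2]]) (use yW in auto)
    then have "convergent (\<lambda>N. \<Sum>n\<le>N. y n - W n w)" unfolding summable_iff_convergent' .
    then have "convergent (\<lambda>N. (\<Sum>n\<le>N. y n - W n w) + (\<Sum>n\<le>N. W n w))" using elim(1) by (rule convergent_add)
    then have "convergent (\<lambda>N. \<Sum>n\<le>N. y n)" by (simp add: sum_subtractf)
    then obtain c where c: "(\<lambda>N. \<Sum>n\<le>N. y n) \<longlonglongrightarrow> c" by (auto simp: convergent_def)
    have ysum: "(\<Sum>n\<le>N. y n) = (\<Sum>p\<in>{p. prime p \<and> p \<le> N}. - ln (1 - X p w / of_nat p))" for N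
      unfolding y_def lessThan_Suc_atMost[symmetric] by (rule sum_primes_le_eq)
    have "(\<Prod>p\<in>{p. prime p \<and> p \<le> N}. inverse (1 - X p w / of_nat p)) = exp (\<Sum>n\<le>N. y n)" for N
      unfolding ysum exp_sum[OF finite_primes_le] by (intro prod.cong refl) (simp only: mem_Collect_eq exp_minus exp_Ln[OF nz])
    then have "(\<lambda>N. \<Prod>p\<in>{p. prime p \<and> p \<le> N}. inverse (1 - X p w / of_nat p)) \<longlonglongrightarrow> exp c"
      using tendsto_exp[OF c] by simp
    then have L: "L1 X w = exp c" unfolding L1_def by (rule limI)
    have "S N w = Re (\<Sum>n\<le>N. y n)" for N
      unfolding ysum S_def Re_sum uminus_complex.simps
      by (intro sum.cong refl arg_cong[of _ _ uminus]) (simp only: mem_Collect_eq Re_Ln[OF nz])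
    then have "(\<lambda>N. S N w) \<longlonglongrightarrow> Re c" using tendsto_Re[OF c] by simp
    then show ?case by (simp add: L norm_exp_eq_Re)
  qed
qed

lemma S_expectation:
  shows "integrable M (\<lambda>w. exp (u * S N w))"
    and "expectation (\<lambda>w. exp (u * S N w)) = (\<Prod>p\<in>{p. prime p \<and> p \<le> N}.
      d p + (1 - d p) * (1/3 * exp (u * log_real p) + 2/3 * exp (- (u * (log_cubic p / 2)))))"
proof -
  define g where "g p z = exp (u * - ln (norm (1 - z / of_nat p)))" for p :: nat and z :: complex
  have [measurable]: "g p \<in> borel_measurable borel" for p unfolding g_def by measurable
  let ?P = "{p. prime p \<and> p \<le> N}"
  have e: "exp (u * S N w) = (\<Prod>p\<in>?P. g p (X p w))" for w
    unfolding S_def sum_distrib_left g_def by (rule exp_sum[OF finite_primes_le])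
  have ind: "indep_vars (\<lambda>_. borel) (\<lambda>p w. g p (X p w)) ?P"
    by (rule indep_vars_compose2[OF indep_vars_subset[OF indep]]) auto
  have int: "integrable M (\<lambda>w. g p (X p w))" if "p \<in> ?P" for p using that by (intro expectation_fn(1)) auto
  show "integrable M (\<lambda>w. exp (u * S N w))" unfolding e by (rule indep_vars_integrable[OF finite_primes_le ind int])
  have "expectation (\<lambda>w. exp (u * S N w)) = (\<Prod>p\<in>?P. expectation (\<lambda>w. g p (X p w)))"
    unfolding e by (rule indep_vars_lebesgue_integral[OF finite_primes_le ind int])
  also have "\<dots> = (\<Prod>p\<in>?P. d p + (1 - d p) * (1/3 * exp (u * log_real p) + 2/3 * exp (- (u * (log_cubic p / 2)))))"
  proof (rule prod.cong[OF refl])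
    fix p assume "p \<in> ?P"
    then have p: "prime p" by simp
    have p2: "real p \<ge> 2" using prime_ge_2_nat[OF p] by simp
    have g0: "g p 0 = 1" by (simp add: g_def)
    have g1: "g p 1 = exp (u * log_real p)"
    proof -
      have "1 - 1 / of_nat p = complex_of_real (1 - 1 / real p)" by simp
      then have "norm (1 - 1 / of_nat p :: complex) = \<bar>1 - 1 / real p\<bar>" by (simp only: norm_of_real)
      also have "\<dots> = 1 - 1 / real p" using p2 by simp
      finally show ?thesis by (simp add: g_def log_real_def)
    qed
    have gw: "g p z = exp (- (u * (log_cubic p / 2)))" if "z \<in> {omega3, omega3\<^sup>2}" for z
    proof -
      have "norm (1 - z / of_nat p) = sqrt (1 + 1 / real p + (1 / real p)\<^sup>2)"
        using norm_one_minus_omega3(1)[OF that, of "1 / real p"] by simp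
      then have "ln (norm (1 - z / of_nat p)) = log_cubic p / 2" unfolding log_cubic_def by (simp add: ln_sqrt)
      then show ?thesis by (simp add: g_def)
    qed
    have "expectation (\<lambda>w. g p (X p w)) = d p *\<^sub>R g p 0 + ((1 - d p) / 3) *\<^sub>R (g p 1 + g p omega3 + g p (omega3\<^sup>2))"
      by (rule expectation_fn(2)[OF p]) measurable
    also have "\<dots> = d p + (1 - d p) * (1/3 * exp (u * log_real p) + 2/3 * exp (- (u * (log_cubic p / 2))))"
      using gw[of omega3] gw[of "omega3\<^sup>2"] by (simp add: g0 g1 field_simps)
    finally show "expectation (\<lambda>w. g p (X p w)) = d p + (1 - d p) * (1/3 * exp (u * log_real p) + 2/3 * exp (- (u * (log_cubic p / 2))))" .
  qed
  finally show "expectation (\<lambda>w. exp (u * S N w)) = (\<Prod>p\<in>?P. d p + (1 - d p) * (1/3 * exp (u * log_real p) + 2/3 * exp (- (u * (log_cubic p / 2)))))" .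
qed

end

section \<open>Identification of the constants and proof of the two tail estimates\<close>

context two_point
begin

lemma integral_stretch_2:
  fixes S :: "real set" and h :: "real \<Rightarrow> real"
  assumes "S \<in> sets lebesgue" "h integrable_on (\<lambda>t. 2 * t) ` S" "\<And>v. v \<in> (\<lambda>t. 2 * t) ` S \<Longrightarrow> 0 \<le> h v"
  shows "integral S (\<lambda>t. 2 * h (2 * t)) = integral ((\<lambda>t. 2 * t) ` S) h"
proof -
  have "((\<lambda>t. 2 * t) has_field_derivative 2) (at x within S)" for x :: real
    by (rule DERIV_subset[of _ _ _ UNIV]) (auto intro!: derivative_eq_intros)
  moreover have "inj_on (\<lambda>t. 2 * t :: real) S" by (auto simp: inj_on_def)
  moreover have "h absolutely_integrable_on (\<lambda>t. 2 * t) ` S" by (rule nonnegative_absolutely_integrable_1) (use assms in auto)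
  ultimately show ?thesis using has_absolute_integral_change_of_variables_1'[of S "\<lambda>t. 2 * t" "\<lambda>_. 2" h "integral ((\<lambda>t. 2 * t) ` S) h"] assms(1) by simp
qed

text \<open>After \<open>v = 2 * t\<close> the splitting point is 2. On \<open>[1, 2]\<close> one
  has \<open>df + dl = 1\<close>, so moving the split back to 1 leaves the integral of
  \<open>1/v\<close>, which is \<open>ln 2\<close>.\<close>

lemma rescaled_constant:
  "integral {0..1} (\<lambda>t. 2 * (df (2 * t) / (2 * t))) - integral {1..} (\<lambda>t. 2 * (dl (2 * t) / (2 * t))) = I0 - I1 + ln 2"
proof -
  have img: "(\<lambda>t. 2 * t) ` {0..1} = {0..2::real}" "(\<lambda>t. 2 * t) ` {1..} = {2::real..}"
  proof -
    show "(\<lambda>t. 2 * t) ` {0..1} = {0..2::real}" by (auto intro!: image_eqI[where x = "_ / 2"])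
    show "(\<lambda>t. 2 * t) ` {1..} = {2::real..}" by (auto intro!: image_eqI[where x = "_ / 2"])
  qed
  have a: "integral {0..1} (\<lambda>t. 2 * (df (2 * t) / (2 * t))) = integral {0..2} (\<lambda>v. df v / v)"
    using integral_stretch_2[of "{0..1}" "\<lambda>v. df v / v"] I0_integrable[of 2] df_bounds(1) unfolding img by simp
  have b: "integral {1..} (\<lambda>t. 2 * (dl (2 * t) / (2 * t))) = integral {2..} (\<lambda>v. dl v / v)"
    using integral_stretch_2[of "{1..}" "\<lambda>v. dl v / v"] I1_integrable[of 2] dl_nonneg unfolding img by simp
  have c: "integral {0..2} (\<lambda>v. df v / v) = I0 + integral {1..2} (\<lambda>v. df v / v)"
    unfolding I0_def using I0_integrable[of 2] by (intro Henstock_Kurzweil_Integration.integral_combine[symmetric]) auto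
  have i: "(\<lambda>v. df v / v) integrable_on {1..2}" "(\<lambda>v. dl v / v) integrable_on {1..2}"
    by (auto intro!: integrable_continuous_interval continuous_intros continuous_dl continuous_df)
  have "((\<lambda>v. 1 / v) has_integral (ln 2 - ln 1)) {1..2::real}"
    by (rule fundamental_theorem_of_calculus) (auto intro!: derivative_eq_intros simp flip: has_real_derivative_iff_has_vector_derivative)
  moreover have "integral {1..2} (\<lambda>v. df v / v) + integral {1..2} (\<lambda>v. dl v / v) = integral {1..2} (\<lambda>v. 1 / v)"
    unfolding Henstock_Kurzweil_Integration.integral_add[OF i, symmetric] by (simp add: df_def flip: add_divide_distrib)
  ultimately have "integral {1..2} (\<lambda>v. df v / v) + integral {1..2} (\<lambda>v. dl v / v) = ln 2" by (simp add: integral_unique)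
  then show ?thesis unfolding a b c using I1_split[of 2] by simp
qed

end

text \<open>Here \<open>\<kappa> = 3\<close>, and expanding \<open>dl\<close> and \<open>df\<close>
  by a factor \<open>exp t\<close> produces the integrands of \<open>C_min\<close> without a change
  of variable.\<close>

lemma C_min_eq: "two_point.I0 (2/3) - two_point.I1 (2/3) = C_min"
proof -
  interpret two_point "2/3" by unfold_locales auto
  have k: "\<kappa> = 3" by (simp add: \<kappa>_def)
  have e: "exp (-2 * t) = exp t * exp (- (3 * t))" for t :: real by (simp flip: exp_add)
  have pos: "2 + E > 0" if "E > 0" for E :: real using that by linarith
  have dl: "dl t = 3 * exp (-2 * t) / (exp (-2 * t) + 2 * exp t)" for t
  proof -
    have "3 * exp (-2 * t) / (exp (-2 * t) + 2 * exp t) = (exp t * (3 * exp (- (3 * t)))) / (exp t * (exp (- (3 * t)) + 2))"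
      unfolding e by (simp add: algebra_simps)
    also have "\<dots> = 3 * exp (- (3 * t)) / (exp (- (3 * t)) + 2)" by (rule mult_divide_mult_cancel_left) simp
    also have "\<dots> = dl t" unfolding dl_def den_def k using pos[of "exp (- (3 * t))"] by (simp add: field_simps)
    finally show ?thesis ..
  qed
  have df: "df t = (2 * exp t - 2 * exp (-2 * t)) / (exp (-2 * t) + 2 * exp t)" for t
  proof -
    have "exp (-2 * t) + 2 * exp t > 0" by (intro add_pos_pos) auto
    then show ?thesis unfolding df_def dl by (simp add: field_simps)
  qed
  have "(2 * exp t - 2 * exp (-2 * t)) / (t * (exp (-2 * t) + 2 * exp t)) = df t / t" for t unfolding df by simp
  moreover have "-3 * exp (-2 * t) / (t * (exp (-2 * t) + 2 * exp t)) = - (dl t / t)" for t unfolding dl by simp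
  ultimately show ?thesis unfolding C_min_def I0_def I1_def by simp
qed

text \<open>The substitution \<open>u = 2 t\<close> moves the splitting point of the integrals from \<open>1\<close> to \<open>2\<close>, which costs \<open>ln 2\<close>
  and accounts for the factor \<open>2\<close> in front of the exponential.\<close>
lemma C_max_eq: "two_point.I0 (1/3) - two_point.I1 (1/3) + ln 2 = C_max"
proof -
  interpret two_point "1/3" by unfold_locales auto
  have k: "\<kappa> = 3/2" by (simp add: \<kappa>_def)
  have dl: "dl (2 * t) = 3 * exp (-t) / (exp (2 * t) + 2 * exp (-t))" for t
  proof -
    have e: "exp (-t) = exp (2 * t) * exp (- (3 * t))" by (simp flip: exp_add)
    have "3 * exp (-t) / (exp (2 * t) + 2 * exp (-t)) = (exp (2 * t) * (3 * exp (- (3 * t)))) / (exp (2 * t) * (1 + 2 * exp (- (3 * t))))"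
      unfolding e by (simp add: algebra_simps)
    also have "\<dots> = 3 * exp (- (3 * t)) / (1 + 2 * exp (- (3 * t)))" by (rule mult_divide_mult_cancel_left) simp
    also have "\<dots> = dl (2 * t)"
      unfolding dl_def den_def k using add_pos_pos[of 1 "2 * exp (- (3 * t))"] by (simp add: field_simps)
    finally show ?thesis ..
  qed
  have dl': "dl (2 * t) = 3 / (exp (3 * t) + 2)" for t
  proof -
    have "3 * exp (-t) / (exp (2 * t) + 2 * exp (-t)) = (exp (-t) * 3) / (exp (-t) * (exp (3 * t) + 2))"
      by (simp add: algebra_simps flip: exp_add)
    also have "\<dots> = 3 / (exp (3 * t) + 2)" by (rule mult_divide_mult_cancel_left) simp
    finally show ?thesis unfolding dl .
  qed
  have df: "df (2 * t) = (exp (2 * t) - exp (-t)) / (exp (2 * t) + 2 * exp (-t))" for t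
  proof -
    have "exp (2 * t) + 2 * exp (-t) > 0" by (intro add_pos_pos) auto
    then show ?thesis unfolding df_def dl by (simp add: field_simps)
  qed
  have a: "(2 * exp (2*t) - 2 * exp (-t)) / (t * (exp (2*t) + 2 * exp (-t))) = 2 * (2 * (df (2 * t) / (2 * t)))" for t
  proof -
    have "(2 * A - 2 * E) / (t * D) = 2 * (2 * ((A - E) / D / (2 * t)))" for A E D :: real
      \<comment> \<open>At \<open>t = 0\<close> both sides are 0 through division by zero, so the
        integrands agree pointwise.\<close>
      by (cases "t = 0"; cases "D = 0") (simp_all add: field_simps)
    then show ?thesis unfolding df .
  qed
  have b: "-6 / (t * (exp (3*t) + 2)) = -2 * (2 * (dl (2 * t) / (2 * t)))" for t
    unfolding dl' by simp
  show ?thesis unfolding C_max_def a b integral_mult_right rescaled_constant[symmetric] by simp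
qed

theorem theorem1p2:
  fixes M :: "'a measure" and X :: "nat \<Rightarrow> 'a \<Rightarrow> complex"
  assumes "prob_space M"
    and "prob_space.indep_vars M (\<lambda>_. borel) X {p. prime p}"
    and "\<And>p. prime p \<Longrightarrow> X p \<in> borel_measurable M"
    and "\<And>p c. prime p \<Longrightarrow> (p mod 3 = 2 \<or> p = 3) \<Longrightarrow> c \<in> {1, omega3, omega3 ^ 2} \<Longrightarrow>
           measure M {w \<in> space M. X p w = c} = 1 / 3"
    and "\<And>p. prime p \<Longrightarrow> p mod 3 = 1 \<Longrightarrow>
           measure M {w \<in> space M. X p w = 0} = 2 / (real p + 2)"
    and "\<And>p c. prime p \<Longrightarrow> p mod 3 = 1 \<Longrightarrow> c \<in> {1, omega3, omega3 ^ 2} \<Longrightarrow>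
           measure M {w \<in> space M. X p w = c} = real p / (3 * (real p + 2))"
  shows "(\<exists>K T. \<forall>\<tau>\<ge>T. \<exists>e. \<bar>e\<bar> \<le> K / \<tau> \<and>
           measure M {w \<in> space M. norm (L1 X w) > exp euler_mascheroni * \<tau>}
             = exp (- (2 * exp (\<tau> - C_max) / \<tau>) * (1 + e))) \<and>
         (\<exists>K T. \<forall>\<tau>\<ge>T. \<exists>e. \<bar>e\<bar> \<le> K / \<tau> \<and>
           measure M {w \<in> space M. norm (L1 X w) < sqrt (zeta3 / exp euler_mascheroni) / \<tau>}
             = exp (- (exp (\<tau>^2 - C_min) / \<tau>^2) * (1 + e)))"
proof -
  interpret cubic_model M X
    using assms by (intro cubic_model.intro cubic_model_axioms.intro)
  define Z where "Z w = ln (norm (L1 X w))" for w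
  have [measurable]: "Z \<in> borel_measurable M" unfolding Z_def by measurable
  have lim: "AE w in M. (\<lambda>N. S N w) \<longlonglongrightarrow> Z w" using S_tendsto by eventually_elim (simp add: Z_def)
  show ?thesis
  proof
    obtain K0 where pm: "prime_model (1/3) log_real (\<lambda>p. - (log_cubic p / 2)) d 4 1 euler_mascheroni K0"
      by (rule prime_model_max)
    interpret mx: prime_model "1/3" log_real "\<lambda>p. - (log_cubic p / 2)" d 4 1 euler_mascheroni K0 by (rule pm)
    have "\<exists>K. \<forall>\<^sub>F T in at_top. \<exists>e. \<bar>e\<bar> \<le> K / T \<and> prob {w \<in> space M. Z w > ln T + euler_mascheroni} = exp (- (exp (T - (mx.I0 - mx.I1)) / T) * (1 + e))"
    proof (rule mx.large_deviation[OF prob_space_axioms _ _ lim])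
      show "expectation (\<lambda>w. exp (u * S N w)) = (\<Prod>p\<in>{p. prime p \<and> p \<le> N}. mx.mom p u)" for N u
        unfolding S_expectation mx.mom_def by simp
    qed (auto intro: S_expectation(1))
    then obtain K where K: "\<forall>\<^sub>F T in at_top. \<exists>e. \<bar>e\<bar> \<le> K / T \<and> prob {w \<in> space M. Z w > ln T + euler_mascheroni} = exp (- (exp (T - (mx.I0 - mx.I1)) / T) * (1 + e))" ..
    have "\<forall>\<^sub>F \<tau> in at_top. \<exists>e. \<bar>e\<bar> \<le> K / \<tau> \<and> prob {w \<in> space M. norm (L1 X w) > exp euler_mascheroni * \<tau>} = exp (- (2 * exp (\<tau> - C_max) / \<tau>) * (1 + e))"
      using K eventually_gt_at_top[of 0]
    proof eventually_elim
      case (elim \<tau>)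
      have "prob {w \<in> space M. norm (L1 X w) > exp euler_mascheroni * \<tau>} = prob {w \<in> space M. Z w > ln \<tau> + euler_mascheroni}"
      proof (rule prob_eq_AE)
        \<comment> \<open>The two events agree only where \<open>L1 X w\<close> is nonzero, hence up
          to a null set.\<close>
        show "AE w in M. (norm (L1 X w) > exp euler_mascheroni * \<tau>) = (Z w > ln \<tau> + euler_mascheroni)"
          using S_tendsto
        proof eventually_elim
          case (elim w)
          have "ln \<tau> + euler_mascheroni = ln (exp euler_mascheroni * \<tau>)" using \<open>\<tau> > 0\<close> by (simp add: ln_mult)
          then show ?case unfolding Z_def using elim \<open>\<tau> > 0\<close> by simp
        qed
      qed auto
      moreover have "2 * exp (\<tau> - C_max) = exp (\<tau> - (mx.I0 - mx.I1))"
        unfolding C_max_eq[symmetric] by (simp add: exp_diff exp_add)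
      ultimately show ?case using elim by simp
    qed
    then show "\<exists>K T. \<forall>\<tau>\<ge>T. \<exists>e. \<bar>e\<bar> \<le> K / \<tau> \<and>
           prob {w \<in> space M. norm (L1 X w) > exp euler_mascheroni * \<tau>} = exp (- (2 * exp (\<tau> - C_max) / \<tau>) * (1 + e))"
      unfolding eventually_at_top_linorder by blast
  next
    obtain K0 where pm: "prime_model (2/3) log_cubic (\<lambda>p. - (2 * log_real p)) d 4 (1/2) (euler_mascheroni - ln zeta3) K0"
      by (rule prime_model_min)
    interpret mn: prime_model "2/3" log_cubic "\<lambda>p. - (2 * log_real p)" d 4 "1/2" "euler_mascheroni - ln zeta3" K0 by (rule pm)
    have "\<exists>K. \<forall>\<^sub>F T in at_top. \<exists>e. \<bar>e\<bar> \<le> K / T \<and> prob {w \<in> space M. -2 * Z w > ln T + (euler_mascheroni - ln zeta3)} = exp (- (exp (T - (mn.I0 - mn.I1)) / T) * (1 + e))"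
    proof (rule mn.large_deviation[OF prob_space_axioms])
      have *: "exp (u * (-2 * S N w)) = exp (-2 * u * S N w)" for u N w by (simp add: mult_ac)
      show "AE w in M. (\<lambda>N. -2 * S N w) \<longlonglongrightarrow> -2 * Z w" using lim by eventually_elim (intro tendsto_intros)
      show "integrable M (\<lambda>w. exp (u * (-2 * S N w)))" for u N unfolding * by (rule S_expectation)
      show "expectation (\<lambda>w. exp (u * (-2 * S N w))) = (\<Prod>p\<in>{p. prime p \<and> p \<le> N}. mn.mom p u)" for N u
        unfolding * S_expectation mn.mom_def by (intro prod.cong) (auto simp: mult_ac)
    qed auto
    then obtain K where K: "\<forall>\<^sub>F T in at_top. \<exists>e. \<bar>e\<bar> \<le> K / T \<and> prob {w \<in> space M. -2 * Z w > ln T + (euler_mascheroni - ln zeta3)} = exp (- (exp (T - (mn.I0 - mn.I1)) / T) * (1 + e))" ..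
    \<comment> \<open>The model describes \<open>1 / |L|^2\<close>, so the threshold for
      \<open>1 / |L|\<close> corresponds to \<open>T = \<tau>^2\<close>. The resulting error
      \<open>K / \<tau>^2\<close> is then weakened to the claimed order.\<close>
    have "filterlim (\<lambda>\<tau>::real. \<tau>\<^sup>2) at_top at_top" by real_asymp
    from eventually_compose_filterlim[OF K this] eventually_ge_at_top[of 1]
    have "\<forall>\<^sub>F \<tau> in at_top. \<exists>e. \<bar>e\<bar> \<le> \<bar>K\<bar> / \<tau> \<and> prob {w \<in> space M. norm (L1 X w) < sqrt (zeta3 / exp euler_mascheroni) / \<tau>} = exp (- (exp (\<tau>\<^sup>2 - C_min) / \<tau>\<^sup>2) * (1 + e))"
    proof eventually_elim
      case (elim \<tau>)
      then have \<tau>: "\<tau> \<ge> 1" "\<tau> > 0" by auto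
      obtain e where e: "\<bar>e\<bar> \<le> K / \<tau>\<^sup>2" "prob {w \<in> space M. -2 * Z w > ln (\<tau>\<^sup>2) + (euler_mascheroni - ln zeta3)} = exp (- (exp (\<tau>\<^sup>2 - (mn.I0 - mn.I1)) / \<tau>\<^sup>2) * (1 + e))"
        using elim(1) by blast
      have "K / \<tau>\<^sup>2 \<le> \<bar>K\<bar> / \<tau>"
        using \<tau> by (intro frac_le) (auto simp: power2_eq_square)
      with e(1) have e1: "\<bar>e\<bar> \<le> \<bar>K\<bar> / \<tau>" by linarith
      have "prob {w \<in> space M. norm (L1 X w) < sqrt (zeta3 / exp euler_mascheroni) / \<tau>} = prob {w \<in> space M. -2 * Z w > ln (\<tau>\<^sup>2) + (euler_mascheroni - ln zeta3)}"
      proof (rule prob_eq_AE)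
        show "AE w in M. (norm (L1 X w) < sqrt (zeta3 / exp euler_mascheroni) / \<tau>) = (-2 * Z w > ln (\<tau>\<^sup>2) + (euler_mascheroni - ln zeta3))"
          using S_tendsto
        proof eventually_elim
          case (elim w)
          have q: "sqrt (zeta3 / exp euler_mascheroni) / \<tau> > 0" using zeta3_pos \<tau> by simp
          have "ln (sqrt (zeta3 / exp euler_mascheroni) / \<tau>) = (ln zeta3 - euler_mascheroni) / 2 - ln \<tau>"
            using zeta3_pos \<tau> by (simp add: ln_div ln_sqrt)
          moreover have "(norm (L1 X w) < sqrt (zeta3 / exp euler_mascheroni) / \<tau>) = (Z w < ln (sqrt (zeta3 / exp euler_mascheroni) / \<tau>))"
            unfolding Z_def using elim q by (subst ln_less_cancel_iff) auto
          moreover have "ln (\<tau>\<^sup>2) = 2 * ln \<tau>" using \<tau> by (simp add: ln_realpow)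
          ultimately show ?case by (simp add: field_simps) linarith
        qed
      qed auto
      then show ?case using e e1 unfolding C_min_eq by auto
    qed
    then show "\<exists>K T. \<forall>\<tau>\<ge>T. \<exists>e. \<bar>e\<bar> \<le> K / \<tau> \<and>
           prob {w \<in> space M. norm (L1 X w) < sqrt (zeta3 / exp euler_mascheroni) / \<tau>} = exp (- (exp (\<tau>^2 - C_min) / \<tau>^2) * (1 + e))"
      unfolding eventually_at_top_linorder by blast
  qed
qed

end
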